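(* Let $(\Omega^{(\bullet,\bullet)},\bar\partial,\partial,\kappa)$ be a positive definite ($A$-covariant) Kähler structure over $M$ and let $\mathbf f$ be a state on $M$ such that the integral $\int=\mathbf f\circ\mathrm{vol}_\kappa$ is closed. Let $(\mathcal F,\bar\partial_{\mathcal F})$ be a (left or right) Hermitian holomorphic vector bundle, and write $\Omega^\bullet_{\mathcal F}$ for $\Omega^\bullet\otimes_M\mathcal F$ (if $\mathcal F$ is left holomorphic) or $\mathcal F\otimes_M\Omega^\bullet$ (if $\mathcal F$ is right holomorphic). If the Hermitian structure on $\mathcal F$ is positive definite and the Kähler structure on $\Omega^\bullet_{\mathcal F}$ is diagonalisable, then there is an orthogonal decomposition of $A$-comodules $$\Omega^\bullet_{\mathcal F}=\mathcal H^\bullet_{\bar\partial_{\mathcal F}}\oplus\bar\partial_{\mathcal F}(\Omega^\bullet_{\mathcal F})\oplus\bar\partial_{\mathcal F}^\dagger(\Omega^\bullet_{\mathcal F}).$$ Furthermore, the projection $\mathcal H^{(a,b)}_{\bar\partial_{\mathcal F}}\to H^{(a,b)}_{\bar\partial_{\mathcal F}}$, $\alpha\mapsto[\alpha]$, is an isomorphism.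
   Context: **Calculi.** Everything is over $\mathbb C$. $A$ is a fixed Hopf $*$-algebra ($A=\mathbb C$, i.e. no covariance, is allowed); left coactions are written $v\mapsto v_{(-1)}\otimes v_{(0)}$. An $A$-comodule $*$-algebra is a unital $*$-algebra $M$ with a left $A$-coaction that is an algebra map and commutes with $*$. An $A$-covariant differential $*$-calculus over $M$ is a graded algebra $\Omega^\bullet=\bigoplus_{k\ge 0}\Omega^k$ (product $\wedge$) with $\Omega^0=M$, a degree one map $d$ with $d^2=0$ satisfying the graded Leibniz rule, generated by $M$ as a dg algebra, with a conjugate-linear involution $*$ extending that of $M$, $(d\omega)^*=d(\omega^* )$, $(\omega\wedge\nu)^*=(-1)^{|\omega||\nu|}\nu^*\wedge\omega^*$, and a graded left $A$-coaction compatible with product, $d$ and $*$. A complex structure is an algebra $\mathbb N_0^2$-grading $\Omega^{(a,b)}$ with $\Omega^k=\bigoplus_{a+b=k}\Omega^{(a,b)}$ (as $A$-comodules and $M$-bimodules), $(\Omega^{(a,b)})^*=\Omega^{(b,a)}$ and $d=\partial+\bar\partial$, where $\partial,\bar\partial$ are the components of $d$ of bidegree $(1,0),(0,1)$. **Kähler structures.** Let $\Omega^\bullet$ have total dimension $2n$ ($\Omega^{2n}\neq0$, $\Omega^k=0$ for $k>2n$). A Kähler structure is a complex structure together with a closed, central, real ($\kappa^*=\kappa$), $A$-coinvariant form $\kappa\in\Omega^{(1,1)}$ such that, for $L(\omega)=\kappa\wedge\omega$, the maps $L^{n-k}:\Omega^k\to\Omega^{2n-k}$ are isomorphisms for $0\le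 k<n$. Put $P^k=\{\alpha\in\Omega^k: L^{n-k+1}\alpha=0\}$ for $k\le n$, $P^k=0$ for $k>n$, and $P^{(a,b)}=P^{a+b}\cap\Omega^{(a,b)}$. The Hodge map $\ast_H:\Omega^\bullet\to\Omega^\bullet$ is the linear map determined by $$\ast_H(L^j\alpha)=(-1)^{\frac{k(k+1)}2}i^{a-b}\frac{j!}{(n-j-k)!}L^{n-j-k}(\alpha),\qquad \alpha\in P^{(a,b)},\ k=a+b,\ 0\le j\le n-k.$$ $\mathrm{vol}_\kappa=\ast_H|_{\Omega^{2n}}:\Omega^{2n}\to M$ (extended by $0$ to lower degrees). **Bundles.** A (left) vector bundle $\mathcal F$ is a left $M$-module, finitely generated projective, with a compatible left $A$-coaction; ${}^\vee\mathcal F$ is the right $M$-module of left $M$-linear maps $\mathcal F\to M$ (with coaction $\phi_{(-1)}\otimes\phi_{(0)}(f)=S(f_{(-1)})\phi(f_{(0)})_{(-1)}\otimes\phi(f_{(0)})_{(0)}$). A left holomorphic structure is an $A$-comodule map $\bar\partial_{\mathcal F}:\mathcal F\to\Omega^{(0,1)}\otimes_M\mathcal F$ with $\bar\partial_{\mathcal F}(mf)=\bar\partial m\otimes f+m\bar\partial_{\mathcal F}f$ whose extension $\bar\partial_{\mathcal F}(\omega\otimes f)=\bar\partial\omega\otimes f+(-1)^{|\omega|}\omega\wedge\bar\partial_{\mathcal F}f$ to $\Omega^\bullet\otimes_M\mathcal F$ squares to zero. A Hermitian structure is an isomorphism of right $M$-modules and $A$-comodules $h:\overline{\mathcal F}\to{}^\vee\mathcal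 F$ with $h(\overline f)(g)=h(\overline g)(f)^*$; here $\overline{\mathcal F}$ is the conjugate vector space with $\overline f\,m=\overline{m^*f}$ and coaction $\overline f\mapsto (f_{(-1)})^*\otimes\overline{f_{(0)}}$. **Metric and adjoints.** The evaluation pairing is $(\omega\otimes f)\wedge_{\mathrm{ev}}(\phi\otimes\nu)=\omega\,\phi(f)\wedge\nu$. For left bundles put $\bar\ast_{\mathcal F}(\omega\otimes f)=h(\overline f)\otimes\ast_H(\omega^* )$, $g_{\mathcal F}(\alpha,\beta)=\mathrm{vol}_\kappa(\alpha\wedge_{\mathrm{ev}}\bar\ast_{\mathcal F}\beta)\in M$ and $\langle\alpha,\beta\rangle_{\mathcal F}=\mathbf f(g_{\mathcal F}(\alpha,\beta))$. $M_{>0}$ is the set of non-zero finite sums $\sum\lambda_i m_im_i^*$ with $\lambda_i\ge0$. The Kähler structure is positive definite if $\mathrm{vol}_\kappa(\omega\wedge\ast_H(\omega^* ))\in M_{>0}$ for all non-zero $\omega\in\Omega^\bullet$; $h$ is positive definite if $h(\overline f)(f)\in M_{>0}$ for all non-zero $f$. A state is a unital linear functional $\mathbf f:M\to\mathbb C$ with $\mathbf f(M_{>0})\subseteq\mathbb R_{>0}$. The integral is closed if $\int d\omega=0$ for all $\omega\in\Omega^{2n-1}$. **Right bundles.** For right bundles everything is mirrored: $\mathcal F$ is a finitely generated projective right $M$-module, $\mathcal F^\vee$ is the left module of right $M$-linear maps to $M$, $\bar\partial_{\mathcal F}:\mathcal F\to\mathcal F\otimes_M\Omega^{(0,1)}$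 extends by $\bar\partial_{\mathcal F}(f\otimes\omega)=\bar\partial_{\mathcal F}(f)\wedge\omega+f\otimes\bar\partial\omega$, $h:\overline{\mathcal F}\to\mathcal F^\vee$ is an isomorphism with $h(\overline f)(g)=h(\overline g)(f)^*$, $\bar\ast_{\mathcal F}(f\otimes\omega)=\ast_H(\omega^* )\otimes h(\overline f)$, and $\langle\alpha,\beta\rangle_{\mathcal F}=(-1)^{|\alpha|}\mathbf f(\mathrm{vol}_\kappa(\bar\ast_{\mathcal F}(\beta)\wedge_{\mathrm{ev}}\alpha))$ for homogeneous $\alpha$. **Dirac operator.** For positive definite $h$, $\langle\cdot,\cdot\rangle_{\mathcal F}$ is an inner product on $\Omega^\bullet_{\mathcal F}$ for which $\bar\partial_{\mathcal F}$ has an adjoint $\bar\partial_{\mathcal F}^\dagger$. $D_{\bar\partial_{\mathcal F}}=\bar\partial_{\mathcal F}+\bar\partial_{\mathcal F}^\dagger$, $\Delta_{\bar\partial_{\mathcal F}}=D_{\bar\partial_{\mathcal F}}^2$, $\mathcal H^\bullet_{\bar\partial_{\mathcal F}}=\ker\Delta_{\bar\partial_{\mathcal F}}$ (harmonic elements), with $\mathcal H^{(a,b)}_{\bar\partial_{\mathcal F}}$ its part of bidegree $(a,b)$; $H^{(a,b)}_{\bar\partial_{\mathcal F}}$ is the $\bar\partial_{\mathcal F}$-cohomology of $\Omega^\bullet_{\mathcal F}$ in bidegree $(a,b)$. The Kähler structure on $\Omega^\bullet_{\mathcal F}$ is diagonalisable if $D_{\bar\partial_{\mathcal F}}$ is diagonalisable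 as a $\mathbb C$-linear operator. *)

theory Defs
  imports Complex_Main "HOL-Library.Function_Algebras"
begin

section \<open>Complex vector spaces and *-algebras\<close>

class complex_vector = ab_group_add +
  fixes scaleC :: "complex \<Rightarrow> 'a \<Rightarrow> 'a" (infixr \<open>*\<^sub>C\<close> 75)
  assumes scaleC_add_right: "c *\<^sub>C (x + y) = c *\<^sub>C x + c *\<^sub>C y"
    and scaleC_add_left: "(b + c) *\<^sub>C x = b *\<^sub>C x + c *\<^sub>C x"
    and scaleC_scaleC: "b *\<^sub>C c *\<^sub>C x = (b * c) *\<^sub>C x"
    and scaleC_one: "1 *\<^sub>C x = x"

class complex_algebra_1 = complex_vector + ring_1 +
  assumes mult_scaleC_left: "(c *\<^sub>C x) * y = c *\<^sub>C (x * y)"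
    and mult_scaleC_right: "x * (c *\<^sub>C y) = c *\<^sub>C (x * y)"

class complex_star_algebra = complex_algebra_1 +
  fixes star :: "'a \<Rightarrow> 'a"
  assumes star_star: "star (star x) = x"
    and star_add: "star (x + y) = star x + star y"
    and star_scaleC: "star (c *\<^sub>C x) = cnj c *\<^sub>C star x"
    and star_mult: "star (x * y) = star y * star x"

global_interpretation complex_vector: vector_space "scaleC :: complex \<Rightarrow> 'a \<Rightarrow> 'a::complex_vector"
  by unfold_locales (simp_all add: scaleC_add_right scaleC_add_left scaleC_scaleC scaleC_one)

instantiation complex :: complex_star_algebra
begin
definition scaleC_complex :: "complex \<Rightarrow> complex \<Rightarrow> complex" where "scaleC_complex = (*)"
definition star_complex :: "complex \<Rightarrow> complex" where "star_complex = cnj"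
instance
  by standard (simp_all add: scaleC_complex_def star_complex_def algebra_simps)
end

instantiation "fun" :: (type, complex_vector) complex_vector
begin
definition scaleC_fun :: "complex \<Rightarrow> ('a \<Rightarrow> 'b) \<Rightarrow> 'a \<Rightarrow> 'b"
  where "scaleC_fun c f = (\<lambda>x. c *\<^sub>C f x)"
instance
  by standard (simp_all add: scaleC_fun_def plus_fun_def fun_eq_iff
      scaleC_add_right scaleC_add_left scaleC_scaleC scaleC_one)
end

abbreviation clinear :: "('a::complex_vector \<Rightarrow> 'b::complex_vector) \<Rightarrow> bool"
  where "clinear \<equiv> Vector_Spaces.linear scaleC scaleC"

abbreviation csubspace :: "'a::complex_vector set \<Rightarrow> bool"
  where "csubspace \<equiv> complex_vector.subspace"

abbreviation cspan :: "'a::complex_vector set \<Rightarrow> 'a set"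
  where "cspan \<equiv> complex_vector.span"

definition cbilinear :: "('a::complex_vector \<Rightarrow> 'b::complex_vector \<Rightarrow> 'c::complex_vector) \<Rightarrow> bool"
  where "cbilinear g \<longleftrightarrow> (\<forall>x. clinear (g x)) \<and> (\<forall>y. clinear (\<lambda>x. g x y))"

text \<open>\<open>V\<close> is the internal direct sum of the subspaces \<open>U i\<close>, \<open>i \<in> I\<close>: summation is a bijection
  from the external direct sum (finitely supported families) onto \<open>V\<close>.\<close>

definition families :: "'i set \<Rightarrow> ('i \<Rightarrow> 'v::complex_vector set) \<Rightarrow> ('i \<Rightarrow> 'v) set"
  where "families I U =
    {c. (\<forall>i\<in>I. c i \<in> U i) \<and> (\<forall>i. i \<notin> I \<longrightarrow> c i = 0) \<and> finite {i. c i \<noteq> 0}}"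

definition direct_sum :: "'i set \<Rightarrow> ('i \<Rightarrow> 'v::complex_vector set) \<Rightarrow> 'v set \<Rightarrow> bool"
  where "direct_sum I U V \<longleftrightarrow> (\<forall>i\<in>I. csubspace (U i)) \<and>
    bij_betw (\<lambda>c. \<Sum>i | c i \<noteq> 0. c i) (families I U) V"

definition component :: "('i \<Rightarrow> 'v::complex_vector set) \<Rightarrow> 'i \<Rightarrow> 'v \<Rightarrow> 'v"
  where "component U i v = (THE c. c \<in> families UNIV U \<and> (\<Sum>i | c i \<noteq> 0. c i) = v) i"

definition diagonalisable :: "('v::complex_vector \<Rightarrow> 'v) \<Rightarrow> bool"
  where "diagonalisable T \<longleftrightarrow> cspan {v. \<exists>c. T v = c *\<^sub>C v} = UNIV"


section \<open>The tensor product over the complex numbers\<close>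

text \<open>A list of pairs stands for the sum of the corresponding pure tensors.  Over a field, two such
  sums agree in the algebraic tensor product iff no bilinear form separates them; the universal
  property is \<open>tensor_universal\<close> below.\<close>

definition tensor_eq ::
    "('a::complex_vector \<times> 'b::complex_vector) list \<Rightarrow> ('a \<times> 'b) list \<Rightarrow> bool"
  where "tensor_eq xs ys \<longleftrightarrow> (\<forall>\<beta> :: 'a \<Rightarrow> 'b \<Rightarrow> complex. cbilinear \<beta> \<longrightarrow>
    (\<Sum>(a, b)\<leftarrow>xs. \<beta> a b) = (\<Sum>(a, b)\<leftarrow>ys. \<beta> a b))"

quotient_type (overloaded) ('a, 'b) tensor = "('a::complex_vector \<times> 'b::complex_vector) list" / tensor_eq
  by (rule equivpI) (auto simp: reflp_def symp_def transp_def tensor_eq_def)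

lift_definition pure_tensor :: "'a::complex_vector \<Rightarrow> 'b::complex_vector \<Rightarrow> ('a, 'b) tensor"
  (infixr \<open>\<otimes>\<close> 76) is "\<lambda>a b. [(a, b)]" .

lemma cbilinear_scale:
  assumes "cbilinear (\<beta> :: 'a::complex_vector \<Rightarrow> 'b::complex_vector \<Rightarrow> 'c::complex_vector)"
  shows "\<beta> (c *\<^sub>C a) b = c *\<^sub>C \<beta> a b" "\<beta> a (c *\<^sub>C b) = c *\<^sub>C \<beta> a b"
    "\<beta> (- a) b = - \<beta> a b" "\<beta> (a + a') b = \<beta> a b + \<beta> a' b" "\<beta> a (b + b') = \<beta> a b + \<beta> a b'"
proof -
  interpret l: Vector_Spaces.linear scaleC scaleC "\<lambda>x. \<beta> x b"
    using assms by (simp add: cbilinear_def)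
  interpret r: Vector_Spaces.linear scaleC scaleC "\<beta> a"
    using assms by (simp add: cbilinear_def)
  show "\<beta> (c *\<^sub>C a) b = c *\<^sub>C \<beta> a b" "\<beta> a (c *\<^sub>C b) = c *\<^sub>C \<beta> a b"
    "\<beta> (- a) b = - \<beta> a b" "\<beta> (a + a') b = \<beta> a b + \<beta> a' b" "\<beta> a (b + b') = \<beta> a b + \<beta> a b'"
    by (simp_all add: l.scale r.scale l.neg l.add r.add)
qed

lemma cbilinear_sum_list_scale:
  assumes "cbilinear (\<beta> :: 'a::complex_vector \<Rightarrow> 'b::complex_vector \<Rightarrow> complex)"
  shows "(\<Sum>(a, b)\<leftarrow>map (\<lambda>(a, b). (c *\<^sub>C a, b)) xs. \<beta> a b) = c * (\<Sum>(a, b)\<leftarrow>xs. \<beta> a b)"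
  by (induction xs) (auto simp: cbilinear_scale[OF assms] scaleC_complex_def algebra_simps)

lemma cbilinear_sum_list_neg:
  assumes "cbilinear (\<beta> :: 'a::complex_vector \<Rightarrow> 'b::complex_vector \<Rightarrow> complex)"
  shows "(\<Sum>(a, b)\<leftarrow>map (\<lambda>(a, b). (- a, b)) xs. \<beta> a b) = - (\<Sum>(a, b)\<leftarrow>xs. \<beta> a b)"
  by (induction xs) (auto simp: cbilinear_scale[OF assms])

instantiation tensor :: (complex_vector, complex_vector) complex_vector
begin
lift_definition zero_tensor :: "('a, 'b) tensor" is "[]" .
lift_definition plus_tensor :: "('a, 'b) tensor \<Rightarrow> ('a, 'b) tensor \<Rightarrow> ('a, 'b) tensor" is "(@)"
  by (simp add: tensor_eq_def)
lift_definition uminus_tensor :: "('a, 'b) tensor \<Rightarrow> ('a, 'b) tensor"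
  is "map (\<lambda>(a, b). (- a, b))"
  unfolding tensor_eq_def using cbilinear_sum_list_neg by metis
lift_definition scaleC_tensor :: "complex \<Rightarrow> ('a, 'b) tensor \<Rightarrow> ('a, 'b) tensor"
  is "\<lambda>c. map (\<lambda>(a, b). (c *\<^sub>C a, b))"
  unfolding tensor_eq_def using cbilinear_sum_list_scale by metis
definition minus_tensor :: "('a, 'b) tensor \<Rightarrow> ('a, 'b) tensor \<Rightarrow> ('a, 'b) tensor"
  where "minus_tensor s t = s + - t"
instance
proof
  fix r s t :: "('a, 'b) tensor" and b c :: complex
  show "r + s + t = r + (s + t)" by transfer (simp add: tensor_eq_def)
  show "s + t = t + s" by transfer (simp add: tensor_eq_def)
  show "0 + t = t" by transfer (simp add: tensor_eq_def)
  show "- t + t = 0"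
    by transfer (simp add: tensor_eq_def cbilinear_sum_list_neg del: map_map)
  show "s - t = s + - t" by (simp add: minus_tensor_def)
  show "c *\<^sub>C (s + t) = c *\<^sub>C s + c *\<^sub>C t" by transfer (simp add: tensor_eq_def)
  show "(b + c) *\<^sub>C t = b *\<^sub>C t + c *\<^sub>C t"
    by transfer (simp add: tensor_eq_def cbilinear_sum_list_scale distrib_right del: map_map)
  show "b *\<^sub>C c *\<^sub>C t = (b * c) *\<^sub>C t"
    by transfer (simp add: tensor_eq_def cbilinear_sum_list_scale mult.assoc del: map_map)
  show "1 *\<^sub>C t = t"
    by transfer (simp add: tensor_eq_def cbilinear_sum_list_scale del: map_map)
qed
end

lemma pure_tensor_bilinear:
  fixes a a' :: "'a::complex_vector" and b b' :: "'b::complex_vector"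
  shows "(a + a') \<otimes> b = a \<otimes> b + a' \<otimes> b"
    and "a \<otimes> (b + b') = a \<otimes> b + a \<otimes> b'"
    and "(c *\<^sub>C a) \<otimes> b = c *\<^sub>C (a \<otimes> b)"
    and "a \<otimes> (c *\<^sub>C b) = c *\<^sub>C (a \<otimes> b)"
  by (transfer; simp add: tensor_eq_def cbilinear_scale)+

lemma tensor_as_sum:
  fixes t :: "('a::complex_vector, 'b::complex_vector) tensor"
  shows "\<exists>xs. t = (\<Sum>(a, b)\<leftarrow>xs. a \<otimes> b)"
proof -
  have "abs_tensor xs = (\<Sum>(a, b)\<leftarrow>xs. a \<otimes> b)" for xs :: "('a \<times> 'b) list"
  proof (induction xs)
    case Nil
    show ?case by (simp add: zero_tensor.abs_eq)
  next
    case (Cons p xs)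
    obtain a b where "p = (a, b)" by fastforce
    with Cons show ?case
      by (metis (no_types, lifting) append_Cons append_Nil list.simps(9) old.prod.case
          plus_tensor.abs_eq pure_tensor.abs_eq sum_list.Cons)
  qed
  then show ?thesis by (metis Quotient3_abs_rep[OF Quotient3_tensor])
qed

lemma functionals_separate:
  fixes x y :: "'c::complex_vector"
  assumes "\<And>\<phi> :: 'c \<Rightarrow> complex. clinear \<phi> \<Longrightarrow> \<phi> x = \<phi> y"
  shows "x = y"
proof (rule ccontr)
  interpret vector_space_pair "scaleC :: complex \<Rightarrow> 'c \<Rightarrow> 'c" "scaleC :: complex \<Rightarrow> complex \<Rightarrow> complex"
    by unfold_locales
  assume "x \<noteq> y"
  then have "complex_vector.independent {x - y}" by simp
  from linear_independent_extend[OF this, of "\<lambda>_. 1"] obtain \<phi> :: "'c \<Rightarrow> complex"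
    where \<phi>: "clinear \<phi>" "\<phi> (x - y) = 1" by auto
  interpret Vector_Spaces.linear scaleC scaleC \<phi> by fact
  from \<phi> assms[OF \<phi>(1)] show False by (simp add: diff)
qed

lemma tensor_additive_exists:
  fixes g :: "'a::complex_vector \<Rightarrow> 'b::complex_vector \<Rightarrow> 'c::complex_vector"
  assumes "\<And>xs ys. tensor_eq xs ys \<Longrightarrow> (\<Sum>(a, b)\<leftarrow>xs. g a b) = (\<Sum>(a, b)\<leftarrow>ys. g a b)"
  shows "\<exists>!L. additive L \<and> (\<forall>a b. L (a \<otimes> b) = g a b)"
proof
  define L where "L t = (\<Sum>(a, b)\<leftarrow>rep_tensor t. g a b)" for t
  have L: "L (abs_tensor xs) = (\<Sum>(a, b)\<leftarrow>xs. g a b)" for xs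
    unfolding L_def
    by (intro assms rep_abs_rsp_left[OF Quotient3_tensor]) (simp add: tensor_eq_def)
  have "L (s + t) = L s + L t" for s t
  proof -
    obtain xs ys where "s = abs_tensor xs" "t = abs_tensor ys"
      by (metis Quotient3_abs_rep[OF Quotient3_tensor])
    then show ?thesis by (simp add: plus_tensor.abs_eq L)
  qed
  moreover have "L (a \<otimes> b) = g a b" for a b by (simp add: pure_tensor.abs_eq L)
  ultimately show "additive L \<and> (\<forall>a b. L (a \<otimes> b) = g a b)" by (simp add: additive_def)
  fix L'
  assume L': "additive L' \<and> (\<forall>a b. L' (a \<otimes> b) = g a b)"
  have *: "K (\<Sum>(a, b)\<leftarrow>xs. a \<otimes> b) = (\<Sum>(a, b)\<leftarrow>xs. g a b)"
    if "additive K \<and> (\<forall>a b. K (a \<otimes> b) = g a b)" for xs and K :: "_ \<Rightarrow> 'c"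
  proof -
    interpret additive K using that by simp
    show ?thesis using that by (induction xs) (auto simp: zero add)
  qed
  show "L' = L"
  proof
    fix t :: "('a, 'b) tensor"
    obtain xs where "t = (\<Sum>(a, b)\<leftarrow>xs. a \<otimes> b)" using tensor_as_sum by blast
    then show "L' t = L t" using *[OF L'] * \<open>additive L \<and> _\<close> by simp
  qed
qed

lemma tensor_universal:
  fixes g :: "'a::complex_vector \<Rightarrow> 'b::complex_vector \<Rightarrow> 'c::complex_vector"
  assumes "cbilinear g"
  shows "\<exists>!L. additive L \<and> (\<forall>a b. L (a \<otimes> b) = g a b)"
proof (rule tensor_additive_exists, rule functionals_separate)
  fix xs ys :: "('a \<times> 'b) list" and \<phi> :: "'c \<Rightarrow> complex"
  assume eq: "tensor_eq xs ys" and \<phi>: "clinear \<phi>"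
  interpret Vector_Spaces.linear scaleC scaleC \<phi> by fact
  have "clinear (\<lambda>b. \<phi> (g a b))" "clinear (\<lambda>a. \<phi> (g a b))" for a b
    using Vector_Spaces.linear_compose[OF _ \<phi>, of scaleC "g a"]
      Vector_Spaces.linear_compose[OF _ \<phi>, of scaleC "\<lambda>a. g a b"] assms
    by (simp_all add: cbilinear_def comp_def)
  then have \<beta>: "cbilinear (\<lambda>a b. \<phi> (g a b))" by (simp add: cbilinear_def)
  have sum: "\<phi> (\<Sum>(a, b)\<leftarrow>zs. g a b) = (\<Sum>(a, b)\<leftarrow>zs. \<phi> (g a b))" for zs
    by (induction zs) (auto simp: add)
  show "\<phi> (\<Sum>(a, b)\<leftarrow>xs. g a b) = \<phi> (\<Sum>(a, b)\<leftarrow>ys. g a b)"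
    unfolding sum using eq[unfolded tensor_eq_def, rule_format, OF \<beta>] .
qed

text \<open>The additive map determined by its values on the elements \<open>tens x y\<close>.  Only additivity is
  asked for, so that the same operator covers linear and conjugate-linear extensions.\<close>

definition lift_over :: "'x set \<Rightarrow> 'y set \<Rightarrow> ('x \<Rightarrow> 'y \<Rightarrow> 't::ab_group_add) \<Rightarrow>
    ('x \<Rightarrow> 'y \<Rightarrow> 'u::ab_group_add) \<Rightarrow> 't \<Rightarrow> 'u"
  where "lift_over X Y tens g =
    (THE L. additive L \<and> (\<forall>x\<in>X. \<forall>y\<in>Y. L (tens x y) = g x y))"

abbreviation tensor_lift :: "('a::complex_vector \<Rightarrow> 'b::complex_vector \<Rightarrow> 'c::ab_group_add) \<Rightarrow>
    ('a, 'b) tensor \<Rightarrow> 'c"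
  where "tensor_lift \<equiv> lift_over UNIV UNIV (\<otimes>)"

definition tensor_map :: "('a::complex_vector \<Rightarrow> 'c::complex_vector) \<Rightarrow>
    ('b::complex_vector \<Rightarrow> 'd::complex_vector) \<Rightarrow> ('a, 'b) tensor \<Rightarrow> ('c, 'd) tensor"
  where "tensor_map f g = tensor_lift (\<lambda>a b. f a \<otimes> g b)"

definition tensor_assoc :: "(('a::complex_vector, 'b::complex_vector) tensor, 'c::complex_vector) tensor
    \<Rightarrow> ('a, ('b, 'c) tensor) tensor"
  where "tensor_assoc = tensor_lift (\<lambda>t c. tensor_lift (\<lambda>a b. a \<otimes> (b \<otimes> c)) t)"

text \<open>\<open>(a \<otimes> v) (b \<otimes> w) = a b \<otimes> p v w\<close> for a bilinear operation \<open>p\<close>.\<close>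

definition tensor_mult :: "('v::complex_vector \<Rightarrow> 'w::complex_vector \<Rightarrow> 'u::complex_vector) \<Rightarrow>
    ('a::complex_algebra_1, 'v) tensor \<Rightarrow> ('a, 'w) tensor \<Rightarrow> ('a, 'u) tensor"
  where "tensor_mult p s t =
    tensor_lift (\<lambda>a v. tensor_lift (\<lambda>b w. (a * b) \<otimes> p v w) t) s"

definition subtensor :: "'a::complex_vector set \<Rightarrow> 'b::complex_vector set \<Rightarrow> ('a, 'b) tensor set"
  where "subtensor X Y = cspan {x \<otimes> y | x y. x \<in> X \<and> y \<in> Y}"


section \<open>Hopf *-algebras and their comodules\<close>

record (overloaded) 'a hopf =
  comult :: "'a \<Rightarrow> ('a, 'a) tensor"
  counit :: "'a \<Rightarrow> complex"
  antipode :: "'a \<Rightarrow> 'a"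

definition hopf_star_algebra :: "('a::complex_star_algebra) hopf \<Rightarrow> bool"
  where "hopf_star_algebra A \<longleftrightarrow>
    clinear (comult A) \<and> clinear (counit A) \<and> clinear (antipode A) \<and>
    (\<forall>a. tensor_assoc (tensor_map (comult A) id (comult A a)) =
      tensor_map id (comult A) (comult A a)) \<and>
    (\<forall>a. tensor_lift (\<lambda>b c. counit A b *\<^sub>C c) (comult A a) = a) \<and>
    (\<forall>a. tensor_lift (\<lambda>b c. counit A c *\<^sub>C b) (comult A a) = a) \<and>
    comult A 1 = 1 \<otimes> 1 \<and>
    (\<forall>a b. comult A (a * b) = tensor_mult (*) (comult A a) (comult A b)) \<and>
    counit A 1 = 1 \<and>
    (\<forall>a b. counit A (a * b) = counit A a * counit A b) \<and>
    (\<forall>a. tensor_lift (\<lambda>b c. antipode A b * c) (comult A a) = counit A a *\<^sub>C 1) \<and>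
    (\<forall>a. tensor_lift (\<lambda>b c. b * antipode A c) (comult A a) = counit A a *\<^sub>C 1) \<and>
    (\<forall>a. comult A (star a) = tensor_map star star (comult A a)) \<and>
    (\<forall>a. counit A (star a) = cnj (counit A a))"

definition comodule :: "('a::complex_star_algebra) hopf \<Rightarrow> ('v::complex_vector \<Rightarrow> ('a, 'v) tensor) \<Rightarrow> bool"
  where "comodule A \<delta> \<longleftrightarrow> clinear \<delta> \<and>
    (\<forall>v. tensor_assoc (tensor_map (comult A) id (\<delta> v)) = tensor_map id \<delta> (\<delta> v)) \<and>
    (\<forall>v. tensor_lift (\<lambda>a w. counit A a *\<^sub>C w) (\<delta> v) = v)"

definition subcomodule :: "('v \<Rightarrow> ('a::complex_vector, 'v::complex_vector) tensor) \<Rightarrow> 'v set \<Rightarrow> bool"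
  where "subcomodule \<delta> X \<longleftrightarrow> csubspace X \<and> \<delta> ` X \<subseteq> subtensor UNIV X"

definition comodule_algebra ::
    "('a::complex_star_algebra) hopf \<Rightarrow> ('v::complex_algebra_1 \<Rightarrow> ('a, 'v) tensor) \<Rightarrow> bool"
  where "comodule_algebra A \<delta> \<longleftrightarrow> comodule A \<delta> \<and> \<delta> 1 = 1 \<otimes> 1 \<and>
    (\<forall>v w. \<delta> (v * w) = tensor_mult (*) (\<delta> v) (\<delta> w))"

definition comodule_star_algebra ::
    "('a::complex_star_algebra) hopf \<Rightarrow> ('m::complex_star_algebra \<Rightarrow> ('a, 'm) tensor) \<Rightarrow> bool"
  where "comodule_star_algebra A \<delta> \<longleftrightarrow> comodule_algebra A \<delta> \<and>
    (\<forall>m. \<delta> (star m) = tensor_map star star (\<delta> m))"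


section \<open>Covariant differential *-calculi and Kaehler structures\<close>

text \<open>\<open>'m\<close> is the base algebra and \<open>'o\<close> the algebra of forms; \<open>incl\<close> identifies the former with the
  forms of degree zero.\<close>

record (overloaded) ('a, 'm, 'o) calculus =
  coactM :: "'m \<Rightarrow> ('a, 'm) tensor"
  incl :: "'m \<Rightarrow> 'o"
  deg :: "nat \<Rightarrow> 'o set"
  diff :: "'o \<Rightarrow> 'o"
  fstar :: "'o \<Rightarrow> 'o"
  coact :: "'o \<Rightarrow> ('a, 'o) tensor"

definition calculus :: "('a::complex_star_algebra) hopf \<Rightarrow>
    ('a, 'm::complex_star_algebra, 'o::complex_algebra_1, 'z) calculus_scheme \<Rightarrow> bool"
  where "calculus A K \<longleftrightarrow>
    comodule_star_algebra A (coactM K) \<and>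
    direct_sum UNIV (deg K) UNIV \<and>
    (\<forall>i j. \<forall>\<omega>\<in>deg K i. \<forall>\<nu>\<in>deg K j. \<omega> * \<nu> \<in> deg K (i + j)) \<and>
    clinear (incl K) \<and> incl K 1 = 1 \<and> (\<forall>m n. incl K (m * n) = incl K m * incl K n) \<and>
    bij_betw (incl K) UNIV (deg K 0) \<and>
    clinear (diff K) \<and>
    (\<forall>k. \<forall>\<omega>\<in>deg K k. diff K \<omega> \<in> deg K (Suc k)) \<and>
    (\<forall>\<omega>. diff K (diff K \<omega>) = 0) \<and>
    (\<forall>k. \<forall>\<omega>\<in>deg K k. \<forall>\<nu>.
      diff K (\<omega> * \<nu>) = diff K \<omega> * \<nu> + (-1) ^ k * (\<omega> * diff K \<nu>)) \<and>
    (\<forall>S. csubspace S \<and> range (incl K) \<subseteq> S \<and> (\<forall>\<omega>\<in>S. diff K \<omega> \<in> S) \<and>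
      (\<forall>\<omega>\<in>S. \<forall>\<nu>\<in>S. \<omega> * \<nu> \<in> S) \<longrightarrow> S = UNIV) \<and>
    additive (fstar K) \<and> (\<forall>c \<omega>. fstar K (c *\<^sub>C \<omega>) = cnj c *\<^sub>C fstar K \<omega>) \<and>
    (\<forall>\<omega>. fstar K (fstar K \<omega>) = \<omega>) \<and>
    (\<forall>m. fstar K (incl K m) = incl K (star m)) \<and>
    (\<forall>k. \<forall>\<omega>\<in>deg K k. fstar K \<omega> \<in> deg K k) \<and>
    (\<forall>\<omega>. fstar K (diff K \<omega>) = diff K (fstar K \<omega>)) \<and>
    (\<forall>i j. \<forall>\<omega>\<in>deg K i. \<forall>\<nu>\<in>deg K j.
      fstar K (\<omega> * \<nu>) = (-1) ^ (i * j) * (fstar K \<nu> * fstar K \<omega>)) \<and>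
    comodule_algebra A (coact K) \<and>
    (\<forall>m. coact K (incl K m) = tensor_map id (incl K) (coactM K m)) \<and>
    (\<forall>k. subcomodule (coact K) (deg K k)) \<and>
    (\<forall>\<omega>. coact K (diff K \<omega>) = tensor_map id (diff K) (coact K \<omega>)) \<and>
    (\<forall>\<omega>. coact K (fstar K \<omega>) = tensor_map star (fstar K) (coact K \<omega>))"

record (overloaded) ('a, 'm, 'o) complex_calculus = "('a, 'm, 'o) calculus" +
  bideg :: "nat \<times> nat \<Rightarrow> 'o set"
  del :: "'o \<Rightarrow> 'o"
  delbar :: "'o \<Rightarrow> 'o"

text \<open>Sub-bimodules: since \<open>incl\<close> maps into bidegree \<open>(0, 0)\<close>, multiplicativity of the
  bigrading already makes each bidegree an \<open>'m\<close>-sub-bimodule.\<close>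

definition complex_structure :: "('a::complex_star_algebra) hopf \<Rightarrow>
    ('a, 'm::complex_star_algebra, 'o::complex_algebra_1, 'z) complex_calculus_scheme \<Rightarrow> bool"
  where "complex_structure A K \<longleftrightarrow> calculus A K \<and>
    (\<forall>k. direct_sum {(a, b). a + b = k} (bideg K) (deg K k)) \<and>
    (\<forall>a b a' b'. \<forall>\<omega>\<in>bideg K (a, b). \<forall>\<nu>\<in>bideg K (a', b'). \<omega> * \<nu> \<in> bideg K (a + a', b + b')) \<and>
    (\<forall>a b. subcomodule (coact K) (bideg K (a, b))) \<and>
    (\<forall>a b. fstar K ` bideg K (a, b) = bideg K (b, a)) \<and>
    clinear (del K) \<and> clinear (delbar K) \<and>
    (\<forall>a b. \<forall>\<omega>\<in>bideg K (a, b). del K \<omega> \<in> bideg K (a + 1, b)) \<and>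
    (\<forall>a b. \<forall>\<omega>\<in>bideg K (a, b). delbar K \<omega> \<in> bideg K (a, b + 1)) \<and>
    (\<forall>\<omega>. diff K \<omega> = del K \<omega> + delbar K \<omega>)"

text \<open>\<open>hdim\<close> is half of the total dimension.\<close>

record (overloaded) ('a, 'm, 'o) kaehler = "('a, 'm, 'o) complex_calculus" +
  hdim :: nat
  kform :: 'o

definition lefschetz :: "('a, 'm, 'o::complex_algebra_1) kaehler \<Rightarrow> 'o \<Rightarrow> 'o"
  where "lefschetz K \<omega> = kform K * \<omega>"

definition kaehler_structure :: "('a::complex_star_algebra) hopf \<Rightarrow>
    ('a, 'm::complex_star_algebra, 'o::complex_algebra_1) kaehler \<Rightarrow> bool"
  where "kaehler_structure A K \<longleftrightarrow> complex_structure A K \<and>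
    deg K (2 * hdim K) \<noteq> {0} \<and> (\<forall>k > 2 * hdim K. deg K k = {0}) \<and>
    kform K \<in> bideg K (1, 1) \<and> diff K (kform K) = 0 \<and>
    (\<forall>\<omega>. kform K * \<omega> = \<omega> * kform K) \<and>
    fstar K (kform K) = kform K \<and> coact K (kform K) = 1 \<otimes> kform K \<and>
    (\<forall>k < hdim K. bij_betw (lefschetz K ^^ (hdim K - k)) (deg K k) (deg K (2 * hdim K - k)))"

definition primitive :: "('a, 'm, 'o::complex_algebra_1) kaehler \<Rightarrow> nat \<Rightarrow> 'o set"
  where "primitive K k = (if k \<le> hdim K
    then {\<alpha> \<in> deg K k. (lefschetz K ^^ (hdim K - k + 1)) \<alpha> = 0} else {0})"

definition hodge :: "('a, 'm, 'o::complex_algebra_1) kaehler \<Rightarrow> 'o \<Rightarrow> 'o"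
  where "hodge K = (THE H. clinear H \<and>
    (\<forall>a b j. \<forall>\<alpha> \<in> primitive K (a + b) \<inter> bideg K (a, b).
      let k = a + b; n = hdim K in k \<le> n \<and> j \<le> n - k \<longrightarrow>
        H ((lefschetz K ^^ j) \<alpha>) =
          ((-1) ^ (k * (k + 1) div 2) * \<i> powi (int a - int b) * (fact j / fact (n - j - k)))
            *\<^sub>C (lefschetz K ^^ (n - j - k)) \<alpha>))"

definition vol :: "('a, 'm, 'o::complex_algebra_1) kaehler \<Rightarrow> 'o \<Rightarrow> 'm"
  where "vol K \<omega> = inv (incl K) (hodge K (component (deg K) (2 * hdim K) \<omega>))"

definition positives :: "'m::complex_star_algebra set"
  where "positives = {m. m \<noteq> 0 \<and> (\<exists>N (lam :: nat \<Rightarrow> real) x. (\<forall>i<N. 0 \<le> lam i) \<and>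
    m = (\<Sum>i<N. complex_of_real (lam i) *\<^sub>C (x i * star (x i))))}"

definition positive_definite_kaehler ::
    "('a, 'm::complex_star_algebra, 'o::complex_algebra_1) kaehler \<Rightarrow> bool"
  where "positive_definite_kaehler K \<longleftrightarrow>
    (\<forall>\<omega>. \<omega> \<noteq> 0 \<longrightarrow> vol K (\<omega> * hodge K (fstar K \<omega>)) \<in> positives)"

definition state :: "('m::complex_star_algebra \<Rightarrow> complex) \<Rightarrow> bool"
  where "state \<tau> \<longleftrightarrow> clinear \<tau> \<and> \<tau> 1 = 1 \<and> (\<forall>m\<in>positives. \<tau> m \<in> \<real> \<and> 0 < Re (\<tau> m))"

definition closed_integral ::
    "('a, 'm, 'o::complex_algebra_1) kaehler \<Rightarrow> ('m \<Rightarrow> complex) \<Rightarrow> bool"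
  where "closed_integral K \<tau> \<longleftrightarrow>
    (\<forall>k. k + 1 = 2 * hdim K \<longrightarrow> (\<forall>\<omega>\<in>deg K k. \<tau> (vol K (diff K \<omega>)) = 0))"


section \<open>Tensor products over the base algebra\<close>

text \<open>Let \<open>X\<close> be a right module with action \<open>r\<close> and \<open>Y\<close> a left module with action \<open>l\<close>.  A vector space
  \<open>'t\<close> with \<open>tens\<close> is their balanced tensor product if \<open>x \<otimes> y \<mapsto> tens x y\<close> induces an isomorphism
  onto \<open>'t\<close> from the quotient of the tensor product of \<open>X\<close> and \<open>Y\<close> over the complex numbers by the
  subspace spanned by all \<open>r x m \<otimes> y - x \<otimes> l m y\<close>.  As HOL has no types depending on
  the actions, a balanced tensor product is always carried along as such a pair.\<close>

definition balanced_tensor :: "'x::complex_vector set \<Rightarrow> ('x \<Rightarrow> 'm \<Rightarrow> 'x) \<Rightarrow>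
    'y::complex_vector set \<Rightarrow> ('m \<Rightarrow> 'y \<Rightarrow> 'y) \<Rightarrow> ('x \<Rightarrow> 'y \<Rightarrow> 't::complex_vector) \<Rightarrow> bool"
  where "balanced_tensor X r Y l tens \<longleftrightarrow> (\<exists>L. clinear L \<and>
    (\<forall>x\<in>X. \<forall>y\<in>Y. L (x \<otimes> y) = tens x y) \<and>
    L ` subtensor X Y = UNIV \<and>
    {u \<in> subtensor X Y. L u = 0} =
      cspan {r x m \<otimes> y - x \<otimes> l m y | x m y. x \<in> X \<and> y \<in> Y})"


section \<open>Left Hermitian holomorphic vector bundles\<close>

text \<open>\<open>ltens\<close> and \<open>ldtens\<close> are the structure maps of the tensor products of the forms with the
  bundle and of the dual bundle with the forms, on the carriers \<open>'t\<close> and \<open>'s\<close>.  The Hermitian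
  structure is curried, \<open>lherm E f g\<close> being the value at \<open>g\<close> of the functional attached
  to the conjugate of \<open>f\<close>; the conjugate space has the same elements as \<open>'f\<close>.\<close>

record (overloaded) ('a, 'm, 'o, 'f, 't, 's) left_bundle =
  laction :: "'m \<Rightarrow> 'f \<Rightarrow> 'f"
  lcoact :: "'f \<Rightarrow> ('a, 'f) tensor"
  ltens :: "'o \<Rightarrow> 'f \<Rightarrow> 't"
  ldtens :: "('f \<Rightarrow> 'm) \<Rightarrow> 'o \<Rightarrow> 's"
  ldbar :: "'f \<Rightarrow> 't"
  lherm :: "'f \<Rightarrow> 'f \<Rightarrow> 'm"

definition left_module :: "('m::complex_algebra_1 \<Rightarrow> 'f::complex_vector \<Rightarrow> 'f) \<Rightarrow> bool"
  where "left_module l \<longleftrightarrow>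
    (\<forall>m n f. l (m + n) f = l m f + l n f) \<and> (\<forall>m f g. l m (f + g) = l m f + l m g) \<and>
    (\<forall>m n f. l (m * n) f = l m (l n f)) \<and> (\<forall>f. l 1 f = f) \<and>
    (\<forall>c m f. l (c *\<^sub>C m) f = c *\<^sub>C l m f)"

definition free_module :: "nat \<Rightarrow> (nat \<Rightarrow> 'm::zero) set"
  where "free_module N = {x. \<forall>j\<ge>N. x j = 0}"

text \<open>A finitely generated projective module is a retract of a free module of finite rank.\<close>

definition fg_projective_left :: "('m::complex_algebra_1 \<Rightarrow> 'f::complex_vector \<Rightarrow> 'f) \<Rightarrow> bool"
  where "fg_projective_left l \<longleftrightarrow> (\<exists>N s p.
    (\<forall>f. s f \<in> free_module N) \<and>
    (\<forall>f g. s (f + g) = s f + s g) \<and> (\<forall>m f. s (l m f) = (\<lambda>j. m * s f j)) \<and>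
    (\<forall>x\<in>free_module N. \<forall>y\<in>free_module N. p (x + y) = p x + p y) \<and>
    (\<forall>m. \<forall>x\<in>free_module N. p (\<lambda>j. m * x j) = l m (p x)) \<and>
    (\<forall>f. p (s f) = f))"

definition left_dual :: "('m::complex_algebra_1 \<Rightarrow> 'f::complex_vector \<Rightarrow> 'f) \<Rightarrow> ('f \<Rightarrow> 'm) set"
  where "left_dual l = {\<phi>. (\<forall>f g. \<phi> (f + g) = \<phi> f + \<phi> g) \<and> (\<forall>m f. \<phi> (l m f) = m * \<phi> f)}"

definition left_vector_bundle :: "('a::complex_star_algebra) hopf \<Rightarrow>
    ('a, 'm::complex_star_algebra, 'o::complex_algebra_1) kaehler \<Rightarrow>
    ('a, 'm, 'o, 'f::complex_vector, 't::complex_vector, 's::complex_vector) left_bundle \<Rightarrow> bool"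
  where "left_vector_bundle A K E \<longleftrightarrow>
    left_module (laction E) \<and> fg_projective_left (laction E) \<and>
    comodule A (lcoact E) \<and>
    (\<forall>m f. lcoact E (laction E m f) = tensor_mult (laction E) (coactM K m) (lcoact E f)) \<and>
    balanced_tensor UNIV (\<lambda>\<omega> m. \<omega> * incl K m) UNIV (laction E) (ltens E) \<and>
    balanced_tensor (left_dual (laction E)) (\<lambda>\<phi> m. (\<lambda>f. \<phi> f * m))
      UNIV (\<lambda>m \<omega>. incl K m * \<omega>) (ldtens E)"

definition left_bideg ::
    "('a, 'm, 'o) kaehler \<Rightarrow> ('a, 'm, 'o, 'f, 't::complex_vector, 's) left_bundle \<Rightarrow> nat \<times> nat \<Rightarrow> 't set"
  where "left_bideg K E ab = cspan {ltens E \<omega> f | \<omega> f. \<omega> \<in> bideg K ab}"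

definition left_coact :: "('a::complex_star_algebra, 'm, 'o::complex_algebra_1) kaehler \<Rightarrow>
    ('a, 'm, 'o, 'f::complex_vector, 't::complex_vector, 's) left_bundle \<Rightarrow> 't \<Rightarrow> ('a, 't) tensor"
  where "left_coact K E = lift_over UNIV UNIV (ltens E)
    (\<lambda>\<omega> f. tensor_mult (ltens E) (coact K \<omega>) (lcoact E f))"

definition left_wedge ::
    "('a, 'm, 'o::times, 'f, 't::complex_vector, 's) left_bundle \<Rightarrow> 'o \<Rightarrow> 't \<Rightarrow> 't"
  where "left_wedge E \<eta> = lift_over UNIV UNIV (ltens E) (\<lambda>\<omega> f. ltens E (\<eta> * \<omega>) f)"

definition left_dbar :: "('a, 'm, 'o::complex_algebra_1) kaehler \<Rightarrow>
    ('a, 'm, 'o, 'f, 't::complex_vector, 's) left_bundle \<Rightarrow> 't \<Rightarrow> 't"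
  where "left_dbar K E = (THE L. additive L \<and> (\<forall>k. \<forall>\<omega>\<in>deg K k. \<forall>f.
    L (ltens E \<omega> f) = ltens E (delbar K \<omega>) f + (-1) ^ k *\<^sub>C left_wedge E \<omega> (ldbar E f)))"

definition left_holomorphic :: "('a::complex_star_algebra, 'm, 'o::complex_algebra_1) kaehler \<Rightarrow>
    ('a, 'm, 'o, 'f::complex_vector, 't::complex_vector, 's) left_bundle \<Rightarrow> bool"
  where "left_holomorphic K E \<longleftrightarrow>
    clinear (ldbar E) \<and> range (ldbar E) \<subseteq> left_bideg K E (0, 1) \<and>
    (\<forall>f. left_coact K E (ldbar E f) = tensor_map id (ldbar E) (lcoact E f)) \<and>
    (\<forall>m f. ldbar E (laction E m f) =
      ltens E (delbar K (incl K m)) f + left_wedge E (incl K m) (ldbar E f)) \<and>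
    (\<forall>t. left_dbar K E (left_dbar K E t) = 0)"

text \<open>The value at \<open>g\<close> of the coaction of a functional \<open>\<phi>\<close>, that is
  \<open>S(g\<^bsub>(-1)\<^esub>) \<phi>(g\<^bsub>(0)\<^esub>)\<^bsub>(-1)\<^esub> \<otimes> \<phi>(g\<^bsub>(0)\<^esub>)\<^bsub>(0)\<^esub>\<close>.\<close>

definition left_dual_coact_at :: "('a::complex_star_algebra) hopf \<Rightarrow>
    ('a, 'm::complex_star_algebra, 'o) kaehler \<Rightarrow>
    ('a, 'm, 'o, 'f::complex_vector, 't, 's) left_bundle \<Rightarrow> ('f \<Rightarrow> 'm) \<Rightarrow> 'f \<Rightarrow> ('a, 'm) tensor"
  where "left_dual_coact_at A K E \<phi> g =
    tensor_lift (\<lambda>b g'. tensor_lift (\<lambda>c m. (antipode A b * c) \<otimes> m) (coactM K (\<phi> g')))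
      (lcoact E g)"

text \<open>In the last but one clause, \<open>tensor_map star (lherm E) (lcoact E f)\<close> is the image of the
  conjugate of \<open>f\<close> under its coaction followed by the Hermitian structure.  It is
  compared with the coaction of \<open>lherm E f\<close> by evaluating both at every \<open>g\<close>.\<close>

definition left_hermitian :: "('a::complex_star_algebra) hopf \<Rightarrow>
    ('a, 'm::complex_star_algebra, 'o) kaehler \<Rightarrow>
    ('a, 'm, 'o, 'f::complex_vector, 't, 's) left_bundle \<Rightarrow> bool"
  where "left_hermitian A K E \<longleftrightarrow>
    bij_betw (lherm E) UNIV (left_dual (laction E)) \<and>
    (\<forall>f g. lherm E (f + g) = lherm E f + lherm E g) \<and>
    (\<forall>c f. lherm E (c *\<^sub>C f) = cnj c *\<^sub>C lherm E f) \<and>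
    (\<forall>m f g. lherm E (laction E (star m) f) g = lherm E f g * m) \<and>
    (\<forall>f g. tensor_map id (\<lambda>\<psi>. \<psi> g) (tensor_map star (lherm E) (lcoact E f)) =
      left_dual_coact_at A K E (lherm E f) g) \<and>
    (\<forall>f g. lherm E f g = star (lherm E g f))"

definition left_positive_definite ::
    "('a, 'm::complex_star_algebra, 'o, 'f::zero, 't, 's) left_bundle \<Rightarrow> bool"
  where "left_positive_definite E \<longleftrightarrow> (\<forall>f. f \<noteq> 0 \<longrightarrow> lherm E f f \<in> positives)"

definition left_eval :: "('a, 'm::complex_star_algebra, 'o::complex_algebra_1) kaehler \<Rightarrow>
    ('a, 'm, 'o, 'f::complex_vector, 't::complex_vector, 's::complex_vector) left_bundle \<Rightarrow>
    't \<Rightarrow> 's \<Rightarrow> 'o"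
  where "left_eval K E \<alpha> \<gamma> = lift_over UNIV UNIV (ltens E)
    (\<lambda>\<omega> f. lift_over (left_dual (laction E)) UNIV (ldtens E)
      (\<lambda>\<phi> \<nu>. \<omega> * incl K (\<phi> f) * \<nu>) \<gamma>) \<alpha>"

definition left_hodge :: "('a, 'm, 'o::complex_algebra_1) kaehler \<Rightarrow>
    ('a, 'm, 'o, 'f, 't::complex_vector, 's::complex_vector) left_bundle \<Rightarrow> 't \<Rightarrow> 's"
  where "left_hodge K E = lift_over UNIV UNIV (ltens E)
    (\<lambda>\<omega> f. ldtens E (lherm E f) (hodge K (fstar K \<omega>)))"

definition left_inner :: "('a, 'm::complex_star_algebra, 'o::complex_algebra_1) kaehler \<Rightarrow>
    ('m \<Rightarrow> complex) \<Rightarrow>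
    ('a, 'm, 'o, 'f::complex_vector, 't::complex_vector, 's::complex_vector) left_bundle \<Rightarrow>
    't \<Rightarrow> 't \<Rightarrow> complex"
  where "left_inner K \<tau> E \<alpha> \<beta> = \<tau> (vol K (left_eval K E \<alpha> (left_hodge K E \<beta>)))"


section \<open>Right Hermitian holomorphic vector bundles\<close>

text \<open>Right bundles still carry left coactions.\<close>

record (overloaded) ('a, 'm, 'o, 'f, 't, 's) right_bundle =
  raction :: "'f \<Rightarrow> 'm \<Rightarrow> 'f"
  rcoact :: "'f \<Rightarrow> ('a, 'f) tensor"
  rtens :: "'f \<Rightarrow> 'o \<Rightarrow> 't"
  rdtens :: "'o \<Rightarrow> ('f \<Rightarrow> 'm) \<Rightarrow> 's"
  rdbar :: "'f \<Rightarrow> 't"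
  rherm :: "'f \<Rightarrow> 'f \<Rightarrow> 'm"

definition right_module :: "('f::complex_vector \<Rightarrow> 'm::complex_algebra_1 \<Rightarrow> 'f) \<Rightarrow> bool"
  where "right_module r \<longleftrightarrow>
    (\<forall>f m n. r f (m + n) = r f m + r f n) \<and> (\<forall>f g m. r (f + g) m = r f m + r g m) \<and>
    (\<forall>f m n. r f (m * n) = r (r f m) n) \<and> (\<forall>f. r f 1 = f) \<and>
    (\<forall>f c m. r f (c *\<^sub>C m) = c *\<^sub>C r f m)"

definition fg_projective_right :: "('f::complex_vector \<Rightarrow> 'm::complex_algebra_1 \<Rightarrow> 'f) \<Rightarrow> bool"
  where "fg_projective_right r \<longleftrightarrow> (\<exists>N s p.
    (\<forall>f. s f \<in> free_module N) \<and>
    (\<forall>f g. s (f + g) = s f + s g) \<and> (\<forall>f m. s (r f m) = (\<lambda>j. s f j * m)) \<and>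
    (\<forall>x\<in>free_module N. \<forall>y\<in>free_module N. p (x + y) = p x + p y) \<and>
    (\<forall>m. \<forall>x\<in>free_module N. p (\<lambda>j. x j * m) = r (p x) m) \<and>
    (\<forall>f. p (s f) = f))"

definition right_dual :: "('f::complex_vector \<Rightarrow> 'm::complex_algebra_1 \<Rightarrow> 'f) \<Rightarrow> ('f \<Rightarrow> 'm) set"
  where "right_dual r = {\<phi>. (\<forall>f g. \<phi> (f + g) = \<phi> f + \<phi> g) \<and> (\<forall>f m. \<phi> (r f m) = \<phi> f * m)}"

definition right_vector_bundle :: "('a::complex_star_algebra) hopf \<Rightarrow>
    ('a, 'm::complex_star_algebra, 'o::complex_algebra_1) kaehler \<Rightarrow>
    ('a, 'm, 'o, 'f::complex_vector, 't::complex_vector, 's::complex_vector) right_bundle \<Rightarrow> bool"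
  where "right_vector_bundle A K E \<longleftrightarrow>
    right_module (raction E) \<and> fg_projective_right (raction E) \<and>
    comodule A (rcoact E) \<and>
    (\<forall>f m. rcoact E (raction E f m) = tensor_mult (raction E) (rcoact E f) (coactM K m)) \<and>
    balanced_tensor UNIV (raction E) UNIV (\<lambda>m \<omega>. incl K m * \<omega>) (rtens E) \<and>
    balanced_tensor UNIV (\<lambda>\<omega> m. \<omega> * incl K m)
      (right_dual (raction E)) (\<lambda>m \<phi>. (\<lambda>f. m * \<phi> f)) (rdtens E)"

definition right_deg ::
    "('a, 'm, 'o) kaehler \<Rightarrow> ('a, 'm, 'o, 'f, 't::complex_vector, 's) right_bundle \<Rightarrow> nat \<Rightarrow> 't set"
  where "right_deg K E k = cspan {rtens E f \<omega> | f \<omega>. \<omega> \<in> deg K k}"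

definition right_bideg ::
    "('a, 'm, 'o) kaehler \<Rightarrow> ('a, 'm, 'o, 'f, 't::complex_vector, 's) right_bundle \<Rightarrow> nat \<times> nat \<Rightarrow> 't set"
  where "right_bideg K E ab = cspan {rtens E f \<omega> | f \<omega>. \<omega> \<in> bideg K ab}"

definition right_coact :: "('a::complex_star_algebra, 'm, 'o::complex_algebra_1) kaehler \<Rightarrow>
    ('a, 'm, 'o, 'f::complex_vector, 't::complex_vector, 's) right_bundle \<Rightarrow> 't \<Rightarrow> ('a, 't) tensor"
  where "right_coact K E = lift_over UNIV UNIV (rtens E)
    (\<lambda>f \<omega>. tensor_mult (rtens E) (rcoact E f) (coact K \<omega>))"

definition right_wedge ::
    "('a, 'm, 'o::times, 'f, 't::complex_vector, 's) right_bundle \<Rightarrow> 't \<Rightarrow> 'o \<Rightarrow> 't"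
  where "right_wedge E t \<eta> = lift_over UNIV UNIV (rtens E) (\<lambda>f \<omega>. rtens E f (\<omega> * \<eta>)) t"

definition right_dbar :: "('a, 'm, 'o::complex_algebra_1) kaehler \<Rightarrow>
    ('a, 'm, 'o, 'f, 't::complex_vector, 's) right_bundle \<Rightarrow> 't \<Rightarrow> 't"
  where "right_dbar K E = lift_over UNIV UNIV (rtens E)
    (\<lambda>f \<omega>. right_wedge E (rdbar E f) \<omega> + rtens E f (delbar K \<omega>))"

definition right_holomorphic :: "('a::complex_star_algebra, 'm, 'o::complex_algebra_1) kaehler \<Rightarrow>
    ('a, 'm, 'o, 'f::complex_vector, 't::complex_vector, 's) right_bundle \<Rightarrow> bool"
  where "right_holomorphic K E \<longleftrightarrow>
    clinear (rdbar E) \<and> range (rdbar E) \<subseteq> right_bideg K E (0, 1) \<and>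
    (\<forall>f. right_coact K E (rdbar E f) = tensor_map id (rdbar E) (rcoact E f)) \<and>
    (\<forall>f m. rdbar E (raction E f m) =
      right_wedge E (rdbar E f) (incl K m) + rtens E f (delbar K (incl K m))) \<and>
    (\<forall>t. right_dbar K E (right_dbar K E t) = 0)"

text \<open>The value at \<open>g\<close> of the coaction of a functional \<open>\<phi>\<close>, that is
  \<open>\<phi>(g\<^bsub>(0)\<^esub>)\<^bsub>(-1)\<^esub> S\<^sup>-\<^sup>1(g\<^bsub>(-1)\<^esub>) \<otimes> \<phi>(g\<^bsub>(0)\<^esub>)\<^bsub>(0)\<^esub>\<close>.
  With a left coaction on a right module it is the inverse antipode that makes evaluation
  a comodule map and keeps the dual inside the module maps; the antipode of a Hopf
  *-algebra is invertible.\<close>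

definition right_dual_coact_at :: "('a::complex_star_algebra) hopf \<Rightarrow>
    ('a, 'm::complex_star_algebra, 'o) kaehler \<Rightarrow>
    ('a, 'm, 'o, 'f::complex_vector, 't, 's) right_bundle \<Rightarrow> ('f \<Rightarrow> 'm) \<Rightarrow> 'f \<Rightarrow> ('a, 'm) tensor"
  where "right_dual_coact_at A K E \<phi> g =
    tensor_lift (\<lambda>b g'. tensor_lift (\<lambda>c m. (c * inv (antipode A) b) \<otimes> m) (coactM K (\<phi> g')))
      (rcoact E g)"

definition right_hermitian :: "('a::complex_star_algebra) hopf \<Rightarrow>
    ('a, 'm::complex_star_algebra, 'o) kaehler \<Rightarrow>
    ('a, 'm, 'o, 'f::complex_vector, 't, 's) right_bundle \<Rightarrow> bool"
  where "right_hermitian A K E \<longleftrightarrow>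
    bij_betw (rherm E) UNIV (right_dual (raction E)) \<and>
    (\<forall>f g. rherm E (f + g) = rherm E f + rherm E g) \<and>
    (\<forall>c f. rherm E (c *\<^sub>C f) = cnj c *\<^sub>C rherm E f) \<and>
    (\<forall>m f g. rherm E (raction E f (star m)) g = m * rherm E f g) \<and>
    (\<forall>f g. tensor_map id (\<lambda>\<psi>. \<psi> g) (tensor_map star (rherm E) (rcoact E f)) =
      right_dual_coact_at A K E (rherm E f) g) \<and>
    (\<forall>f g. rherm E f g = star (rherm E g f))"

definition right_positive_definite ::
    "('a, 'm::complex_star_algebra, 'o, 'f::zero, 't, 's) right_bundle \<Rightarrow> bool"
  where "right_positive_definite E \<longleftrightarrow> (\<forall>f. f \<noteq> 0 \<longrightarrow> rherm E f f \<in> positives)"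

definition right_eval :: "('a, 'm::complex_star_algebra, 'o::complex_algebra_1) kaehler \<Rightarrow>
    ('a, 'm, 'o, 'f::complex_vector, 't::complex_vector, 's::complex_vector) right_bundle \<Rightarrow>
    's \<Rightarrow> 't \<Rightarrow> 'o"
  where "right_eval K E \<gamma> \<alpha> = lift_over UNIV (right_dual (raction E)) (rdtens E)
    (\<lambda>\<nu> \<phi>. lift_over UNIV UNIV (rtens E) (\<lambda>f \<omega>. \<nu> * incl K (\<phi> f) * \<omega>) \<alpha>) \<gamma>"

definition right_hodge :: "('a, 'm, 'o::complex_algebra_1) kaehler \<Rightarrow>
    ('a, 'm, 'o, 'f, 't::complex_vector, 's::complex_vector) right_bundle \<Rightarrow> 't \<Rightarrow> 's"
  where "right_hodge K E = lift_over UNIV UNIV (rtens E)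
    (\<lambda>f \<omega>. rdtens E (hodge K (fstar K \<omega>)) (rherm E f))"

text \<open>The sum extends the formula for homogeneous \<open>\<alpha>\<close>, with its sign, additively to all \<open>\<alpha>\<close>.\<close>

definition right_inner :: "('a, 'm::complex_star_algebra, 'o::complex_algebra_1) kaehler \<Rightarrow>
    ('m \<Rightarrow> complex) \<Rightarrow>
    ('a, 'm, 'o, 'f::complex_vector, 't::complex_vector, 's::complex_vector) right_bundle \<Rightarrow>
    't \<Rightarrow> 't \<Rightarrow> complex"
  where "right_inner K \<tau> E \<alpha> \<beta> = (\<Sum>k\<le>2 * hdim K. (-1) ^ k *
    \<tau> (vol K (right_eval K E (right_hodge K E \<beta>) (component (right_deg K E) k \<alpha>))))"


section \<open>Dirac operator, Laplacian and cohomology\<close>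

definition adjoint :: "('v \<Rightarrow> 'v \<Rightarrow> complex) \<Rightarrow> ('v \<Rightarrow> 'v) \<Rightarrow> 'v \<Rightarrow> 'v"
  where "adjoint ip T = (THE T'. \<forall>x y. ip (T x) y = ip x (T' y))"

definition dirac :: "('v::complex_vector \<Rightarrow> 'v \<Rightarrow> complex) \<Rightarrow> ('v \<Rightarrow> 'v) \<Rightarrow> 'v \<Rightarrow> 'v"
  where "dirac ip dbar x = dbar x + adjoint ip dbar x"

definition laplacian :: "('v::complex_vector \<Rightarrow> 'v \<Rightarrow> complex) \<Rightarrow> ('v \<Rightarrow> 'v) \<Rightarrow> 'v \<Rightarrow> 'v"
  where "laplacian ip dbar = dirac ip dbar \<circ> dirac ip dbar"

definition harmonic :: "('v::complex_vector \<Rightarrow> 'v \<Rightarrow> complex) \<Rightarrow> ('v \<Rightarrow> 'v) \<Rightarrow> 'v set"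
  where "harmonic ip dbar = {x. laplacian ip dbar x = 0}"

definition orthogonal_decomposition ::
    "('v::complex_vector \<Rightarrow> 'v \<Rightarrow> complex) \<Rightarrow> 'v set list \<Rightarrow> bool"
  where "orthogonal_decomposition ip Us \<longleftrightarrow>
    direct_sum {..<length Us} ((!) Us) UNIV \<and>
    (\<forall>i<length Us. \<forall>j<length Us. i \<noteq> j \<longrightarrow> (\<forall>x\<in>Us ! i. \<forall>y\<in>Us ! j. ip x y = 0))"

text \<open>Cocycles and coboundaries lying in a graded piece \<open>U\<close>.\<close>

definition cocycles :: "('v::zero \<Rightarrow> 'v) \<Rightarrow> 'v set \<Rightarrow> 'v set"
  where "cocycles dbar U = {x \<in> U. dbar x = 0}"

definition coboundaries :: "('v \<Rightarrow> 'v) \<Rightarrow> 'v set \<Rightarrow> 'v set"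
  where "coboundaries dbar U = range dbar \<inter> U"

definition coset :: "'v::plus set \<Rightarrow> 'v \<Rightarrow> 'v set"
  where "coset B x = {x + y | y. y \<in> B}"

text \<open>\<open>x \<mapsto> x + B\<close> maps \<open>H\<close> isomorphically onto the quotient space \<open>Z / B\<close>, the set of
  cosets \<open>coset B ` Z\<close>.  The quotient operations are those of representatives, so the map is
  linear and its bijectivity is the content.\<close>

definition represents_quotient :: "'v::complex_vector set \<Rightarrow> 'v set \<Rightarrow> 'v set \<Rightarrow> bool"
  where "represents_quotient H Z B \<longleftrightarrow>
    csubspace H \<and> csubspace Z \<and> csubspace B \<and> B \<subseteq> Z \<and> H \<subseteq> Z \<and>
    bij_betw (coset B) H (coset B ` Z)"

end

theory Submission
  imports Defs
begin

text \<open>The Dirac operator is symmetric for a non-degenerate Hermitian form. If it is diagonalisable, its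
  square has the same kernel, and since the Laplacian preserves the bigrading, a harmonic element is killed by the
  holomorphic structure and by its adjoint separately. The eigenvectors with non-zero eigenvalue lie in the
  sum of the two images, and non-degeneracy makes the resulting decomposition direct.

  To construct the adjoint, an element \<open>\<omega> \<otimes> g\<close> is turned into the \<open>M\<close>-linear map \<open>f \<mapsto> h(g)(f) \<and> *(\<omega>*)\<close> from
  the bundle to the forms. By a dual basis every such map arises exactly once, so the dual holomorphic structure,
  which satisfies a Leibniz rule, can be transported back; as the integral is closed, the result is the adjoint up
  to sign. It is a comodule map because the antipode allows to cancel the coaction in the covariance of this
  correspondence. Right bundles are left bundles for the opposite base algebra and the graded opposite product of forms.\<close>

section \<open>Sums over tensors\<close>

text \<open>Spaces of bundle-valued forms need not be finite dimensional, so an adjoint must be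
  exhibited. The Leibniz rule dictates its formula: integrating \<open>delbar\<close> of
  \<open>x\<close> times \<open>\<Psi> t f\<close> gives zero, and the two remaining terms express
  \<open>db\<close> on one side through \<open>N\<close> on the other, with the sign
  \<open>- sg\<close>. Defining this on a tensor product over the base algebra would need a check on
  a quotient; on maps from the bundle to the forms only \<open>M\<close>-linearity has to be
  checked. The Hodge map is given by a description on the summands \<open>L ^^ j\<close> of
  primitive forms, so the Lefschetz decomposition has to be derived first from the isomorphisms
  \<open>L ^^ (n - k)\<close>. Identities between coactions are handled in two ways: by slicing with
  a functional on the Hopf algebra, which replaces a coaction by a family of endomorphisms, or by
  sums over a representative of a tensor. The sign in the inner product of right bundles is that of
  the graded opposite product in top degree: forms of degrees \<open>k\<close> and
  \<open>2 * n - k\<close> are swapped at the cost of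
  \<open>(-1) ^ (k * (2 * n - k)) = (-1) ^ k\<close>.\<close>

definition balanced :: "('a::complex_vector \<Rightarrow> 'b::complex_vector \<Rightarrow> 'c::ab_group_add) \<Rightarrow> bool"
  where "balanced g \<longleftrightarrow> (\<forall>a a' b. g (a + a') b = g a b + g a' b) \<and>
    (\<forall>a b b'. g a (b + b') = g a b + g a b') \<and> (\<forall>c a b. g (c *\<^sub>C a) b = g a (c *\<^sub>C b))"

lemma balancedI:
  assumes "\<And>a a' b. g (a + a') b = g a b + g a' b" "\<And>a b b'. g a (b + b') = g a b + g a b'"
    "\<And>c a b. g (c *\<^sub>C a) b = g a (c *\<^sub>C b)"
  shows "balanced g"
  using assms by (auto simp: balanced_def)

lemma balancedD:
  assumes "balanced g"
  shows "g (a + a') b = g a b + g a' b" "g a (b + b') = g a b + g a b'"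
    "g (c *\<^sub>C a) b = g a (c *\<^sub>C b)"
  using assms by (auto simp: balanced_def)

lemma balanced_additive:
  assumes "balanced g"
  shows "additive (g a)" "additive (\<lambda>a. g a b)"
  using balancedD[OF assms] by (auto simp: additive_def)

lemma balanced_zero [simp]:
  assumes "balanced g" shows "g 0 b = 0" "g a 0 = 0"
  using additive.zero[OF balanced_additive(1)[OF assms, of a]]
    additive.zero[OF balanced_additive(2)[OF assms, of b]] by auto

lemma additive_sum_list: "additive f \<Longrightarrow> f (sum_list xs) = (\<Sum>x\<leftarrow>xs. f x)"
  by (induction xs) (auto simp: additive.zero additive.add)

lemma clinear_iff:
  "clinear f \<longleftrightarrow> (\<forall>x y. f (x + y) = f x + f y) \<and> (\<forall>c x. f (c *\<^sub>C x) = c *\<^sub>C f x)"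
  by (simp add: Vector_Spaces.linear_def module_hom_iff complex_vector.vector_space_axioms
      complex_vector.module_axioms)

lemma clinear_additive: "clinear f \<Longrightarrow> additive f"
  by (simp add: additive_def clinear_iff)

lemmas clinear_zero = additive.zero[OF clinear_additive]
  and clinear_diff = additive.diff[OF clinear_additive]
  and clinear_minus = additive.minus[OF clinear_additive]
  and clinear_sum = additive.sum[OF clinear_additive]

lemma clinearI:
  assumes "\<And>x y. f (x + y) = f x + f y" "\<And>c x. f (c *\<^sub>C x) = c *\<^sub>C f x"
  shows "clinear f"
  using assms by (simp add: clinear_iff)

lemma clinearD:
  assumes "clinear f"
  shows "f (x + y) = f x + f y" "f (c *\<^sub>C x) = c *\<^sub>C f x"
  using assms by (simp_all add: clinear_iff)

text \<open>\<open>extend_basis {}\<close> is a basis of the whole space, so this is the coefficient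
  of \<open>a\<close> at the basis vector \<open>e\<close>, and zero when \<open>e\<close> is not a
  basis vector.\<close>

definition coord :: "'a::complex_vector \<Rightarrow> 'a \<Rightarrow> complex"
  where "coord e a = complex_vector.representation (complex_vector.extend_basis {}) a e"

lemma coord_linear: "clinear (coord e :: 'a::complex_vector \<Rightarrow> complex)"
proof -
  have i: "complex_vector.independent (complex_vector.extend_basis {} :: 'a set)"
    and s: "complex_vector.span (complex_vector.extend_basis {} :: 'a set) = UNIV"
    by (auto simp: complex_vector.independent_extend_basis complex_vector.span_extend_basis
        complex_vector.independent_empty)
  show ?thesis
    unfolding coord_def
    by (rule clinearI) (simp_all add: i s complex_vector.representation_add
        complex_vector.representation_scale scaleC_complex_def)
qed

lemma coord_finite: "finite {e. coord e a \<noteq> 0}"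
  by (simp add: coord_def complex_vector.finite_representation)

lemma coord_sum:
  fixes a :: "'a::complex_vector"
  assumes "finite E" "{e. coord e a \<noteq> 0} \<subseteq> E"
  shows "(\<Sum>e\<in>E. coord e a *\<^sub>C e) = a"
proof -
  have "(\<Sum>e | coord e a \<noteq> 0. coord e a *\<^sub>C e) = a"
    unfolding coord_def
    by (rule complex_vector.sum_nonzero_representation_eq)
      (auto simp: complex_vector.independent_extend_basis complex_vector.span_extend_basis
        complex_vector.independent_empty)
  then show ?thesis using sum.mono_neutral_left[OF assms, of "\<lambda>e. coord e a *\<^sub>C e"]
    by (auto simp: complex_vector.scale_zero_left)
qed

lemma coord_sum_list:
  fixes xs :: "('a::complex_vector \<times> 'b) list"
  obtains E :: "'a set" where "finite E" "\<And>a b. (a, b) \<in> set xs \<Longrightarrow> (\<Sum>e\<in>E. coord e a *\<^sub>C e) = a"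
proof -
  let ?E = "\<Union>(a, b)\<in>set xs. {e. coord e a \<noteq> 0}"
  have fin: "finite ?E" by (auto simp: coord_finite)
  have "(\<Sum>e\<in>?E. coord e a *\<^sub>C e) = a" if "(a, b) \<in> set xs" for a b
    using that fin by (intro coord_sum) auto
  with fin show thesis using that by blast
qed

lemma sum_list_pair_cong:
  "(\<And>a b. (a, b) \<in> set xs \<Longrightarrow> f a b = g a b) \<Longrightarrow> (\<Sum>(a, b)\<leftarrow>xs. f a b) = (\<Sum>(a, b)\<leftarrow>xs. g a b)"
  by (intro arg_cong[of _ _ sum_list] map_cong) auto

text \<open>\<open>tensor_eq\<close> compares sums only under complex-valued bilinear forms. Writing
  the first entries in finitely many basis vectors \<open>e\<close> collects each sum into terms
  \<open>g e y\<close>, one vector \<open>y\<close> for each \<open>e\<close>, and these vectors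
  agree because the forms \<open>coord e a * \<phi> b\<close> separate them. Hence the target may be
  any abelian group and \<open>g\<close> may be conjugate-linear.\<close>

lemma balanced_tensor_eq:
  assumes g: "balanced g" and eq: "tensor_eq xs ys"
  shows "(\<Sum>(a, b)\<leftarrow>xs. g a b) = (\<Sum>(a, b)\<leftarrow>ys. g a b)"
proof -
  obtain E where E: "finite E" "\<And>a b. (a, b) \<in> set (xs @ ys) \<Longrightarrow> (\<Sum>e\<in>E. coord e a *\<^sub>C e) = a"
    using coord_sum_list[of "xs @ ys"] by metis
  have expand: "(\<Sum>(a, b)\<leftarrow>zs. g a b) = (\<Sum>e\<in>E. g e (\<Sum>(a, b)\<leftarrow>zs. coord e a *\<^sub>C b))"
    if "set zs \<subseteq> set (xs @ ys)" for zs
    using that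
  proof (induction zs)
    case (Cons p zs)
    obtain a b where p: "p = (a, b)" by fastforce
    have "g a b = g (\<Sum>e\<in>E. coord e a *\<^sub>C e) b" using E(2)[of a b] Cons.prems p by simp
    also have "\<dots> = (\<Sum>e\<in>E. g e (coord e a *\<^sub>C b))"
      by (simp add: additive.sum[OF balanced_additive(2)[OF g]] balancedD[OF g])
    finally show ?case using Cons p by (simp add: balancedD[OF g] sum.distrib)
  qed (simp add: g)
  have "(\<Sum>(a, b)\<leftarrow>xs. coord e a *\<^sub>C b) = (\<Sum>(a, b)\<leftarrow>ys. coord e a *\<^sub>C b)" for e
  proof (rule functionals_separate)
    fix \<phi> :: "'b \<Rightarrow> complex" assume \<phi>: "clinear \<phi>"
    have "cbilinear (\<lambda>a b. coord e a * \<phi> b)"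
      unfolding cbilinear_def clinear_iff
      by (simp add: clinearD(1)[OF coord_linear] clinearD(1)[OF \<phi>] clinearD(2)[OF coord_linear, unfolded scaleC_complex_def]
           clinearD(2)[OF \<phi>, unfolded scaleC_complex_def] scaleC_complex_def distrib_left distrib_right)
    then have "(\<Sum>(a, b)\<leftarrow>xs. coord e a * \<phi> b) = (\<Sum>(a, b)\<leftarrow>ys. coord e a * \<phi> b)"
      using eq by (simp add: tensor_eq_def)
    moreover have "\<phi> (\<Sum>(a, b)\<leftarrow>zs. coord e a *\<^sub>C b) = (\<Sum>(a, b)\<leftarrow>zs. coord e a * \<phi> b)" for zs
      using clinearD[OF \<phi>] additive_sum_list[OF clinear_additive[OF \<phi>]]
      by (auto simp: scaleC_complex_def comp_def case_prod_unfold)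
    ultimately show "\<phi> (\<Sum>(a, b)\<leftarrow>xs. coord e a *\<^sub>C b) = \<phi> (\<Sum>(a, b)\<leftarrow>ys. coord e a *\<^sub>C b)" by simp
  qed
  then show ?thesis using expand[of xs] expand[of ys] by simp
qed

text \<open>Sweedler's sum \<open>g v\<^bsub>(-1)\<^esub> v\<^bsub>(0)\<^esub>\<close>: it depends on the tensor only when \<open>g\<close> is balanced, but for a
  fixed representative it is linear in \<open>g\<close> without side conditions.\<close>

definition tsum :: "('a::complex_vector, 'b::complex_vector) tensor \<Rightarrow> ('a \<Rightarrow> 'b \<Rightarrow> 'c::ab_group_add) \<Rightarrow> 'c"
  where "tsum t g = (\<Sum>(a, b)\<leftarrow>rep_tensor t. g a b)"

lemma tsum_abs:
  assumes "balanced g" shows "tsum (abs_tensor xs) g = (\<Sum>(a, b)\<leftarrow>xs. g a b)"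
  unfolding tsum_def
  by (intro balanced_tensor_eq[OF assms] rep_abs_rsp_left[OF Quotient3_tensor]) (simp add: tensor_eq_def)

lemma tensor_cases: obtains xs where "t = abs_tensor xs"
  by (metis Quotient3_abs_rep[OF Quotient3_tensor])

lemma tsum_pure: "balanced g \<Longrightarrow> tsum (a \<otimes> b) g = g a b"
  by (simp add: pure_tensor.abs_eq tsum_abs)

lemma tsum_additive: "balanced g \<Longrightarrow> additive (\<lambda>t. tsum t g)"
proof (rule additive.intro)
  fix s t assume g: "balanced g"
  show "tsum (s + t) g = tsum s g + tsum t g"
    by (rule tensor_cases[of s], rule tensor_cases[of t]) (simp add: plus_tensor.abs_eq tsum_abs[OF g])
qed

lemmas tsum_add = additive.add[OF tsum_additive]

lemma additive_tsum: "additive f \<Longrightarrow> f (tsum t g) = tsum t (\<lambda>a b. f (g a b))"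
  by (simp add: tsum_def additive_sum_list comp_def case_prod_unfold)

lemma tsum_distrib: "tsum t (\<lambda>a b. g a b + h a b) = tsum t g + tsum t h"
  by (simp add: tsum_def case_prod_unfold sum_list_addf)

lemma tsum_minus: "tsum t (\<lambda>a b. g a b - h a b) = tsum t g - tsum t h"
  by (simp add: tsum_def case_prod_unfold sum_list_subtractf)

lemma tsum_swap: "tsum t (\<lambda>a b. tsum s (g a b)) = tsum s (\<lambda>c d. tsum t (\<lambda>a b. g a b c d))"
proof -
  have "(\<Sum>(a, b)\<leftarrow>xs. \<Sum>(c, d)\<leftarrow>ys. g a b c d) = (\<Sum>(c, d)\<leftarrow>ys. \<Sum>(a, b)\<leftarrow>xs. g a b c d)" for xs ys
    by (induction xs) (auto simp: case_prod_unfold sum_list_addf)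
  then show ?thesis by (simp add: tsum_def)
qed

lemma tsum_scale: "tsum t (\<lambda>a b. c *\<^sub>C g a b) = c *\<^sub>C tsum t g"
  by (rule additive_tsum[symmetric]) (simp add: additive_def scaleC_add_right)

lemma tsum_zero [simp]: "tsum t (\<lambda>a b. 0) = 0"
  by (simp add: tsum_def case_prod_unfold)

lemma tsum_sum: "tsum t (\<lambda>a b. \<Sum>i\<in>I. g i a b) = (\<Sum>i\<in>I. tsum t (g i))"
  by (induction I rule: infinite_finite_induct) (auto simp: tsum_distrib)

lemma balanced_pure: "balanced (\<otimes>)"
  by (rule balancedI) (simp_all add: pure_tensor_bilinear)

lemma tsum_self: "tsum t (\<otimes>) = t"
proof (rule tensor_cases[of t])
  fix xs assume t: "t = abs_tensor xs"
  have "(\<Sum>(a, b)\<leftarrow>xs. a \<otimes> b) = abs_tensor xs"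
  proof (induction xs)
    case Nil
    show ?case by (simp add: zero_tensor.abs_eq)
  next
    case (Cons p xs)
    obtain a b where "p = (a, b)" by fastforce
    with Cons show ?case
      by (metis (no_types, lifting) append_Cons append_Nil list.simps(9) old.prod.case
          plus_tensor.abs_eq pure_tensor.abs_eq sum_list.Cons)
  qed
  then show ?thesis by (simp add: t tsum_abs[OF balanced_pure])
qed

text \<open>The bridge from the description operator in \<open>tensor_lift\<close> to a concrete
  sum: for balanced \<open>g\<close>, \<open>tsum\<close> is additive with the prescribed values,
  and such a map is unique.\<close>

lemma tensor_lift_tsum:
  fixes g :: "'a::complex_vector \<Rightarrow> 'b::complex_vector \<Rightarrow> 'c::complex_vector"
  assumes g: "balanced g" shows "tensor_lift g t = tsum t g"
proof -
  have "additive (\<lambda>t. tsum t g) \<and> (\<forall>a b. tsum (a \<otimes> b) g = g a b)"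
    by (simp add: tsum_additive[OF g] tsum_pure[OF g])
  then have "tensor_lift g = (\<lambda>t. tsum t g)"
    unfolding lift_over_def
    using tensor_additive_exists[OF balanced_tensor_eq[OF g]] by (intro the1_equality) simp_all
  then show ?thesis by simp
qed

lemma tsum_tsum:
  assumes "balanced g"
  shows "tsum (tsum t h) g = tsum t (\<lambda>a b. tsum (h a b) g)"
  by (rule additive_tsum[OF tsum_additive[OF assms]])

lemma tensor_map_tsum:
  assumes "balanced (\<lambda>a b. f a \<otimes> h b)"
  shows "tensor_map f h t = tsum t (\<lambda>a b. f a \<otimes> h b)"
  by (simp add: tensor_map_def tensor_lift_tsum[OF assms])

lemma tsum_tensor_map:
  assumes "balanced (\<lambda>a b. f a \<otimes> h b)" "balanced g"
  shows "tsum (tensor_map f h t) g = tsum t (\<lambda>a b. g (f a) (h b))"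
  by (simp add: tensor_map_tsum[OF assms(1)] tsum_tsum[OF assms(2)] tsum_pure[OF assms(2)])

lemma balanced_linear:
  assumes "clinear f" "clinear h" shows "balanced (\<lambda>a b. f a \<otimes> h b)"
  by (rule balancedI) (simp_all add: clinearD[OF assms(1)] clinearD[OF assms(2)] pure_tensor_bilinear)

lemma clinear_id: "clinear id" "clinear (\<lambda>x. x)"
  by (rule clinearI; simp)+

lemma balanced_conj_linear:
  assumes "additive f" "\<And>c x. f (c *\<^sub>C x) = cnj c *\<^sub>C f x"
    "additive h" "\<And>c x. h (c *\<^sub>C x) = cnj c *\<^sub>C h x"
  shows "balanced (\<lambda>a b. f a \<otimes> h b)"
  by (rule balancedI) (simp_all add: assms additive.add[OF assms(1)] additive.add[OF assms(3)]
      pure_tensor_bilinear)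

lemma balanced_scale_left:
  assumes "additive f" "\<And>c x. f (c *\<^sub>C x) = c *\<^sub>C f x"
  shows "balanced (\<lambda>a b. f a *\<^sub>C b)"
  by (rule balancedI) (simp_all add: assms additive.add[OF assms(1)] scaleC_complex_def
      scaleC_add_left scaleC_add_right scaleC_scaleC mult.commute)

lemma balanced_right: "clinear f \<Longrightarrow> balanced (\<lambda>a b. a \<otimes> f b)"
  using balanced_linear[OF clinear_id(2)] by blast

lemma tensor_map_id_tsum: "clinear f \<Longrightarrow> tensor_map id f t = tsum t (\<lambda>a b. a \<otimes> f b)"
  using tensor_map_tsum[OF balanced_linear[OF clinear_id(1)]] by fastforce

lemma tsum_tensor_map_id:
  "clinear f \<Longrightarrow> balanced g \<Longrightarrow> tsum (tensor_map id f t) g = tsum t (\<lambda>a b. g a (f b))"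
  using tsum_tensor_map[OF balanced_linear[OF clinear_id(1)]] by fastforce

lemma tsum_scaleC:
  assumes g: "balanced g"
  shows "tsum (c *\<^sub>C t) g = tsum t (\<lambda>a b. g (c *\<^sub>C a) b)"
proof (rule tensor_cases[of t])
  fix xs assume "t = abs_tensor xs"
  moreover have "balanced (\<lambda>a b. g (c *\<^sub>C a) b)"
  proof (rule balancedI)
    show "g (c *\<^sub>C d *\<^sub>C a) b = g (c *\<^sub>C a) (d *\<^sub>C b)" for d a b
      using balancedD(3)[OF g, of d "c *\<^sub>C a" b] by (simp add: scaleC_scaleC mult.commute)
  qed (simp_all add: balancedD(1,2)[OF g] scaleC_add_right)
  ultimately show ?thesis
    by (simp add: scaleC_tensor.abs_eq tsum_abs g comp_def case_prod_unfold)
qed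

lemma clinear_tsum:
  assumes "balanced g" "\<And>c a b. g (c *\<^sub>C a) b = c *\<^sub>C g a b"
  shows "clinear (\<lambda>t. tsum t g)"
proof (rule clinearI)
  fix s t c
  show "tsum (s + t) g = tsum s g + tsum t g" by (rule tsum_add[OF assms(1)])
  have "tsum (c *\<^sub>C t) g = tsum t (\<lambda>a b. g (c *\<^sub>C a) b)"
  proof (rule tensor_cases[of t])
    fix xs assume "t = abs_tensor xs"
    moreover have "balanced (\<lambda>a b. g (c *\<^sub>C a) b)"
      unfolding assms(2) by (rule balancedI) (simp_all add: balancedD[OF assms(1)] scaleC_add_right)
    ultimately show ?thesis
      by (simp add: scaleC_tensor.abs_eq tsum_abs assms(1) comp_def case_prod_unfold)
  qed
  then show "tsum (c *\<^sub>C t) g = c *\<^sub>C tsum t g" by (simp add: assms(2) tsum_scale)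
qed

text \<open>This is \<open>\<phi>\<close> tensored with the identity. Slices by all functionals
  separate tensors, which turns identities between coactions and membership in subcomodules into
  statements about single vectors.\<close>

definition slice :: "('a \<Rightarrow> complex) \<Rightarrow> ('a::complex_vector, 'b::complex_vector) tensor \<Rightarrow> 'b"
  where "slice \<phi> t = tsum t (\<lambda>a b. \<phi> a *\<^sub>C b)"

lemma balanced_slice: "clinear \<phi> \<Longrightarrow> balanced (\<lambda>a b. \<phi> a *\<^sub>C b)"
  by (rule balanced_scale_left) (simp_all add: clinear_additive clinearD)

lemma slice_linear:
  assumes "clinear \<phi>" shows "clinear (slice \<phi>)"
proof (rule clinearI)
  fix s t :: "('a, 'b) tensor" and c
  note b = balanced_slice[OF assms]
  show "slice \<phi> (s + t) = slice \<phi> s + slice \<phi> t" by (simp add: slice_def tsum_add[OF b])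
  show "slice \<phi> (c *\<^sub>C t) = c *\<^sub>C slice \<phi> t"
  proof (rule tensor_cases[of t])
    fix xs assume t: "t = abs_tensor xs"
    show ?thesis unfolding slice_def t scaleC_tensor.abs_eq tsum_abs[OF b]
      by (induction xs) (auto simp: clinearD[OF assms] scaleC_complex_def scaleC_add_right scaleC_scaleC
          complex_vector.scale_zero_right)
  qed
qed

lemma slice_pure: "clinear \<phi> \<Longrightarrow> slice \<phi> (a \<otimes> b) = \<phi> a *\<^sub>C b"
  by (simp add: slice_def tsum_pure balanced_slice)

text \<open>Only finitely many basis vectors occur in the first entries of a representative;
  collecting by them makes the second factors the coordinate slices.\<close>

lemma tensor_slices:
  fixes t :: "('a::complex_vector, 'b::complex_vector) tensor"
  obtains E where "finite E" "t = (\<Sum>e\<in>E. e \<otimes> slice (coord e) t)"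
proof -
  obtain E where E: "finite E" "\<And>a b. (a, b) \<in> set (rep_tensor t) \<Longrightarrow> (\<Sum>e\<in>E. coord e a *\<^sub>C e) = a"
    using coord_sum_list[of "rep_tensor t"] by metis
  have "t = tsum t (\<otimes>)" by (simp add: tsum_self)
  also have "\<dots> = tsum t (\<lambda>a b. (\<Sum>e\<in>E. coord e a *\<^sub>C e) \<otimes> b)"
    unfolding tsum_def by (rule sum_list_pair_cong) (simp add: E)
  also have "\<dots> = tsum t (\<lambda>a b. \<Sum>e\<in>E. e \<otimes> (coord e a *\<^sub>C b))"
    by (simp add: additive.sum[OF balanced_additive(2)[OF balanced_pure]] pure_tensor_bilinear)
  also have "\<dots> = (\<Sum>e\<in>E. e \<otimes> slice (coord e) t)"
    by (simp add: tsum_sum slice_def additive_tsum[OF balanced_additive(1)[OF balanced_pure]])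
  finally show thesis using that E(1) by blast
qed

lemma slice_eqI:
  assumes "\<And>\<phi>. clinear \<phi> \<Longrightarrow> slice \<phi> s = slice \<phi> t"
  shows "s = t"
proof -
  obtain E where E: "finite E" "s - t = (\<Sum>e\<in>E. e \<otimes> slice (coord e) (s - t))" by (rule tensor_slices)
  have "slice (coord e) (s - t) = 0" for e
    by (simp add: assms[OF coord_linear]
        clinear_diff[OF slice_linear[OF coord_linear]])
  then have "s - t = 0" using E(2) by (simp add: balanced_zero[OF balanced_pure])
  then show ?thesis by simp
qed

text \<open>Pure tensors with second factor in \<open>X\<close> have slices in \<open>X\<close>;
  conversely the expansion of \<open>tensor_slices\<close> has slices as second factors. For a
  coaction, being a subcomodule thus becomes stability under all slices.\<close>

lemma subtensor_iff_slices:
  fixes t :: "('a::complex_vector, 'b::complex_vector) tensor"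
  assumes X: "csubspace X"
  shows "t \<in> subtensor UNIV X \<longleftrightarrow> (\<forall>\<phi> :: 'a \<Rightarrow> complex. clinear \<phi> \<longrightarrow> slice \<phi> t \<in> X)"
proof
  assume t: "t \<in> subtensor UNIV X"
  show "\<forall>\<phi> :: 'a \<Rightarrow> complex. clinear \<phi> \<longrightarrow> slice \<phi> t \<in> X"
  proof (intro allI impI)
    fix \<phi> :: "'a \<Rightarrow> complex" assume \<phi>: "clinear \<phi>"
    show "slice \<phi> t \<in> X"
      using t unfolding subtensor_def
    proof (induction rule: complex_vector.span_induct_alt)
      case base
      then show ?case
        by (simp add: clinear_zero[OF slice_linear[OF \<phi>]]
            complex_vector.subspace_0[OF X])
    next
      case (step c x y)
      then show ?case
        by (auto simp: clinearD[OF slice_linear[OF \<phi>]] slice_pure[OF \<phi>]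
            intro!: complex_vector.subspace_add[OF X] complex_vector.subspace_scale[OF X])
    qed
  qed
next
  assume s: "\<forall>\<phi> :: 'a \<Rightarrow> complex. clinear \<phi> \<longrightarrow> slice \<phi> t \<in> X"
  obtain E where E: "finite E" "t = (\<Sum>e\<in>E. e \<otimes> slice (coord e) t)" by (rule tensor_slices)
  show "t \<in> subtensor UNIV X"
    using s coord_linear by (subst E(2), unfold subtensor_def)
      (intro complex_vector.span_sum complex_vector.span_base, blast)
qed

lemma slice_tensor_map_id:
  assumes "clinear \<phi>" "clinear f"
  shows "slice \<phi> (tensor_map id f t) = f (slice \<phi> t)"
  by (simp add: slice_def clinearD[OF assms(2)] additive_tsum[OF clinear_additive[OF assms(2)]]
      tsum_tensor_map[OF balanced_linear[OF clinear_id(1) assms(2)] balanced_slice[OF assms(1)]])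

section \<open>Balanced tensor products\<close>

text \<open>A scalar is absorbed by the first factor, which stays in the subspace \<open>X\<close>;
  hence there is no case for scaling and the rule applies to merely additive maps.\<close>

lemma subtensor_induct [consumes 2, case_names zero add pure]:
  assumes "u \<in> subtensor X Y" "csubspace X"
    and "P 0" "\<And>s t. s \<in> subtensor X Y \<Longrightarrow> t \<in> subtensor X Y \<Longrightarrow> P s \<Longrightarrow> P t \<Longrightarrow> P (s + t)"
    and "\<And>x y. x \<in> X \<Longrightarrow> y \<in> Y \<Longrightarrow> P (x \<otimes> y)"
  shows "P u"
proof -
  have "u \<in> subtensor X Y \<and> P u"
    using assms(1) unfolding subtensor_def
  proof (induction rule: complex_vector.span_induct_alt)
    case base
    then show ?case using assms(3) by (simp add: complex_vector.span_zero)
  next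
    case (step c z s)
    then obtain x y where z: "z = x \<otimes> y" "x \<in> X" "y \<in> Y" by blast
    have c: "c *\<^sub>C z = (c *\<^sub>C x) \<otimes> y" "c *\<^sub>C x \<in> X"
      using z by (simp_all add: pure_tensor_bilinear complex_vector.subspace_scale[OF assms(2)])
    then have "c *\<^sub>C z \<in> subtensor X Y" "P (c *\<^sub>C z)"
      using z assms(5) by (auto simp: subtensor_def intro!: complex_vector.span_base)
    then show ?case using step assms(4) by (auto simp: subtensor_def intro: complex_vector.span_add)
  qed
  then show ?thesis by simp
qed

lemma pure_in_subtensor: "x \<in> X \<Longrightarrow> y \<in> Y \<Longrightarrow> x \<otimes> y \<in> subtensor X Y"
  by (auto simp: subtensor_def intro!: complex_vector.span_base)

lemma balanced_tensor_induct [consumes 2, case_names zero add tens]: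
  assumes bt: "balanced_tensor X r Y l tens" and X: "csubspace X"
    and "P 0" "\<And>s t. P s \<Longrightarrow> P t \<Longrightarrow> P (s + t)"
    and "\<And>x y. x \<in> X \<Longrightarrow> y \<in> Y \<Longrightarrow> P (tens x y)"
  shows "P t"
proof -
  obtain L where L: "clinear L" "\<forall>x\<in>X. \<forall>y\<in>Y. L (x \<otimes> y) = tens x y" "L ` subtensor X Y = UNIV"
    using bt by (auto simp: balanced_tensor_def)
  obtain u where "u \<in> subtensor X Y" "L u = t" using L(3) by (metis UNIV_I imageE)
  from this(1) X have "P (L u)"
    using assms(3-) L(2) clinearD(1)[OF L(1)] clinear_zero[OF L(1)]
    by (induction rule: subtensor_induct) auto
  then show ?thesis using \<open>L u = t\<close> by simp
qed

text \<open>The carrier is the quotient of \<open>subtensor X Y\<close> by the span of the balancing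
  relations, so \<open>g\<close> descends once its sum vanishes on that span.\<close>

lemma balanced_tensor_lift:
  assumes bt: "balanced_tensor X r Y l tens" and X: "csubspace X"
    and r: "\<And>c x m. x \<in> X \<Longrightarrow> r (c *\<^sub>C x) m = c *\<^sub>C r x m"
    and g: "balanced g" and gm: "\<And>x m y. x \<in> X \<Longrightarrow> y \<in> Y \<Longrightarrow> g (r x m) y = g x (l m y)"
  shows "\<exists>!L. additive L \<and> (\<forall>x\<in>X. \<forall>y\<in>Y. L (tens x y) = g x y)"
proof -
  let ?R = "{r x m \<otimes> y - x \<otimes> l m y | x m y. x \<in> X \<and> y \<in> Y}"
  obtain L where L: "clinear L" "\<And>x y. x \<in> X \<Longrightarrow> y \<in> Y \<Longrightarrow> L (x \<otimes> y) = tens x y"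
    "L ` subtensor X Y = UNIV" "{u \<in> subtensor X Y. L u = 0} = cspan ?R"
    using bt by (auto simp: balanced_tensor_def)
  note g_add = additive.add[OF tsum_additive[OF g]] and g_diff = additive.diff[OF tsum_additive[OF g]]
  have ker: "tsum u g = 0" if "u \<in> cspan ?R" for u
    using that
  proof (induction rule: complex_vector.span_induct_alt)
    case base
    then show ?case by (simp add: additive.zero[OF tsum_additive[OF g]])
  next
    case (step c z s)
    then obtain x m y where z: "z = r x m \<otimes> y - x \<otimes> l m y" "x \<in> X" "y \<in> Y" by blast
    \<comment> \<open>Summing with \<open>g\<close> is only additive, so the scalar is moved inside
      the relation; this is where homogeneity of \<open>r\<close> enters.\<close>
    have cx: "c *\<^sub>C x \<in> X" using z X by (simp add: complex_vector.subspace_scale)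
    have "c *\<^sub>C z = r (c *\<^sub>C x) m \<otimes> y - (c *\<^sub>C x) \<otimes> l m y"
      by (simp add: z r[OF z(2)] pure_tensor_bilinear complex_vector.scale_right_diff_distrib)
    then have "tsum (c *\<^sub>C z) g = 0"
      by (simp add: g_diff tsum_pure[OF g] gm[OF cx z(3)])
    then show ?case using step by (simp add: g_add)
  qed
  have wd: "tsum u g = tsum v g" if "u \<in> subtensor X Y" "v \<in> subtensor X Y" "L u = L v" for u v
  proof -
    have "u - v \<in> subtensor X Y" using that unfolding subtensor_def by (intro complex_vector.span_diff)
    moreover have "L (u - v) = 0"
      using that clinear_diff[OF L(1)] by simp
    ultimately have "tsum (u - v) g = 0" using ker L(4) by blast
    then show ?thesis by (simp add: g_diff)
  qed
  define G where "G t = tsum (SOME u. u \<in> subtensor X Y \<and> L u = t) g" for t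
  have G: "G (L u) = tsum u g" if "u \<in> subtensor X Y" for u
  proof -
    have "\<exists>v. v \<in> subtensor X Y \<and> L v = L u" using that by blast
    from someI_ex[OF this] show ?thesis unfolding G_def using that by (intro wd) auto
  qed
  show ?thesis
  proof
    have "G (s + t) = G s + G t" for s t
    proof -
      obtain u v where u: "u \<in> subtensor X Y" "L u = s" "v \<in> subtensor X Y" "L v = t"
        using L(3) by (metis UNIV_I imageE)
      moreover have "u + v \<in> subtensor X Y" using u unfolding subtensor_def by (intro complex_vector.span_add)
      ultimately show ?thesis using G[of "u + v"] G[of u] G[of v] by (simp add: clinearD[OF L(1)] g_add)
    qed
    then show "additive G \<and> (\<forall>x\<in>X. \<forall>y\<in>Y. G (tens x y) = g x y)"
      using G[OF pure_in_subtensor] L(2) by (simp add: additive_def tsum_pure[OF g])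
    fix H assume H: "additive H \<and> (\<forall>x\<in>X. \<forall>y\<in>Y. H (tens x y) = g x y)"
    show "H = G"
    proof
      fix t
      show "H t = G t"
        using bt X
      proof (induction t rule: balanced_tensor_induct)
        case zero
        then show ?case using H \<open>additive G \<and> _\<close> by (simp add: additive.zero)
      next
        case (add s t)
        then show ?case using H \<open>additive G \<and> _\<close> by (simp add: additive.add)
      qed (use H \<open>additive G \<and> _\<close> in simp)
    qed
  qed
qed

lemma lift_over_tens:
  assumes "\<exists>!L. additive L \<and> (\<forall>x\<in>X. \<forall>y\<in>Y. L (tens x y) = g x y)"
  shows "additive (lift_over X Y tens g)"
    and "x \<in> X \<Longrightarrow> y \<in> Y \<Longrightarrow> lift_over X Y tens g (tens x y) = g x y"
    and "additive H \<Longrightarrow> (\<And>x y. x \<in> X \<Longrightarrow> y \<in> Y \<Longrightarrow> H (tens x y) = g x y) \<Longrightarrow> lift_over X Y tens g = H"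
proof -
  have *: "additive (lift_over X Y tens g) \<and> (\<forall>x\<in>X. \<forall>y\<in>Y. lift_over X Y tens g (tens x y) = g x y)"
    unfolding lift_over_def by (rule theI'[OF assms])
  then show "additive (lift_over X Y tens g)"
    and "x \<in> X \<Longrightarrow> y \<in> Y \<Longrightarrow> lift_over X Y tens g (tens x y) = g x y" by auto
  show "lift_over X Y tens g = H" if "additive H" "\<And>x y. x \<in> X \<Longrightarrow> y \<in> Y \<Longrightarrow> H (tens x y) = g x y"
    using assms * that by blast
qed

lemma balanced_tensor_tens:
  assumes "balanced_tensor UNIV r UNIV l tens"
  shows "tens (x + x') y = tens x y + tens x' y" "tens x (y + y') = tens x y + tens x y'"
    "tens (c *\<^sub>C x) y = c *\<^sub>C tens x y" "tens x (c *\<^sub>C y) = c *\<^sub>C tens x y"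
    "tens (r x m) y = tens x (l m y)"
proof -
  let ?R = "{r x m \<otimes> y - x \<otimes> l m y | x m y. x \<in> UNIV \<and> y \<in> UNIV}"
  obtain L where L: "clinear L" "\<And>x y. L (x \<otimes> y) = tens x y"
    "{u \<in> subtensor UNIV UNIV. L u = 0} = cspan ?R"
    using assms by (auto simp: balanced_tensor_def)
  note lin = clinearD[OF L(1)] clinear_diff[OF L(1)]
  show "tens (x + x') y = tens x y + tens x' y" "tens x (y + y') = tens x y + tens x y'"
    "tens (c *\<^sub>C x) y = c *\<^sub>C tens x y" "tens x (c *\<^sub>C y) = c *\<^sub>C tens x y"
    by (simp_all add: lin pure_tensor_bilinear flip: L(2))
  have "r x m \<otimes> y - x \<otimes> l m y \<in> cspan ?R" by (intro complex_vector.span_base) blast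
  then have "L (r x m \<otimes> y - x \<otimes> l m y) = 0" using L(3) by blast
  then show "tens (r x m) y = tens x (l m y)" by (simp add: lin L(2))
qed

section \<open>Exchanging the two factors of a tensor product\<close>

lemma balanced_swap: "balanced (\<lambda>a b. b \<otimes> a)"
  by (rule balancedI) (simp_all add: pure_tensor_bilinear)

definition tensor_swap :: "('a::complex_vector, 'b::complex_vector) tensor \<Rightarrow> ('b, 'a) tensor"
  where "tensor_swap t = tsum t (\<lambda>a b. b \<otimes> a)"

lemma tensor_swap_linear: "clinear (tensor_swap :: ('a::complex_vector, 'b::complex_vector) tensor \<Rightarrow> _)"
  using clinear_tsum[OF balanced_swap] by (simp add: tensor_swap_def[abs_def] pure_tensor_bilinear)

lemma tensor_swap_pure: "tensor_swap (a \<otimes> b) = b \<otimes> a"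
  by (simp add: tensor_swap_def tsum_pure balanced_swap)

lemma tensor_swap_swap: "tensor_swap (tensor_swap t) = t"
proof -
  have "tensor_swap (tensor_swap t) = tsum t (\<lambda>a b. tensor_swap (b \<otimes> a))"
    unfolding tensor_swap_def[of t] by (rule additive_tsum[OF clinear_additive[OF tensor_swap_linear]])
  then show ?thesis by (simp add: tensor_swap_pure tsum_self)
qed

lemma clinear_image_span: "clinear f \<Longrightarrow> f ` cspan S = cspan (f ` S)"
  by (rule module_hom.span_image[symmetric]) (simp add: module_hom_iff_linear)

lemma subtensor_swap: "tensor_swap ` subtensor X Y = subtensor Y X"
proof -
  have "tensor_swap ` {x \<otimes> y | x y. x \<in> X \<and> y \<in> Y} = {y \<otimes> x | y x. y \<in> Y \<and> x \<in> X}"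
    by (force simp: tensor_swap_pure image_iff)
  then show ?thesis by (simp add: subtensor_def clinear_image_span tensor_swap_linear)
qed

text \<open>The flip sends the balancing relations to the negatives of the mirrored ones, which span
  the same subspace. This lets a right module tensored with forms be read as forms tensored with a
  left module over the opposite algebra.\<close>

lemma balanced_tensor_swap:
  fixes X :: "'x::complex_vector set" and Y :: "'y::complex_vector set"
  assumes "balanced_tensor X r Y l tens"
  shows "balanced_tensor Y (\<lambda>y m. l m y) X (\<lambda>m x. r x m) (\<lambda>y x. tens x y)"
proof -
  let ?R = "{r x m \<otimes> y - x \<otimes> l m y | x m y. x \<in> X \<and> y \<in> Y}"
    and ?R' = "{l m y \<otimes> x - y \<otimes> r x m | y m x. y \<in> Y \<and> x \<in> X}"
  obtain L where L: "clinear L" "\<And>x y. x \<in> X \<Longrightarrow> y \<in> Y \<Longrightarrow> L (x \<otimes> y) = tens x y"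
    "L ` subtensor X Y = UNIV" "{u \<in> subtensor X Y. L u = 0} = cspan ?R"
    using assms by (auto simp: balanced_tensor_def)
  note neg = clinear_minus[OF tensor_swap_linear]
    clinear_diff[OF tensor_swap_linear]
  have eq: "tensor_swap ` ?R = uminus ` ?R'"
  proof (intro subset_antisym subsetI)
    fix u assume "u \<in> tensor_swap ` ?R"
    then obtain x m y where "u = tensor_swap (r x m \<otimes> y - x \<otimes> l m y)" "x \<in> X" "y \<in> Y" by blast
    then have "u = - (l m y \<otimes> x - y \<otimes> r x m)" "x \<in> X" "y \<in> Y" by (simp_all add: neg tensor_swap_pure)
    then show "u \<in> uminus ` ?R'" by blast
  next
    fix u assume "u \<in> uminus ` ?R'"
    then obtain x m y where "u = - (l m y \<otimes> x - y \<otimes> r x m)" "x \<in> X" "y \<in> Y" by blast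
    then have "u = tensor_swap (r x m \<otimes> y - x \<otimes> l m y)" "x \<in> X" "y \<in> Y"
      by (simp_all add: neg tensor_swap_pure)
    then show "u \<in> tensor_swap ` ?R" by blast
  qed
  have "clinear (uminus :: ('y, 'x) tensor \<Rightarrow> _)"
    by (rule clinearI) simp_all
  then have "cspan (uminus ` ?R') = uminus ` cspan ?R'" by (simp add: clinear_image_span)
  also have "\<dots> = cspan ?R'"
    using complex_vector.span_neg by (force simp: image_iff intro: exI[of _ "- _"])
  finally have span: "tensor_swap ` cspan ?R = cspan ?R'"
    by (simp add: clinear_image_span tensor_swap_linear eq)
  have "{u \<in> subtensor Y X. L (tensor_swap u) = 0} = tensor_swap ` {u \<in> subtensor X Y. L u = 0}"
    using subtensor_swap[of X Y] subtensor_swap[of Y X]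
    by (auto simp: image_iff tensor_swap_swap) (metis tensor_swap_swap imageI)
  then have ker: "{u \<in> subtensor Y X. L (tensor_swap u) = 0} = cspan ?R'" by (simp add: L(4) span)
  show ?thesis unfolding balanced_tensor_def
  proof (intro exI conjI ballI)
    show "clinear (\<lambda>u. L (tensor_swap u))"
      by (rule clinearI) (simp_all add: clinearD[OF L(1)] clinearD[OF tensor_swap_linear])
    show "L (tensor_swap (y \<otimes> x)) = tens x y" if "y \<in> Y" "x \<in> X" for y x
      using that by (simp add: tensor_swap_pure L(2))
    show "(\<lambda>u. L (tensor_swap u)) ` subtensor Y X = UNIV"
      using L(3) by (simp add: subtensor_swap flip: image_image)
    show "{u \<in> subtensor Y X. L (tensor_swap u) = 0} = cspan ?R'" by (rule ker)
  qed
qed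

text \<open>Dual modules are only subspaces of a function type, and \<open>g\<close> is balanced
  only on \<open>X\<close>. Precomposing with a linear projection onto \<open>X\<close> extends it
  to the whole type without changing the values that matter.\<close>

lemma balanced_tensor_lift_on:
  assumes bt: "balanced_tensor X r Y l tens" and X: "csubspace X"
    and r: "\<And>c x m. x \<in> X \<Longrightarrow> r (c *\<^sub>C x) m = c *\<^sub>C r x m" "\<And>x m. x \<in> X \<Longrightarrow> r x m \<in> X"
    and g: "\<And>x x' y. x \<in> X \<Longrightarrow> x' \<in> X \<Longrightarrow> g (x + x') y = g x y + g x' y"
      "\<And>x y y'. x \<in> X \<Longrightarrow> g x (y + y') = g x y + g x y'"
      "\<And>c x y. x \<in> X \<Longrightarrow> g (c *\<^sub>C x) y = g x (c *\<^sub>C y)"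
      "\<And>x m y. x \<in> X \<Longrightarrow> g (r x m) y = g x (l m y)"
  shows "\<exists>!L. additive L \<and> (\<forall>x\<in>X. \<forall>y\<in>Y. L (tens x y) = g x y)"
proof -
  interpret vector_space_pair "scaleC :: complex \<Rightarrow> 'a \<Rightarrow> 'a" "scaleC :: complex \<Rightarrow> 'a \<Rightarrow> 'a"
    by unfold_locales
  obtain \<pi> :: "'a \<Rightarrow> 'a" where \<pi>: "\<pi> ` UNIV \<subseteq> X" "clinear \<pi>" "\<forall>x\<in>X. \<pi> x = x"
    using linear_exists_left_inverse_on[OF clinear_id(1) X] by auto
  have \<pi>X: "\<pi> x \<in> X" for x using \<pi>(1) by blast
  have b: "balanced (\<lambda>x y. g (\<pi> x) y)"
    by (rule balancedI) (simp_all add: clinearD[OF \<pi>(2)] g \<pi>X)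
  have "\<exists>!L. additive L \<and> (\<forall>x\<in>X. \<forall>y\<in>Y. L (tens x y) = g (\<pi> x) y)"
    by (rule balanced_tensor_lift[OF bt X r(1) b]) (simp_all add: \<pi>(3) r(2) g(4))
  moreover have "(\<forall>x\<in>X. \<forall>y\<in>Y. L (tens x y) = g (\<pi> x) y) \<longleftrightarrow> (\<forall>x\<in>X. \<forall>y\<in>Y. L (tens x y) = g x y)" for L
    by (simp add: \<pi>(3))
  ultimately show ?thesis by simp
qed

lemma balanced_tensor_tens_on:
  assumes bt: "balanced_tensor X r UNIV l tens" and X: "x \<in> X" "x' \<in> X" "x + x' \<in> X" "c *\<^sub>C x \<in> X" "r x m \<in> X"
  shows "tens (x + x') y = tens x y + tens x' y" "tens x (y + y') = tens x y + tens x y'"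
    "tens (c *\<^sub>C x) y = c *\<^sub>C tens x y" "tens x (c *\<^sub>C y) = c *\<^sub>C tens x y"
    "tens (r x m) y = tens x (l m y)"
proof -
  let ?R = "{r x m \<otimes> y - x \<otimes> l m y | x m y. x \<in> X \<and> y \<in> UNIV}"
  obtain L where L: "clinear L" "\<And>x y. x \<in> X \<Longrightarrow> L (x \<otimes> y) = tens x y"
    "{u \<in> subtensor X UNIV. L u = 0} = cspan ?R"
    using bt by (auto simp: balanced_tensor_def)
  note lin = clinearD[OF L(1)] clinear_diff[OF L(1)]
  show "tens (x + x') y = tens x y + tens x' y" "tens x (y + y') = tens x y + tens x y'"
    "tens (c *\<^sub>C x) y = c *\<^sub>C tens x y" "tens x (c *\<^sub>C y) = c *\<^sub>C tens x y"
    using X by (simp_all add: lin pure_tensor_bilinear flip: L(2))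
  have "r x m \<otimes> y - x \<otimes> l m y \<in> cspan ?R" using X(1) by (intro complex_vector.span_base) blast
  then have "L (r x m \<otimes> y - x \<otimes> l m y) = 0" using L(3) by blast
  then show "tens (r x m) y = tens x (l m y)" using X by (simp add: lin L(2))
qed

lemma lift_over_swap: "lift_over X Y tens g = lift_over Y X (\<lambda>y x. tens x y) (\<lambda>y x. g x y)"
proof -
  have "(\<forall>x\<in>X. \<forall>y\<in>Y. L (tens x y) = g x y) \<longleftrightarrow> (\<forall>y\<in>Y. \<forall>x\<in>X. L (tens x y) = g x y)" for L
    by blast
  then show ?thesis unfolding lift_over_def by simp
qed

lemma lift_over_linear:
  assumes bt: "balanced_tensor UNIV r UNIV l tens" and r: "\<And>c x m. r (c *\<^sub>C x) m = c *\<^sub>C r x m"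
    and g: "balanced g" "\<And>x m y. g (r x m) y = g x (l m y)"
  shows "additive (lift_over UNIV UNIV tens g)" "lift_over UNIV UNIV tens g (tens x y) = g x y"
    and "(\<And>c x y. g (c *\<^sub>C x) y = c *\<^sub>C g x y) \<Longrightarrow> clinear (lift_over UNIV UNIV tens g)"
proof -
  have ex1: "\<exists>!L. additive L \<and> (\<forall>x\<in>UNIV. \<forall>y\<in>UNIV. L (tens x y) = g x y)"
    by (rule balanced_tensor_lift[OF bt complex_vector.subspace_UNIV r g(1)]) (rule g(2))
  show add: "additive (lift_over UNIV UNIV tens g)" by (rule lift_over_tens(1)[OF ex1])
  show eq: "lift_over UNIV UNIV tens g (tens x y) = g x y" for x y
    by (rule lift_over_tens(2)[OF ex1]) simp_all
  assume sc: "\<And>c x y. g (c *\<^sub>C x) y = c *\<^sub>C g x y"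
  show "clinear (lift_over UNIV UNIV tens g)"
  proof (rule clinearI)
    show "lift_over UNIV UNIV tens g (c *\<^sub>C t) = c *\<^sub>C lift_over UNIV UNIV tens g t" for c t
      using bt complex_vector.subspace_UNIV
    proof (induction t rule: balanced_tensor_induct)
      case (tens x y)
      then show ?case using eq sc by (simp flip: balanced_tensor_tens(3)[OF bt])
    qed (simp_all add: additive.zero[OF add] additive.add[OF add] complex_vector.scale_zero_right scaleC_add_right)
  qed (rule additive.add[OF add])
qed

section \<open>Hodge decomposition of a diagonalisable Dirac operator\<close>

text \<open>A family over the list positions is determined by its values at 0, 1 and 2, so its sum
  is \<open>a + b + c\<close>; a trivial kernel then gives injectivity.\<close>

lemma direct_sum_three:
  assumes sub: "csubspace A" "csubspace B" "csubspace C"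
    and ex: "\<And>x. \<exists>a\<in>A. \<exists>b\<in>B. \<exists>c\<in>C. x = a + b + c"
    and un: "\<And>a b c. a \<in> A \<Longrightarrow> b \<in> B \<Longrightarrow> c \<in> C \<Longrightarrow> a + b + c = 0 \<Longrightarrow> a = 0 \<and> b = 0 \<and> c = 0"
  shows "direct_sum {..<length [A, B, C]} ((!) [A, B, C]) UNIV"
proof -
  let ?F = "families {..<length [A, B, C]} ((!) [A, B, C])"
  have I: "{..<length [A, B, C]} = {0, 1, 2}" by auto
  have F: "f \<in> ?F \<longleftrightarrow> f 0 \<in> A \<and> f 1 \<in> B \<and> f 2 \<in> C \<and> (\<forall>i. i \<ge> 3 \<longrightarrow> f i = 0)" for f
  proof -
    have "finite {i. f i \<noteq> 0}" if "\<forall>i. i \<ge> 3 \<longrightarrow> f i = 0"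
    proof (rule finite_subset)
      show "{i. f i \<noteq> 0} \<subseteq> {..<3}" using that not_less unfolding lessThan_def by blast
    qed simp
    then show ?thesis unfolding families_def I by (auto simp: numeral_eq_Suc)
  qed
  have S: "(\<Sum>i | f i \<noteq> 0. f i) = f 0 + f 1 + f 2" if "f \<in> ?F" for f
  proof -
    have "i \<in> {0, 1, 2}" if "f i \<noteq> 0" for i
    proof -
      have "i < 3" using that \<open>f \<in> ?F\<close> F[of f] not_less by blast
      then show ?thesis by auto
    qed
    then have "{i. f i \<noteq> 0} \<subseteq> {0, 1, 2}" by blast
    then have "(\<Sum>i | f i \<noteq> 0. f i) = (\<Sum>i\<in>{0, 1, 2}. f i)" by (intro sum.mono_neutral_left) auto
    then show ?thesis by (simp add: add.assoc)
  qed
  have "bij_betw (\<lambda>c. \<Sum>i | c i \<noteq> 0. c i) ?F UNIV"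
  proof (rule bij_betwI')
    fix f g assume f: "f \<in> ?F" and g: "g \<in> ?F"
    show "((\<Sum>i | f i \<noteq> 0. f i) = (\<Sum>i | g i \<noteq> 0. g i)) = (f = g)"
    proof
      assume "(\<Sum>i | f i \<noteq> 0. f i) = (\<Sum>i | g i \<noteq> 0. g i)"
      then have "(f 0 - g 0) + (f 1 - g 1) + (f 2 - g 2) = 0"
        using S[OF f] S[OF g] by (simp add: algebra_simps)
      then have "f 0 - g 0 = 0 \<and> f 1 - g 1 = 0 \<and> f 2 - g 2 = 0"
        using f g F by (intro un) (auto intro: complex_vector.subspace_diff[OF sub(1)]
            complex_vector.subspace_diff[OF sub(2)] complex_vector.subspace_diff[OF sub(3)])
      moreover have "f i = g i" if "i \<ge> 3" for i using that f g F by simp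
      ultimately have "f i = g i" for i
        by (cases "i \<ge> 3") (auto simp: not_le less_Suc_eq numeral_eq_Suc)
      then show "f = g" by blast
    qed simp
  next
    fix x
    obtain a b c where x: "a \<in> A" "b \<in> B" "c \<in> C" "x = a + b + c" using ex by blast
    define f :: "nat \<Rightarrow> _" where "f = (\<lambda>i. if i = 0 then a else if i = 1 then b else if i = 2 then c else 0)"
    have "f \<in> ?F" using x F[of f] by (auto simp: f_def)
    then show "\<exists>f\<in>?F. x = (\<Sum>i | f i \<noteq> 0. f i)" using S x by (intro bexI[of _ f]) (auto simp: f_def)
  qed simp
  moreover have "\<forall>i\<in>{..<length [A, B, C]}. csubspace ([A, B, C] ! i)"
    using sub unfolding I by auto
  ultimately show ?thesis by (simp add: direct_sum_def)
qed

text \<open>The setting common to left and right bundles: \<open>P\<close> are the projections onto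
  the bidegrees, \<open>J\<close> is a finite set containing all bidegrees that occur, and
  \<open>\<delta>\<close> is the coaction.\<close>

locale hodge_theory =
  fixes ip :: "'t::complex_vector \<Rightarrow> 't \<Rightarrow> complex" and db adj :: "'t \<Rightarrow> 't"
    and P :: "nat \<times> nat \<Rightarrow> 't \<Rightarrow> 't" and J :: "(nat \<times> nat) set"
    and \<delta> :: "'t \<Rightarrow> ('a::complex_vector, 't) tensor"
  assumes ip_add: "ip (x + y) z = ip x z + ip y z"
    and ip_scale: "ip (c *\<^sub>C x) y = c * ip x y"
    and ip_sym: "ip x y = cnj (ip y x)"
    and ip_nondegenerate: "(\<And>x. ip x y = 0) \<Longrightarrow> y = 0"
    and db_linear: "clinear db" and db_db: "db (db x) = 0"
    and ip_db: "ip (db x) y = ip x (adj y)"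
    and P_linear: "clinear (P i)"
    and P_P: "P i (P j x) = (if i = j then P i x else 0)"
    and J: "finite J" and P_sum: "(\<Sum>i\<in>J. P i x) = x"
    and db_P: "db (P (a, b) x) = P (a, b + 1) (db x)" and P_db_0: "P (a, 0) (db x) = 0"
    and ip_P: "ip (P i x) y = ip x (P i y)"
    and \<delta>_db: "\<delta> (db x) = tensor_map id db (\<delta> x)"
    and \<delta>_adj: "\<delta> (adj x) = tensor_map id adj (\<delta> x)"
    and \<delta>_P: "\<delta> (P i x) = tensor_map id (P i) (\<delta> x)"
begin

lemma ip_add_right: "ip x (y + z) = ip x y + ip x z"
  using ip_add[of y z x] by (metis complex_cnj_add ip_sym)

lemma ip_scale_right: "ip x (c *\<^sub>C y) = cnj c * ip x y"
  using ip_scale[of c y x] by (metis complex_cnj_mult ip_sym)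

lemma ip_zero [simp]: "ip 0 x = 0" "ip x 0 = 0"
  using ip_add[of 0 0 x] ip_add_right[of x 0 0] by auto

lemma ip_minus: "ip x (y - z) = ip x y - ip x z" "ip (y - z) x = ip y x - ip z x"
proof -
  show "ip x (y - z) = ip x y - ip x z" using ip_add_right[of x "y - z" z] by simp
  show "ip (y - z) x = ip y x - ip z x" using ip_add[of "y - z" z x] by simp
qed

lemma ip_eqI:
  assumes "\<And>x. ip x y = ip x z" shows "y = z"
  using ip_nondegenerate[of "y - z"] assms by (simp add: ip_minus)

lemma ip_nondegenerate':
  assumes "\<And>y. ip x y = 0" shows "x = 0"
  using assms ip_sym ip_nondegenerate by (metis complex_cnj_zero)

lemma ip_adj: "ip (adj x) y = ip x (db y)"
  using ip_db[of y x] ip_sym by metis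

lemma adj_linear: "clinear adj"
  by (rule clinearI; rule ip_eqI) (simp_all add: ip_add_right ip_scale_right flip: ip_db)

lemma adj_adj: "adj (adj x) = 0"
  by (rule ip_eqI) (simp add: db_db flip: ip_db)

lemma adjoint_eq: "adjoint ip db = adj"
  unfolding adjoint_def
proof (rule the_equality)
  show "T = adj" if "\<forall>x y. ip (db x) y = ip x (T y)" for T
    using that ip_db by (intro ext ip_eqI) metis
qed (simp add: ip_db)

text \<open>Obtained by moving the self-adjoint projections and \<open>adj\<close> across
  \<open>ip\<close>: since \<open>db\<close> raises the second degree by one, its adjoint lowers
  it.\<close>

lemma P_adj: "adj (P (a, b + 1) x) = P (a, b) (adj x)" "adj (P (a, 0) x) = 0"
  by (rule ip_eqI; simp add: ip_P[symmetric] db_P P_db_0 flip: ip_db)+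

definition D where "D x = db x + adj x"
definition \<Delta> where "\<Delta> x = D (D x)"

lemma D_linear: "clinear D"
  by (rule clinearI) (simp_all add: D_def clinearD[OF db_linear] clinearD[OF adj_linear]
      scaleC_add_right algebra_simps)

lemma \<Delta>_linear: "clinear \<Delta>"
  by (rule clinearI) (simp_all add: \<Delta>_def clinearD[OF D_linear])

lemma D_symmetric: "ip (D x) y = ip x (D y)"
  by (simp add: D_def ip_add ip_add_right ip_db ip_adj)

lemma dirac_eq: "dirac ip db = D" and laplacian_eq: "laplacian ip db = \<Delta>"
  and harmonic_eq: "harmonic ip db = {x. \<Delta> x = 0}"
proof -
  show d: "dirac ip db = D" by (simp add: fun_eq_iff dirac_def adjoint_eq D_def)
  then show l: "laplacian ip db = \<Delta>" by (simp add: fun_eq_iff laplacian_def \<Delta>_def)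
  then show "harmonic ip db = {x. \<Delta> x = 0}" by (simp add: harmonic_def)
qed

lemma zero_simps [simp]: "db 0 = 0" "adj 0 = 0" "D 0 = 0" "\<Delta> 0 = 0" "P i 0 = 0"
  by (rule additive.zero, rule clinear_additive, rule db_linear adj_linear D_linear \<Delta>_linear P_linear)+

lemma \<Delta>_eq: "\<Delta> x = db (adj x) + adj (db x)"
  by (simp add: \<Delta>_def D_def clinearD[OF db_linear] clinearD[OF adj_linear] db_db adj_adj)

lemma \<Delta>_P: "\<Delta> (P i x) = P i (\<Delta> x)"
proof (cases i)
  case (Pair a b)
  show ?thesis
  proof (cases b)
    case 0
    \<comment> \<open>In second degree 0 only the term \<open>adj (db x)\<close> contributes, since
      \<open>adj\<close> kills these bidegrees.\<close>
    have "db (P (a, 0) x) = P (a, 0 + 1) (db x)" by (rule db_P)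
    then show ?thesis
      using P_adj(1)[of a 0 "db x"] by (simp add: Pair 0 \<Delta>_eq P_adj(2) clinearD[OF P_linear] P_db_0)
  next
    case (Suc c)
    have "adj (P (a, Suc c) x) = P (a, c) (adj x)" using P_adj(1)[of a c x] by simp
    moreover have "adj (P (a, Suc (Suc c)) (db x)) = P (a, Suc c) (adj (db x))"
      using P_adj(1)[of a "Suc c" "db x"] by simp
    ultimately show ?thesis by (simp add: Pair Suc \<Delta>_eq clinearD[OF P_linear] db_P)
  qed
qed

definition U where "U i = {x. P i x = x}"

lemma subspaces:
  "csubspace {x. \<Delta> x = 0}" "csubspace {x. db x = 0}" "csubspace (range db)" "csubspace (range adj)"
  "csubspace (U i)"
proof -
  have ker: "csubspace {x. f x = 0}" if "clinear f" for f :: "'t \<Rightarrow> 't"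
    using that by (auto intro!: complex_vector.subspaceI simp: clinearD clinear_zero
        complex_vector.scale_zero_right)
  have ran: "csubspace (range f)" if f: "clinear f" for f :: "'t \<Rightarrow> 't"
    using complex_vector.subspace_UNIV clinear_image_span[OF f, of UNIV]
    by (metis complex_vector.span_UNIV complex_vector.subspace_span)
  show "csubspace {x. \<Delta> x = 0}" "csubspace {x. db x = 0}" "csubspace (range db)" "csubspace (range adj)"
    by (intro ker ran \<Delta>_linear db_linear adj_linear)+
  show "csubspace (U i)"
    by (rule complex_vector.subspaceI) (simp_all add: U_def clinearD[OF P_linear])
qed

lemma slices:
  assumes \<phi>: "clinear \<phi>"
  shows "slice \<phi> (\<delta> (db x)) = db (slice \<phi> (\<delta> x))" "slice \<phi> (\<delta> (adj x)) = adj (slice \<phi> (\<delta> x))"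
    "slice \<phi> (\<delta> (P i x)) = P i (slice \<phi> (\<delta> x))" 
  by (simp_all add: \<delta>_db \<delta>_adj \<delta>_P slice_tensor_map_id[OF \<phi>] db_linear adj_linear P_linear)

lemma slice_\<Delta>:
  assumes \<phi>: "clinear \<phi>" and \<delta>: "clinear \<delta>"
  shows "slice \<phi> (\<delta> (\<Delta> x)) = \<Delta> (slice \<phi> (\<delta> x))"
  by (simp add: \<Delta>_eq clinearD[OF \<delta>] clinearD[OF slice_linear[OF \<phi>]] slices[OF \<phi>])

lemma subcomodule_iff:
  assumes "csubspace X"
  shows "subcomodule \<delta> X \<longleftrightarrow> (\<forall>\<phi> x. clinear \<phi> \<longrightarrow> x \<in> X \<longrightarrow> slice \<phi> (\<delta> x) \<in> X)"
  using assms by (auto simp: subcomodule_def subtensor_iff_slices image_subset_iff)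

lemma subcomodules:
  assumes \<delta>: "clinear \<delta>"
  shows "subcomodule \<delta> {x. \<Delta> x = 0}" "subcomodule \<delta> (range db)" "subcomodule \<delta> (range adj)"
    "subcomodule \<delta> ({x. \<Delta> x = 0} \<inter> U i)" "subcomodule \<delta> (cocycles db (U i))"
    "subcomodule \<delta> (coboundaries db (U i))"
proof -
  have z: "slice \<phi> (\<delta> 0) = 0" if "clinear \<phi>" for \<phi>
    using that by (simp add: clinear_zero[OF \<delta>]
        clinear_zero[OF slice_linear[OF that]])
  have cc: "cocycles db (U i) = {x. db x = 0} \<inter> U i" by (auto simp: cocycles_def)
  have cb: "coboundaries db (U i) = range db \<inter> U i" by (auto simp: coboundaries_def)
  have 1: "slice \<phi> (\<delta> x) \<in> {x. \<Delta> x = 0}" if "clinear \<phi>" "x \<in> {x. \<Delta> x = 0}" for \<phi> x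
    using that slice_\<Delta>[OF that(1) \<delta>, of x] z by simp
  have 2: "slice \<phi> (\<delta> x) \<in> {x. db x = 0}" if "clinear \<phi>" "x \<in> {x. db x = 0}" for \<phi> x
    using that slices(1)[OF that(1), of x] z by simp
  have 3: "slice \<phi> (\<delta> x) \<in> range db" if "clinear \<phi>" "x \<in> range db" for \<phi> x
    using that slices(1)[OF that(1)] by auto
  have 4: "slice \<phi> (\<delta> x) \<in> range adj" if "clinear \<phi>" "x \<in> range adj" for \<phi> x
    using that slices(2)[OF that(1)] by auto
  have 5: "slice \<phi> (\<delta> x) \<in> U i" if "clinear \<phi>" "x \<in> U i" for \<phi> x
    using that slices(3)[OF that(1), of i x] by (simp add: U_def)
  show "subcomodule \<delta> {x. \<Delta> x = 0}" "subcomodule \<delta> (range db)" "subcomodule \<delta> (range adj)"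
    "subcomodule \<delta> ({x. \<Delta> x = 0} \<inter> U i)" "subcomodule \<delta> (cocycles db (U i))"
    "subcomodule \<delta> (coboundaries db (U i))"
    unfolding cc cb using 1 2 3 4 5
    by (simp_all add: subcomodule_iff subspaces complex_vector.subspace_inter)
qed

text \<open>In this locale \<open>ip\<close> may be indefinite, so \<open>ip (D x) (D x) = 0\<close>
  would not suffice. Instead \<open>D x\<close> is tested against the spanning eigenvectors of
  \<open>D\<close>: a non-zero eigenvalue is divided out after moving one \<open>D\<close> across, a
  zero eigenvalue is settled by symmetry alone.\<close>

lemma kernel_\<Delta>:
  assumes diag: "diagonalisable D" and x: "\<Delta> x = 0"
  shows "D x = 0"
proof (rule ip_nondegenerate')
  fix y
  have "y \<in> cspan {v. \<exists>c. D v = c *\<^sub>C v}" using diag by (simp add: diagonalisable_def)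
  then show "ip (D x) y = 0"
  proof (induction rule: complex_vector.span_induct_alt)
    case (step c v y)
    then obtain e where e: "D v = e *\<^sub>C v" by blast
    have "ip (D x) v = 0"
    proof (cases "e = 0")
      case True
      then show ?thesis using e by (simp add: D_symmetric complex_vector.scale_zero_left)
    next
      case False
      have "cnj e * ip (D x) v = ip (D x) (D v)" by (simp add: e ip_scale_right)
      also have "\<dots> = ip (\<Delta> x) v" by (simp add: \<Delta>_def D_symmetric)
      finally show ?thesis using False x by simp
    qed
    then show ?case using step by (simp add: ip_add_right ip_scale_right)
  qed simp
qed

text \<open>For homogeneous \<open>x\<close> the summands of \<open>D x\<close> have different bidegrees, so they vanish separately.\<close>

lemma harmonic_closed:
  assumes diag: "diagonalisable D" and x: "\<Delta> x = 0"
  shows "db x = 0" "adj x = 0"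
proof -
  have *: "db (P i x) = 0 \<and> adj (P i x) = 0" for i
  proof (cases i)
    case (Pair a b)
    have D0: "D (P i x) = 0" using kernel_\<Delta>[OF diag] x \<Delta>_P by simp
    have "P (a, b + 1) (D (P i x)) = db (P i x)"
    proof -
      have "P (a, b + 1) (db (P i x)) = db (P i x)" 
        using db_P[of a b "P i x"] by (simp add: Pair P_P)
      \<comment> \<open>\<open>adj\<close> lowers the second degree, so this part comes from the
        \<open>(a, b + 2)\<close> part of \<open>P i x\<close>, which vanishes.\<close>
      moreover have "P (a, b + 1) (adj (P i x)) = 0"
        using P_adj(1)[of a "b + 1" "P i x"] by (simp add: Pair P_P)
      ultimately show ?thesis by (simp add: D_def clinearD[OF P_linear])
    qed
    then have "db (P i x) = 0" using D0 by simp
    with D0 show ?thesis by (simp add: D_def)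
  qed
  have "db x = (\<Sum>i\<in>J. db (P i x))" "adj x = (\<Sum>i\<in>J. adj (P i x))"
    using P_sum[of x] clinear_sum[OF db_linear, of "\<lambda>i. P i x" J]
      clinear_sum[OF adj_linear, of "\<lambda>i. P i x" J] by simp_all
  then show "db x = 0" "adj x = 0" using * by simp_all
qed

lemma decomposition_exists:
  assumes diag: "diagonalisable D"
  shows "\<exists>h\<in>{x. \<Delta> x = 0}. \<exists>y\<in>range db. \<exists>z\<in>range adj. x = h + y + z"
proof -
  let ?S = "{h + y + z | h y z. h \<in> {x. \<Delta> x = 0} \<and> y \<in> range db \<and> z \<in> range adj}"
  have sub: "csubspace ?S"
  proof (rule complex_vector.subspaceI)
    have "0 = (0::'t) + db 0 + adj 0" "\<Delta> 0 = 0" by simp_all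
    then show "0 \<in> ?S" by blast
  next
    fix x y assume "x \<in> ?S" "y \<in> ?S"
    then obtain h u v h' u' v' where
      x: "x = h + db u + adj v" "\<Delta> h = 0" and y: "y = h' + db u' + adj v'" "\<Delta> h' = 0"
      by (auto elim!: rangeE)
    have "x + y = (h + h') + db (u + u') + adj (v + v')" "\<Delta> (h + h') = 0"
      by (simp_all add: x y clinearD[OF db_linear] clinearD[OF adj_linear] clinearD[OF \<Delta>_linear])
    then show "x + y \<in> ?S" by blast
  next
    fix c x assume "x \<in> ?S"
    then obtain h u v where x: "x = h + db u + adj v" "\<Delta> h = 0" by (auto elim!: rangeE)
    have "c *\<^sub>C x = c *\<^sub>C h + db (c *\<^sub>C u) + adj (c *\<^sub>C v)" "\<Delta> (c *\<^sub>C h) = 0"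
      by (simp_all add: x clinearD[OF db_linear] clinearD[OF adj_linear] clinearD[OF \<Delta>_linear]
          scaleC_add_right complex_vector.scale_zero_right)
    then show "c *\<^sub>C x \<in> ?S" by blast
  qed
  have "{v. \<exists>c. D v = c *\<^sub>C v} \<subseteq> ?S"
  proof
    fix v assume "v \<in> {v. \<exists>c. D v = c *\<^sub>C v}"
    then obtain c where c: "D v = c *\<^sub>C v" by blast
    show "v \<in> ?S"
    proof (cases "c = 0")
      case True
      then have "v = v + db 0 + adj 0" "\<Delta> v = 0"
        using c by (simp_all add: \<Delta>_def complex_vector.scale_zero_left)
      then show ?thesis by blast
    next
      case False
      then have "v = inverse c *\<^sub>C D v" by (simp add: c scaleC_scaleC scaleC_one)
      also have "\<dots> = 0 + db (inverse c *\<^sub>C v) + adj (inverse c *\<^sub>C v)"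
        by (simp add: D_def clinearD[OF db_linear] clinearD[OF adj_linear] scaleC_add_right)
      finally show ?thesis using zero_simps(4) by blast
    qed
  qed
  then have "cspan {v. \<exists>c. D v = c *\<^sub>C v} \<subseteq> ?S" using sub by (rule complex_vector.span_minimal)
  then have "x \<in> ?S" using diag unfolding diagonalisable_def by blast
  then show ?thesis by blast
qed

lemma orthogonal:
  assumes diag: "diagonalisable D" and h: "\<Delta> h = 0"
  shows "ip h (db y) = 0" "ip (db y) h = 0" "ip h (adj y) = 0" "ip (adj y) h = 0"
    "ip (db x) (adj y) = 0" "ip (adj y) (db x) = 0"
proof -
  show "ip h (db y) = 0" using harmonic_closed(2)[OF diag h] ip_adj[of h y] by simp
  show "ip h (adj y) = 0" using harmonic_closed(1)[OF diag h] ip_db[of h y] by simp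
qed (simp_all add: ip_db ip_adj db_db adj_adj harmonic_closed[OF diag h])

text \<open>By existence and orthogonality, a harmonic element orthogonal to all harmonic ones is
  orthogonal to everything, hence zero. This applies to \<open>h\<close>, and then to
  \<open>db y = - adj z\<close>, which is harmonic because both operators square to zero.\<close>

lemma decomposition_unique:
  assumes diag: "diagonalisable D" and h: "\<Delta> h = 0" and 0: "h + db y + adj z = 0"
  shows "h = 0" "db y = 0" "adj z = 0"
proof -
  have orth: "x = 0" if x: "\<Delta> x = 0" "\<And>k. \<Delta> k = 0 \<Longrightarrow> ip x k = 0" for x
  proof (rule ip_nondegenerate')
    fix w
    obtain k u v where "\<Delta> k = 0" "w = k + db u + adj v"
      using decomposition_exists[OF diag, of w] by blast
    then show "ip x w = 0" using x orthogonal[OF diag x(1)] by (simp add: ip_add_right)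
  qed
  show "h = 0"
  proof (rule orth[OF h])
    fix k assume k: "\<Delta> k = 0"
    have "ip (h + db y + adj z) k = ip h k"
      using orthogonal(2,4)[OF diag k] by (simp add: ip_add)
    then show "ip h k = 0" unfolding 0 by simp
  qed
  have yz: "db y = - adj z" using 0 \<open>h = 0\<close> by (simp add: eq_neg_iff_add_eq_0)
  have "\<Delta> (db y) = db (adj (db y))" by (simp add: \<Delta>_eq db_db)
  also have "\<dots> = 0"
    unfolding yz clinear_minus[OF adj_linear] by (simp add: adj_adj)
  finally show "db y = 0" by (rule orth) (rule orthogonal(2)[OF diag])
  then show "adj z = 0" using yz by simp
qed

lemma hodge_decomposition:
  assumes diag: "diagonalisable D"
  shows "orthogonal_decomposition ip [{x. \<Delta> x = 0}, range db, range adj]"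
proof -
  have "direct_sum {..<length [{x. \<Delta> x = 0}, range db, range adj]}
      ((!) [{x. \<Delta> x = 0}, range db, range adj]) UNIV"
  proof (rule direct_sum_three)
    fix a b c assume "a \<in> {x. \<Delta> x = 0}" "b \<in> range db" "c \<in> range adj" "a + b + c = 0"
    then show "a = 0 \<and> b = 0 \<and> c = 0" using decomposition_unique[OF diag, of a] by auto
  qed (rule subspaces decomposition_exists[OF diag])+
  then show ?thesis
    unfolding orthogonal_decomposition_def
    using orthogonal(1-4)[OF diag] orthogonal(5,6)[OF diag, of 0] by (auto simp: All_less_Suc)
qed

text \<open>Injective: an exact difference of harmonic elements is zero by uniqueness of the
  decomposition. Surjective: the \<open>adj\<close> part of a cocycle is closed, hence harmonic,
  hence zero; projecting the rest to the bidegree yields the harmonic representative.\<close>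

lemma hodge_isomorphism:
  assumes diag: "diagonalisable D"
  shows "represents_quotient ({x. \<Delta> x = 0} \<inter> U (a, b)) (cocycles db (U (a, b))) (coboundaries db (U (a, b)))"
    (is "represents_quotient ?H ?Z ?B")
proof -
  have cc: "?Z = {x. db x = 0} \<inter> U (a, b)" by (auto simp: cocycles_def)
  have cb: "?B = range db \<inter> U (a, b)" by (auto simp: coboundaries_def)
  have sub: "csubspace ?H" "csubspace ?Z" "csubspace ?B"
    unfolding cc cb by (intro complex_vector.subspace_inter subspaces)+
  have BZ: "?B \<subseteq> ?Z" by (auto simp: cc cb db_db)
  have HZ: "?H \<subseteq> ?Z" using harmonic_closed[OF diag] by (auto simp: cc)
  have coset_eq: "coset ?B x = coset ?B y \<longleftrightarrow> x - y \<in> ?B" for x y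
  proof
    assume "coset ?B x = coset ?B y"
    moreover have "x + 0 \<in> coset ?B x"
      using complex_vector.subspace_0[OF sub(3)] unfolding coset_def by blast
    ultimately show "x - y \<in> ?B" by (auto simp: coset_def)
  next
    have le: "coset ?B x \<subseteq> coset ?B y" if "x - y \<in> ?B" for x y
    proof
      fix z assume "z \<in> coset ?B x"
      then obtain w where "w \<in> ?B" "z = x + w" by (auto simp: coset_def)
      then have "z = y + ((x - y) + w)" "(x - y) + w \<in> ?B"
        using that complex_vector.subspace_add[OF sub(3)] by auto
      then show "z \<in> coset ?B y" unfolding coset_def by blast
    qed
    assume "x - y \<in> ?B"
    then have "x - y \<in> ?B" "y - x \<in> ?B" using complex_vector.subspace_neg[OF sub(3), of "x - y"] by auto
    then show "coset ?B x = coset ?B y" using le by blast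
  qed
  have "bij_betw (coset ?B) ?H (coset ?B ` ?Z)"
    unfolding bij_betw_def
  proof
    show "inj_on (coset ?B) ?H"
    proof (rule inj_onI)
      fix x y assume x: "x \<in> ?H" "y \<in> ?H" "coset ?B x = coset ?B y"
      then have "x - y \<in> ?B" using coset_eq by blast
      then obtain w where w: "x - y = db w" by (auto simp: cb)
      have "\<Delta> (x - y) = 0" using x clinear_diff[OF \<Delta>_linear] by simp
      moreover have "(x - y) + db (- w) + adj 0 = 0"
        using clinear_minus[OF db_linear] by (simp add: w)
      ultimately have "x - y = 0" using decomposition_unique(1)[OF diag] by blast
      then show "x = y" by simp
    qed
    show "coset ?B ` ?H = coset ?B ` ?Z"
    proof
      show "coset ?B ` ?H \<subseteq> coset ?B ` ?Z" by (rule image_mono[OF HZ])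
    next
      show "coset ?B ` ?Z \<subseteq> coset ?B ` ?H"
      proof
      fix c assume "c \<in> coset ?B ` ?Z"
      then obtain z where z: "db z = 0" "P (a, b) z = z" "c = coset ?B z"
        by (auto simp: cocycles_def U_def)
      obtain h y w where h: "\<Delta> h = 0" "z = h + db y + adj w"
        using decomposition_exists[OF diag, of z] by blast
      have "db (adj w) = 0"
        using z(1) harmonic_closed[OF diag h(1)] by (simp add: h(2) clinearD[OF db_linear] db_db)
      then have "\<Delta> (adj w) = 0" by (simp add: \<Delta>_eq adj_adj)
      moreover have "adj w + db 0 + adj (- w) = 0"
        using clinear_minus[OF adj_linear] by simp
      ultimately have "adj w = 0" using decomposition_unique(1)[OF diag] by blast
      then have z_eq: "z = P (a, b) h + P (a, b) (db y)"
        using z(2) h(2) by (simp add: clinearD[OF P_linear])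
      \<comment> \<open>\<open>y\<close> need not be homogeneous: for \<open>b = 0\<close> the
        projection vanishes, otherwise it is \<open>db\<close> of the \<open>(a, b - 1)\<close> part
        of \<open>y\<close>.\<close>
      have "P (a, b) (db y) \<in> range db"
      proof (cases b)
        case 0
        then show ?thesis using P_db_0 zero_simps(1) by (metis rangeI)
      next
        case (Suc c)
        then show ?thesis using db_P[of a c y] by (metis Suc_eq_plus1 rangeI)
      qed
      then have "z - P (a, b) h \<in> ?B" using z_eq by (simp add: coboundaries_def U_def P_P)
      moreover have "P (a, b) h \<in> ?H" using h(1) by (simp add: U_def P_P \<Delta>_P)
      ultimately show "c \<in> coset ?B ` ?H" using z(3) coset_eq by blast
      qed
    qed
  qed
  then show ?thesis using sub BZ HZ by (simp add: represents_quotient_def)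
qed

theorem hodge_theorem:
  assumes "diagonalisable (dirac ip db)" "clinear \<delta>"
  shows "orthogonal_decomposition ip [harmonic ip db, range db, range (adjoint ip db)] \<and>
    subcomodule \<delta> (harmonic ip db) \<and> subcomodule \<delta> (range db) \<and>
    subcomodule \<delta> (range (adjoint ip db)) \<and>
    (\<forall>a b. represents_quotient (harmonic ip db \<inter> U (a, b)) (cocycles db (U (a, b))) (coboundaries db (U (a, b))) \<and>
      subcomodule \<delta> (harmonic ip db \<inter> U (a, b)) \<and> subcomodule \<delta> (cocycles db (U (a, b))) \<and>
      subcomodule \<delta> (coboundaries db (U (a, b))))"
  using assms by (simp add: dirac_eq adjoint_eq harmonic_eq hodge_decomposition subcomodules
      hodge_isomorphism)

end

section \<open>Comodules and the inverse antipode\<close>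

lemma balanced_tsum_curried:
  assumes "\<And>a. balanced (G a)" "\<And>c. balanced (\<lambda>a b. G a b c)"
  shows "balanced (\<lambda>a t. tsum t (G a))"
proof (rule balancedI)
  show "tsum t (G (a + a')) = tsum t (G a) + tsum t (G a')" for a a' t
    by (simp add: tsum_def case_prod_unfold balancedD(1)[OF assms(2)] flip: sum_list_addf)
  show "tsum (s + t) (G a) = tsum s (G a) + tsum t (G a)" for s t a
    by (rule tsum_add[OF assms(1)])
  show "tsum t (G (c *\<^sub>C a)) = tsum (c *\<^sub>C t) (G a)" for c a t
    by (simp add: tsum_scaleC[OF assms(1)])
      (simp add: tsum_def case_prod_unfold balancedD(3)[OF assms(2)])
qed

text \<open>Coassociativity in the form in which it is used, under an arbitrary trilinear
  \<open>G\<close>. Both iterated coactions are compared under \<open>H\<close>, the lift of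
  \<open>G\<close> in its last two arguments, which makes \<open>tensor_assoc\<close>
  disappear.\<close>

lemma comodule_coassoc:
  fixes G :: "'a::complex_star_algebra \<Rightarrow> 'a \<Rightarrow> 'v::complex_vector \<Rightarrow> 'w::complex_vector"
  assumes \<delta>: "comodule A \<delta>" and \<Delta>: "clinear (comult A)"
    and G: "\<And>a. balanced (G a)" "\<And>c. balanced (\<lambda>a b. G a b c)"
  shows "tsum (\<delta> v) (\<lambda>a w. tsum (comult A a) (\<lambda>b c. G b c w)) = tsum (\<delta> v) (\<lambda>a w. tsum (\<delta> w) (G a))"
proof -
  define H where "H a t = tsum t (G a)" for a t
  have H: "balanced H" unfolding H_def[abs_def] by (rule balanced_tsum_curried[OF G])
  have \<delta>l: "clinear \<delta>" using \<delta> by (simp add: comodule_def)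
  have inner: "balanced (\<lambda>a b. a \<otimes> (b \<otimes> c))" for c :: 'v
    by (rule balancedI) (simp_all add: pure_tensor_bilinear)
  have outer: "balanced (\<lambda>t (c :: 'v). tsum t (\<lambda>(a :: 'a) (b :: 'a). a \<otimes> (b \<otimes> c)))"
    by (rule balancedI)
      (simp_all add: tsum_add[OF inner] tsum_scaleC[OF inner] pure_tensor_bilinear tsum_scale flip: tsum_distrib)
  have "tsum (tensor_assoc (tensor_map (comult A) id (\<delta> v))) H =
      tsum (tensor_map (comult A) id (\<delta> v)) (\<lambda>t c. tsum t (\<lambda>a b. H a (b \<otimes> c)))"
    by (simp add: tensor_assoc_def tensor_lift_tsum inner outer tsum_tsum[OF H] tsum_pure[OF H])
  also have "\<dots> = tsum (tensor_map (comult A) id (\<delta> v)) (\<lambda>t c. tsum t (\<lambda>a b. G a b c))"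
    by (simp add: H_def tsum_pure[OF G(1)])
  also have "\<dots> = tsum (\<delta> v) (\<lambda>a w. tsum (comult A a) (\<lambda>b c. G b c w))"
  proof -
    have "balanced (\<lambda>t c. tsum t (\<lambda>a b. G a b c))"
      by (rule balancedI) (simp_all add: tsum_add[OF G(2)] tsum_scaleC[OF G(2)] balancedD[OF G(1)]
          balancedD(3)[OF G(2)] flip: tsum_distrib)
    then show ?thesis
      by (simp add: tsum_tensor_map[OF balanced_linear[OF \<Delta> clinear_id(1)]])
  qed
  finally have "tsum (tensor_assoc (tensor_map (comult A) id (\<delta> v))) H = \<dots>" .
  moreover have "tsum (tensor_map id \<delta> (\<delta> v)) H = tsum (\<delta> v) (\<lambda>a w. tsum (\<delta> w) (G a))"
    by (simp add: tsum_tensor_map[OF balanced_linear[OF clinear_id(1) \<delta>l] H] H_def)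
  ultimately show ?thesis using \<delta> by (simp add: comodule_def)
qed

lemma comodule_counit:
  assumes "comodule A \<delta>" "clinear (counit A)"
  shows "tsum (\<delta> v) (\<lambda>a w. counit A a *\<^sub>C w) = v"
  using assms(1) by (simp add: comodule_def flip: tensor_lift_tsum[OF balanced_slice[OF assms(2)]])

lemma tsum_tensor_mult:
  fixes p :: "'v::complex_vector \<Rightarrow> 'w::complex_vector \<Rightarrow> 'u::complex_vector"
    and s :: "('a::complex_algebra_1, 'v) tensor" and t :: "('a, 'w) tensor"
    and g :: "'a \<Rightarrow> 'u \<Rightarrow> 'z::ab_group_add"
  assumes p: "\<And>v v' w. p (v + v') w = p v w + p v' w" "\<And>v w w'. p v (w + w') = p v w + p v w'"
      "\<And>c v w. p (c *\<^sub>C v) w = c *\<^sub>C p v w" "\<And>c v w. p v (c *\<^sub>C w) = c *\<^sub>C p v w"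
    and g: "balanced g"
  shows "tsum (tensor_mult p s t) g = tsum s (\<lambda>a v. tsum t (\<lambda>b w. g (a * b) (p v w)))"
proof -
  have inner: "balanced (\<lambda>b w. (a * b) \<otimes> p v w)" for a :: 'a and v
    by (rule balancedI) (simp_all add: p pure_tensor_bilinear distrib_left mult_scaleC_right)
  have outer: "balanced (\<lambda>(a :: 'a) v. tsum t (\<lambda>b w. (a * b) \<otimes> p v w))"
    by (rule balancedI)
      (simp_all add: p pure_tensor_bilinear distrib_right mult_scaleC_left tsum_distrib tsum_scale)
  show ?thesis
    by (simp add: tensor_mult_def tensor_lift_tsum inner outer tsum_tsum[OF g] tsum_pure[OF g])
qed

lemma tensor_mult_tsum:
  fixes p :: "'v::complex_vector \<Rightarrow> 'w::complex_vector \<Rightarrow> 'u::complex_vector"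
    and s :: "('a::complex_algebra_1, 'v) tensor"
  assumes "\<And>v v' w. p (v + v') w = p v w + p v' w" "\<And>v w w'. p v (w + w') = p v w + p v w'"
      "\<And>c v w. p (c *\<^sub>C v) w = c *\<^sub>C p v w" "\<And>c v w. p v (c *\<^sub>C w) = c *\<^sub>C p v w"
  shows "tensor_mult p s t = tsum s (\<lambda>a v. tsum t (\<lambda>b w. (a * b) \<otimes> p v w))"
  using tsum_tensor_mult[of p "(\<otimes>)" s t] assms balanced_pure by (simp add: tsum_self)

locale hopf =
  fixes A :: "('a::complex_star_algebra) hopf"
  assumes hopf: "hopf_star_algebra A"
begin

lemma linear: "clinear (comult A)" "clinear (counit A)" "clinear (antipode A)"
  using hopf by (auto simp: hopf_star_algebra_def)

lemmas lin_simps = clinearD[OF linear(1)] clinearD[OF linear(2)] clinearD[OF linear(3)]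

text \<open>The Hopf algebra is a comodule over itself, so the Sweedler rules for comodules also
  serve its coproduct.\<close>

lemma comodule_comult: "comodule A (comult A)"
  using hopf by (simp add: hopf_star_algebra_def comodule_def)

lemma counit_left: "tsum (comult A a) (\<lambda>b c. counit A b *\<^sub>C c) = a"
  by (rule comodule_counit[OF comodule_comult linear(2)])

lemma counit_right: "tsum (comult A a) (\<lambda>b c. counit A c *\<^sub>C b) = a"
proof -
  have "balanced (\<lambda>(b :: 'a) c. counit A c *\<^sub>C b)"
    by (rule balancedI) (simp_all add: lin_simps scaleC_complex_def scaleC_add_left scaleC_add_right
        scaleC_scaleC mult.commute)
  then show ?thesis using hopf tensor_lift_tsum by (fastforce simp: hopf_star_algebra_def)
qed

lemma counit_mult: "counit A (a * b) = counit A a * counit A b"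
  using hopf by (simp add: hopf_star_algebra_def)

lemma antipode_left: "tsum (comult A a) (\<lambda>b c. antipode A b * c) = counit A a *\<^sub>C 1"
proof -
  have "balanced (\<lambda>b c. antipode A b * c)"
    by (rule balancedI) (simp_all add: lin_simps distrib_left distrib_right mult_scaleC_left mult_scaleC_right)
  from tensor_lift_tsum[OF this] show ?thesis using hopf by (simp add: hopf_star_algebra_def)
qed

lemma antipode_right: "tsum (comult A a) (\<lambda>b c. b * antipode A c) = counit A a *\<^sub>C 1"
proof -
  have "balanced (\<lambda>b c. b * antipode A c)"
    by (rule balancedI) (simp_all add: lin_simps distrib_left distrib_right mult_scaleC_left mult_scaleC_right)
  from tensor_lift_tsum[OF this] show ?thesis using hopf by (simp add: hopf_star_algebra_def)
qed

lemma comult_mult: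
  assumes "balanced g"
  shows "tsum (comult A (a * b)) g =
    tsum (comult A a) (\<lambda>a1 a2. tsum (comult A b) (\<lambda>b1 b2. g (a1 * b1) (a2 * b2)))"
proof -
  have "comult A (a * b) = tensor_mult (*) (comult A a) (comult A b)"
    using hopf by (simp add: hopf_star_algebra_def)
  then show ?thesis
    by (simp add: tsum_tensor_mult[OF _ _ _ _ assms] distrib_left distrib_right mult_scaleC_left mult_scaleC_right)
qed

lemma comult_star:
  assumes "balanced g"
  shows "tsum (comult A (star a)) g = tsum (comult A a) (\<lambda>b c. g (star b) (star c))"
proof -
  have "comult A (star a) = tensor_map star star (comult A a)"
    using hopf by (simp add: hopf_star_algebra_def)
  moreover have "balanced (\<lambda>a b. star (a :: 'a) \<otimes> star (b :: 'a))"
    by (rule balanced_conj_linear) (simp_all add: additive_def star_add star_scaleC)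
  ultimately show ?thesis by (simp add: tsum_tensor_map assms)
qed

lemmas bilin = lin_simps distrib_left distrib_right mult_scaleC_left mult_scaleC_right
  scaleC_add_left scaleC_add_right scaleC_scaleC tsum_distrib tsum_scale scaleC_complex_def

text \<open>Both sides are convolution inverses of the product map on pairs.\<close>

lemma antipode_mult: "antipode A (a * b) = antipode A b * antipode A a"
proof -
  let ?S = "antipode A" and ?\<Delta> = "comult A" and ?\<epsilon> = "counit A"
  \<comment> \<open>The convolution product, over pairs \<open>(a, b)\<close>, of
    \<open>?S (a * b)\<close>, \<open>a * b\<close> and \<open>?S b * ?S a\<close>. Collapsing the
    last two factors leaves the left side of the claim, collapsing the first two leaves the right
    side.\<close>
  define X where "X = tsum (?\<Delta> a) (\<lambda>a1 p. tsum (?\<Delta> p) (\<lambda>a2 a3. tsum (?\<Delta> b) (\<lambda>b1 q.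
    tsum (?\<Delta> q) (\<lambda>b2 b3. ?S (a1 * b1) * (a2 * b2) * (?S b3 * ?S a3)))))"
  have in1: "tsum (?\<Delta> q) (\<lambda>b2 b3. s * (a2 * b2) * (?S b3 * t)) = ?\<epsilon> q *\<^sub>C (s * (a2 * t))" for q s a2 t
  proof -
    have "tsum (?\<Delta> q) (\<lambda>b2 b3. s * (a2 * b2) * (?S b3 * t)) = tsum (?\<Delta> q) (\<lambda>b2 b3. (s * a2) * (b2 * ?S b3) * t)"
      by (simp add: mult.assoc)
    also have "\<dots> = (s * a2) * tsum (?\<Delta> q) (\<lambda>b2 b3. b2 * ?S b3) * t"
      by (rule additive_tsum[symmetric]) (simp add: additive_def distrib_left distrib_right)
    finally show ?thesis by (simp add: antipode_right mult_scaleC_left mult_scaleC_right mult.assoc)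
  qed
  have in2: "tsum (?\<Delta> p) (\<lambda>a2 a3. s * (a2 * ?S a3)) = ?\<epsilon> p *\<^sub>C s" for p s
  proof -
    have "tsum (?\<Delta> p) (\<lambda>a2 a3. s * (a2 * ?S a3)) = s * tsum (?\<Delta> p) (\<lambda>a2 a3. a2 * ?S a3)"
      by (rule additive_tsum[symmetric]) (simp add: additive_def distrib_left)
    then show ?thesis by (simp add: antipode_right mult_scaleC_right)
  qed
  have "X = tsum (?\<Delta> a) (\<lambda>a1 p. tsum (?\<Delta> b) (\<lambda>b1 q. ?\<epsilon> q *\<^sub>C
      tsum (?\<Delta> p) (\<lambda>a2 a3. ?S (a1 * b1) * (a2 * ?S a3))))"
    unfolding X_def in1
    by (subst tsum_swap) (simp add: tsum_scale)
  also have "\<dots> = tsum (?\<Delta> a) (\<lambda>a1 p. ?\<epsilon> p *\<^sub>C ?S (a1 * tsum (?\<Delta> b) (\<lambda>b1 q. ?\<epsilon> q *\<^sub>C b1)))"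
  proof -
    have "?S (a1 * tsum (?\<Delta> b) (\<lambda>b1 q. ?\<epsilon> q *\<^sub>C b1)) = tsum (?\<Delta> b) (\<lambda>b1 q. ?S (a1 * (?\<epsilon> q *\<^sub>C b1)))" for a1
      by (rule additive_tsum) (simp add: additive_def distrib_left lin_simps)
    then show ?thesis
      by (simp add: in2 mult_scaleC_right lin_simps scaleC_scaleC mult.commute flip: tsum_scale)
  qed
  also have "\<dots> = ?S (tsum (?\<Delta> a) (\<lambda>a1 p. ?\<epsilon> p *\<^sub>C a1) * b)"
  proof -
    have "?S (tsum (?\<Delta> a) (\<lambda>a1 p. ?\<epsilon> p *\<^sub>C a1) * b) = tsum (?\<Delta> a) (\<lambda>a1 p. ?S ((?\<epsilon> p *\<^sub>C a1) * b))"
      by (rule additive_tsum) (simp add: additive_def distrib_right lin_simps)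
    then show ?thesis by (simp add: counit_right mult_scaleC_left lin_simps)
  qed
  finally have X1: "X = ?S (a * b)" by (simp add: counit_right)
  \<comment> \<open>For the other bracketing, coassociativity in both variables moves the inner
    coproducts to the first two legs.\<close>
  have co: "tsum (?\<Delta> b) (\<lambda>b1 q. tsum (?\<Delta> q) (\<lambda>b2 b3. ?S (a1 * b1) * (a2 * b2) * (?S b3 * t))) =
      tsum (?\<Delta> b) (\<lambda>p b3. tsum (?\<Delta> p) (\<lambda>b1 b2. ?S (a1 * b1) * (a2 * b2) * (?S b3 * t)))" for a1 a2 t
    by (rule comodule_coassoc[OF comodule_comult linear(1), symmetric])
      (rule balancedI; simp add: bilin)+
  have "X = tsum (?\<Delta> a) (\<lambda>p a3. tsum (?\<Delta> p) (\<lambda>a1 a2. tsum (?\<Delta> b) (\<lambda>q b3.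
      tsum (?\<Delta> q) (\<lambda>b1 b2. ?S (a1 * b1) * (a2 * b2) * (?S b3 * ?S a3)))))"
    unfolding X_def co
    by (rule comodule_coassoc[OF comodule_comult linear(1), symmetric])
      (rule balancedI; simp add: bilin)+
  also have "\<dots> = tsum (?\<Delta> a) (\<lambda>p a3. tsum (?\<Delta> b) (\<lambda>q b3. (?\<epsilon> p * ?\<epsilon> q) *\<^sub>C (?S b3 * ?S a3)))"
  proof -
    have "tsum (?\<Delta> p) (\<lambda>a1 a2. tsum (?\<Delta> b) (\<lambda>q b3. tsum (?\<Delta> q) (\<lambda>b1 b2. ?S (a1 * b1) * (a2 * b2) * (?S b3 * ?S a3)))) =
      tsum (?\<Delta> b) (\<lambda>q b3. (?\<epsilon> p * ?\<epsilon> q) *\<^sub>C (?S b3 * ?S a3))" for p a3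
    proof -
      have "tsum (?\<Delta> p) (\<lambda>a1 a2. tsum (?\<Delta> q) (\<lambda>b1 b2. ?S (a1 * b1) * (a2 * b2) * t)) =
        (?\<epsilon> p * ?\<epsilon> q) *\<^sub>C t" for q t
      proof -
        have b: "balanced (\<lambda>x y. ?S x * y * t)" by (rule balancedI) (simp_all add: bilin)
        have "tsum (?\<Delta> p) (\<lambda>a1 a2. tsum (?\<Delta> q) (\<lambda>b1 b2. ?S (a1 * b1) * (a2 * b2) * t)) =
          tsum (?\<Delta> (p * q)) (\<lambda>x y. ?S x * y * t)" by (rule comult_mult[OF b, symmetric])
        also have "\<dots> = tsum (?\<Delta> (p * q)) (\<lambda>x y. ?S x * y) * t"
          by (rule additive_tsum[symmetric]) (simp add: additive_def distrib_right)
        finally show ?thesis by (simp add: antipode_left counit_mult mult_scaleC_left)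
      qed
      then show ?thesis by (subst tsum_swap) simp
    qed
    then show ?thesis by simp
  qed
  also have "\<dots> = tsum (?\<Delta> a) (\<lambda>p a3. ?\<epsilon> p *\<^sub>C (?S b * ?S a3))"
  proof -
    have "?\<epsilon> p *\<^sub>C (?S (tsum (?\<Delta> b) (\<lambda>q b3. ?\<epsilon> q *\<^sub>C b3)) * ?S a3) =
      tsum (?\<Delta> b) (\<lambda>q b3. ?\<epsilon> p *\<^sub>C (?S (?\<epsilon> q *\<^sub>C b3) * ?S a3))" for p a3
      by (rule additive_tsum) (simp add: additive_def bilin)
    then show ?thesis by (simp add: counit_left lin_simps mult_scaleC_left scaleC_scaleC)
  qed
  also have "\<dots> = ?S b * ?S (tsum (?\<Delta> a) (\<lambda>p a3. ?\<epsilon> p *\<^sub>C a3))"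
  proof -
    have "?S b * ?S (tsum (?\<Delta> a) (\<lambda>p a3. ?\<epsilon> p *\<^sub>C a3)) = tsum (?\<Delta> a) (\<lambda>p a3. ?S b * ?S (?\<epsilon> p *\<^sub>C a3))"
      by (rule additive_tsum) (simp add: additive_def bilin)
    then show ?thesis by (simp add: lin_simps mult_scaleC_right)
  qed
  finally show ?thesis using X1 by (simp add: counit_left)
qed

text \<open>This is the inverse of the antipode; invertibility is a consequence of the involution.
  \<open>skew_left\<close> and \<open>skew_right\<close> are the antipode laws for the opposite
  product.\<close>

definition skew where "skew a = star (antipode A (star a))"

lemma star_scalar: "star (c *\<^sub>C 1) = cnj c *\<^sub>C (1 :: 'a)"
proof -
  have "star (star 1 * 1) = star 1 * star (star (1 :: 'a))" by (rule star_mult)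
  then have "star 1 = (1 :: 'a)" by (simp add: star_star)
  then show ?thesis by (simp add: star_scaleC)
qed

lemma star_additive: "additive (star :: 'a \<Rightarrow> 'a)"
  by (simp add: additive_def star_add)

lemma counit_star: "counit A (star a) = cnj (counit A a)"
  using hopf by (simp add: hopf_star_algebra_def)

lemma skew_linear: "clinear skew"
  by (rule clinearI) (simp_all add: skew_def star_add star_scaleC lin_simps)

lemma skew_right: "tsum (comult A a) (\<lambda>b c. c * skew b) = counit A a *\<^sub>C 1"
proof -
  have b: "balanced (\<lambda>b c. antipode A b * c)" by (rule balancedI) (simp_all add: bilin)
  have "star (tsum (comult A (star a)) (\<lambda>b c. antipode A b * c)) = tsum (comult A a) (\<lambda>b c. c * skew b)"
    by (simp add: comult_star[OF b] additive_tsum[OF star_additive] star_mult star_star skew_def)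
  then show ?thesis by (simp add: antipode_left star_scalar counit_star)
qed

lemma skew_left: "tsum (comult A a) (\<lambda>b c. skew c * b) = counit A a *\<^sub>C 1"
proof -
  have b: "balanced (\<lambda>b c. b * antipode A c)" by (rule balancedI) (simp_all add: bilin)
  have "star (tsum (comult A (star a)) (\<lambda>b c. b * antipode A c)) = tsum (comult A a) (\<lambda>b c. skew c * b)"
    by (simp add: comult_star[OF b] additive_tsum[OF star_additive] star_mult star_star skew_def)
  then show ?thesis by (simp add: antipode_right star_scalar counit_star)
qed

lemma antipode_one: "antipode A 1 = 1"
proof -
  have "tsum (comult A 1) (\<lambda>b c. antipode A b * c) = antipode A 1 * 1"
  proof -
    have "balanced (\<lambda>b c. antipode A b * c)" by (rule balancedI) (simp_all add: bilin)
    moreover have "comult A 1 = 1 \<otimes> 1" using hopf by (simp add: hopf_star_algebra_def)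
    ultimately show ?thesis by (simp add: tsum_pure)
  qed
  moreover have "counit A 1 = 1" using hopf by (simp add: hopf_star_algebra_def)
  ultimately show ?thesis by (simp add: antipode_left scaleC_one)
qed

text \<open>Applying the antipode to \<open>skew_left\<close> shows that the antipode after
  \<open>skew\<close> is a right convolution inverse of the antipode. The identity is a left one,
  and associativity of convolution makes the two agree.\<close>

lemma antipode_skew: "antipode A (skew a) = a"
proof -
  let ?S = "antipode A" and ?\<Delta> = "comult A" and ?\<epsilon> = "counit A"
  have conv: "tsum (?\<Delta> a) (\<lambda>b c. ?S b * ?S (skew c)) = ?\<epsilon> a *\<^sub>C 1" for a
  proof -
    have "?S (tsum (?\<Delta> a) (\<lambda>b c. skew c * b)) = tsum (?\<Delta> a) (\<lambda>b c. ?S b * ?S (skew c))"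
      by (simp add: additive_tsum[OF clinear_additive[OF linear(3)]] antipode_mult)
    then show ?thesis by (simp add: skew_left lin_simps antipode_one)
  qed
  have "tsum (?\<Delta> a) (\<lambda>b p. tsum (?\<Delta> p) (\<lambda>c d. b * ?S c * ?S (skew d))) =
      tsum (?\<Delta> a) (\<lambda>p d. tsum (?\<Delta> p) (\<lambda>b c. b * ?S c * ?S (skew d)))"
    by (rule comodule_coassoc[OF comodule_comult linear(1), symmetric])
      (rule balancedI; simp add: bilin clinearD[OF skew_linear])+
  moreover have "tsum (?\<Delta> p) (\<lambda>c d. b * ?S c * ?S (skew d)) = ?\<epsilon> p *\<^sub>C b" for b p
  proof -
    have "b * tsum (?\<Delta> p) (\<lambda>c d. ?S c * ?S (skew d)) = tsum (?\<Delta> p) (\<lambda>c d. b * (?S c * ?S (skew d)))"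
      by (rule additive_tsum) (simp add: additive_def distrib_left)
    then show ?thesis by (simp add: conv mult_scaleC_right mult.assoc)
  qed
  moreover have "tsum (?\<Delta> p) (\<lambda>b c. b * ?S c * ?S (skew d)) = ?\<epsilon> p *\<^sub>C ?S (skew d)" for p d
  proof -
    have "tsum (?\<Delta> p) (\<lambda>b c. b * ?S c) * ?S (skew d) = tsum (?\<Delta> p) (\<lambda>b c. b * ?S c * ?S (skew d))"
      by (rule additive_tsum) (simp add: additive_def distrib_right)
    then show ?thesis by (simp add: antipode_right mult_scaleC_left)
  qed
  ultimately have "a = tsum (?\<Delta> a) (\<lambda>p d. ?\<epsilon> p *\<^sub>C ?S (skew d))" by (simp add: counit_right)
  also have "\<dots> = ?S (skew (tsum (?\<Delta> a) (\<lambda>p d. ?\<epsilon> p *\<^sub>C d)))"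
  proof -
    have "?S (skew (tsum (?\<Delta> a) (\<lambda>p d. ?\<epsilon> p *\<^sub>C d))) = tsum (?\<Delta> a) (\<lambda>p d. ?S (skew (?\<epsilon> p *\<^sub>C d)))"
      by (rule additive_tsum) (simp add: additive_def lin_simps clinearD[OF skew_linear])
    then show ?thesis by (simp add: lin_simps clinearD[OF skew_linear])
  qed
  finally show ?thesis by (simp add: counit_left)
qed

lemma inv_antipode: "inv (antipode A) = skew"
proof (rule inv_unique_comp)
  show "antipode A \<circ> skew = id" by (simp add: fun_eq_iff antipode_skew)
  \<comment> \<open>The second composite is the first one conjugated by \<open>star\<close>.\<close>
  have "skew (antipode A a) = star (antipode A (skew (star a)))" for a
    by (simp add: skew_def star_star)
  then show "skew \<circ> antipode A = id" by (simp add: fun_eq_iff antipode_skew star_star)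
qed

end

section \<open>Internal direct sums\<close>

text \<open>\<open>component\<close> for an arbitrary index set, needed because bidegrees are given
  as summands of each degree separately.\<close>

definition family_of :: "'i set \<Rightarrow> ('i \<Rightarrow> 'v::complex_vector set) \<Rightarrow> 'v \<Rightarrow> 'i \<Rightarrow> 'v"
  where "family_of I U v = (THE c. c \<in> families I U \<and> (\<Sum>i | c i \<noteq> 0. c i) = v)"

lemma component_eq: "component U i v = family_of UNIV U v i"
  by (simp add: component_def family_of_def)

lemma sum_support: "finite S \<Longrightarrow> {i. c i \<noteq> 0} \<subseteq> S \<Longrightarrow> (\<Sum>i | c i \<noteq> 0. c i) = (\<Sum>i\<in>S. c i)"
  by (rule sum.mono_neutral_left) auto

context
  fixes I :: "'i set" and U :: "'i \<Rightarrow> 'v::complex_vector set" and V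
  assumes ds: "direct_sum I U V"
begin

lemma family_of_unique:
  assumes "c \<in> families I U" "(\<Sum>i | c i \<noteq> 0. c i) = v"
  shows "family_of I U v = c"
  unfolding family_of_def
proof (rule the_equality)
  fix d assume d: "d \<in> families I U \<and> (\<Sum>i | d i \<noteq> 0. d i) = v"
  have "inj_on (\<lambda>c. \<Sum>i | c i \<noteq> 0. c i) (families I U)"
    using ds by (simp add: direct_sum_def bij_betw_def)
  from inj_onD[OF this, of d c] show "d = c" using d assms by simp
qed (simp add: assms)

lemma family_of:
  assumes "v \<in> V"
  shows "family_of I U v \<in> families I U" "(\<Sum>i | family_of I U v i \<noteq> 0. family_of I U v i) = v"
proof -
  have "V = (\<lambda>c. \<Sum>i | c i \<noteq> 0. c i) ` families I U"
    using ds by (simp add: direct_sum_def bij_betw_def)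
  then obtain c where c: "c \<in> families I U" "(\<Sum>i | c i \<noteq> 0. c i) = v" using assms by auto
  with family_of_unique[OF c]
  show "family_of I U v \<in> families I U" "(\<Sum>i | family_of I U v i \<noteq> 0. family_of I U v i) = v" by auto
qed

lemma family_of_finite: "v \<in> V \<Longrightarrow> finite {i. family_of I U v i \<noteq> 0}"
  using family_of(1) by (simp add: families_def)

lemma sub: "i \<in> I \<Longrightarrow> csubspace (U i)"
  using ds by (simp add: direct_sum_def)

lemma family_of_add:
  assumes "v \<in> V" "w \<in> V"
  shows "family_of I U (v + w) = (\<lambda>i. family_of I U v i + family_of I U w i)"
proof (rule family_of_unique)
  let ?c = "family_of I U v" and ?d = "family_of I U w"
  have f: "finite ({i. ?c i \<noteq> 0} \<union> {i. ?d i \<noteq> 0})" using family_of_finite assms by simp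
  have s: "{i. ?c i + ?d i \<noteq> 0} \<subseteq> {i. ?c i \<noteq> 0} \<union> {i. ?d i \<noteq> 0}" by auto
  show "(\<lambda>i. ?c i + ?d i) \<in> families I U"
    using family_of(1)[OF assms(1)] family_of(1)[OF assms(2)] finite_subset[OF s f]
    by (auto simp: families_def complex_vector.subspace_add sub)
  show "(\<Sum>i | ?c i + ?d i \<noteq> 0. ?c i + ?d i) = v + w"
    using family_of(2)[OF assms(1)] family_of(2)[OF assms(2)]
      sum_support[OF f s] sum_support[OF f, of ?c] sum_support[OF f, of ?d]
    by (simp add: sum.distrib)
qed

lemma family_of_scale:
  assumes "v \<in> V"
  shows "family_of I U (c *\<^sub>C v) = (\<lambda>i. c *\<^sub>C family_of I U v i)"
proof (rule family_of_unique)
  let ?c = "family_of I U v"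
  have f: "finite {i. ?c i \<noteq> 0}" using family_of_finite assms by simp
  have s: "{i. c *\<^sub>C ?c i \<noteq> 0} \<subseteq> {i. ?c i \<noteq> 0}" by (auto simp: complex_vector.scale_zero_right)
  show "(\<lambda>i. c *\<^sub>C ?c i) \<in> families I U"
    using family_of(1)[OF assms(1)] finite_subset[OF s f]
    by (auto simp: families_def complex_vector.subspace_scale sub complex_vector.scale_zero_right)
  show "(\<Sum>i | c *\<^sub>C ?c i \<noteq> 0. c *\<^sub>C ?c i) = c *\<^sub>C v"
    using family_of(2)[OF assms(1)] sum_support[OF f s]
    by (simp flip: complex_vector.scale_sum_right)
qed

lemma family_of_base:
  assumes "i \<in> I" "v \<in> U i"
  shows "family_of I U v = (\<lambda>j. if j = i then v else 0)"
proof (rule family_of_unique)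
  have s: "{j. (if j = i then v else 0) \<noteq> 0} \<subseteq> {i}" by auto
  show "(\<lambda>j. if j = i then v else 0) \<in> families I U"
    using assms finite_subset[OF s] sub complex_vector.subspace_0 by (auto simp: families_def)
  show "(\<Sum>j | (if j = i then v else 0) \<noteq> 0. if j = i then v else 0) = v"
    using sum_support[OF _ s] by simp
qed

lemma direct_sum_subset: "i \<in> I \<Longrightarrow> U i \<subseteq> V"
proof
  fix v assume v: "i \<in> I" "v \<in> U i"
  have s: "{j. (if j = i then v else 0) \<noteq> 0} \<subseteq> {i}" by auto
  have "(\<lambda>j. if j = i then v else 0) \<in> families I U"
    using v finite_subset[OF s] sub complex_vector.subspace_0 by (auto simp: families_def)
  then have "(\<Sum>j | (if j = i then v else 0) \<noteq> 0. if j = i then v else 0) \<in> V"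
    using ds unfolding direct_sum_def bij_betw_def by blast
  moreover have "(\<Sum>j | (if j = i then v else 0) \<noteq> 0. if j = i then v else 0) = v"
    using sum_support[OF _ s] by simp
  ultimately show "v \<in> V" by simp
qed

end

text \<open>A consistent choice of coefficients in a unique decomposition is linear.\<close>

lemma unique_decomposition_linear:
  fixes T :: "'i \<Rightarrow> 'v::complex_vector \<Rightarrow> 'w::complex_vector"
  assumes I: "finite I" and sub: "\<And>i. i \<in> I \<Longrightarrow> csubspace (V i)" and T: "\<And>i. clinear (T i)"
    and span: "cspan {T i v | i v. i \<in> I \<and> v \<in> V i} = UNIV"
    and indep: "\<And>f. (\<And>i. i \<in> I \<Longrightarrow> f i \<in> V i) \<Longrightarrow> (\<Sum>i\<in>I. T i (f i)) = 0 \<Longrightarrow> (\<And>i. i \<in> I \<Longrightarrow> f i = 0)"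
  obtains C where "\<And>i. i \<in> I \<Longrightarrow> clinear (C i)"
    "\<And>i j v. i \<in> I \<Longrightarrow> j \<in> I \<Longrightarrow> v \<in> V i \<Longrightarrow> C j (T i v) = (if j = i then v else 0)"
proof -
  define dec where "dec w f \<longleftrightarrow> (\<forall>i\<in>I. f i \<in> V i) \<and> (\<Sum>i\<in>I. T i (f i)) = w" for w f
  have add: "dec (w + w') (\<lambda>i. f i + f' i)" if "dec w f" "dec w' f'" for w w' f f'
    using that by (auto simp: dec_def clinearD[OF T] sum.distrib intro: complex_vector.subspace_add[OF sub])
  have scale: "dec (c *\<^sub>C w) (\<lambda>i. c *\<^sub>C f i)" if "dec w f" for c w f
    using that by (auto simp: dec_def clinearD[OF T] complex_vector.scale_sum_right
        intro: complex_vector.subspace_scale[OF sub])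
  have uniq: "f i = g i" if "dec w f" "dec w g" "i \<in> I" for w f g i
  proof -
    have "T i (f i - g i) = T i (f i) - T i (g i)" for i
      by (rule clinear_diff[OF T])
    then have "(\<Sum>i\<in>I. T i (f i - g i)) = 0"
      using that by (simp add: dec_def sum_subtractf)
    moreover have "f i - g i \<in> V i" if "i \<in> I" for i
      using that \<open>dec w f\<close> \<open>dec w g\<close> by (auto simp: dec_def intro: complex_vector.subspace_diff[OF sub])
    ultimately have "f i - g i = 0" using indep[of "\<lambda>i. f i - g i"] that(3) by blast
    then show ?thesis by simp
  qed
  have base: "dec (T i v) (\<lambda>j. if j = i then v else 0)" if "i \<in> I" "v \<in> V i" for i v
  proof -
    have "T j (if j = i then v else 0) = (if j = i then T i v else 0)" for j
      by (simp add: clinear_zero[OF T])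
    then show ?thesis using that I by (auto simp: dec_def complex_vector.subspace_0[OF sub])
  qed
  have ex: "\<exists>f. dec w f" for w
  proof -
    have "w \<in> cspan {T i v | i v. i \<in> I \<and> v \<in> V i}" using span by simp
    then show ?thesis
    proof (induction rule: complex_vector.span_induct_alt)
      case base
      have "dec 0 (\<lambda>i. 0)"
        by (auto simp: dec_def complex_vector.subspace_0[OF sub] clinear_zero[OF T])
      then show ?case by blast
    next
      case (step c x y)
      then obtain i v f where "x = T i v" "i \<in> I" "v \<in> V i" "dec y f" by blast
      then show ?case using add[OF scale[OF base]] by blast
    qed
  qed
  \<comment> \<open>One decomposition is chosen for each \<open>w\<close>. By \<open>uniq\<close>
    its values at indices in \<open>I\<close> are forced, and this is where linearity comes
    from.\<close>
  define C where "C i w = (SOME f. dec w f) i" for i w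
  have C: "dec w (\<lambda>i. C i w)" for w unfolding C_def using someI_ex[OF ex] by simp
  show thesis
  proof
    show "clinear (C i)" if "i \<in> I" for i
      using uniq[OF C add[OF C C] that] uniq[OF C scale[OF C] that] by (intro clinearI)
    show "C j (T i v) = (if j = i then v else 0)" if "i \<in> I" "j \<in> I" "v \<in> V i" for i j v
      using uniq[OF C base[OF that(1,3)] that(2)] .
  qed
qed

text \<open>Given a finite system of orthogonal idempotents, the family with sum \<open>x\<close> is
  forced: applying \<open>Q k\<close> to the sum leaves its member at \<open>k\<close>. It serves
  for the degrees of right bundles, whose decomposition is not given in advance.\<close>

lemma component_projection:
  assumes Q: "\<And>k. clinear (Q k)" "\<And>k l x. Q k (Q l x) = (if k = l then Q k x else 0)"
    and I: "finite I" "\<And>x. (\<Sum>k\<in>I. Q k x) = x"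
  shows "component (\<lambda>k. {x. Q k x = x}) k x = Q k x"
proof -
  note zero = clinear_zero[OF Q(1)]
  have out: "Q k x = 0" if "k \<notin> I" for k x
  proof -
    have "Q k x = (\<Sum>l\<in>I. Q k (Q l x))"
      using I(2)[of x] clinear_sum[OF Q(1), of k "\<lambda>l. Q l x" I] by simp
    also have "\<dots> = 0" using that by (intro sum.neutral) (auto simp: Q(2))
    finally show ?thesis .
  qed
  have supp: "{k. Q k x \<noteq> 0} \<subseteq> I" using out by blast
  have "(THE c. c \<in> families UNIV (\<lambda>k. {x. Q k x = x}) \<and> (\<Sum>i | c i \<noteq> 0. c i) = x) = (\<lambda>k. Q k x)"
  proof (rule the_equality)
    show "(\<lambda>k. Q k x) \<in> families UNIV (\<lambda>k. {x. Q k x = x}) \<and> (\<Sum>i | Q i x \<noteq> 0. Q i x) = x"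
      using finite_subset[OF supp I(1)] sum_support[OF I(1) supp] I(2) by (simp add: families_def Q(2))
    fix c assume c: "c \<in> families UNIV (\<lambda>k. {x. Q k x = x}) \<and> (\<Sum>i | c i \<noteq> 0. c i) = x"
    then have fin: "finite {i. c i \<noteq> 0}" and fix_c: "Q i (c i) = c i" for i by (auto simp: families_def)
    have "Q k (c i) = (if k = i then c i else 0)" for i k
      using Q(2)[of k i "c i"] fix_c[of i] by auto
    then have "Q k x = (\<Sum>i | c i \<noteq> 0. if k = i then c i else 0)" for k
      using c clinear_sum[OF Q(1), of k c "{i. c i \<noteq> 0}"] by auto
    then show "c = (\<lambda>k. Q k x)" using fin by (auto simp: fun_eq_iff)
  qed
  then show ?thesis by (simp add: component_def)
qed

section \<open>The bigrading of the forms\<close>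

lemma scaleC_minus_one: "(-1 :: complex) *\<^sub>C x = - (x :: 'v::complex_vector)"
  by (simp add: complex_vector.scale_minus_left scaleC_one)

lemma sign_mult: "(-1) ^ k * x = ((-1) ^ k :: complex) *\<^sub>C (x :: 'v::complex_algebra_1)"
  by (simp add: minus_one_power_iff scaleC_minus_one scaleC_one)

lemmas mult_simps = distrib_left distrib_right mult_scaleC_left mult_scaleC_right

locale kaehler_forms = hopf A
  for A :: "('a::complex_star_algebra) hopf" +
  fixes K :: "('a, 'm::complex_star_algebra, 'o::complex_algebra_1) kaehler"
  assumes kaehler: "kaehler_structure A K"
begin

abbreviation n where "n \<equiv> hdim K"
abbreviation L where "L \<equiv> lefschetz K"
abbreviation \<kappa> where "\<kappa> \<equiv> kform K"

lemma complex_str: "complex_structure A K" and calc: "calculus A K"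
  using kaehler by (simp_all add: kaehler_structure_def complex_structure_def)

lemma deg_ds: "direct_sum UNIV (deg K) UNIV"
  using calc by (simp add: calculus_def)

lemma bideg_ds: "direct_sum {(a, b). a + b = k} (bideg K) (deg K k)"
  using complex_str by (simp add: complex_structure_def)

lemma deg_mult: "\<omega> \<in> deg K i \<Longrightarrow> \<nu> \<in> deg K j \<Longrightarrow> \<omega> * \<nu> \<in> deg K (i + j)"
  using calc by (simp add: calculus_def)

lemma bideg_mult: "\<omega> \<in> bideg K (a, b) \<Longrightarrow> \<nu> \<in> bideg K (c, d) \<Longrightarrow> \<omega> * \<nu> \<in> bideg K (a + c, b + d)"
  using complex_str by (simp add: complex_structure_def)

lemma incl_linear: "clinear (incl K)" and incl_one: "incl K 1 = 1"
  and incl_mult: "incl K (m * m') = incl K m * incl K m'"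
  and incl_bij: "bij_betw (incl K) UNIV (deg K 0)"
  using calc by (simp_all add: calculus_def)

lemma diff_linear: "clinear (diff K)"
  and diff_mult: "\<omega> \<in> deg K k \<Longrightarrow> diff K (\<omega> * \<nu>) = diff K \<omega> * \<nu> + ((-1) ^ k :: complex) *\<^sub>C (\<omega> * diff K \<nu>)"
  using calc by (simp_all add: calculus_def sign_mult)

lemma fstar_additive: "additive (fstar K)" and fstar_scale: "fstar K (c *\<^sub>C \<omega>) = cnj c *\<^sub>C fstar K \<omega>"
  and fstar_fstar [simp]: "fstar K (fstar K \<omega>) = \<omega>"
  and fstar_incl: "fstar K (incl K m) = incl K (star m)"
  and fstar_deg: "\<omega> \<in> deg K k \<Longrightarrow> fstar K \<omega> \<in> deg K k"
  and fstar_diff: "fstar K (diff K \<omega>) = diff K (fstar K \<omega>)"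
  and fstar_mult: "\<omega> \<in> deg K i \<Longrightarrow> \<nu> \<in> deg K j \<Longrightarrow>
      fstar K (\<omega> * \<nu>) = ((-1) ^ (i * j) :: complex) *\<^sub>C (fstar K \<nu> * fstar K \<omega>)"
  using calc by (simp_all add: calculus_def sign_mult)

lemmas fstar_add = additive.add[OF fstar_additive]

lemma coact_comodule: "comodule_algebra A (coact K)"
  and coactM_comodule: "comodule_star_algebra A (coactM K)"
  and coact_incl: "coact K (incl K m) = tensor_map id (incl K) (coactM K m)"
  and coact_diff: "coact K (diff K \<omega>) = tensor_map id (diff K) (coact K \<omega>)"
  and coact_fstar: "coact K (fstar K \<omega>) = tensor_map star (fstar K) (coact K \<omega>)"
  using calc by (simp_all add: calculus_def)

lemma coact_bideg: "subcomodule (coact K) (bideg K i)"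
  and fstar_bideg: "\<omega> \<in> bideg K (a, b) \<Longrightarrow> fstar K \<omega> \<in> bideg K (b, a)"
  and del_linear: "clinear (del K)" and delbar_linear: "clinear (delbar K)"
  and del_bideg: "\<omega> \<in> bideg K (a, b) \<Longrightarrow> del K \<omega> \<in> bideg K (a + 1, b)"
  and delbar_bideg: "\<omega> \<in> bideg K (a, b) \<Longrightarrow> delbar K \<omega> \<in> bideg K (a, b + 1)"
  and diff_eq: "diff K \<omega> = del K \<omega> + delbar K \<omega>"
proof -
  show "subcomodule (coact K) (bideg K i)" using complex_str by (cases i) (simp add: complex_structure_def)
  show "clinear (del K)" "clinear (delbar K)" "diff K \<omega> = del K \<omega> + delbar K \<omega>"
    "\<omega> \<in> bideg K (a, b) \<Longrightarrow> del K \<omega> \<in> bideg K (a + 1, b)"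
    "\<omega> \<in> bideg K (a, b) \<Longrightarrow> delbar K \<omega> \<in> bideg K (a, b + 1)"
    using complex_str by (auto simp: complex_structure_def)
  have "fstar K ` bideg K (a, b) = bideg K (b, a)"
    using complex_str by (simp add: complex_structure_def)
  then show "\<omega> \<in> bideg K (a, b) \<Longrightarrow> fstar K \<omega> \<in> bideg K (b, a)" by blast
qed

lemma deg_top: "k > 2 * n \<Longrightarrow> deg K k = {0}"
  and kform_bideg: "\<kappa> \<in> bideg K (1, 1)" and kform_central: "\<kappa> * \<omega> = \<omega> * \<kappa>"
  and kform_star: "fstar K \<kappa> = \<kappa>" and kform_coact: "coact K \<kappa> = 1 \<otimes> \<kappa>"
  and lefschetz_bij: "k < n \<Longrightarrow> bij_betw (L ^^ (n - k)) (deg K k) (deg K (2 * n - k))"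
  using kaehler by (simp_all add: kaehler_structure_def)

lemma deg_subspace: "csubspace (deg K k)"
  using deg_ds by (simp add: direct_sum_def)

lemma bideg_subspace: "csubspace (bideg K i)"
  using bideg_ds[of "fst i + snd i"] by (cases i) (simp add: direct_sum_def)

lemma bideg_deg: "\<omega> \<in> bideg K (a, b) \<Longrightarrow> \<omega> \<in> deg K (a + b)"
  using direct_sum_subset[OF bideg_ds[of "a + b"], of "(a, b)"] by auto

text \<open>A projection in two stages, since the bigrading is given as a decomposition of each
  \<open>deg K k\<close>.\<close>

definition p where
  "p i \<omega> = family_of {(a, b). a + b = fst i + snd i} (bideg K) (component (deg K) (fst i + snd i) \<omega>) i"

definition J where "J = {(a, b). a + b \<le> 2 * n}"

text \<open>The parity operator. It replaces the signs \<open>(-1) ^ k\<close> in the graded rules,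
  so that they hold for all forms and not only for homogeneous ones.\<close>

definition sg where "sg \<omega> = (\<Sum>i\<in>J. ((-1) ^ (fst i + snd i) :: complex) *\<^sub>C p i \<omega>)"

lemma finite_J: "finite J"
  by (rule finite_subset[of _ "{..2 * n} \<times> {..2 * n}"]) (auto simp: J_def)

lemma component_deg: "component (deg K) k \<omega> \<in> deg K k"
  using family_of(1)[OF deg_ds, of \<omega>] by (simp add: component_eq families_def)

lemma component_linear: "clinear (component (deg K) k)"
  by (rule clinearI) (simp_all add: component_eq family_of_add[OF deg_ds] family_of_scale[OF deg_ds])

lemma component_base: "\<omega> \<in> deg K l \<Longrightarrow> component (deg K) k \<omega> = (if k = l then \<omega> else 0)"
  by (simp add: component_eq family_of_base[OF deg_ds])

lemma p_linear: "clinear (p i)"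
  by (rule clinearI) (simp_all add: p_def clinearD[OF component_linear]
      family_of_add[OF bideg_ds] family_of_scale[OF bideg_ds] component_deg)

lemmas p_zero [simp] = clinear_zero[OF p_linear]

lemma p_in: "p i \<omega> \<in> bideg K i"
  using family_of(1)[OF bideg_ds component_deg[of "fst i + snd i" \<omega>]]
  by (cases i) (simp add: p_def families_def)

lemma p_base:
  assumes "\<omega> \<in> bideg K j" shows "p i \<omega> = (if i = j then \<omega> else 0)"
proof -
  obtain a b where j: "j = (a, b)" by fastforce
  have d: "\<omega> \<in> deg K (a + b)" using bideg_deg assms j by simp
  show ?thesis
  proof (cases "fst i + snd i = a + b")
    case True
    then have "component (deg K) (fst i + snd i) \<omega> = \<omega>" using component_base[OF d] by simp
    then show ?thesis
      unfolding p_def True using family_of_base[OF bideg_ds[of "a + b"], of j \<omega>] assms by (auto simp: j)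
  next
    case False
    then have c: "component (deg K) (fst i + snd i) \<omega> = component (deg K) (fst i + snd i) 0"
      using component_base[OF d] clinear_zero[OF component_linear] by simp
    have "p i \<omega> = p i 0" unfolding p_def c ..
    then show ?thesis using False by (auto simp: j)
  qed
qed

lemma p_p: "p i (p j \<omega>) = (if i = j then p i \<omega> else 0)"
  using p_base[OF p_in[of j \<omega>], of i] by auto

lemma p_deg: "\<omega> \<in> deg K k \<Longrightarrow> fst i + snd i \<noteq> k \<Longrightarrow> p i \<omega> = 0"
proof -
  assume "\<omega> \<in> deg K k" "fst i + snd i \<noteq> k"
  then have c: "component (deg K) (fst i + snd i) \<omega> = component (deg K) (fst i + snd i) 0"
    using component_base clinear_zero[OF component_linear] by simp
  have "p i \<omega> = p i 0" unfolding p_def c ..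
  then show ?thesis by simp
qed

lemma component_p: "component (deg K) k \<omega> = (\<Sum>i\<in>{(a, b). a + b = k}. p i \<omega>)"
proof -
  let ?I = "{(a, b). a + b = k}"
  let ?c = "family_of ?I (bideg K) (component (deg K) k \<omega>)"
  have f: "finite ?I" by (rule finite_subset[of _ "{..k} \<times> {..k}"]) auto
  have "component (deg K) k \<omega> = (\<Sum>i | ?c i \<noteq> 0. ?c i)"
    using family_of(2)[OF bideg_ds component_deg] by simp
  also have "\<dots> = (\<Sum>i\<in>?I. ?c i)"
    using family_of(1)[OF bideg_ds component_deg, of k \<omega>] by (intro sum_support f) (auto simp: families_def)
  also have "\<dots> = (\<Sum>i\<in>?I. p i \<omega>)" by (intro sum.cong) (auto simp: p_def)
  finally show ?thesis .
qed

lemma p_sum: "(\<Sum>i\<in>J. p i \<omega>) = \<omega>"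
proof -
  let ?c = "family_of UNIV (deg K) \<omega>"
  have "?c k = 0" if "k > 2 * n" for k
    using component_deg[of k \<omega>] deg_top[OF that] by (simp add: component_eq)
  then have "{k. ?c k \<noteq> 0} \<subseteq> {..2 * n}" by (auto simp: not_less[symmetric])
  then have "\<omega> = (\<Sum>k\<le>2 * n. component (deg K) k \<omega>)"
    using family_of(2)[OF deg_ds, of \<omega>] sum_support[of "{..2 * n}" ?c] by (simp add: component_eq)
  also have "\<dots> = (\<Sum>k\<le>2 * n. \<Sum>i\<in>{i \<in> J. (case i of (a, b) \<Rightarrow> a + b) = k}. p i \<omega>)"
    by (intro sum.cong refl) (auto simp: component_p J_def intro!: sum.cong)
  also have "\<dots> = (\<Sum>i\<in>J. p i \<omega>)"
    by (intro sum.group finite_J) (auto simp: J_def)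
  finally show ?thesis by simp
qed

text \<open>Every form is the finite sum of its components under \<open>p\<close>. Asking only for
  additivity lets the rule serve maps involving \<open>fstar\<close>.\<close>

lemma additive_ext:
  assumes "additive F" "additive G" "\<And>a b \<omega>. \<omega> \<in> bideg K (a, b) \<Longrightarrow> F \<omega> = G \<omega>"
  shows "F \<omega> = G \<omega>"
proof -
  have "F \<omega> = (\<Sum>i\<in>J. F (p i \<omega>))" "G \<omega> = (\<Sum>i\<in>J. G (p i \<omega>))"
    using additive.sum[OF assms(1), of "\<lambda>i. p i \<omega>" J] additive.sum[OF assms(2), of "\<lambda>i. p i \<omega>" J] p_sum[of \<omega>]
    by simp_all
  moreover have "F (p i \<omega>) = G (p i \<omega>)" for i using assms(3) p_in by (cases i) blast
  ultimately show ?thesis by simp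
qed

lemma p_shift:
  assumes X: "additive X" "\<And>a b \<omega>. \<omega> \<in> bideg K (a, b) \<Longrightarrow> X \<omega> \<in> bideg K (a + c, b + d)"
  shows "p (a + c, b + d) (X \<omega>) = X (p (a, b) \<omega>)"
    and "x < c \<or> y < d \<Longrightarrow> p (x, y) (X \<omega>) = 0"
proof -
  have X0: "X 0 = 0" by (rule additive.zero[OF X(1)])
  have "(\<lambda>\<omega>. p (a + c, b + d) (X \<omega>)) \<omega> = (\<lambda>\<omega>. X (p (a, b) \<omega>)) \<omega>"
  proof (rule additive_ext[of "\<lambda>\<omega>. p (a + c, b + d) (X \<omega>)" "\<lambda>\<omega>. X (p (a, b) \<omega>)"])
    fix a' b' \<omega> assume w: "\<omega> \<in> bideg K (a', b')"
    show "p (a + c, b + d) (X \<omega>) = X (p (a, b) \<omega>)"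
      unfolding p_base[OF X(2)[OF w]] p_base[OF w] using X0 by simp
  qed (simp_all add: additive_def additive.add[OF X(1)] clinearD[OF p_linear])
  then show "p (a + c, b + d) (X \<omega>) = X (p (a, b) \<omega>)" .
  assume xy: "x < c \<or> y < d"
  have "(\<lambda>\<omega>. p (x, y) (X \<omega>)) \<omega> = (\<lambda>\<omega>. 0) \<omega>"
  proof (rule additive_ext[of "\<lambda>\<omega>. p (x, y) (X \<omega>)" "\<lambda>\<omega>. 0"])
    fix a' b' \<omega> assume w: "\<omega> \<in> bideg K (a', b')"
    show "p (x, y) (X \<omega>) = 0" unfolding p_base[OF X(2)[OF w]] using xy by auto
  qed (simp_all add: additive_def additive.add[OF X(1)] clinearD[OF p_linear])
  then show "p (x, y) (X \<omega>) = 0" .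
qed

lemma sg_linear: "clinear sg"
  by (rule clinearI) (simp_all add: sg_def clinearD[OF p_linear] scaleC_add_right sum.distrib
      complex_vector.scale_sum_right scaleC_scaleC mult.commute)

lemma sg_bideg: "\<omega> \<in> bideg K (a, b) \<Longrightarrow> sg \<omega> = ((-1) ^ (a + b) :: complex) *\<^sub>C \<omega>"
proof -
  assume w: "\<omega> \<in> bideg K (a, b)"
  have eq: "((-1) ^ (fst i + snd i) :: complex) *\<^sub>C p i \<omega> = ((-1) ^ (a + b) :: complex) *\<^sub>C p i \<omega>" for i
    by (simp add: p_base[OF w] complex_vector.scale_zero_right)
  have "sg \<omega> = (\<Sum>i\<in>J. ((-1) ^ (a + b) :: complex) *\<^sub>C p i \<omega>)" by (simp only: sg_def eq)
  then show ?thesis by (simp add: p_sum flip: complex_vector.scale_sum_right)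
qed

lemma sg_deg: "\<omega> \<in> deg K k \<Longrightarrow> sg \<omega> = ((-1) ^ k :: complex) *\<^sub>C \<omega>"
proof -
  assume w: "\<omega> \<in> deg K k"
  have eq: "((-1) ^ (fst i + snd i) :: complex) *\<^sub>C p i \<omega> = ((-1) ^ k :: complex) *\<^sub>C p i \<omega>" for i
    using p_deg[OF w, of i] by (cases "fst i + snd i = k") (simp_all add: complex_vector.scale_zero_right)
  have "sg \<omega> = (\<Sum>i\<in>J. ((-1) ^ k :: complex) *\<^sub>C p i \<omega>)" by (simp only: sg_def eq)
  then show ?thesis by (simp add: p_sum flip: complex_vector.scale_sum_right)
qed

lemma sign_sign: "((-1) ^ k :: complex) *\<^sub>C ((-1) ^ k :: complex) *\<^sub>C (x :: 'v::complex_vector) = x"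
  by (simp add: scaleC_scaleC scaleC_one flip: power_mult_distrib)

lemma sg_sg: "sg (sg \<omega>) = \<omega>"
proof -
  show ?thesis
    by (rule additive_ext[of "\<lambda>\<omega>. sg (sg \<omega>)" "\<lambda>\<omega>. \<omega>"]) (auto simp: additive_def clinearD[OF sg_linear] sg_bideg sign_sign)
qed

lemma sg_mult: "sg (\<omega> * \<nu>) = sg \<omega> * sg \<nu>"
proof -
  have 1: "sg (\<omega> * \<nu>) = sg \<omega> * sg \<nu>" if \<omega>: "\<omega> \<in> bideg K (a, b)" for \<omega> a b
  proof -
    show ?thesis
    proof (rule additive_ext[of "\<lambda>\<nu>. sg (\<omega> * \<nu>)" "\<lambda>\<nu>. sg \<omega> * sg \<nu>"])
      fix c d \<nu> assume \<nu>: "\<nu> \<in> bideg K (c, d)"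
      have "((-1) ^ (a + c + (b + d)) :: complex) = (-1) ^ (a + b) * (-1) ^ (c + d)"
        by (simp add: power_add)
      then show "sg (\<omega> * \<nu>) = sg \<omega> * sg \<nu>"
        using sg_bideg[OF bideg_mult[OF \<omega> \<nu>]] sg_bideg[OF \<omega>] sg_bideg[OF \<nu>]
        by (simp add: mult_simps scaleC_scaleC mult.commute)
    qed (auto simp: additive_def clinearD[OF sg_linear] distrib_left)
  qed
  show ?thesis
    by (rule additive_ext[of "\<lambda>\<omega>. sg (\<omega> * \<nu>)" "\<lambda>\<omega>. sg \<omega> * sg \<nu>", OF _ _ 1]) (auto simp: additive_def clinearD[OF sg_linear] distrib_right)
qed

lemma sg_p: "p i (sg \<omega>) = sg (p i \<omega>)"
proof (cases i)
  case (Pair a b)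
  have sub: "sg \<nu> \<in> bideg K (c, d)" if "\<nu> \<in> bideg K (c, d)" for \<nu> c d
    using sg_bideg[OF that] that complex_vector.subspace_scale[OF bideg_subspace] by simp
  have "p (a + 0, b + 0) (sg \<omega>) = sg (p (a, b) \<omega>)"
    by (rule p_shift(1)) (simp_all add: clinear_additive[OF sg_linear] sub)
  then show ?thesis by (simp add: Pair)
qed

lemma incl_bideg: "incl K m \<in> bideg K (0, 0)"
proof -
  have d: "incl K m \<in> deg K 0" using incl_bij by (auto simp: bij_betw_def)
  then have "component (deg K) 0 (incl K m) = incl K m" using component_base by simp
  moreover have "{(a, b). a + b = (0 :: nat)} = {(0, 0)}" by auto
  ultimately have "incl K m = p (0, 0) (incl K m)" using component_p[of 0 "incl K m"] by simp
  then show ?thesis using p_in by metis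
qed

lemma deg_0: "\<omega> \<in> bideg K (0, 0) \<Longrightarrow> \<exists>m. \<omega> = incl K m"
  using bideg_deg[of \<omega> 0 0] incl_bij by (auto simp: bij_betw_def)

lemma sg_incl: "sg (incl K m) = incl K m"
  using sg_bideg[OF incl_bideg] by (simp add: scaleC_one)

lemma p_incl_mult: "p i (incl K m * \<omega>) = incl K m * p i \<omega>" "p i (\<omega> * incl K m) = p i \<omega> * incl K m"
proof -
  obtain a b where i: "i = (a, b)" by fastforce
  have "p (a + 0, b + 0) (incl K m * \<omega>) = incl K m * p (a, b) \<omega>"
    by (rule p_shift(1)[of "(*) (incl K m)"]) (use bideg_mult[OF incl_bideg] in \<open>auto simp: additive_def distrib_left\<close>)
  then show "p i (incl K m * \<omega>) = incl K m * p i \<omega>" by (simp add: i)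
  have "p (a + 0, b + 0) (\<omega> * incl K m) = p (a, b) \<omega> * incl K m"
    by (rule p_shift(1)[of "\<lambda>\<omega>. \<omega> * incl K m"])
      (use bideg_mult[OF _ incl_bideg] in \<open>force simp: additive_def distrib_right\<close>)+
  then show "p i (\<omega> * incl K m) = p i \<omega> * incl K m" by (simp add: i)
qed

lemma p_delbar: "p (a, b + 1) (delbar K \<omega>) = delbar K (p (a, b) \<omega>)" "p (a, 0) (delbar K \<omega>) = 0"
  using p_shift[of "delbar K" 0 1] clinear_additive[OF delbar_linear] delbar_bideg by auto

text \<open>The Leibniz rule for \<open>diff\<close> is projected to the bidegree shifted by
  \<open>(s, t)\<close>; as \<open>s\<close> and \<open>t\<close> differ, the terms with
  \<open>D'\<close> lie elsewhere and drop out. It is used with the shifts \<open>(0, 1)\<close> and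
  \<open>(1, 0)\<close>.\<close>

lemma Leibniz_aux:
  assumes D: "clinear D" "clinear D'" "\<And>\<omega>. diff K \<omega> = D \<omega> + D' \<omega>"
    and D1: "\<And>a b \<omega>. \<omega> \<in> bideg K (a, b) \<Longrightarrow> D \<omega> \<in> bideg K (a + s, b + t)"
    and D2: "\<And>a b \<omega>. \<omega> \<in> bideg K (a, b) \<Longrightarrow> D' \<omega> \<in> bideg K (a + t, b + s)"
    and st: "s \<noteq> t"
  shows "D (\<omega> * \<nu>) = D \<omega> * \<nu> + sg \<omega> * D \<nu>"
proof -
  have 2: "D (\<omega> * \<nu>) = D \<omega> * \<nu> + sg \<omega> * D \<nu>"
    if \<omega>: "\<omega> \<in> bideg K (a, b)" and \<nu>: "\<nu> \<in> bideg K (c, d)" for \<omega> \<nu> a b c d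
  proof -
    let ?p = "p (a + c + s, b + d + t)"
    have pl: "?p (x + y) = ?p x + ?p y" for x y by (rule clinearD[OF p_linear])
    have "?p (diff K (\<omega> * \<nu>)) = D (\<omega> * \<nu>)"
      using p_base[OF D1[OF bideg_mult[OF \<omega> \<nu>]]] p_base[OF D2[OF bideg_mult[OF \<omega> \<nu>]]] st
      by (simp add: D(3) pl)
    moreover have "?p (diff K \<omega> * \<nu>) = D \<omega> * \<nu>"
      using p_base[OF bideg_mult[OF D1[OF \<omega>] \<nu>]] p_base[OF bideg_mult[OF D2[OF \<omega>] \<nu>]] st
      by (simp add: D(3) distrib_right pl)
    moreover have "?p (\<omega> * diff K \<nu>) = \<omega> * D \<nu>"
      using p_base[OF bideg_mult[OF \<omega> D1[OF \<nu>]]] p_base[OF bideg_mult[OF \<omega> D2[OF \<nu>]]] st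
      by (simp add: D(3) distrib_left pl)
    ultimately show ?thesis
      using arg_cong[OF diff_mult[OF bideg_deg[OF \<omega>], of \<nu>], of ?p]
      by (simp add: pl clinearD(2)[OF p_linear] sg_bideg[OF \<omega>] mult_simps)
  qed
  have 1: "D (\<omega> * \<nu>) = D \<omega> * \<nu> + sg \<omega> * D \<nu>" if \<omega>: "\<omega> \<in> bideg K (a, b)" for \<omega> a b
  proof -
    show ?thesis
      by (rule additive_ext[of "\<lambda>\<nu>. D (\<omega> * \<nu>)" "\<lambda>\<nu>. D \<omega> * \<nu> + sg \<omega> * D \<nu>", OF _ _ 2[OF \<omega>]]) (auto simp: additive_def clinearD[OF D(1)] distrib_left)
  qed
  show ?thesis
    by (rule additive_ext[of "\<lambda>\<omega>. D (\<omega> * \<nu>)" "\<lambda>\<omega>. D \<omega> * \<nu> + sg \<omega> * D \<nu>", OF _ _ 1]) (auto simp: additive_def clinearD[OF D(1)] clinearD[OF sg_linear] distrib_right)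
qed

lemma delbar_mult: "delbar K (\<omega> * \<nu>) = delbar K \<omega> * \<nu> + sg \<omega> * delbar K \<nu>"
  by (rule Leibniz_aux[of _ "del K" 0 1])
    (use delbar_bideg del_bideg in \<open>simp_all add: delbar_linear del_linear diff_eq\<close>)

lemma del_mult: "del K (\<omega> * \<nu>) = del K \<omega> * \<nu> + sg \<omega> * del K \<nu>"
  by (rule Leibniz_aux[of _ "delbar K" 1 0])
    (use delbar_bideg del_bideg in \<open>simp_all add: delbar_linear del_linear diff_eq\<close>)

lemma fstar_p: "fstar K (p (a, b) \<omega>) = p (b, a) (fstar K \<omega>)"
proof -
  show ?thesis
    by (rule additive_ext[of "\<lambda>\<omega>. fstar K (p (a, b) \<omega>)" "\<lambda>\<omega>. p (b, a) (fstar K \<omega>)"]) (auto simp: additive_def fstar_add clinearD[OF p_linear] p_base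
        p_base[OF fstar_bideg] additive.zero[OF fstar_additive])
qed

lemma fstar_sg: "fstar K (sg \<omega>) = sg (fstar K \<omega>)"
proof -
  show ?thesis
    by (rule additive_ext[of "\<lambda>\<omega>. fstar K (sg \<omega>)" "\<lambda>\<omega>. sg (fstar K \<omega>)"]) (auto simp: additive_def fstar_add clinearD[OF sg_linear] sg_bideg
        sg_bideg[OF fstar_bideg] fstar_scale add.commute)
qed

text \<open>This is one component of \<open>fstar_diff\<close>: conjugation swaps the two degrees
  and therefore the two parts of \<open>diff\<close>.\<close>

lemma fstar_delbar: "fstar K (delbar K \<omega>) = del K (fstar K \<omega>)"
proof -
  show ?thesis
  proof (rule additive_ext[of "\<lambda>\<omega>. fstar K (delbar K \<omega>)" "\<lambda>\<omega>. del K (fstar K \<omega>)"])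
    fix a b \<omega> assume w: "\<omega> \<in> bideg K (a, b)"
    have "p (b + 1, a) (fstar K (diff K \<omega>)) = fstar K (delbar K \<omega>)"
      using p_base[OF fstar_bideg[OF del_bideg[OF w]]] p_base[OF fstar_bideg[OF delbar_bideg[OF w]]]
      by (simp add: diff_eq fstar_add clinearD[OF p_linear])
    moreover have "p (b + 1, a) (diff K (fstar K \<omega>)) = del K (fstar K \<omega>)"
      using p_base[OF del_bideg[OF fstar_bideg[OF w]]] p_base[OF delbar_bideg[OF fstar_bideg[OF w]]]
      by (simp add: diff_eq clinearD[OF p_linear])
    ultimately show "fstar K (delbar K \<omega>) = del K (fstar K \<omega>)" by (simp add: fstar_diff)
  qed (auto simp: additive_def fstar_add clinearD[OF del_linear] clinearD[OF delbar_linear])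
qed

lemma fstar_del: "fstar K (del K \<omega>) = delbar K (fstar K \<omega>)"
  using fstar_delbar[of "fstar K \<omega>"] by (metis fstar_fstar)

subsection \<open>The coaction on forms\<close>

lemma coact_linear: "clinear (coact K)"
  using coact_comodule by (simp add: comodule_algebra_def comodule_def)

lemma coact_mult:
  assumes "balanced g"
  shows "tsum (coact K (\<omega> * \<nu>)) g = tsum (coact K \<omega>) (\<lambda>a x. tsum (coact K \<nu>) (\<lambda>b y. g (a * b) (x * y)))"
proof -
  have "coact K (\<omega> * \<nu>) = tensor_mult (*) (coact K \<omega>) (coact K \<nu>)"
    using coact_comodule by (simp add: comodule_algebra_def)
  then show ?thesis by (simp add: tsum_tensor_mult[OF _ _ _ _ assms] mult_simps)
qed

text \<open>The action of the functional \<open>\<phi>\<close> through the coaction. A linear map of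
  forms is a comodule map once it commutes with every \<open>act \<phi>\<close>.\<close>

definition act where "act \<phi> \<omega> = slice \<phi> (coact K \<omega>)"

context
  fixes \<phi> :: "'a \<Rightarrow> complex" assumes \<phi>: "clinear \<phi>"
begin

lemma act_linear: "clinear (act \<phi>)"
  by (rule clinearI) (simp_all add: act_def clinearD[OF coact_linear] clinearD[OF slice_linear[OF \<phi>]])

lemma act_bideg: "\<omega> \<in> bideg K i \<Longrightarrow> act \<phi> \<omega> \<in> bideg K i"
  using coact_bideg[of i] \<phi>
  by (auto simp: subcomodule_def subtensor_iff_slices[OF bideg_subspace] act_def)

text \<open>\<open>kform\<close> is coinvariant, so its coaction contributes only the factor 1 in
  the Hopf algebra, and multiplication by it passes through the slice.\<close>

lemma act_L: "act \<phi> (L \<omega>) = L (act \<phi> \<omega>)"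
proof -
  have b: "balanced (\<lambda>a x. \<phi> a *\<^sub>C (x :: 'o))" by (rule balanced_slice[OF \<phi>])
  have "act \<phi> (L \<omega>) = tsum (coact K \<kappa>) (\<lambda>a x. tsum (coact K \<omega>) (\<lambda>b y. \<phi> (a * b) *\<^sub>C (x * y)))"
    unfolding act_def slice_def lefschetz_def by (rule coact_mult[OF b])
  also have "\<dots> = tsum (coact K \<omega>) (\<lambda>b y. \<phi> b *\<^sub>C (\<kappa> * y))"
  proof -
    have "balanced (\<lambda>a x. tsum (coact K \<omega>) (\<lambda>b y. \<phi> (a * b) *\<^sub>C (x * y)))"
      by (rule balancedI) (simp_all add: mult_simps clinearD[OF \<phi>] scaleC_add_left scaleC_add_right
          tsum_distrib scaleC_scaleC scaleC_complex_def mult.commute)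
    then show ?thesis by (simp add: kform_coact tsum_pure)
  qed
  also have "\<dots> = \<kappa> * tsum (coact K \<omega>) (\<lambda>b y. \<phi> b *\<^sub>C y)"
    by (subst additive_tsum) (simp_all add: additive_def mult_simps)
  finally show ?thesis by (simp add: act_def slice_def lefschetz_def)
qed

lemma act_delbar: "act \<phi> (delbar K \<omega>) = delbar K (act \<phi> \<omega>)"
proof -
  show ?thesis
  proof (rule additive_ext[of "\<lambda>\<omega>. act \<phi> (delbar K \<omega>)" "\<lambda>\<omega>. delbar K (act \<phi> \<omega>)"])
    fix a b \<omega> assume w: "\<omega> \<in> bideg K (a, b)"
    have "act \<phi> (diff K \<omega>) = diff K (act \<phi> \<omega>)"
      by (simp add: act_def coact_diff slice_tensor_map_id[OF \<phi> diff_linear])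
    then have "p (a, b + 1) (act \<phi> (delbar K \<omega>) + act \<phi> (del K \<omega>)) =
        p (a, b + 1) (delbar K (act \<phi> \<omega>) + del K (act \<phi> \<omega>))"
      by (simp add: diff_eq clinearD[OF act_linear] add.commute)
    then show "act \<phi> (delbar K \<omega>) = delbar K (act \<phi> \<omega>)"
      using p_base[OF act_bideg[OF delbar_bideg[OF w]]] p_base[OF act_bideg[OF del_bideg[OF w]]]
        p_base[OF delbar_bideg[OF act_bideg[OF w]]] p_base[OF del_bideg[OF act_bideg[OF w]]]
      by (simp add: clinearD[OF p_linear])
  qed (auto simp: additive_def clinearD[OF act_linear] clinearD[OF delbar_linear])
qed

lemma act_p: "act \<phi> (p i \<omega>) = p i (act \<phi> \<omega>)"
proof (cases i)
  case (Pair a b)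
  have "p (a + 0, b + 0) (act \<phi> \<omega>) = act \<phi> (p (a, b) \<omega>)"
    by (rule p_shift(1)) (simp_all add: clinear_additive[OF act_linear] act_bideg)
  then show ?thesis by (simp add: Pair)
qed

lemma act_sg: "act \<phi> (sg \<omega>) = sg (act \<phi> \<omega>)"
  by (simp add: sg_def clinear_sum[OF act_linear] clinearD[OF act_linear] act_p)

end

lemma coact_commute:
  assumes "clinear X" "\<And>\<phi> \<omega>. clinear \<phi> \<Longrightarrow> act \<phi> (X \<omega>) = X (act \<phi> \<omega>)"
  shows "coact K (X \<omega>) = tensor_map id X (coact K \<omega>)"
  by (rule slice_eqI) (simp add: slice_tensor_map_id assms(1) assms(2)[unfolded act_def])

lemma coact_delbar: "coact K (delbar K \<omega>) = tensor_map id (delbar K) (coact K \<omega>)"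
  by (rule coact_commute[OF delbar_linear act_delbar])

lemma coact_p: "coact K (p i \<omega>) = tensor_map id (p i) (coact K \<omega>)"
  by (rule coact_commute[OF p_linear act_p])

lemma coact_sg: "coact K (sg \<omega>) = tensor_map id sg (coact K \<omega>)"
  by (rule coact_commute[OF sg_linear act_sg])

end

section \<open>The Lefschetz decomposition and the Hodge map\<close>

context kaehler_forms
begin

lemma L_linear: "clinear L"
  by (rule clinearI) (simp_all add: lefschetz_def mult_simps)

lemma L_pow_linear: "clinear (L ^^ j)"
  by (induction j) (auto intro!: clinearI simp: clinearD[OF L_linear] clinear_iff)

lemmas L_pow_zero [simp] = clinear_zero[OF L_pow_linear]
lemmas L_zero [simp] = clinear_zero[OF L_linear]

lemma L_pow_L_pow: "(L ^^ i) ((L ^^ j) \<omega>) = (L ^^ (i + j)) \<omega>"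
  by (simp add: funpow_add)

lemma L_pow_bideg: "\<omega> \<in> bideg K (a, b) \<Longrightarrow> (L ^^ j) \<omega> \<in> bideg K (a + j, b + j)"
proof (induction j)
  case (Suc j)
  show ?case using bideg_mult[OF kform_bideg Suc(1)[OF Suc(2)]] by (simp add: lefschetz_def)
qed simp

lemma L_pow_deg: "\<omega> \<in> deg K k \<Longrightarrow> (L ^^ j) \<omega> \<in> deg K (k + 2 * j)"
proof (induction j)
  case (Suc j)
  have "\<kappa> \<in> deg K 2" using bideg_deg[OF kform_bideg] by (simp add: numeral_eq_Suc)
  from deg_mult[OF this Suc(1)[OF Suc(2)]] show ?case by (simp add: lefschetz_def add.commute)
qed simp

lemma L_pow_p: "p (a + j, b + j) ((L ^^ j) \<omega>) = (L ^^ j) (p (a, b) \<omega>)"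
  by (rule p_shift(1)[OF clinear_additive[OF L_pow_linear]]) (rule L_pow_bideg)

lemma L_pow_injective: "\<omega> \<in> deg K k \<Longrightarrow> k \<le> n \<Longrightarrow> (L ^^ (n - k)) \<omega> = 0 \<Longrightarrow> \<omega> = 0"
proof (cases "k = n")
  case False
  assume \<omega>: "\<omega> \<in> deg K k" "k \<le> n" "(L ^^ (n - k)) \<omega> = 0"
  then have "inj_on (L ^^ (n - k)) (deg K k)" using lefschetz_bij[of k] False by (simp add: bij_betw_def)
  from inj_onD[OF this, of \<omega> 0] \<omega> show ?thesis
    by (simp add: complex_vector.subspace_0[OF deg_subspace])
qed simp

lemma L_pow_surjective: "\<omega> \<in> deg K (2 * n - k) \<Longrightarrow> k < n \<Longrightarrow> \<exists>\<eta>\<in>deg K k. \<omega> = (L ^^ (n - k)) \<eta>"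
  using lefschetz_bij[of k] by (auto simp: bij_betw_def)

definition Prim where "Prim a b = primitive K (a + b) \<inter> bideg K (a, b)"

lemma Prim_iff: "a + b \<le> n \<Longrightarrow> \<alpha> \<in> Prim a b \<longleftrightarrow> \<alpha> \<in> bideg K (a, b) \<and> (L ^^ (n - (a + b) + 1)) \<alpha> = 0"
  using bideg_deg by (auto simp: Prim_def primitive_def)

lemma Prim_subspace: "a + b \<le> n \<Longrightarrow> csubspace (Prim a b)"
proof (rule complex_vector.subspaceI)
  assume ab: "a + b \<le> n"
  show "0 \<in> Prim a b" using ab complex_vector.subspace_0[OF bideg_subspace] L_pow_zero Prim_iff by blast
  show "x + y \<in> Prim a b" if "x \<in> Prim a b" "y \<in> Prim a b" for x y
    using that unfolding Prim_iff[OF ab] clinearD[OF L_pow_linear]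
    by (simp add: complex_vector.subspace_add[OF bideg_subspace])
  show "c *\<^sub>C x \<in> Prim a b" if "x \<in> Prim a b" for c x
    using that unfolding Prim_iff[OF ab] clinearD[OF L_pow_linear]
    by (simp add: complex_vector.subspace_scale[OF bideg_subspace] complex_vector.scale_zero_right)
qed

lemma Prim_kernel: "\<alpha> \<in> Prim a b \<Longrightarrow> a + b \<le> n \<Longrightarrow> n - (a + b) < m \<Longrightarrow> (L ^^ m) \<alpha> = 0"
proof -
  assume "\<alpha> \<in> Prim a b" "a + b \<le> n" "n - (a + b) < m"
  then have "m = (m - (n - (a + b) + 1)) + (n - (a + b) + 1)" "(L ^^ (n - (a + b) + 1)) \<alpha> = 0"
    using Prim_iff by auto
  then show "(L ^^ m) \<alpha> = 0" by (metis L_pow_L_pow L_pow_zero)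
qed

text \<open>Indices of the summands \<open>L ^^ j\<close> of \<open>Prim a b\<close>. The bound is
  \<open>j \<le> n - (a + b)\<close>, beyond which the power kills primitive forms.\<close>

definition Idx :: "(nat \<times> nat \<times> nat) set" where "Idx = {(a, b, j). a + b + j \<le> n}"

definition Gen where "Gen = {(L ^^ j) \<alpha> | \<alpha> a b j. \<alpha> \<in> Prim a b \<and> a + b + j \<le> n}"

lemma finite_Idx: "finite Idx"
  by (rule finite_subset[of _ "{..n} \<times> {..n} \<times> {..n}"]) (auto simp: Idx_def)

lemma L_span_Gen: "\<omega> \<in> cspan Gen \<Longrightarrow> (L ^^ m) \<omega> \<in> cspan Gen"
proof (induction rule: complex_vector.span_induct_alt)
  case base
  then show ?case by (simp add: complex_vector.span_zero)
next
  case (step c x y)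
  then obtain \<alpha> a b j where x: "x = (L ^^ j) \<alpha>" "\<alpha> \<in> Prim a b" "a + b + j \<le> n" by (auto simp: Gen_def)
  have "(L ^^ m) x \<in> cspan Gen"
  proof (cases "a + b + (m + j) \<le> n")
    case True
    then show ?thesis using x L_pow_L_pow unfolding Gen_def by (intro complex_vector.span_base) blast
  next
    case False
    then have "(L ^^ (m + j)) \<alpha> = 0" using x(3) by (intro Prim_kernel[OF x(2)]) auto
    then show ?thesis by (simp add: x L_pow_L_pow complex_vector.span_zero)
  qed
  then show ?case using step
    by (simp add: clinearD[OF L_pow_linear] complex_vector.span_add complex_vector.span_scale)
qed

text \<open>\<open>L\<close> shifts bidegrees by \<open>(1, 1)\<close>, so the bidegree components
  of a primitive form are again primitive.\<close>

lemma primitive_span: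
  assumes "k \<le> n" "\<alpha> \<in> deg K k" "(L ^^ (n - k + 1)) \<alpha> = 0"
  shows "\<alpha> \<in> cspan Gen"
proof -
  have "p i \<alpha> \<in> cspan Gen" for i
  proof (cases "fst i + snd i = k")
    case True
    obtain a b where i: "i = (a, b)" by fastforce
    have "(L ^^ (n - k + 1)) (p (a, b) \<alpha>) = 0"
      unfolding L_pow_p[symmetric] assms(3) by simp
    then have "(L ^^ 0) (p (a, b) \<alpha>) \<in> Gen"
      unfolding Gen_def using True assms(1) p_in[of "(a, b)" \<alpha>] Prim_iff[of a b] i
      by (intro CollectI exI[of _ "p (a, b) \<alpha>"] exI[of _ a] exI[of _ b] exI[of _ 0]) simp
    then show ?thesis by (simp add: i complex_vector.span_base)
  next
    case False
    then show ?thesis using p_deg[OF assms(2)] by (simp add: complex_vector.span_zero)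
  qed
  then have "(\<Sum>i\<in>J. p i \<alpha>) \<in> cspan Gen" by (intro complex_vector.span_sum)
  then show ?thesis by (simp add: p_sum)
qed

text \<open>Descent by two degrees. \<open>L ^^ (n - k + 1)\<close> sends degree \<open>k\<close> to
  degree \<open>2 * n - (k - 2)\<close>, which \<open>L ^^ (n - (k - 2))\<close> reaches
  isomorphically from degree \<open>k - 2\<close>. Hence \<open>\<omega> - L \<eta>\<close> is
  primitive for some \<open>\<eta>\<close> of degree \<open>k - 2\<close>.\<close>

lemma lefschetz_span_low: "k \<le> n \<Longrightarrow> \<omega> \<in> deg K k \<Longrightarrow> \<omega> \<in> cspan Gen"
proof (induction k arbitrary: \<omega> rule: less_induct)
  case (less k)
  have top: "(L ^^ (n - k + 1)) \<omega> \<in> deg K (k + 2 * (n - k + 1))" by (rule L_pow_deg[OF less(3)])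
  show ?case
  proof (cases "k < 2")
    case True
    \<comment> \<open>The power lands above the top degree \<open>2 * n\<close>, so
      \<open>\<omega>\<close> is itself primitive.\<close>
    have "deg K (k + 2 * (n - k + 1)) = {0}" using less(2) True by (intro deg_top) auto
    then show ?thesis using top less by (intro primitive_span[of k]) auto
  next
    case False
    have e: "k + 2 * (n - k + 1) = 2 * n - (k - 2)" "n - (k - 2) = n - k + 2" using False less(2) by auto
    obtain \<eta> where \<eta>: "\<eta> \<in> deg K (k - 2)" "(L ^^ (n - k + 1)) \<omega> = (L ^^ (n - k + 2)) \<eta>"
      using L_pow_surjective[OF top[unfolded e(1)]] False less(2) unfolding e(2) by force
    have "L \<eta> \<in> deg K (k - 2 + 2 * 1)" using L_pow_deg[OF \<eta>(1), of 1] by simp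
    moreover have "k - 2 + 2 * 1 = k" using False by simp
    ultimately have d: "\<omega> - L \<eta> \<in> deg K k" using less(3) complex_vector.subspace_diff[OF deg_subspace] by metis
    have "(L ^^ (n - k + 1)) (L \<eta>) = (L ^^ (n - k + 2)) \<eta>" using L_pow_L_pow[of "n - k + 1" 1 \<eta>] by simp
    then have "(L ^^ (n - k + 1)) (\<omega> - L \<eta>) = 0"
      by (simp only: clinear_diff[OF L_pow_linear] \<eta>(2) diff_self)
    then have 1: "\<omega> - L \<eta> \<in> cspan Gen" using primitive_span[OF less(2) d] by blast
    have "\<eta> \<in> cspan Gen" using less(1)[of "k - 2"] \<eta>(1) False less(2) by simp
    then have "L \<eta> \<in> cspan Gen" using L_span_Gen[of \<eta> 1] by simp
    with 1 have "(\<omega> - L \<eta>) + L \<eta> \<in> cspan Gen" by (rule complex_vector.span_add)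
    then show ?thesis by simp
  qed
qed

text \<open>Above the middle degree every form is a power of \<open>L\<close> applied to a form
  below it, and powers of \<open>L\<close> preserve the span.\<close>

lemma lefschetz_span: "cspan Gen = UNIV"
proof -
  have "\<omega> \<in> cspan Gen" if \<omega>: "\<omega> \<in> deg K k" for \<omega> k
  proof (cases "k \<le> n")
    case True
    then show ?thesis using lefschetz_span_low \<omega> by blast
  next
    case False
    show ?thesis
    proof (cases "k > 2 * n")
      case True
      then show ?thesis using \<omega> deg_top by (simp add: complex_vector.span_zero)
    next
      assume "\<not> k > 2 * n"
      then obtain \<eta> where "\<eta> \<in> deg K (2 * n - k)" "\<omega> = (L ^^ (n - (2 * n - k))) \<eta>"
        using L_pow_surjective[of \<omega> "2 * n - k"] \<omega> False by force
      then show ?thesis using lefschetz_span_low[of "2 * n - k"] False L_span_Gen by auto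
    qed
  qed
  then have "p i \<omega> \<in> cspan Gen" for i \<omega> using p_in bideg_deg by (cases i) blast
  then have "(\<Sum>i\<in>J. p i \<omega>) \<in> cspan Gen" for \<omega> by (intro complex_vector.span_sum)
  then show ?thesis by (auto simp: p_sum)
qed

text \<open>A suitable power of \<open>L\<close> kills every term of given bidegree except the one with the largest \<open>j\<close>,
  on which it is injective.\<close>

lemma lefschetz_independent:
  assumes f: "\<And>a b j. (a, b, j) \<in> Idx \<Longrightarrow> f (a, b, j) \<in> Prim a b"
    and 0: "(\<Sum>(a, b, j)\<in>Idx. (L ^^ j) (f (a, b, j))) = 0" and i: "i \<in> Idx"
  shows "f i = 0"
proof (rule ccontr)
  assume nz: "f i \<noteq> 0"
  obtain a0 b0 j0 where i0: "i = (a0, b0, j0)" by (cases i)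
  \<comment> \<open>Only the terms with the bidegree of the term at \<open>i\<close> are kept; among
    them \<open>j\<close> determines \<open>a\<close> and \<open>b\<close>.\<close>
  define x y where "x = a0 + j0" and "y = b0 + j0"
  define S where "S = {(a, b, j) \<in> Idx. a + j = x \<and> b + j = y}"
  define T where "T = {j. \<exists>a b. (a, b, j) \<in> S \<and> f (a, b, j) \<noteq> 0}"
  have fS: "finite S" using finite_Idx by (rule finite_subset[rotated]) (auto simp: S_def)
  have "T \<subseteq> (\<lambda>(a, b, j). j) ` S" by (force simp: T_def)
  then have fT: "finite T" using fS finite_surj by blast
  have "j0 \<in> T" using nz i i0 by (auto simp: T_def S_def x_def y_def)
  then have "Max T \<in> T" using fT by (intro Max_in) auto
  then obtain a b where ab: "(a, b, Max T) \<in> S" "f (a, b, Max T) \<noteq> 0" by (auto simp: T_def)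
  define j where "j = Max T"
  have abj: "a + j = x" "b + j = y" "a + b + j \<le> n" "f (a, b, j) \<in> Prim a b"
    using ab(1) f by (auto simp: S_def Idx_def j_def)
  have "(\<Sum>(a, b, j)\<in>S. (L ^^ j) (f (a, b, j))) = (\<Sum>(a, b, j)\<in>Idx. p (x, y) ((L ^^ j) (f (a, b, j))))"
  proof (rule sum.mono_neutral_cong_left)
    show "finite Idx" "S \<subseteq> Idx" by (auto simp: finite_Idx S_def)
    have p: "p (x, y) ((L ^^ j') (f (a', b', j'))) = (if (x, y) = (a' + j', b' + j') then (L ^^ j') (f (a', b', j')) else 0)"
      if "(a', b', j') \<in> Idx" for a' b' j'
      using f[OF that] by (intro p_base L_pow_bideg) (simp add: Prim_def)
    then show "\<forall>i\<in>Idx - S. (case i of (a, b, j) \<Rightarrow> p (x, y) ((L ^^ j) (f (a, b, j)))) = 0"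
      by (auto simp: S_def split: if_splits)
    show "(case i of (a, b, j) \<Rightarrow> (L ^^ j) (f (a, b, j))) = (case i of (a, b, j) \<Rightarrow> p (x, y) ((L ^^ j) (f (a, b, j))))"
      if "i \<in> S" for i using that p by (auto simp: S_def)
  qed
  also have "\<dots> = p (x, y) (\<Sum>(a, b, j)\<in>Idx. (L ^^ j) (f (a, b, j)))"
    by (simp add: clinear_sum[OF p_linear] case_prod_unfold)
  finally have S0: "(\<Sum>(a, b, j)\<in>S. (L ^^ j) (f (a, b, j))) = 0" by (simp add: 0)
  \<comment> \<open>\<open>m + j = n - (a + b)\<close> is the exponent for which the power of
    \<open>L\<close> is injective on degree \<open>a + b\<close>. A term with \<open>j' < j\<close>
    has \<open>a' + b' = a + b + 2 * (j - j')\<close>, so its power \<open>m + j'\<close> exceeds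
    \<open>n - (a' + b')\<close> and kills it.\<close>
  define m where "m = n - (a + b) - j"
  have "(L ^^ m) (\<Sum>(a, b, j)\<in>S. (L ^^ j) (f (a, b, j))) = (\<Sum>(a, b, j)\<in>S. (L ^^ (m + j)) (f (a, b, j)))"
    by (simp add: clinear_sum[OF L_pow_linear] case_prod_unfold L_pow_L_pow)
  also have "\<dots> = (\<Sum>(a', b', j')\<in>{(a, b, j)}. (L ^^ (m + j')) (f (a', b', j')))"
  proof (rule sum.mono_neutral_right[OF fS])
    show "{(a, b, j)} \<subseteq> S" using ab(1) j_def by simp
    show "\<forall>i\<in>S - {(a, b, j)}. (case i of (a', b', j') \<Rightarrow> (L ^^ (m + j')) (f (a', b', j'))) = 0"
    proof
      fix i assume "i \<in> S - {(a, b, j)}"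
      then obtain a' b' j' where i: "i = (a', b', j')" and s: "(a', b', j') \<in> S" "(a', b', j') \<noteq> (a, b, j)"
        by (cases i) auto
      have eq: "a' + j' = x" "b' + j' = y" "a' + b' + j' \<le> n" "f (a', b', j') \<in> Prim a' b'"
        using s(1) f by (auto simp: S_def Idx_def)
      then have "j' \<noteq> j" using s(2) abj by auto
      have "(L ^^ (m + j')) (f (a', b', j')) = 0"
      proof (cases "f (a', b', j') = 0")
        case False
        then have "j' \<in> T" using s(1) by (auto simp: T_def)
        then have "j' < j" using Max_ge[OF fT] \<open>j' \<noteq> j\<close> by (fastforce simp: j_def)
        then have "n - (a' + b') < m + j'" using eq abj by (simp add: m_def)
        then show ?thesis using eq by (intro Prim_kernel[of _ a' b']) auto
      qed simp
      then show "(case i of (a', b', j') \<Rightarrow> (L ^^ (m + j')) (f (a', b', j'))) = 0" by (simp add: i)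
    qed
  qed
  finally have "(L ^^ (n - (a + b))) (f (a, b, j)) = 0"
    using S0 abj(3) by (simp add: m_def)
  then have "f (a, b, j) = 0"
    
    using L_pow_injective[of "f (a, b, j)" "a + b"] abj(3,4) bideg_deg[of "f (a, b, j)" a b]
    by (simp add: Prim_def)
  then show False using ab(2) j_def by simp
qed

section \<open>The Hodge map\<close>

definition hcoef :: "nat \<Rightarrow> nat \<Rightarrow> nat \<Rightarrow> complex" where
  "hcoef a b j = (-1) ^ ((a + b) * (a + b + 1) div 2) * \<i> powi (int a - int b) * (fact j / fact (n - j - (a + b)))"

lemma gen_ext:
  assumes "additive F" "additive G"
    and "\<And>\<alpha> a b j. \<alpha> \<in> Prim a b \<Longrightarrow> a + b + j \<le> n \<Longrightarrow> F ((L ^^ j) \<alpha>) = G ((L ^^ j) \<alpha>)"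
  shows "F \<omega> = G \<omega>"
proof -
  have "\<omega> \<in> cspan Gen" by (simp add: lefschetz_span)
  then show ?thesis
  proof (induction rule: complex_vector.span_induct_alt)
    case base
    show ?case using assms(1,2) by (simp add: additive.zero)
  next
    case (step c x y)
    then obtain \<alpha> a b j where x: "x = (L ^^ j) \<alpha>" "\<alpha> \<in> Prim a b" "a + b + j \<le> n" by (auto simp: Gen_def)
    then have "c *\<^sub>C x = (L ^^ j) (c *\<^sub>C \<alpha>)" "c *\<^sub>C \<alpha> \<in> Prim a b"
      using complex_vector.subspace_scale[OF Prim_subspace] by (simp_all add: clinearD[OF L_pow_linear])
    then have "F (c *\<^sub>C x) = G (c *\<^sub>C x)" using assms(3) x(3) by metis
    then show ?case using step assms(1,2) by (simp add: additive.add)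
  qed
qed

text \<open>The Lefschetz decomposition has linear coefficient maps \<open>C\<close>, and the
  prescribed values on the summands are assembled from them.\<close>

lemma hodge_exists:
  "\<exists>H. clinear H \<and> (\<forall>\<alpha> a b j. \<alpha> \<in> Prim a b \<longrightarrow> a + b + j \<le> n \<longrightarrow>
    H ((L ^^ j) \<alpha>) = hcoef a b j *\<^sub>C (L ^^ (n - j - (a + b))) \<alpha>)"
proof -
  let ?V = "\<lambda>(a, b, j). Prim a b" and ?T = "\<lambda>(a, b, j). L ^^ j"
  have "Gen = {?T i v | i v. i \<in> Idx \<and> v \<in> ?V i}"
    by (force simp: Gen_def Idx_def)
  then have span: "cspan {?T i v | i v. i \<in> Idx \<and> v \<in> ?V i} = UNIV" using lefschetz_span by simp
  obtain C where C: "\<And>i. i \<in> Idx \<Longrightarrow> clinear (C i)"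
    "\<And>i j v. i \<in> Idx \<Longrightarrow> j \<in> Idx \<Longrightarrow> v \<in> ?V i \<Longrightarrow> C j (?T i v) = (if j = i then v else 0)"
  proof (rule unique_decomposition_linear[OF finite_Idx _ _ span])
    show "csubspace (?V i)" if "i \<in> Idx" for i using that Prim_subspace by (auto simp: Idx_def)
    show "clinear (?T i)" for i using L_pow_linear by (auto split: prod.split)
    show "f i = 0" if "\<And>i. i \<in> Idx \<Longrightarrow> f i \<in> ?V i" "(\<Sum>i\<in>Idx. ?T i (f i)) = 0" "i \<in> Idx" for f i
    proof (rule lefschetz_independent)
      show "f (a, b, j) \<in> Prim a b" if "(a, b, j) \<in> Idx" for a b j using \<open>\<And>i. i \<in> Idx \<Longrightarrow> f i \<in> ?V i\<close>[OF that] by simp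
      show "(\<Sum>(a, b, j)\<in>Idx. (L ^^ j) (f (a, b, j))) = 0" using that(2) by (simp add: case_prod_unfold)
    qed fact
  qed blast
  define H where "H \<omega> = (\<Sum>(a, b, j)\<in>Idx. hcoef a b j *\<^sub>C (L ^^ (n - j - (a + b))) (C (a, b, j) \<omega>))" for \<omega>
  have "clinear H"
    by (rule clinearI; simp add: H_def C(1) clinearD[OF C(1)] clinearD[OF L_pow_linear] case_prod_unfold
        scaleC_add_right sum.distrib complex_vector.scale_sum_right scaleC_scaleC mult.commute)
  moreover have "H ((L ^^ j) \<alpha>) = hcoef a b j *\<^sub>C (L ^^ (n - j - (a + b))) \<alpha>"
    if "\<alpha> \<in> Prim a b" "a + b + j \<le> n" for \<alpha> a b j
  proof -
    have i: "(a, b, j) \<in> Idx" using that by (simp add: Idx_def)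
    have "H ((L ^^ j) \<alpha>) = (\<Sum>i\<in>Idx. if i = (a, b, j) then hcoef a b j *\<^sub>C (L ^^ (n - j - (a + b))) \<alpha> else 0)"
      unfolding H_def
    proof (rule sum.cong[OF refl])
      fix i assume "i \<in> Idx"
      then have "C i ((L ^^ j) \<alpha>) = (if i = (a, b, j) then \<alpha> else 0)" using C(2)[OF i] that by simp
      then show "(case i of (a, b, j') \<Rightarrow> hcoef a b j' *\<^sub>C (L ^^ (n - j' - (a + b))) (C (a, b, j') ((L ^^ j) \<alpha>))) =
          (if i = (a, b, j) then hcoef a b j *\<^sub>C (L ^^ (n - j - (a + b))) \<alpha> else 0)"
        by (auto simp: complex_vector.scale_zero_right split: prod.split)
    qed
    then show ?thesis using i finite_Idx by simp
  qed
  ultimately show ?thesis by blast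
qed

text \<open>The predicate under the description operator is rewritten with \<open>Prim\<close> and
  the single bound \<open>a + b + j \<le> n\<close>; uniqueness is then
  \<open>gen_ext\<close>.\<close>

lemma hodge: "clinear (hodge K)"
  "\<alpha> \<in> Prim a b \<Longrightarrow> a + b + j \<le> n \<Longrightarrow>
    hodge K ((L ^^ j) \<alpha>) = hcoef a b j *\<^sub>C (L ^^ (n - j - (a + b))) \<alpha>"
proof -
  let ?P = "\<lambda>H. clinear H \<and> (\<forall>a b j. \<forall>\<alpha> \<in> primitive K (a + b) \<inter> bideg K (a, b).
      let k = a + b; n = hdim K in k \<le> n \<and> j \<le> n - k \<longrightarrow>
        H ((lefschetz K ^^ j) \<alpha>) =
          ((-1) ^ (k * (k + 1) div 2) * \<i> powi (int a - int b) * (fact j / fact (n - j - k)))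
            *\<^sub>C (lefschetz K ^^ (n - j - k)) \<alpha>)"
  let ?Q = "\<lambda>H. clinear H \<and> (\<forall>\<alpha> a b j. \<alpha> \<in> Prim a b \<longrightarrow> a + b + j \<le> n \<longrightarrow>
    H ((L ^^ j) \<alpha>) = hcoef a b j *\<^sub>C (L ^^ (n - j - (a + b))) \<alpha>)"
  have le: "a + b \<le> n \<and> j \<le> n - (a + b) \<longleftrightarrow> a + b + j \<le> n" for a b j :: nat by auto
  have PQ: "?P H \<longleftrightarrow> ?Q H" for H
    unfolding Let_def le Prim_def hcoef_def by blast
  have "H = H'" if "?Q H" "?Q H'" for H H'
  proof
    fix \<omega> show "H \<omega> = H' \<omega>"
    proof (rule gen_ext[of H H'])
      show "additive H" "additive H'" using that clinear_additive by blast+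
      show "H ((L ^^ j) \<alpha>) = H' ((L ^^ j) \<alpha>)" if "\<alpha> \<in> Prim a b" "a + b + j \<le> n" for \<alpha> a b j
        using that \<open>?Q H\<close> \<open>?Q H'\<close> by presburger
    qed
  qed
  then have ex1: "\<exists>!H. ?Q H" using hodge_exists by blast
  have "hodge K = (THE H. ?Q H)" unfolding hodge_def PQ ..
  with theI'[OF ex1] have "?Q (hodge K)" by simp
  then show "clinear (hodge K)" "\<alpha> \<in> Prim a b \<Longrightarrow> a + b + j \<le> n \<Longrightarrow>
    hodge K ((L ^^ j) \<alpha>) = hcoef a b j *\<^sub>C (L ^^ (n - j - (a + b))) \<alpha>" by blast+
qed

text \<open>Replacing \<open>j\<close> by \<open>n - j - (a + b)\<close> exchanges the two
  factorials, and the quadratic sign squares to 1. What remains is \<open>\<i>\<close> to the power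
  \<open>2 * (a - b)\<close>, a sign depending on the parity of \<open>a + b\<close>.\<close>

lemma hcoef_hcoef:
  assumes "a + b + j \<le> n"
  shows "hcoef a b j * hcoef a b (n - j - (a + b)) = (-1) ^ (a + b)"
proof -
  let ?s = "(-1) ^ ((a + b) * (a + b + 1) div 2) :: complex" and ?e = "\<i> powi (int a - int b)"
  have "?s * ?s = 1" by (simp flip: power_mult_distrib)
  moreover have "?e * ?e = (-1) ^ (a + b)"
  proof -
    have "?e * ?e = (-1) powi (int a - int b)" by (simp flip: power_int_mult_distrib)
    also have "\<dots> = (-1) ^ a / (-1) ^ b" by (simp add: power_int_diff)
    also have "\<dots> = (-1) ^ (a + b)" by (simp add: minus_one_power_iff)
    finally show ?thesis .
  qed
  moreover have "n - (n - j - (a + b)) - (a + b) = j" using assms by simp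
  moreover have "hcoef a b j * hcoef a b (n - j - (a + b)) =
    (?s * ?s) * (?e * ?e) * ((fact j / fact (n - j - (a + b))) * (fact (n - j - (a + b)) / fact (n - (n - j - (a + b)) - (a + b))))"
    unfolding hcoef_def by (simp only: mult.assoc mult.left_commute mult.commute)
  ultimately show ?thesis by simp
qed

lemma cnj_hcoef: "cnj (hcoef a b j) = hcoef b a j"
proof -
  have "cnj (\<i> powi (int a - int b)) = (inverse \<i>) powi (int a - int b)" by (simp add: complex_cnj_power_int)
  also have "\<dots> = \<i> powi (int b - int a)"
    by (metis minus_diff_eq power_int_inverse power_int_minus)
  finally show ?thesis by (simp add: hcoef_def add.commute)
qed

lemma hodge_hodge: "hodge K (hodge K \<omega>) = sg \<omega>"
proof -
  show ?thesis
  proof (rule gen_ext[of "\<lambda>\<omega>. hodge K (hodge K \<omega>)" "\<lambda>\<omega>. sg \<omega>"])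
    fix \<alpha> a b j assume a: "\<alpha> \<in> Prim a b" "a + b + j \<le> n"
    have "hodge K (hodge K ((L ^^ j) \<alpha>)) =
        (hcoef a b j * hcoef a b (n - j - (a + b))) *\<^sub>C (L ^^ (n - (n - j - (a + b)) - (a + b))) \<alpha>"
      using hodge(2)[OF a] hodge(2)[OF a(1), of "n - j - (a + b)"] a(2)
      by (simp add: clinearD[OF hodge(1)] scaleC_scaleC)
    also have "\<dots> = ((-1) ^ (a + b) :: complex) *\<^sub>C (L ^^ j) \<alpha>" using hcoef_hcoef[OF a(2)] a(2) by simp
    also have "\<dots> = sg ((L ^^ j) \<alpha>)"
    proof -
      have "(L ^^ j) \<alpha> \<in> bideg K (a + j, b + j)" using a by (intro L_pow_bideg) (simp add: Prim_def)
      moreover have "((-1) ^ (a + j + (b + j)) :: complex) = (-1) ^ (a + b)"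
      proof -
        have "even (a + j + (b + j)) = even (a + b)" by presburger
        then show ?thesis by (simp only: minus_one_power_iff)
      qed
      ultimately show ?thesis using sg_bideg by metis
    qed
    finally show "hodge K (hodge K ((L ^^ j) \<alpha>)) = sg ((L ^^ j) \<alpha>)" .
  qed (simp_all add: additive_def clinearD[OF hodge(1)] clinearD[OF sg_linear])
qed

text \<open>Such an \<open>X\<close> preserves each \<open>Prim a b\<close> and commutes with powers
  of \<open>L\<close>, hence respects the defining formula. It covers multiplication by the base
  algebra and the maps \<open>act \<phi>\<close>.\<close>

lemma hodge_commute:
  assumes X: "clinear X" "\<And>\<omega>. X (L \<omega>) = L (X \<omega>)" "\<And>\<omega> a b. \<omega> \<in> bideg K (a, b) \<Longrightarrow> X \<omega> \<in> bideg K (a, b)"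
  shows "hodge K (X \<omega>) = X (hodge K \<omega>)"
proof (rule gen_ext[of "\<lambda>\<omega>. hodge K (X \<omega>)" "\<lambda>\<omega>. X (hodge K \<omega>)"])
  have XL: "X ((L ^^ j) \<omega>) = (L ^^ j) (X \<omega>)" for j \<omega> by (induction j) (simp_all add: X(2))
  fix \<alpha> a b j assume a: "\<alpha> \<in> Prim a b" "a + b + j \<le> n"
  have "X \<alpha> \<in> Prim a b"
    using a X(3) XL[of _ \<alpha>] clinear_zero[OF X(1)] Prim_iff[of a b]
    by (metis add_leD1)
  then show "hodge K (X ((L ^^ j) \<alpha>)) = X (hodge K ((L ^^ j) \<alpha>))"
    using hodge(2) a by (simp add: XL clinearD[OF X(1)])
qed (simp_all add: additive_def clinearD[OF hodge(1)] clinearD[OF X(1)])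

lemma hodge_incl: "hodge K (incl K m * \<omega>) = incl K m * hodge K \<omega>" "hodge K (\<omega> * incl K m) = hodge K \<omega> * incl K m"
proof -
  show "hodge K (incl K m * \<omega>) = incl K m * hodge K \<omega>"
  proof (rule hodge_commute[of "(*) (incl K m)"])
    show "incl K m * L \<omega> = L (incl K m * \<omega>)" for \<omega>
      unfolding lefschetz_def by (metis kform_central mult.assoc)
    show "\<omega> \<in> bideg K (a, b) \<Longrightarrow> incl K m * \<omega> \<in> bideg K (a, b)" for \<omega> a b
      using bideg_mult[OF incl_bideg] by force
  qed (auto intro!: clinearI simp: mult_simps)
  show "hodge K (\<omega> * incl K m) = hodge K \<omega> * incl K m"
  proof (rule hodge_commute[of "\<lambda>\<omega>. \<omega> * incl K m"])
    show "\<omega> \<in> bideg K (a, b) \<Longrightarrow> \<omega> * incl K m \<in> bideg K (a, b)" for \<omega> a b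
      using bideg_mult[OF _ incl_bideg] by force
  qed (auto intro!: clinearI simp: mult_simps lefschetz_def mult.assoc)
qed

lemma hodge_act: "clinear \<phi> \<Longrightarrow> hodge K (act \<phi> \<omega>) = act \<phi> (hodge K \<omega>)"
  by (rule hodge_commute) (simp_all add: act_linear act_L act_bideg)

text \<open>\<open>kform\<close> is real, central and of even degree, so reversing the product
  changes neither the sign nor the result.\<close>

lemma L_fstar: "fstar K (L \<omega>) = L (fstar K \<omega>)"
proof -
  show ?thesis
  proof (rule additive_ext[of "\<lambda>\<omega>. fstar K (L \<omega>)" "\<lambda>\<omega>. L (fstar K \<omega>)"])
    fix a b \<omega> assume "\<omega> \<in> bideg K (a, b)"
    from fstar_mult[OF bideg_deg[OF kform_bideg] bideg_deg[OF this]]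
    show "fstar K (L \<omega>) = L (fstar K \<omega>)"
      by (simp add: lefschetz_def kform_star kform_central scaleC_one)
  qed (simp_all add: additive_def fstar_add clinearD[OF L_linear])
qed

lemma fstar_zero [simp]: "fstar K 0 = 0"
  by (rule additive.zero[OF fstar_additive])

text \<open>Conjugation swaps the bidegree of a primitive form, and conjugating the coefficient
  turns the exponent \<open>a - b\<close> of \<open>\<i>\<close> into \<open>b - a\<close>
  accordingly.\<close>

lemma hodge_fstar: "hodge K (fstar K \<omega>) = fstar K (hodge K \<omega>)"
proof (rule gen_ext[of "\<lambda>\<omega>. hodge K (fstar K \<omega>)" "\<lambda>\<omega>. fstar K (hodge K \<omega>)"])
  have XL: "fstar K ((L ^^ j) \<omega>) = (L ^^ j) (fstar K \<omega>)" for j \<omega> by (induction j) (simp_all add: L_fstar)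
  fix \<alpha> a b j assume a: "\<alpha> \<in> Prim a b" "a + b + j \<le> n"
  have "fstar K \<alpha> \<in> bideg K (b, a)" "(L ^^ (n - (b + a) + 1)) (fstar K \<alpha>) = 0"
    using a fstar_bideg Prim_iff[of a b \<alpha>] XL[of "n - (b + a) + 1" \<alpha>]
    by (simp_all add: add.commute flip: XL)
  then have "fstar K \<alpha> \<in> Prim b a" using a Prim_iff[of b a] by simp
  from hodge(2)[OF this, of j] hodge(2)[OF a] a(2)
  show "hodge K (fstar K ((L ^^ j) \<alpha>)) = fstar K (hodge K ((L ^^ j) \<alpha>))"
    by (simp add: XL fstar_scale cnj_hcoef add.commute)
qed (simp_all add: additive_def clinearD[OF hodge(1)] fstar_add)

text \<open>\<open>L ^^ j\<close> of a primitive form in \<open>(a, b)\<close> has bidegree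
  \<open>(a + j, b + j)\<close>, and its image, with exponent \<open>n - j - (a + b)\<close>, has
  bidegree \<open>(n - b - j, n - a - j)\<close>.\<close>

lemma hodge_bideg:
  assumes "\<omega> \<in> bideg K (x, y)" shows "hodge K \<omega> \<in> bideg K (n - y, n - x)"
proof -
  have "(\<lambda>\<omega>. p (n - y, n - x) (hodge K (p (x, y) \<omega>))) \<omega> = (\<lambda>\<omega>. hodge K (p (x, y) \<omega>)) \<omega>"
  proof (rule gen_ext[of "\<lambda>\<omega>. p (n - y, n - x) (hodge K (p (x, y) \<omega>))" "\<lambda>\<omega>. hodge K (p (x, y) \<omega>)"])
    fix \<alpha> a b j assume a: "\<alpha> \<in> Prim a b" "a + b + j \<le> n"
    have b: "(L ^^ i) \<alpha> \<in> bideg K (a + i, b + i)" for i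
      using a by (intro L_pow_bideg) (simp add: Prim_def)
    show "p (n - y, n - x) (hodge K (p (x, y) ((L ^^ j) \<alpha>))) = hodge K (p (x, y) ((L ^^ j) \<alpha>))"
    proof (cases "(x, y) = (a + j, b + j)")
      case True
      then have "n - y = a + (n - j - (a + b))" "n - x = b + (n - j - (a + b))" using a(2) by auto
      then have "p (n - y, n - x) ((L ^^ (n - j - (a + b))) \<alpha>) = (L ^^ (n - j - (a + b))) \<alpha>"
        using p_base[OF b[of "n - j - (a + b)"]] by simp
      then show ?thesis using True p_base[OF b[of j]] hodge(2)[OF a] by (simp add: clinearD[OF p_linear])
    next
      case False
      then have "p (x, y) ((L ^^ j) \<alpha>) = 0" using p_base[OF b[of j], of "(x, y)"] by auto
      then show ?thesis by (simp add: clinear_zero[OF hodge(1)])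
    qed
  qed (simp_all add: additive_def clinearD[OF hodge(1)] clinearD[OF p_linear])
  then have "hodge K \<omega> = p (n - y, n - x) (hodge K \<omega>)" using p_base[OF assms, of "(x, y)"] by simp
  then show ?thesis using p_in by metis
qed

text \<open>The top degree is \<open>L ^^ n\<close> of the base algebra, which has bidegree
  \<open>(0, 0)\<close>. For \<open>n = 0\<close> no Lefschetz isomorphism is available, but then
  the top degree is the base algebra itself.\<close>

lemma deg_top_bideg: "\<omega> \<in> deg K (2 * n) \<Longrightarrow> \<omega> \<in> bideg K (n, n)"
proof (cases "n = 0")
  case True
  assume "\<omega> \<in> deg K (2 * n)"
  then obtain m where "\<omega> = incl K m" using incl_bij True by (auto simp: bij_betw_def)
  then show ?thesis using incl_bideg True by simp
next
  case False
  assume "\<omega> \<in> deg K (2 * n)"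
  then obtain \<eta> where "\<eta> \<in> deg K 0" "\<omega> = (L ^^ n) \<eta>" using L_pow_surjective[of \<omega> 0] False by auto
  moreover from this obtain m where "\<eta> = incl K m" using incl_bij by (auto simp: bij_betw_def)
  ultimately show ?thesis using L_pow_bideg[OF incl_bideg[of m], of n] by simp
qed

lemma component_top: "component (deg K) (2 * n) \<omega> = p (n, n) \<omega>"
proof -
  have "p i \<omega> = 0" if "fst i + snd i = 2 * n" "i \<noteq> (n, n)" for i
  proof -
    have "p i \<omega> \<in> bideg K (n, n)"
      using p_in[of i \<omega>] bideg_deg deg_top_bideg that(1) by (metis prod.collapse)
    from p_base[OF this, of i] that(2) show ?thesis by (simp add: p_p)
  qed
  moreover have "finite {(a, b). a + b = 2 * n}" by (rule finite_subset[of _ "{..2 * n} \<times> {..2 * n}"]) auto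
  ultimately have "(\<Sum>i\<in>{(a, b). a + b = 2 * n}. p i \<omega>) = (\<Sum>i\<in>{(n, n)}. p i \<omega>)"
    by (intro sum.mono_neutral_right) (fastforce+)
  then show ?thesis by (simp add: component_p)
qed

lemma incl_vol: "incl K (vol K \<omega>) = hodge K (p (n, n) \<omega>)"
proof -
  have "hodge K (p (n, n) \<omega>) \<in> bideg K (n - n, n - n)" by (rule hodge_bideg[OF p_in])
  then obtain m where m: "hodge K (p (n, n) \<omega>) = incl K m" using deg_0 by auto
  have "inj (incl K)" using incl_bij by (simp add: bij_betw_def)
  then show ?thesis by (simp add: vol_def component_top m)
qed

lemma incl_inj: "incl K m = incl K m' \<Longrightarrow> m = m'"
  using incl_bij by (auto simp: bij_betw_def inj_def)

lemma vol_linear: "clinear (vol K)"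
  by (rule clinearI; rule incl_inj)
    (simp_all add: incl_vol clinearD[OF incl_linear] clinearD[OF p_linear] clinearD[OF hodge(1)])

lemma vol_fstar: "vol K (fstar K \<omega>) = star (vol K \<omega>)"
  by (rule incl_inj) (simp add: incl_vol hodge_fstar flip: fstar_incl fstar_p)

lemma vol_p: "vol K (p i \<omega>) = (if i = (n, n) then vol K \<omega> else 0)"
  by (rule incl_inj) (simp add: incl_vol p_p clinear_zero[OF hodge(1)]
      clinear_zero[OF incl_linear])

lemma vol_sg: "vol K (sg \<omega>) = vol K \<omega>"
proof -
  have "sg (p (n, n) \<omega>) = p (n, n) \<omega>" using sg_bideg[OF p_in] by (simp add: scaleC_one flip: mult_2)
  then show ?thesis by (intro incl_inj) (simp add: incl_vol sg_p)
qed

lemma coact_hodge_fstar: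
  "coact K (hodge K (fstar K \<omega>)) = tensor_map star (\<lambda>\<omega>. hodge K (fstar K \<omega>)) (coact K \<omega>)"
proof -
  have b: "balanced (\<lambda>(a :: 'a) \<omega>. star a \<otimes> fstar K \<omega>)"
    by (rule balanced_conj_linear) (simp_all add: additive_def star_add star_scaleC fstar_add fstar_scale)
  have b': "balanced (\<lambda>(a :: 'a) \<omega>. star a \<otimes> hodge K (fstar K \<omega>))"
    by (rule balanced_conj_linear)
      (simp_all add: additive_def star_add star_scaleC fstar_add fstar_scale clinearD[OF hodge(1)])
  have bh: "balanced (\<lambda>(a :: 'a) \<omega>. id a \<otimes> hodge K \<omega>)" by (rule balanced_linear[OF clinear_id(1) hodge(1)])
  have "coact K (hodge K (fstar K \<omega>)) = tensor_map id (hodge K) (coact K (fstar K \<omega>))"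
    by (rule coact_commute[OF hodge(1)]) (simp add: hodge_act)
  also have "\<dots> = tsum (tensor_map star (fstar K) (coact K \<omega>)) (\<lambda>a \<omega>. id a \<otimes> hodge K \<omega>)"
    by (simp only: tensor_map_tsum[OF bh] coact_fstar)
  also have "\<dots> = tensor_map star (\<lambda>\<omega>. hodge K (fstar K \<omega>)) (coact K \<omega>)"
    unfolding tsum_tensor_map[OF b bh] tensor_map_tsum[OF b'] by simp
  finally show ?thesis .
qed

end

section \<open>The integral\<close>

text \<open>Polarisation: reality at \<open>x + y\<close> makes the imaginary parts opposite, and
  reality at \<open>x + \<i> *\<^sub>C y\<close> makes the real parts equal.\<close>

lemma sesquilinear_hermitian:
  fixes f :: "'v::complex_vector \<Rightarrow> 'v \<Rightarrow> complex"
  assumes add: "\<And>x y z. f (x + y) z = f x z + f y z" "\<And>x y z. f x (y + z) = f x y + f x z"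
    and scale: "\<And>c x y. f (c *\<^sub>C x) y = c * f x y" "\<And>c x y. f x (c *\<^sub>C y) = cnj c * f x y"
    and real: "\<And>x. f x x \<in> \<real>"
  shows "f x y = cnj (f y x)"
proof -
  have im: "Im (f z z) = 0" for z using real complex_is_Real_iff by blast
  have "Im (f x y) + Im (f y x) = 0"
    using im[of "x + y"] im[of x] im[of y] by (simp add: add)
  moreover have "Re (f y x) = Re (f x y)"
    using im[of "x + \<i> *\<^sub>C y"] im[of x] im[of y] by (simp add: add scale)
  ultimately show ?thesis by (simp add: complex_eq_iff)
qed

locale kaehler_state = kaehler_forms A K
  for A :: "('a::complex_star_algebra) hopf"
    and K :: "('a, 'm::complex_star_algebra, 'o::complex_algebra_1) kaehler" +
  fixes \<tau> :: "'m \<Rightarrow> complex"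
  assumes pos: "positive_definite_kaehler K" and state: "state \<tau>" and closed: "closed_integral K \<tau>"
begin

lemma tau_linear: "clinear \<tau>" and tau_positive: "m \<in> positives \<Longrightarrow> \<tau> m \<in> \<real> \<and> 0 < Re (\<tau> m)"
  using state by (simp_all add: state_def)

lemma star_one: "star (1 :: 'm) = 1"
  by (metis mult_1 mult_1_right star_mult star_star)

text \<open>The form sending \<open>x\<close>, \<open>y\<close> to
  \<open>\<tau> (x * star y)\<close> is real on the diagonal, so polarisation makes it Hermitian;
  the claim is the case \<open>x = m\<close>, \<open>y = 1\<close>.\<close>

lemma tau_star: "\<tau> (star m) = cnj (\<tau> m)"
proof -
  have "\<tau> (x * star x) \<in> \<real>" for x
  proof (cases "x * star x = 0")
    case True
    then show ?thesis by (simp add: clinear_zero[OF tau_linear])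
  next
    case False
    have "x * star x = (\<Sum>i<1::nat. complex_of_real 1 *\<^sub>C (x * star x))" by (simp add: scaleC_one)
    then have "x * star x \<in> positives"
      using False unfolding positives_def
      by (intro CollectI conjI exI[of _ "1 :: nat"] exI[of _ "\<lambda>_. 1 :: real"] exI[of _ "\<lambda>_. x"]) auto
    then show ?thesis using tau_positive by blast
  qed
  then have "\<tau> (m * star 1) = cnj (\<tau> (1 * star m))"
    by (intro sesquilinear_hermitian[of "\<lambda>x y. \<tau> (x * star y)"])
      (simp_all add: mult_simps star_add star_scaleC clinearD[OF tau_linear] scaleC_complex_def)
  then show ?thesis by (simp add: star_one)
qed

section \<open>Integration and the inner product of forms\<close>

definition v where "v \<omega> = \<tau> (vol K \<omega>)"
definition hs where "hs \<omega> = hodge K (fstar K \<omega>)"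

lemma v_linear: "clinear v"
  by (rule clinearI) (simp_all add: v_def clinearD[OF vol_linear] clinearD[OF tau_linear])

lemma v_fstar: "v (fstar K \<omega>) = cnj (v \<omega>)"
  by (simp add: v_def vol_fstar tau_star)

lemma v_bideg: "\<omega> \<in> bideg K i \<Longrightarrow> i \<noteq> (n, n) \<Longrightarrow> v \<omega> = 0"
  using vol_p[of i \<omega>] p_base[of \<omega> i i] by (simp add: v_def clinear_zero[OF tau_linear])

lemma v_sg: "v (sg \<omega> * \<nu>) = v (\<omega> * sg \<nu>)"
  using vol_sg[of "sg \<omega> * \<nu>"] by (simp add: v_def sg_mult sg_sg)

text \<open>Only forms of bidegree \<open>(n, n - 1)\<close> matter. On these \<open>del\<close>
  lands in \<open>(n + 1, n - 1)\<close>, which does not contribute to the integral, so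
  \<open>delbar\<close> inherits closedness from \<open>diff\<close>.\<close>

lemma v_delbar: "v (delbar K \<omega>) = 0"
proof -
  show ?thesis
  proof (rule additive_ext[of "\<lambda>\<omega>. v (delbar K \<omega>)" "\<lambda>\<omega>. 0"])
    fix a b \<omega> assume w: "\<omega> \<in> bideg K (a, b)"
    show "v (delbar K \<omega>) = 0"
    proof (cases "(a, b + 1) = (n, n)")
      case False
      then show ?thesis using v_bideg[OF delbar_bideg[OF w]] by blast
    next
      case True
      then have "(a + 1, b) \<noteq> (n, n)" "a + b + 1 = 2 * n" by auto
      then have "v (del K \<omega>) = 0" "v (diff K \<omega>) = 0"
        using v_bideg[OF del_bideg[OF w]] closed bideg_deg[OF w] by (auto simp: closed_integral_def v_def)
      then show ?thesis by (simp add: diff_eq clinearD[OF v_linear])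
    qed
  qed (simp_all add: additive_def clinearD[OF v_linear] clinearD[OF delbar_linear])
qed

lemma hs_add: "hs (x + y) = hs x + hs y" and hs_scale: "hs (c *\<^sub>C x) = cnj c *\<^sub>C hs x"
  by (simp_all add: hs_def fstar_add fstar_scale clinearD[OF hodge(1)])

lemma hs_incl: "hs (\<omega> * incl K m) = incl K (star m) * hs \<omega>" "hs (incl K m * \<omega>) = hs \<omega> * incl K (star m)"
proof -
  have 1: "fstar K (\<omega> * incl K m) = incl K (star m) * fstar K \<omega>" for \<omega> m
  proof (rule additive_ext[of "\<lambda>\<omega>. fstar K (\<omega> * incl K m)" "\<lambda>\<omega>. incl K (star m) * fstar K \<omega>"])
    fix a b \<omega> assume w: "\<omega> \<in> bideg K (a, b)"
    show "fstar K (\<omega> * incl K m) = incl K (star m) * fstar K \<omega>"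
      using fstar_mult[OF bideg_deg[OF w] bideg_deg[OF incl_bideg]] by (simp add: fstar_incl scaleC_one)
  qed (simp_all add: additive_def fstar_add mult_simps)
  then show "hs (\<omega> * incl K m) = incl K (star m) * hs \<omega>"
    by (simp add: hs_def hodge_incl)
  have "fstar K (fstar K \<omega> * incl K (star m)) = incl K m * \<omega>" for \<omega>
    by (simp add: 1 star_star)
  then have "fstar K (incl K m * \<omega>) = fstar K \<omega> * incl K (star m)" by (metis fstar_fstar)
  then show "hs (incl K m * \<omega>) = hs \<omega> * incl K (star m)"
    by (simp add: hs_def hodge_incl)
qed

text \<open>The square of the Hodge map is the involution \<open>sg\<close>, and the Hodge map
  commutes with \<open>fstar\<close>; so \<open>fstar\<close> after \<open>hodge K\<close> after
  \<open>sg\<close> inverts \<open>hs\<close>.\<close>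

lemma bij_hs: "bij hs"
proof (rule bijI)
  have 1: "fstar K (hodge K (sg (hs x))) = x" for x
  proof -
    have "hodge K (sg (hs x)) = sg (hodge K (hs x))" by (metis hodge_hodge)
    then show ?thesis by (simp add: hs_def hodge_hodge sg_sg)
  qed
  show "inj hs" by (rule inj_on_inverseI[of _ "\<lambda>x. fstar K (hodge K (sg x))"]) (simp add: 1)
  have "hs (fstar K (hodge K (sg x))) = x" for x by (simp add: hs_def hodge_hodge sg_sg)
  then show "surj hs" by (rule surjI)
qed

text \<open>The generators have bidegree \<open>(a + j, b + j)\<close> with
  \<open>a + b + j \<le> n\<close>. Excluding larger bidegrees matters because
  \<open>hodge_bideg\<close> is stated with truncated subtraction.\<close>

lemma p_large: "c > n \<or> d > n \<Longrightarrow> p (c, d) \<omega> = 0"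
proof (rule gen_ext[of "\<lambda>\<omega>. p (c, d) \<omega>" "\<lambda>\<omega>. 0"])
  fix \<alpha> a b j assume "c > n \<or> d > n" "\<alpha> \<in> Prim a b" "a + b + j \<le> n"
  moreover from this have "(L ^^ j) \<alpha> \<in> bideg K (a + j, b + j)" by (intro L_pow_bideg) (simp add: Prim_def)
  ultimately show "p (c, d) ((L ^^ j) \<alpha>) = 0" using p_base[of _ "(a + j, b + j)" "(c, d)"] by auto
qed (simp_all add: additive_def clinearD[OF p_linear])

definition B where "B \<omega> \<nu> = v (\<omega> * hs \<nu>)"

lemma B_positive: "\<omega> \<noteq> 0 \<Longrightarrow> B \<omega> \<omega> \<in> \<real> \<and> 0 < Re (B \<omega> \<omega>)"
  using pos tau_positive by (simp add: positive_definite_kaehler_def B_def v_def hs_def)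

lemma B_definite: "B \<omega> \<omega> = 0 \<Longrightarrow> \<omega> = 0"
  using B_positive[of \<omega>] by force

lemma B_bilinear:
  "B (x + y) z = B x z + B y z" "B x (y + z) = B x y + B x z"
  "B (c *\<^sub>C x) y = c * B x y" "B x (c *\<^sub>C y) = cnj c * B x y"
  by (simp_all add: B_def mult_simps hs_add hs_scale clinearD[OF v_linear] scaleC_complex_def)

lemma B_hermitian: "B \<omega> \<nu> = cnj (B \<nu> \<omega>)"
proof (rule sesquilinear_hermitian[OF B_bilinear])
  fix \<omega> show "B \<omega> \<omega> \<in> \<real>"
    using B_positive[of \<omega>] B_bilinear(3)[of 0 0 0] by (cases "\<omega> = 0") (auto simp: complex_vector.scale_zero_left)
qed

text \<open>For distinct bidegrees the product with the Hodge dual misses bidegree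
  \<open>(n, n)\<close>, so the integral vanishes and the bigrading is orthogonal.\<close>

lemma B_p: "B (p i \<omega>) \<nu> = B \<omega> (p i \<nu>)"
proof -
  have B0: "B 0 x = 0" "B x 0 = 0" for x
    using B_bilinear(3)[of 0 0 x] B_bilinear(4)[of x 0 0] by (auto simp: complex_vector.scale_zero_left)
  have orth: "B (p (a, b) \<omega>) (p (c, d) \<nu>) = 0" if "(a, b) \<noteq> (c, d)" for a b c d \<omega> \<nu>
  proof (cases "c > n \<or> d > n")
    case True
    then show ?thesis by (simp add: p_large B0)
  next
    case False
    have "p (a, b) \<omega> * hs (p (c, d) \<nu>) \<in> bideg K (a + (n - c), b + (n - d))"
      unfolding hs_def by (intro bideg_mult p_in hodge_bideg fstar_bideg)
    moreover have "(a + (n - c), b + (n - d)) \<noteq> (n, n)" using that False by auto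
    ultimately show ?thesis unfolding B_def by (rule v_bideg)
  qed
  have "B (p i \<omega>) \<nu> = (\<Sum>j\<in>J. B (p i \<omega>) (p j \<nu>))"
    using additive.sum[of "B (p i \<omega>)" "\<lambda>j. p j \<nu>" J] by (simp add: additive_def B_bilinear p_sum)
  also have "\<dots> = (\<Sum>j\<in>J. B (p j \<omega>) (p i \<nu>))"
    using orth by (intro sum.cong refl) (metis prod.collapse)
  also have "\<dots> = B \<omega> (p i \<nu>)"
    using additive.sum[of "\<lambda>x. B x (p i \<nu>)" "\<lambda>j. p j \<omega>" J] by (simp add: additive_def B_bilinear p_sum)
  finally show ?thesis .
qed

subsection \<open>The opposite algebra of forms\<close>

text \<open>Conjugating the product by the involution gives the graded opposite product
  \<open>(-1)\<^bsup>kl\<^esup> \<nu> \<omega>\<close>. For it, right bundles become left bundles.\<close>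

definition tw where "tw \<omega> \<nu> = fstar K (fstar K \<omega> * fstar K \<nu>)"

lemma tw_deg: "\<omega> \<in> deg K k \<Longrightarrow> \<nu> \<in> deg K l \<Longrightarrow> tw \<omega> \<nu> = ((-1) ^ (k * l) :: complex) *\<^sub>C (\<nu> * \<omega>)"
  using fstar_mult[OF fstar_deg fstar_deg] by (simp add: tw_def)

lemma tw_bilinear: "tw (x + y) z = tw x z + tw y z" "tw x (y + z) = tw x y + tw x z"
  "tw (c *\<^sub>C x) y = c *\<^sub>C tw x y" "tw x (c *\<^sub>C y) = c *\<^sub>C tw x y"
  by (simp_all add: tw_def fstar_add fstar_scale mult_simps)

lemma tw_assoc: "tw (tw x y) z = tw x (tw y z)"
  by (simp add: tw_def mult.assoc)

lemma tw_incl: "tw (incl K m) \<omega> = \<omega> * incl K m" "tw \<omega> (incl K m) = incl K m * \<omega>"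
proof -
  show "tw (incl K m) \<omega> = \<omega> * incl K m"
  proof (rule additive_ext[of "\<lambda>\<omega>. tw (incl K m) \<omega>" "\<lambda>\<omega>. \<omega> * incl K m"])
    fix a b \<omega> assume "\<omega> \<in> bideg K (a, b)"
    from tw_deg[OF bideg_deg[OF incl_bideg[of m]] bideg_deg[OF this]]
    show "tw (incl K m) \<omega> = \<omega> * incl K m" by (simp add: scaleC_one)
  qed (simp_all add: additive_def tw_bilinear mult_simps)
  show "tw \<omega> (incl K m) = incl K m * \<omega>"
  proof (rule additive_ext[of "\<lambda>\<omega>. tw \<omega> (incl K m)" "\<lambda>\<omega>. incl K m * \<omega>"])
    fix a b \<omega> assume "\<omega> \<in> bideg K (a, b)"
    from tw_deg[OF bideg_deg[OF this] bideg_deg[OF incl_bideg[of m]]]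
    show "tw \<omega> (incl K m) = incl K m * \<omega>" by (simp add: scaleC_one)
  qed (simp_all add: additive_def tw_bilinear mult_simps)
qed

lemma delbar_tw: "delbar K (tw x y) = tw (delbar K x) y + tw (sg x) (delbar K y)"
  by (simp add: tw_def fstar_add fstar_delbar fstar_sg del_mult flip: fstar_del)

lemma sg_tw: "sg (tw x y) = tw (sg x) (sg y)"
  by (simp add: tw_def sg_mult fstar_sg flip: fstar_sg)

lemma v_sg_tw: "v (tw (sg x) y) = v (tw x (sg y))"
  by (simp add: tw_def v_fstar fstar_sg v_sg)

text \<open>Conjugation reduces the pairing for the opposite product to \<open>B\<close>, from which
  it inherits symmetry and definiteness.\<close>

lemma v_tw: "v (tw x (hs y)) = cnj (B (fstar K x) (fstar K y))"
  by (simp add: tw_def v_fstar B_def hs_def flip: hodge_fstar)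

text \<open>The coaction is multiplicative and compatible with the involutions. Conjugating before
  and after the product therefore reverses the factors from the Hopf algebra, which is why right
  bundles live over its opposite algebra.\<close>

lemma coact_tw: "coact K (tw x y) = tsum (coact K x) (\<lambda>a \<omega>. tsum (coact K y) (\<lambda>b \<nu>. (b * a) \<otimes> tw \<omega> \<nu>))"
proof -
  have b: "balanced (\<lambda>(a :: 'a) \<omega>. star a \<otimes> fstar K \<omega>)"
    by (rule balanced_conj_linear) (simp_all add: additive_def star_add star_scaleC fstar_add fstar_scale)
  have g: "balanced (\<lambda>a \<omega>. star (c * a) \<otimes> fstar K (\<nu> * \<omega>))" "balanced (\<lambda>a \<omega>. star (a * c) \<otimes> fstar K (\<omega> * \<nu>))"
    for c :: 'a and \<nu>
    by (rule balancedI; simp add: mult_simps star_add star_scaleC fstar_add fstar_scale pure_tensor_bilinear)+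
  have g': "balanced (\<lambda>a \<omega>. tsum t (\<lambda>c \<nu>. star (a * star c) \<otimes> fstar K (\<omega> * fstar K \<nu>)))" for t :: "('a, 'o) tensor"
    by (rule balancedI) (simp_all add: mult_simps star_add star_scaleC fstar_add fstar_scale
        pure_tensor_bilinear tsum_distrib tsum_scale)
  have "coact K (tw x y) = tsum (coact K (fstar K x * fstar K y)) (\<lambda>a \<omega>. star a \<otimes> fstar K \<omega>)"
    by (simp add: tw_def coact_fstar tensor_map_tsum[OF b])
  also have "\<dots> = tsum (coact K x) (\<lambda>a \<omega>. tsum (coact K y) (\<lambda>c \<nu>. star (star a * star c) \<otimes> fstar K (fstar K \<omega> * fstar K \<nu>)))"
    by (simp add: coact_mult[OF b] coact_fstar tsum_tensor_map[OF b g(1)] tsum_tensor_map[OF b g'])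
  finally show ?thesis by (simp add: tw_def star_mult star_star)
qed

lemma p_mult: "p (0, 1) \<nu> = \<nu> \<Longrightarrow> p (a, b + 1) (\<omega> * \<nu>) = p (a, b) \<omega> * \<nu>"
  "p (0, 1) \<nu> = \<nu> \<Longrightarrow> p (a, 0) (\<omega> * \<nu>) = 0"
proof -
  assume "p (0, 1) \<nu> = \<nu>"
  then have \<nu>: "\<nu> \<in> bideg K (0, 1)" using p_in by metis
  have X: "additive (\<lambda>\<omega>. \<omega> * \<nu>)" "\<omega> \<in> bideg K (a, b) \<Longrightarrow> \<omega> * \<nu> \<in> bideg K (a + 0, b + 1)" for a b \<omega>
    using bideg_mult[OF _ \<nu>] by (auto simp: additive_def distrib_right)
  from p_shift[OF X]
  show "p (a, b + 1) (\<omega> * \<nu>) = p (a, b) \<omega> * \<nu>" "p (a, 0) (\<omega> * \<nu>) = 0" by force+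
qed

lemma p_tw: "p (0, 1) \<nu> = \<nu> \<Longrightarrow> p (a, b + 1) (tw \<omega> \<nu>) = tw (p (a, b) \<omega>) \<nu>"
  "p (0, 1) \<nu> = \<nu> \<Longrightarrow> p (a, 0) (tw \<omega> \<nu>) = 0"
proof -
  assume "p (0, 1) \<nu> = \<nu>"
  then have \<nu>: "\<nu> \<in> bideg K (0, 1)" using p_in by metis
  have X: "additive (\<lambda>\<omega>. tw \<omega> \<nu>)" "\<omega> \<in> bideg K (a, b) \<Longrightarrow> tw \<omega> \<nu> \<in> bideg K (a + 0, b + 1)" for a b \<omega>
  proof -
    assume w: "\<omega> \<in> bideg K (a, b)"
    have "\<nu> * \<omega> \<in> bideg K (a + 0, b + 1)" using bideg_mult[OF \<nu> w] by (simp add: add.commute)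
    then show "tw \<omega> \<nu> \<in> bideg K (a + 0, b + 1)"
      using tw_deg[OF bideg_deg[OF w] bideg_deg[OF \<nu>]] complex_vector.subspace_scale[OF bideg_subspace] by simp
  qed (simp add: additive_def tw_bilinear)
  from p_shift[OF X]
  show "p (a, b + 1) (tw \<omega> \<nu>) = tw (p (a, b) \<omega>) \<nu>" "p (a, 0) (tw \<omega> \<nu>) = 0" by force+
qed

end

section \<open>Bundles over an algebra of forms\<close>

text \<open>The products on the Hopf algebra, the base algebra and the forms are parameters, so that the same
  argument applies to left bundles and, with opposite products, to right bundles. The map \<open>hs\<close> stands for
  the Hodge map after the involution, and \<open>v\<close> for the state applied to the volume map.\<close>

locale form_algebra =
  fixes A :: "('a::complex_star_algebra) hopf" and ma :: "'a \<Rightarrow> 'a \<Rightarrow> 'a" and anti :: "'a \<Rightarrow> 'a"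
    and mm :: "'m::complex_star_algebra \<Rightarrow> 'm \<Rightarrow> 'm"
    and mo :: "'o::complex_vector \<Rightarrow> 'o \<Rightarrow> 'o"
    and incl :: "'m \<Rightarrow> 'o" and delbar sg hs :: "'o \<Rightarrow> 'o"
    and p :: "nat \<times> nat \<Rightarrow> 'o \<Rightarrow> 'o" and J :: "(nat \<times> nat) set" and v :: "'o \<Rightarrow> complex"
    and \<delta>M :: "'m \<Rightarrow> ('a, 'm) tensor" and \<delta>O :: "'o \<Rightarrow> ('a, 'o) tensor"
  assumes comult_linear: "clinear (comult A)" and counit_linear: "clinear (counit A)"
    and anti_linear: "clinear anti"
    and ma_bilin: "ma (a + a') b = ma a b + ma a' b" "ma a (b + b') = ma a b + ma a b'"
      "ma (c *\<^sub>C a) b = c *\<^sub>C ma a b" "ma a (c *\<^sub>C b) = c *\<^sub>C ma a b"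
    and ma_assoc: "ma (ma a b) a' = ma a (ma b a')" and ma_one: "ma 1 a = a"
    and ma_star: "star (ma a b) = ma (star b) (star a)"
    and anti_left: "tsum (comult A a) (\<lambda>b c. ma (anti b) c) = counit A a *\<^sub>C 1"
    and anti_right: "tsum (comult A a) (\<lambda>b c. ma b (anti c)) = counit A a *\<^sub>C 1"
    and mm_scale: "mm (c *\<^sub>C 1) m = c *\<^sub>C m" "mm m (c *\<^sub>C 1) = c *\<^sub>C m"
    and mo_bilin: "mo (x + x') y = mo x y + mo x' y" "mo x (y + y') = mo x y + mo x y'"
      "mo (c *\<^sub>C x) y = c *\<^sub>C mo x y" "mo x (c *\<^sub>C y) = c *\<^sub>C mo x y"
    and mo_assoc: "mo (mo x y) z = mo x (mo y z)"
    and incl_linear: "clinear incl" and incl_one: "mo (incl 1) x = x"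
    and incl_mult: "mo (incl m) (incl m') = incl (mm m m')"
    and delbar_linear: "clinear delbar" and sg_linear: "clinear sg"
    and delbar_mult: "delbar (mo x y) = mo (delbar x) y + mo (sg x) (delbar y)"
    and sg_mult: "sg (mo x y) = mo (sg x) (sg y)" and sg_incl: "sg (incl m) = incl m"
    and hs_add: "hs (x + y) = hs x + hs y" and hs_scale: "hs (c *\<^sub>C x) = cnj c *\<^sub>C hs x"
    and hs_bij: "bij hs" and hs_incl: "hs (mo x (incl m)) = mo (incl (star m)) (hs x)"
    and p_linear: "clinear (p i)" and p_p: "p i (p j x) = (if i = j then p i x else 0)"
    and J: "finite J" and p_sum: "(\<Sum>i\<in>J. p i x) = x"
    and p_incl: "p i (mo x (incl m)) = mo (p i x) (incl m)"
    and p_delbar: "p (k, l + 1) (delbar x) = delbar (p (k, l) x)" "p (k, 0) (delbar x) = 0"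
    and p_sg: "p i (sg x) = sg (p i x)"
    and p_mo: "p (0, 1) y = y \<Longrightarrow> p (k, l + 1) (mo x y) = mo (p (k, l) x) y"
      "p (0, 1) y = y \<Longrightarrow> p (k, 0) (mo x y) = 0"
    and v_linear: "clinear v" and v_delbar: "v (delbar x) = 0" and v_sg: "v (mo (sg x) y) = v (mo x (sg y))"
    and v_hermitian: "v (mo x (hs y)) = cnj (v (mo y (hs x)))"
    and v_definite: "v (mo x (hs x)) = 0 \<Longrightarrow> x = 0"
    and v_p: "v (mo (p i x) (hs y)) = v (mo x (hs (p i y)))"
    and \<delta>M_linear: "clinear \<delta>M" and \<delta>O_linear: "clinear \<delta>O"
    and \<delta>O_incl: "\<delta>O (incl m) = tensor_map id incl (\<delta>M m)"
    and \<delta>O_mult: "\<delta>O (mo x y) = tsum (\<delta>O x) (\<lambda>a x'. tsum (\<delta>O y) (\<lambda>b y'. ma a b \<otimes> mo x' y'))"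
    and \<delta>O_delbar: "\<delta>O (delbar x) = tensor_map id delbar (\<delta>O x)"
    and \<delta>O_sg: "\<delta>O (sg x) = tensor_map id sg (\<delta>O x)"
    and \<delta>O_p: "\<delta>O (p i x) = tensor_map id (p i) (\<delta>O x)"
    and \<delta>O_hs: "\<delta>O (hs x) = tensor_map star hs (\<delta>O x)"

text \<open>\<open>e\<close> and \<open>coor\<close> form a finite dual basis, the usable form of
  projectivity, and \<open>rank\<close> is its length.\<close>

locale form_bundle = form_algebra A ma anti mm mo incl delbar sg hs p J v \<delta>M \<delta>O
  for A :: "('a::complex_star_algebra) hopf" and ma anti
    and mm :: "'m::complex_star_algebra \<Rightarrow> 'm \<Rightarrow> 'm"
    and mo :: "'o::complex_vector \<Rightarrow> 'o \<Rightarrow> 'o" and incl delbar sg hs p J v \<delta>M \<delta>O +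
  fixes lact :: "'m \<Rightarrow> 'f::complex_vector \<Rightarrow> 'f" and \<delta>F :: "'f \<Rightarrow> ('a, 'f) tensor"
    and tens :: "'o \<Rightarrow> 'f \<Rightarrow> 't::complex_vector"
    and rank :: nat and e :: "nat \<Rightarrow> 'f" and coor :: "nat \<Rightarrow> 'f \<Rightarrow> 'm"
  assumes lact_add: "lact (m + m') f = lact m f + lact m' f" "lact m (f + g) = lact m f + lact m g"
    and lact_mult: "lact (mm m m') f = lact m (lact m' f)" and lact_one: "lact 1 f = f"
    and lact_scale: "lact (c *\<^sub>C m) f = c *\<^sub>C lact m f"
    and coor: "\<And>i. coor i (f + g) = coor i f + coor i g" "\<And>i. coor i (lact m f) = mm m (coor i f)"
    and coor_sum: "(\<Sum>i<rank. lact (coor i f) (e i)) = f"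
    and \<delta>F: "comodule A \<delta>F"
    and \<delta>F_lact: "\<delta>F (lact m f) = tsum (\<delta>M m) (\<lambda>a m'. tsum (\<delta>F f) (\<lambda>b g. ma a b \<otimes> lact m' g))"
    and bt: "balanced_tensor UNIV (\<lambda>x m. mo x (incl m)) UNIV lact tens"
begin

lemma scale_lact: "c *\<^sub>C f = lact (c *\<^sub>C 1) f"
  by (simp add: lact_scale lact_one)

lemma lact_scale': "lact m (c *\<^sub>C f) = c *\<^sub>C lact m f"
  using lact_mult[of m "c *\<^sub>C 1" f] by (simp add: mm_scale lact_scale lact_one)

lemmas zeros [simp] = clinear_zero[OF delbar_linear]
  clinear_zero[OF sg_linear] clinear_zero[OF p_linear]
  clinear_zero[OF v_linear]

lemmas tens_bilin = balanced_tensor_tens(1-4)[OF bt]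
lemmas tens_balanced = balanced_tensor_tens(5)[OF bt]

lemmas bilin = ma_bilin mo_bilin tens_bilin pure_tensor_bilinear tsum_distrib tsum_scale
  scaleC_add_right scaleC_add_left scaleC_scaleC clinearD[OF delbar_linear] clinearD[OF sg_linear]
  clinearD[OF p_linear] clinearD[OF v_linear] clinearD[OF incl_linear] star_add star_scaleC hs_add hs_scale
  clinearD[OF \<delta>M_linear] clinearD[OF \<delta>O_linear] lact_add lact_scale lact_scale' clinearD[OF anti_linear]

lemma T_induct [case_names zero add tens]:
  "P 0 \<Longrightarrow> (\<And>s t. P s \<Longrightarrow> P t \<Longrightarrow> P (s + t)) \<Longrightarrow> (\<And>x f. P (tens x f)) \<Longrightarrow> P t"
  by (rule balanced_tensor_induct[OF bt complex_vector.subspace_UNIV]) blast+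

lemma T_ext:
  assumes "additive F" "additive G" "\<And>x f. F (tens x f) = G (tens x f)"
  shows "F t = G t"
  by (induction t rule: T_induct) (simp_all add: assms additive.zero additive.add)

lemmas lift = lift_over_linear[OF bt mo_bilin(3)]

definition W :: "'o \<Rightarrow> 't \<Rightarrow> 't" where
  "W y = lift_over UNIV UNIV tens (\<lambda>x f. tens (mo y x) f)"

lemma W: "clinear (W y)" "W y (tens x f) = tens (mo y x) f"
proof -
  have b: "balanced (\<lambda>x f. tens (mo y x) f)" by (rule balancedI) (simp_all add: bilin)
  have m: "tens (mo y (mo x (incl m))) f = tens (mo y x) (lact m f)" for x m f
    by (simp add: tens_balanced flip: mo_assoc)
  show "W y (tens x f) = tens (mo y x) f" unfolding W_def by (rule lift(2)[OF b m])
  show "clinear (W y)" unfolding W_def by (rule lift(3)[OF b m]) (simp add: bilin)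
qed

lemma W_left: "W (x + y) t = W x t + W y t" "W (c *\<^sub>C x) t = c *\<^sub>C W x t" "W (mo x y) t = W x (W y t)"
  by (induction t rule: T_induct)
    (simp_all add: clinear_zero[OF W(1)] clinearD[OF W(1)] W(2) bilin mo_assoc
      complex_vector.scale_zero_right algebra_simps)

lemmas W_zero [simp] = clinear_zero[OF W(1)]

definition Hom where "Hom = {u. (\<forall>f g. u (f + g) = u f + u g) \<and> (\<forall>m f. u (lact m f) = mo (incl m) (u f))}"

lemma HomD:
  assumes "u \<in> Hom"
  shows "u (f + g) = u f + u g" "u (lact m f) = mo (incl m) (u f)" "u (c *\<^sub>C f) = c *\<^sub>C u f"
proof -
  show 1: "u (f + g) = u f + u g" "u (lact m f) = mo (incl m) (u f)" for f g m using assms by (auto simp: Hom_def)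
  show "u (c *\<^sub>C f) = c *\<^sub>C u f" 
    unfolding scale_lact[of c f] 1(2) by (simp add: bilin incl_one)
qed

lemma Hom_additive: "u \<in> Hom \<Longrightarrow> additive u"
  by (simp add: additive_def HomD)

definition ev :: "('f \<Rightarrow> 'o) \<Rightarrow> 't \<Rightarrow> 'o" where
  "ev u = lift_over UNIV UNIV tens (\<lambda>x f. mo x (u f))"

lemma ev:
  assumes u: "u \<in> Hom" shows "clinear (ev u)" "ev u (tens x f) = mo x (u f)"
proof -
  have b: "balanced (\<lambda>x f. mo x (u f))" by (rule balancedI) (simp_all add: bilin HomD[OF u])
  have m: "mo (mo x (incl m)) (u f) = mo x (u (lact m f))" for x m f by (simp add: HomD[OF u] mo_assoc)
  show "ev u (tens x f) = mo x (u f)" unfolding ev_def by (rule lift(2)[OF b m])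
  show "clinear (ev u)" unfolding ev_def by (rule lift(3)[OF b m]) (simp add: bilin)
qed

lemma ev_W: "u \<in> Hom \<Longrightarrow> ev u (W y t) = mo y (ev u t)"
proof -
  assume u: "u \<in> Hom"
  note l = clinearD[OF ev(1)[OF u]]
  show ?thesis
    by (rule T_ext[of "\<lambda>t. ev u (W y t)" "\<lambda>t. mo y (ev u t)"])
      (simp_all add: additive_def clinearD[OF W(1)] W(2) l ev(2)[OF u] bilin mo_assoc)
qed

definition P :: "nat \<times> nat \<Rightarrow> 't \<Rightarrow> 't" where
  "P i = lift_over UNIV UNIV tens (\<lambda>x f. tens (p i x) f)"

lemma P: "clinear (P i)" "P i (tens x f) = tens (p i x) f"
proof -
  have b: "balanced (\<lambda>x f. tens (p i x) f)" by (rule balancedI) (simp_all add: bilin)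
  have m: "tens (p i (mo x (incl m))) f = tens (p i x) (lact m f)" for x m f
    by (simp add: tens_balanced p_incl)
  show "P i (tens x f) = tens (p i x) f" unfolding P_def by (rule lift(2)[OF b m])
  show "clinear (P i)" unfolding P_def by (rule lift(3)[OF b m]) (simp add: bilin)
qed

lemma tens_zero [simp]: "tens 0 f = 0" "tens x 0 = 0"
  using tens_bilin(3)[of 0 x f] tens_bilin(4)[of x 0 f] tens_bilin(3)[of 0 0 f] tens_bilin(4)[of x 0 0]
  by (simp_all add: complex_vector.scale_zero_left)

lemma P_P: "P i (P j t) = (if i = j then P i t else 0)"
  by (rule T_ext[of "\<lambda>t. P i (P j t)" "\<lambda>t. if i = j then P i t else 0"])
    (auto simp: additive_def clinearD[OF P(1)] P(2) p_p)

lemma P_sum: "(\<Sum>i\<in>J. P i t) = t"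
proof (rule T_ext[of "\<lambda>t. \<Sum>i\<in>J. P i t" "\<lambda>t. t"])
  fix x f
  have "tens (\<Sum>i\<in>J. p i x) f = (\<Sum>i\<in>J. tens (p i x) f)"
    by (rule additive.sum[of "\<lambda>x. tens x f"]) (simp add: additive_def bilin)
  then show "(\<Sum>i\<in>J. P i (tens x f)) = tens x f"
    unfolding P(2) p_sum by (rule sym)
qed (simp_all add: additive_def clinearD[OF P(1)] sum.distrib)

definition \<delta>T :: "'t \<Rightarrow> ('a, 't) tensor" where
  "\<delta>T = lift_over UNIV UNIV tens (\<lambda>x f. tsum (\<delta>O x) (\<lambda>a x'. tsum (\<delta>F f) (\<lambda>b g. ma a b \<otimes> tens x' g)))"

lemma \<delta>F_linear: "clinear \<delta>F"
  using \<delta>F by (simp add: comodule_def)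

lemma \<delta>O_sum:
  assumes "balanced g"
  shows "tsum (\<delta>O (mo x y)) g = tsum (\<delta>O x) (\<lambda>a x'. tsum (\<delta>O y) (\<lambda>b y'. g (ma a b) (mo x' y')))"
  by (simp add: \<delta>O_mult tsum_tsum[OF assms] tsum_pure[OF assms])

lemma \<delta>F_sum:
  assumes "balanced g"
  shows "tsum (\<delta>F (lact m f)) g = tsum (\<delta>M m) (\<lambda>a m'. tsum (\<delta>F f) (\<lambda>b g'. g (ma a b) (lact m' g')))"
  by (simp add: \<delta>F_lact tsum_tsum[OF assms] tsum_pure[OF assms])

lemma incl_sum:
  assumes "balanced g"
  shows "tsum (\<delta>O (incl m)) g = tsum (\<delta>M m) (\<lambda>a m'. g a (incl m'))"
  by (simp add: \<delta>O_incl tsum_tensor_map[OF balanced_linear[OF clinear_id(1) incl_linear] assms])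

text \<open>The codiagonal coaction descends to the tensor product over the base algebra because
  both coactions are compatible with multiplication by the element that is moved across.\<close>

lemma \<delta>T: "clinear \<delta>T"
  "\<delta>T (tens x f) = tsum (\<delta>O x) (\<lambda>a x'. tsum (\<delta>F f) (\<lambda>b g. ma a b \<otimes> tens x' g))"
proof -
  let ?g = "\<lambda>x f. tsum (\<delta>O x) (\<lambda>a x'. tsum (\<delta>F f) (\<lambda>b g. ma a b \<otimes> tens x' g))"
  have inner: "balanced (\<lambda>b g. ma a b \<otimes> tens x' g)" for a x' by (rule balancedI) (simp_all add: bilin)
  have outer: "balanced (\<lambda>a x'. tsum (\<delta>F f) (\<lambda>b g. ma a b \<otimes> tens x' g))" for f
    by (rule balancedI) (simp_all add: bilin)
  have sc: "tsum (\<delta>O (c *\<^sub>C x)) (\<lambda>a x'. tsum (\<delta>F f) (\<lambda>b g. ma a b \<otimes> tens x' g)) = c *\<^sub>C ?g x f" for c x f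
    by (simp add: clinearD[OF \<delta>O_linear] tsum_scaleC[OF outer] bilin)
  have sc': "tsum (\<delta>F (c *\<^sub>C f)) (\<lambda>b g. ma a b \<otimes> tens x' g) = c *\<^sub>C tsum (\<delta>F f) (\<lambda>b g. ma a b \<otimes> tens x' g)" for c f a x'
    by (simp add: clinearD[OF \<delta>F_linear] tsum_scaleC[OF inner] bilin)
  have b: "balanced ?g"
    by (rule balancedI) (simp_all add: clinearD(1)[OF \<delta>O_linear] clinearD(1)[OF \<delta>F_linear]
        tsum_add[OF outer] tsum_add[OF inner] sc sc' tsum_distrib tsum_scale)
  have m: "?g (mo x (incl m)) f = ?g x (lact m f)" for x m f
  proof -
    have *: "balanced (\<lambda>b y. tsum (\<delta>F f) (\<lambda>c g. ma a (ma b c) \<otimes> tens (mo x y) g))" for a x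
      by (rule balancedI) (simp_all add: bilin)
    show ?thesis
      by (simp add: \<delta>O_sum[OF outer] incl_sum[OF *] \<delta>F_sum[OF inner] ma_assoc tens_balanced)
  qed
  show "\<delta>T (tens x f) = ?g x f" unfolding \<delta>T_def by (rule lift(2)[OF b m])
  show "clinear \<delta>T" unfolding \<delta>T_def by (rule lift(3)[OF b m]) (rule sc)
qed

lemma \<delta>T_sum:
  assumes "balanced g"
  shows "tsum (\<delta>T (tens x f)) g = tsum (\<delta>O x) (\<lambda>a x'. tsum (\<delta>F f) (\<lambda>b f'. g (ma a b) (tens x' f')))"
  by (simp add: \<delta>T(2) tsum_tsum[OF assms] tsum_pure[OF assms])

lemma \<delta>T_P: "\<delta>T (P i t) = tensor_map id (P i) (\<delta>T t)"
proof (rule T_ext[of "\<lambda>t. \<delta>T (P i t)" "\<lambda>t. tensor_map id (P i) (\<delta>T t)"])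
  have b: "balanced (\<lambda>a t. id (a :: 'a) \<otimes> P i t)" by (rule balanced_linear[OF clinear_id(1) P(1)])
  show "additive (\<lambda>t. tensor_map id (P i) (\<delta>T t))"
    by (rule additive.intro) (simp only: tensor_map_tsum[OF b] clinearD(1)[OF \<delta>T(1)] tsum_add[OF b])
  show "additive (\<lambda>t. \<delta>T (P i t))" by (simp add: additive_def clinearD[OF \<delta>T(1)] clinearD[OF P(1)])
  fix x f
  have outer: "balanced (\<lambda>a x'. tsum (\<delta>F f) (\<lambda>b g. ma a b \<otimes> tens x' g))" for f
    by (rule balancedI) (simp_all add: bilin)
  show "\<delta>T (P i (tens x f)) = tensor_map id (P i) (\<delta>T (tens x f))"
    unfolding tensor_map_tsum[OF b] \<delta>T_sum[OF b]
    by (simp add: P(2) \<delta>T(2) \<delta>O_p tsum_tensor_map[OF balanced_linear[OF clinear_id(1) p_linear] outer])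
qed

lemma \<delta>T_W_sum:
  assumes g: "balanced g"
  shows "tsum (\<delta>T (W y t)) g = tsum (\<delta>O y) (\<lambda>a y'. tsum (\<delta>T t) (\<lambda>b s. g (ma a b) (W y' s)))"
proof -
  have b: "balanced (\<lambda>b s. g (ma a b) (W y' s))" for a y'
    by (rule balancedI) (simp_all add: balancedD[OF g] bilin clinearD[OF W(1)])
  have outer: "balanced (\<lambda>a x'. tsum (\<delta>F f) (\<lambda>b f'. g (ma a b) (tens x' f')))" for f
    by (rule balancedI) (simp_all add: balancedD[OF g] bilin)
  show ?thesis
  proof (rule T_ext[of "\<lambda>t. tsum (\<delta>T (W y t)) g" "\<lambda>t. tsum (\<delta>O y) (\<lambda>a y'. tsum (\<delta>T t) (\<lambda>b s. g (ma a b) (W y' s)))"])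
    show "additive (\<lambda>t. tsum (\<delta>T (W y t)) g)"
      by (simp add: additive_def clinearD[OF \<delta>T(1)] clinearD[OF W(1)] tsum_add[OF g])
    show "additive (\<lambda>t. tsum (\<delta>O y) (\<lambda>a y'. tsum (\<delta>T t) (\<lambda>b s. g (ma a b) (W y' s))))"
      by (simp add: additive_def clinearD[OF \<delta>T(1)] tsum_add[OF b] tsum_distrib)
    fix x f
    show "tsum (\<delta>T (W y (tens x f))) g = tsum (\<delta>O y) (\<lambda>a y'. tsum (\<delta>T (tens x f)) (\<lambda>b s. g (ma a b) (W y' s)))"
      by (simp add: W(2) \<delta>T_sum[OF g] \<delta>T_sum[OF b] \<delta>O_sum[OF outer] ma_assoc)
  qed
qed

end

context form_bundle
begin

text \<open>With \<open>sg\<close> in place of \<open>(-1) ^ k\<close> the extension is one formula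
  in all degrees, hence a lift over pure tensors; the Leibniz rule for \<open>dF\<close> makes it
  balanced.\<close>

definition dbar :: "('f \<Rightarrow> 't) \<Rightarrow> 't \<Rightarrow> 't" where
  "dbar dF = lift_over UNIV UNIV tens (\<lambda>x f. tens (delbar x) f + W (sg x) (dF f))"

lemma dbar:
  assumes l: "clinear dF" and m: "\<And>m f. dF (lact m f) = tens (delbar (incl m)) f + W (incl m) (dF f)"
  shows "clinear (dbar dF)" "dbar dF (tens x f) = tens (delbar x) f + W (sg x) (dF f)"
proof -
  have b: "balanced (\<lambda>x f. tens (delbar x) f + W (sg x) (dF f))"
    by (rule balancedI) (simp_all add: bilin W_left clinearD[OF W(1)] clinearD[OF l] algebra_simps)
  have m: "tens (delbar (mo x (incl m))) f + W (sg (mo x (incl m))) (dF f) =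
      tens (delbar x) (lact m f) + W (sg x) (dF (lact m f))" for x m f
    by (simp add: m delbar_mult sg_mult sg_incl bilin W_left W(2) clinearD[OF W(1)] tens_balanced)
  show "dbar dF (tens x f) = tens (delbar x) f + W (sg x) (dF f)" unfolding dbar_def by (rule lift(2)[OF b m])
  show "clinear (dbar dF)" unfolding dbar_def by (rule lift(3)[OF b m]) (simp add: bilin W_left)
qed

end

locale hermitian_bundle = form_bundle A ma anti mm mo incl delbar sg hs p J v \<delta>M \<delta>O lact \<delta>F tens rank e coor
  for A :: "('a::complex_star_algebra) hopf" and ma anti
    and mm :: "'m::complex_star_algebra \<Rightarrow> 'm \<Rightarrow> 'm"
    and mo :: "'o::complex_vector \<Rightarrow> 'o \<Rightarrow> 'o" and incl delbar sg hs p J v \<delta>M \<delta>O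
    and lact :: "'m \<Rightarrow> 'f::complex_vector \<Rightarrow> 'f" and \<delta>F
    and tens :: "'o \<Rightarrow> 'f \<Rightarrow> 't::complex_vector" and rank e coor +
  fixes dF :: "'f \<Rightarrow> 't" and h :: "'f \<Rightarrow> 'f \<Rightarrow> 'm"
  assumes dF_linear: "clinear dF" and dF_range: "dF f \<in> cspan {tens y g | y g. p (0, 1) y = y}"
    and dF_lact: "dF (lact m f) = tens (delbar (incl m)) f + W (incl m) (dF f)"
    and dF_coact: "\<delta>T (dF f) = tensor_map id dF (\<delta>F f)"
    and dbar_dbar: "dbar dF (dbar dF t) = 0"
    and h_bij: "bij_betw h UNIV {\<phi>. (\<forall>f g. \<phi> (f + g) = \<phi> f + \<phi> g) \<and> (\<forall>m f. \<phi> (lact m f) = mm m (\<phi> f))}"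
    and h_add: "h (f + g) = h f + h g" and h_scale: "h (c *\<^sub>C f) = cnj c *\<^sub>C h f"
    and h_lact: "h (lact (star m) f) g = mm (h f g) m" and h_herm: "h f g = star (h g f)"
    and h_coact: "tensor_map id (\<lambda>\<psi>. \<psi> g) (tensor_map star h (\<delta>F f)) =
      tsum (\<delta>F g) (\<lambda>b g'. tsum (\<delta>M (h f g')) (\<lambda>c m. ma (anti b) c \<otimes> m))"
begin

abbreviation db where "db \<equiv> dbar dF"

lemmas db = dbar[OF dF_linear dF_lact]

lemma h_left: "h (f + f') g = h f g + h f' g" "h (c *\<^sub>C f) g = cnj c *\<^sub>C h f g"
  by (simp_all add: h_add h_scale plus_fun_def scaleC_fun_def)

lemma h_right: "h f (g + g') = h f g + h f g'" "h f (lact m g) = mm m (h f g)" "h f (c *\<^sub>C g) = c *\<^sub>C h f g"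
proof -
  have "h f \<in> {\<phi>. (\<forall>f g. \<phi> (f + g) = \<phi> f + \<phi> g) \<and> (\<forall>m f. \<phi> (lact m f) = mm m (\<phi> f))}"
    using h_bij unfolding bij_betw_def by blast
  then show 1: "h f (g + g') = h f g + h f g'" "h f (lact m g) = mm m (h f g)" for g g' m by auto
  show "h f (c *\<^sub>C g) = c *\<^sub>C h f g" unfolding scale_lact[of c g] 1(2) mm_scale ..
qed

lemma h_eqI: "(\<And>g. h f g = h f' g) \<Longrightarrow> f = f'"
proof -
  assume "\<And>g. h f g = h f' g"
  then have "h f = h f'" by blast
  moreover have "inj h" using h_bij by (simp add: bij_betw_def)
  ultimately show "f = f'" by (simp add: inj_eq)
qed

section \<open>Dual bases and the conjugate-linear Hodge map\<close>

definition dual :: "nat \<Rightarrow> 'f" where "dual i = (SOME g. h g = coor i)"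

lemma h_dual: "h (dual i) = coor i"
proof -
  have "coor i \<in> {\<phi>. (\<forall>f g. \<phi> (f + g) = \<phi> f + \<phi> g) \<and> (\<forall>m f. \<phi> (lact m f) = mm m (\<phi> f))}"
    using coor by simp
  then have "\<exists>g. h g = coor i" using h_bij unfolding bij_betw_def by (metis (no_types, lifting) imageE)
  then show ?thesis unfolding dual_def by (rule someI_ex)
qed

lemma basis: "(\<Sum>i<rank. lact (h (dual i) f) (e i)) = f"
  using coor_sum by (simp add: h_dual)

text \<open>Applying \<open>h\<close> and using Hermitian symmetry reduces this to the expansion of
  a test vector \<open>f\<close> in the elements \<open>e i\<close>. Thus the representatives
  \<open>dual i\<close> of the coordinates span as well, with coordinates
  \<open>h (e i)\<close>.\<close>

lemma dual_basis: "(\<Sum>i<rank. lact (h (e i) g) (dual i)) = g"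
proof (rule h_eqI)
  fix f
  have "additive (\<lambda>x. h x f)" "additive (h g)" by (simp_all add: additive_def h_left h_right)
  note sum = additive.sum[OF this(1)] additive.sum[OF this(2)]
  have "h (\<Sum>i<rank. lact (h (e i) g) (dual i)) f = (\<Sum>i<rank. mm (h (dual i) f) (star (h (e i) g)))"
    unfolding sum(1) using h_lact[of "star (h (e i) g)" for i] by (simp add: star_star)
  also have "\<dots> = h g (\<Sum>i<rank. lact (h (dual i) f) (e i))"
    unfolding sum(2) by (simp add: h_right flip: h_herm)
  finally show "h (\<Sum>i<rank. lact (h (e i) g) (dual i)) f = h g f" by (simp add: basis)
qed

definition R where "R = inv hs"

lemma hs_R: "hs (R y) = y" and R_hs: "R (hs x) = x"
  using hs_bij by (simp_all add: R_def bij_is_surj surj_f_inv_f bij_is_inj)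

lemma R: "R (x + y) = R x + R y" "R (c *\<^sub>C x) = cnj c *\<^sub>C R x" "R (mo (incl m) x) = mo (R x) (incl (star m))"
proof -
  have hs_eqI: "hs a = hs b \<Longrightarrow> a = b" for a b using R_hs by metis
  show "R (x + y) = R x + R y" "R (c *\<^sub>C x) = cnj c *\<^sub>C R x"
    by (rule hs_eqI; simp add: hs_R hs_add hs_scale)+
  show "R (mo (incl m) x) = mo (R x) (incl (star m))"
    by (rule hs_eqI) (simp add: hs_R hs_incl star_star)
qed

lemma hs_zero: "hs 0 = 0"
  using hs_add[of 0 0] by simp

text \<open>\<open>\<Psi>\<close> is the conjugate-linear Hodge map followed by evaluation. The dual basis makes it a bijection from
  the bundle-valued forms onto the linear maps from the bundle to the forms, with inverse \<open>\<Phi>\<close>.\<close>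

definition \<Psi> :: "'t \<Rightarrow> 'f \<Rightarrow> 'o" where
  "\<Psi> = lift_over UNIV UNIV tens (\<lambda>x g. \<lambda>f. mo (incl (h g f)) (hs x))"

lemma \<Psi>_aux: "additive \<Psi>" "\<Psi> (tens x g) = (\<lambda>f. mo (incl (h g f)) (hs x))"
proof -
  have b: "balanced (\<lambda>x g f. mo (incl (h g f)) (hs x))"
    by (rule balancedI) (simp_all add: fun_eq_iff bilin h_left plus_fun_def)
  have m: "(\<lambda>f. mo (incl (h g f)) (hs (mo x (incl m)))) = (\<lambda>f. mo (incl (h (lact m g) f)) (hs x))" for x m g
    using h_lact[of "star m" g] by (simp add: hs_incl star_star flip: mo_assoc incl_mult)
  show "additive \<Psi>" unfolding \<Psi>_def by (rule lift(1)[OF b m])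
  show "\<Psi> (tens x g) = (\<lambda>f. mo (incl (h g f)) (hs x))" unfolding \<Psi>_def by (rule lift(2)[OF b m])
qed

lemma \<Psi>_tens: "\<Psi> (tens x g) f = mo (incl (h g f)) (hs x)"
  by (simp add: \<Psi>_aux(2))

lemma \<Psi>_add: "\<Psi> (s + t) f = \<Psi> s f + \<Psi> t f" and \<Psi>_zero: "\<Psi> 0 f = 0"
  using additive.add[OF \<Psi>_aux(1)] additive.zero[OF \<Psi>_aux(1)] by (simp_all add: plus_fun_def zero_fun_def)

lemma \<Psi>_scale: "\<Psi> (c *\<^sub>C t) f = cnj c *\<^sub>C \<Psi> t f"
proof (rule T_ext[of "\<lambda>t. \<Psi> (c *\<^sub>C t) f" "\<lambda>t. cnj c *\<^sub>C \<Psi> t f"])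
  show "\<Psi> (c *\<^sub>C tens x g) f = cnj c *\<^sub>C \<Psi> (tens x g) f" for x g
    by (simp add: \<Psi>_tens bilin flip: tens_bilin(3))
qed (simp_all add: additive_def scaleC_add_right \<Psi>_add)

lemma \<Psi>_Hom: "\<Psi> t \<in> Hom"
proof (induction t rule: T_induct)
  case zero
  show ?case by (simp add: Hom_def \<Psi>_zero) (metis add_cancel_left_right mo_bilin(2))
next
  case (add s t)
  then show ?case by (simp add: Hom_def \<Psi>_add bilin)
next
  case (tens x f)
  then show ?case by (simp add: Hom_def \<Psi>_tens bilin h_right mo_assoc flip: incl_mult)
qed

lemmas \<Psi>_lin = \<Psi>_add \<Psi>_scale HomD[OF \<Psi>_Hom]

definition \<Phi> :: "('f \<Rightarrow> 'o) \<Rightarrow> 't" where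
  "\<Phi> u = (\<Sum>i<rank. tens (R (u (e i))) (dual i))"

lemma \<Psi>_\<Phi>: "u \<in> Hom \<Longrightarrow> \<Psi> (\<Phi> u) = u"
proof
  fix f assume u: "u \<in> Hom"
  have add: "additive (\<lambda>t. \<Psi> t f)" by (simp add: additive_def \<Psi>_add)
  have "\<Psi> (\<Phi> u) f = (\<Sum>i<rank. mo (incl (h (dual i) f)) (u (e i)))"
    unfolding \<Phi>_def additive.sum[OF add] by (simp add: \<Psi>_tens hs_R)
  also have "\<dots> = u (\<Sum>i<rank. lact (h (dual i) f) (e i))"
    unfolding additive.sum[OF Hom_additive[OF u]] by (simp add: HomD[OF u])
  finally show "\<Psi> (\<Phi> u) f = u f" by (simp add: basis)
qed

lemma \<Phi>_\<Psi>: "\<Phi> (\<Psi> t) = t"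
proof (rule T_ext[of "\<lambda>t. \<Phi> (\<Psi> t)" "\<lambda>t. t"])
  fix x g
  have "\<Phi> (\<Psi> (tens x g)) = (\<Sum>i<rank. tens x (lact (h (e i) g) (dual i)))"
    unfolding \<Phi>_def \<Psi>_tens by (simp add: R R_hs tens_balanced flip: h_herm)
  also have "\<dots> = tens x (\<Sum>i<rank. lact (h (e i) g) (dual i))"
    by (rule additive.sum[symmetric]) (simp add: additive_def bilin)
  finally show "\<Phi> (\<Psi> (tens x g)) = tens x g" by (simp add: dual_basis)
qed (simp_all add: additive_def \<Phi>_def \<Psi>_add R bilin sum.distrib)

lemma ev_\<Psi>: "clinear (ev (\<Psi> t))" "ev (\<Psi> t) (tens x f) = mo x (\<Psi> t f)" "ev (\<Psi> t) (W y s) = mo y (ev (\<Psi> t) s)"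
  by (rule ev[OF \<Psi>_Hom] ev_W[OF \<Psi>_Hom])+

lemma ev_\<Psi>_conj: "ev (\<Psi> (s + t)) r = ev (\<Psi> s) r + ev (\<Psi> t) r" "ev (\<Psi> (c *\<^sub>C t)) r = cnj c *\<^sub>C ev (\<Psi> t) r"
proof -
  show "ev (\<Psi> (s + t)) r = ev (\<Psi> s) r + ev (\<Psi> t) r"
    by (rule T_ext[of "ev (\<Psi> (s + t))" "\<lambda>r. ev (\<Psi> s) r + ev (\<Psi> t) r"])
      (simp_all add: additive_def clinearD[OF ev_\<Psi>(1)] ev_\<Psi>(2) \<Psi>_add bilin)
  show "ev (\<Psi> (c *\<^sub>C t)) r = cnj c *\<^sub>C ev (\<Psi> t) r"
    by (rule T_ext[of "ev (\<Psi> (c *\<^sub>C t))" "\<lambda>r. cnj c *\<^sub>C ev (\<Psi> t) r"])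
      (simp_all add: additive_def clinearD[OF ev_\<Psi>(1)] ev_\<Psi>(2) \<Psi>_scale bilin)
qed

section \<open>The inner product of bundle-valued forms\<close>

definition ip where "ip s t = v (ev (\<Psi> t) s)"

lemma ip_bilin: "ip (r + s) t = ip r t + ip s t" "ip r (s + t) = ip r s + ip r t" "ip (c *\<^sub>C s) t = c * ip s t"
  by (simp_all add: ip_def clinearD[OF ev_\<Psi>(1)] ev_\<Psi>_conj bilin scaleC_complex_def)

lemma ip_tens: "ip (tens x f) (tens y g) = v (mo (mo x (incl (h g f))) (hs y))"
  by (simp add: ip_def ev_\<Psi> \<Psi>_tens mo_assoc)

lemma ip_sym: "ip s t = cnj (ip t s)"
proof (rule T_ext[of "\<lambda>s. ip s t" "\<lambda>s. cnj (ip t s)"])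
  fix x f
  show "ip (tens x f) t = cnj (ip t (tens x f))"
  proof (rule T_ext[of "\<lambda>t. ip (tens x f) t" "\<lambda>t. cnj (ip t (tens x f))"])
    fix y g
    have "ip (tens x f) (tens y g) = cnj (v (mo y (hs (mo x (incl (h g f))))))"
      unfolding ip_tens by (rule v_hermitian)
    also have "hs (mo x (incl (h g f))) = mo (incl (h f g)) (hs x)"
      using h_herm[of f g] by (simp add: hs_incl)
    finally show "ip (tens x f) (tens y g) = cnj (ip (tens y g) (tens x f))" by (simp add: ip_tens mo_assoc)
  qed (simp_all add: additive_def ip_bilin)
qed (simp_all add: additive_def ip_bilin)

lemma \<Phi>_zero: "\<Phi> (\<lambda>f. 0) = 0"
  using \<Phi>_\<Psi>[of 0] \<Psi>_zero by (metis ext)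

text \<open>The test vector is \<open>tens x f\<close> with \<open>x = R (\<Psi> t f)\<close>. Its
  product with \<open>t\<close> is \<open>v (mo x (hs x))\<close>, so definiteness on forms makes
  every value of \<open>\<Psi> t\<close> vanish.\<close>

lemma ip_nondegenerate:
  assumes "\<And>s. ip s t = 0" shows "t = 0"
proof -
  have "\<Psi> t f = 0" for f
  proof -
    have "v (mo (R (\<Psi> t f)) (hs (R (\<Psi> t f)))) = 0"
      using assms[of "tens (R (\<Psi> t f)) f"] by (simp add: ip_def ev_\<Psi> hs_R)
    then have "R (\<Psi> t f) = 0" by (rule v_definite)
    then show ?thesis using hs_R hs_zero by metis
  qed
  then have "\<Psi> t = (\<lambda>f. 0)" by blast
  then show ?thesis using \<Phi>_\<Psi>[of t] \<Phi>_zero by simp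
qed

lemma ip_P: "ip (P i s) t = ip s (P i t)"
proof (rule T_ext[of "\<lambda>s. ip (P i s) t" "\<lambda>s. ip s (P i t)"])
  fix x f
  show "ip (P i (tens x f)) t = ip (tens x f) (P i t)"
    by (rule T_ext[of "\<lambda>t. ip (P i (tens x f)) t" "\<lambda>t. ip (tens x f) (P i t)"])
      (simp_all add: additive_def clinearD[OF P(1)] ip_bilin P(2) ip_tens v_p flip: p_incl)
qed (simp_all add: additive_def clinearD[OF P(1)] ip_bilin)

text \<open>\<open>dF\<close> takes values in bidegree \<open>(0, 1)\<close>, so multiplying them by
  a form shifts the second degree of that form by one.\<close>

lemma P_W_dF: "P (k, l + 1) (W x (dF f)) = W (p (k, l) x) (dF f)" "P (k, 0) (W x (dF f)) = 0"
proof -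
  have "P (k, l + 1) (W x t) = W (p (k, l) x) t \<and> P (k, 0) (W x t) = 0"
    if "t \<in> cspan {tens y g | y g. p (0, 1) y = y}" for t
    using that
  proof (induction rule: complex_vector.span_induct_alt)
    case base
    show ?case by (simp add: clinear_zero[OF P(1)])
  next
    case (step c s t)
    then obtain y g where s: "s = tens y g" "p (0, 1) y = y" by blast
    then have "P (k, l + 1) (W x s) = W (p (k, l) x) s" "P (k, 0) (W x s) = 0"
      using p_mo[OF s(2)] by (simp_all add: W(2) P(2))
    then show ?case using step
      by (simp add: clinearD[OF P(1)] clinearD[OF W(1)] complex_vector.scale_zero_right)
  qed
  then show "P (k, l + 1) (W x (dF f)) = W (p (k, l) x) (dF f)" "P (k, 0) (W x (dF f)) = 0"
    using dF_range by blast+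
qed

lemma db_P: "db (P (k, l) t) = P (k, l + 1) (db t)" and P_db_0: "P (k, 0) (db t) = 0"
proof -
  show "db (P (k, l) t) = P (k, l + 1) (db t)"
  proof (rule T_ext[of "\<lambda>t. db (P (k, l) t)" "\<lambda>t. P (k, l + 1) (db t)"])
    fix x f
    have "P (k, l + 1) (db (tens x f)) = tens (p (k, l + 1) (delbar x)) f + P (k, l + 1) (W (sg x) (dF f))"
      by (simp only: db(2) clinearD[OF P(1)] P(2))
    also have "\<dots> = db (P (k, l) (tens x f))" unfolding P_W_dF p_delbar p_sg by (simp add: P(2) db(2))
    finally show "db (P (k, l) (tens x f)) = P (k, l + 1) (db (tens x f))" ..
  qed (simp_all add: additive_def clinearD[OF P(1)] clinearD[OF db(1)])
  show "P (k, 0) (db t) = 0"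
    by (rule T_ext[of "\<lambda>t. P (k, 0) (db t)" "\<lambda>t. 0"])
      (simp_all add: additive_def clinearD[OF P(1)] clinearD[OF db(1)] db(2) P(2) p_delbar P_W_dF)
qed

text \<open>\<open>N\<close> is the holomorphic structure on the dual bundle, determined by the Leibniz rule for the evaluation pairing.\<close>

definition N where "N u f = delbar (u f) - ev u (dF f)"

text \<open>The terms with \<open>delbar (incl m)\<close> from the two Leibniz rules cancel, which
  leaves an \<open>M\<close>-linear map; \<open>sg\<close> preserves this because it fixes
  \<open>incl m\<close>.\<close>

lemma N_Hom: "u \<in> Hom \<Longrightarrow> (\<lambda>f. - sg (N u f)) \<in> Hom"
proof -
  assume u: "u \<in> Hom"
  note l = clinearD[OF ev(1)[OF u]] and hom = HomD[OF u]
  have neg: "mo y (- x) = - mo y x" "mo y (x - x') = mo y x - mo y x'" for x x' y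
    using additive.minus[of "mo y"] additive.diff[of "mo y"] by (simp_all add: additive_def bilin)
  have sgd: "sg (x - y) = sg x - sg y" for x y
    by (rule clinear_diff[OF sg_linear])
  have "N u (f + g) = N u f + N u g" for f g
    by (simp add: N_def hom bilin clinearD[OF dF_linear] l)
  moreover have "N u (lact m f) = mo (incl m) (N u f)" for m f
    by (simp add: N_def hom bilin dF_lact l ev(2)[OF u] ev_W[OF u] delbar_mult sg_incl neg)
  ultimately show ?thesis by (simp add: Hom_def bilin sg_mult sg_incl neg)
qed

definition adj where "adj t = \<Phi> (\<lambda>f. - sg (N (\<Psi> t) f))"

lemma \<Psi>_adj: "\<Psi> (adj t) f = - sg (N (\<Psi> t) f)"
  unfolding adj_def using \<Psi>_\<Phi>[OF N_Hom[OF \<Psi>_Hom]] by simp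

lemma \<Psi>_eqI: "(\<And>f. \<Psi> s f = \<Psi> t f) \<Longrightarrow> s = t"
  using \<Phi>_\<Psi> by (metis ext)

lemma adj_linear: "clinear adj"
proof -
  have "N (\<Psi> (s + t)) f = N (\<Psi> s) f + N (\<Psi> t) f" "N (\<Psi> (c *\<^sub>C s)) f = cnj c *\<^sub>C N (\<Psi> s) f" for s t c f
    by (simp_all add: N_def \<Psi>_add \<Psi>_scale ev_\<Psi>_conj bilin complex_vector.scale_right_diff_distrib)
  then show ?thesis
    by (intro clinearI \<Psi>_eqI) (simp_all add: \<Psi>_adj \<Psi>_add \<Psi>_scale bilin complex_vector.scale_minus_right)
qed

text \<open>The integral of \<open>delbar (mo x (\<Psi> t f))\<close> vanishes, which leaves
  \<open>- v (mo (sg x) (N (\<Psi> t) f))\<close>. Under the integral \<open>sg\<close> moves to the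
  second factor, and \<open>adj\<close> is defined to match the result.\<close>

lemma ip_db: "ip (db s) t = ip s (adj t)"
proof (rule T_ext[of "\<lambda>s. ip (db s) t" "\<lambda>s. ip s (adj t)"])
  fix x f
  have neg: "mo y (- x) = - mo y x" "mo y (x - x') = mo y x - mo y x'" for x x' y
    using additive.minus[of "mo y"] additive.diff[of "mo y"] by (simp_all add: additive_def bilin)
  have "ev (\<Psi> t) (db (tens x f)) = delbar (mo x (\<Psi> t f)) - mo (sg x) (N (\<Psi> t) f)"
    by (simp add: db(2) clinearD[OF ev_\<Psi>(1)] ev_\<Psi> delbar_mult N_def neg)
  then have "ip (db (tens x f)) t = - v (mo (sg x) (N (\<Psi> t) f))"
    by (simp add: ip_def clinear_diff[OF v_linear] v_delbar)
  also have "\<dots> = ip (tens x f) (adj t)"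
    by (simp add: ip_def ev_\<Psi> \<Psi>_adj neg v_sg clinear_minus[OF v_linear])
  finally show "ip (db (tens x f)) t = ip (tens x f) (adj t)" .
qed (simp_all add: additive_def clinearD[OF db(1)] ip_bilin)

subsection \<open>Covariance\<close>

lemma \<delta>T_db: "\<delta>T (db t) = tensor_map id db (\<delta>T t)"
proof (rule T_ext[of "\<lambda>t. \<delta>T (db t)" "\<lambda>t. tensor_map id db (\<delta>T t)"])
  have b: "balanced (\<lambda>a t. id (a :: 'a) \<otimes> db t)" by (rule balanced_linear[OF clinear_id(1) db(1)])
  have bd: "balanced (\<lambda>a t. id (a :: 'a) \<otimes> dF t)" by (rule balanced_linear[OF clinear_id(1) dF_linear])
  show "additive (\<lambda>t. tensor_map id db (\<delta>T t))"
    by (rule additive.intro) (simp only: tensor_map_tsum[OF b] clinearD(1)[OF \<delta>T(1)] tsum_add[OF b])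
  show "additive (\<lambda>t. \<delta>T (db t))" by (simp add: additive_def clinearD[OF \<delta>T(1)] clinearD[OF db(1)])
  fix x f
  have b1: "balanced (\<lambda>a x'. tsum (\<delta>F f) (\<lambda>b g. ma a b \<otimes> tens x' g))"
    by (rule balancedI) (simp_all add: bilin)
  have b2: "balanced (\<lambda>a y. tsum (\<delta>F f) (\<lambda>b g. ma a b \<otimes> W y (dF g)))"
    by (rule balancedI) (simp_all add: bilin W_left)
  have b3: "balanced (\<lambda>b s. ma a b \<otimes> W y s)" for a y
    by (rule balancedI) (simp_all add: bilin clinearD[OF W(1)])
  have "\<delta>T (W (sg x) (dF f)) = tsum (\<delta>O (sg x)) (\<lambda>a y. tsum (\<delta>T (dF f)) (\<lambda>b s. ma a b \<otimes> W y s))"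
    using \<delta>T_W_sum[OF balanced_pure, of "sg x" "dF f"] by (simp add: tsum_self)
  also have "\<dots> = tsum (\<delta>O (sg x)) (\<lambda>a y. tsum (\<delta>F f) (\<lambda>b g. ma a b \<otimes> W y (dF g)))"
    by (simp only: dF_coact tsum_tensor_map[OF bd b3] id_apply)
  also have "\<dots> = tsum (\<delta>O x) (\<lambda>a y. tsum (\<delta>F f) (\<lambda>b g. ma a b \<otimes> W (sg y) (dF g)))"
    by (simp add: \<delta>O_sg tsum_tensor_map[OF balanced_linear[OF clinear_id(1) sg_linear] b2])
  finally have 1: "\<delta>T (W (sg x) (dF f)) = \<dots>" .
  have 2: "\<delta>T (tens (delbar x) f) = tsum (\<delta>O x) (\<lambda>a y. tsum (\<delta>F f) (\<lambda>b g. ma a b \<otimes> tens (delbar y) g))"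
    by (simp add: \<delta>T(2) \<delta>O_delbar tsum_tensor_map[OF balanced_linear[OF clinear_id(1) delbar_linear] b1])
  show "\<delta>T (db (tens x f)) = tensor_map id db (\<delta>T (tens x f))"
    unfolding tensor_map_tsum[OF b] \<delta>T_sum[OF b]
    by (simp add: db(2) clinearD[OF \<delta>T(1)] 1 2 bilin)
qed

lemma h_sum: "tsum (\<delta>F f) (\<lambda>a f'. star a \<otimes> h f' g) = tsum (\<delta>F g) (\<lambda>b g'. tsum (\<delta>M (h f g')) (\<lambda>c m. ma (anti b) c \<otimes> m))"
proof -
  have b: "balanced (\<lambda>(a :: 'a) f. star a \<otimes> h f)"
    by (rule balanced_conj_linear) (simp_all add: additive_def star_add star_scaleC h_add h_scale)
  have b': "balanced (\<lambda>(a :: 'a) \<psi>. id a \<otimes> (\<psi> :: 'f \<Rightarrow> 'm) g)"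
    by (rule balancedI) (simp_all add: pure_tensor_bilinear plus_fun_def scaleC_fun_def)
  show ?thesis using h_coact[of g f, unfolded tensor_map_tsum[OF b'] tsum_tensor_map[OF b b']] by simp
qed

text \<open>Multiplying by \<open>g\<^bsub>(-1)\<^esub>\<close> cancels the antipode in the equivariance of the Hermitian structure.\<close>

lemma \<delta>M_h: "\<delta>M (h f g) = tsum (\<delta>F g) (\<lambda>b g'. tsum (\<delta>F f) (\<lambda>a f'. ma b (star a) \<otimes> h f' g'))"
proof -
  have bm: "balanced (\<lambda>c m. ma b c \<otimes> (m :: 'm))" for b by (rule balancedI) (simp_all add: bilin)
  have "tsum (\<delta>F g) (\<lambda>b g'. tsum (\<delta>F f) (\<lambda>a f'. ma b (star a) \<otimes> h f' g')) =
      tsum (\<delta>F g) (\<lambda>b g'. tsum (tsum (\<delta>F f) (\<lambda>a f'. star a \<otimes> h f' g')) (\<lambda>c m. ma b c \<otimes> m))"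
    by (simp add: tsum_tsum[OF bm] tsum_pure[OF bm])
  also have "\<dots> = tsum (\<delta>F g) (\<lambda>b g0. tsum (\<delta>F g0) (\<lambda>b' g'. tsum (\<delta>M (h f g')) (\<lambda>c m. ma b (ma (anti b') c) \<otimes> m)))"
    by (simp add: h_sum tsum_tsum[OF bm] tsum_pure[OF bm])
  also have "\<dots> = tsum (\<delta>F g) (\<lambda>x g'. tsum (comult A x) (\<lambda>b b'. tsum (\<delta>M (h f g')) (\<lambda>c m. ma b (ma (anti b') c) \<otimes> m)))"
  proof (rule comodule_coassoc[OF \<delta>F comult_linear, symmetric])
    have *: "balanced (\<lambda>c m. ma b (ma (anti b') c) \<otimes> (m :: 'm))" for b b'
      by (rule balancedI) (simp_all add: bilin)
    show "balanced (\<lambda>b' g'. tsum (\<delta>M (h f g')) (\<lambda>c m. ma b (ma (anti b') c) \<otimes> m))" for b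
      by (rule balancedI) (simp_all add: bilin h_right tsum_add[OF *] tsum_scaleC[OF *])
    show "balanced (\<lambda>b b'. tsum (\<delta>M (h f g')) (\<lambda>c m. ma b (ma (anti b') c) \<otimes> m))" for g'
      by (rule balancedI) (simp_all add: bilin)
  qed
  also have "\<dots> = tsum (\<delta>F g) (\<lambda>x g'. counit A x *\<^sub>C \<delta>M (h f g'))"
  proof -
    have "tsum (comult A x) (\<lambda>b b'. tsum t (\<lambda>c m. ma b (ma (anti b') c) \<otimes> m)) = counit A x *\<^sub>C t"
      for x and t :: "('a, 'm) tensor"
    proof -
      have "tsum (comult A x) (\<lambda>b b'. ma (ma b (anti b')) c \<otimes> m) = counit A x *\<^sub>C (c \<otimes> m)" for c and m :: 'm
        by (subst additive_tsum[of "\<lambda>y. ma y c \<otimes> m", symmetric])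
          (simp_all add: additive_def bilin anti_right ma_one)
      then show ?thesis
        by (subst tsum_swap) (simp add: tsum_scale tsum_self flip: ma_assoc)
    qed
    then show ?thesis by simp
  qed
  also have "\<dots> = \<delta>M (h f (tsum (\<delta>F g) (\<lambda>x g'. counit A x *\<^sub>C g')))"
    by (subst additive_tsum[of "\<lambda>g. \<delta>M (h f g)"]) (simp_all add: additive_def bilin h_right)
  finally show ?thesis by (simp add: comodule_counit[OF \<delta>F counit_linear])
qed

text \<open>Evaluates an \<open>A\<close>-valued tensor \<open>Y\<close> at \<open>f\<close> through
  \<open>\<Psi>\<close>, with the coaction of \<open>f\<close> multiplied in. The
  \<open>star\<close> is there because \<open>\<Psi>\<close> is conjugate-linear in its first
  argument. At \<open>Y = \<delta>T t\<close> the value is the coaction of the form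
  \<open>\<Psi> t f\<close>.\<close>

definition pairing where
  "pairing f Y = tsum (\<delta>F f) (\<lambda>b g. tsum Y (\<lambda>a t. ma b (star a) \<otimes> \<Psi> t g))"

lemma pair_balanced: "balanced (\<lambda>a t. ma b (star a) \<otimes> \<Psi> t g)" "balanced (\<lambda>b g. ma b (star a) \<otimes> \<Psi> t g)"
  by (rule balancedI; simp add: bilin \<Psi>_lin)+

text \<open>Equivariance of \<open>\<Psi>\<close>, assembled from that of the Hermitian structure in
  \<open>\<delta>M_h\<close> and of the conjugate-linear Hodge map in
  \<open>\<delta>O_hs\<close>.\<close>

lemma \<delta>O_\<Psi>: "\<delta>O (\<Psi> t f) = pairing f (\<delta>T t)"
proof (rule T_ext[of "\<lambda>t. \<delta>O (\<Psi> t f)" "\<lambda>t. pairing f (\<delta>T t)"])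
  fix x g
  have b2: "balanced (\<lambda>a z. ma c a \<otimes> mo y z)" for c y by (rule balancedI) (simp_all add: bilin)
  have b3: "balanced (\<lambda>(a :: 'a) x. star a \<otimes> hs x)"
    by (rule balanced_conj_linear) (simp_all add: additive_def star_add star_scaleC hs_add hs_scale)
  have b1': "balanced (\<lambda>c y. tsum (\<delta>O x) (\<lambda>a z. ma c (star a) \<otimes> mo y (hs z)))"
    by (rule balancedI) (simp_all add: bilin)
  have b4: "balanced (\<lambda>c k. tsum (\<delta>O x) (\<lambda>a z. ma c (star a) \<otimes> mo (incl k) (hs z)))"
    by (rule balancedI) (simp_all add: bilin)
  have "\<delta>O (\<Psi> (tens x g) f) = tsum (\<delta>O (incl (h g f))) (\<lambda>c y. tsum (\<delta>O (hs x)) (\<lambda>a z. ma c a \<otimes> mo y z))"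
    by (simp add: \<Psi>_tens \<delta>O_mult)
  also have "\<dots> = tsum (\<delta>M (h g f)) (\<lambda>c k. tsum (\<delta>O x) (\<lambda>a z. ma c (star a) \<otimes> mo (incl k) (hs z)))"
    by (simp add: \<delta>O_hs tsum_tensor_map[OF b3 b2] incl_sum[OF b1'])
  also have "\<dots> = tsum (\<delta>F f) (\<lambda>b f'. tsum (\<delta>F g) (\<lambda>a g'. tsum (\<delta>O x) (\<lambda>a' z. ma (ma b (star a)) (star a') \<otimes> mo (incl (h g' f')) (hs z))))"
    by (simp add: \<delta>M_h tsum_tsum[OF b4] tsum_pure[OF b4])
  also have "\<dots> = tsum (\<delta>F f) (\<lambda>b f'. tsum (\<delta>O x) (\<lambda>a' z. tsum (\<delta>F g) (\<lambda>a g'. ma (ma b (star a)) (star a') \<otimes> mo (incl (h g' f')) (hs z))))"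
    by (subst (2) tsum_swap) simp
  also have "\<dots> = pairing f (\<delta>T (tens x g))"
    by (simp add: pairing_def \<delta>T_sum[OF pair_balanced(1)] \<Psi>_tens ma_star ma_assoc)
  finally show "\<delta>O (\<Psi> (tens x g) f) = pairing f (\<delta>T (tens x g))" .
qed (simp_all add: additive_def \<Psi>_add bilin pairing_def clinearD[OF \<delta>T(1)] tsum_add[OF pair_balanced(1)])

lemma \<delta>O_ev: "\<delta>O (ev (\<Psi> t) s) = tsum (\<delta>T s) (\<lambda>b r. tsum (\<delta>T t) (\<lambda>a q. ma b (star a) \<otimes> ev (\<Psi> q) r))"
proof -
  have b: "balanced (\<lambda>b r. tsum (\<delta>T t) (\<lambda>a q. ma b (star a) \<otimes> ev (\<Psi> q) r))"
    by (rule balancedI) (simp_all add: bilin clinearD[OF ev_\<Psi>(1)])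
  show ?thesis
  proof (rule T_ext[of "\<lambda>s. \<delta>O (ev (\<Psi> t) s)" "\<lambda>s. tsum (\<delta>T s) (\<lambda>b r. tsum (\<delta>T t) (\<lambda>a q. ma b (star a) \<otimes> ev (\<Psi> q) r))"])
    fix x f
    have b2: "balanced (\<lambda>b y'. ma a b \<otimes> mo x' y')" for a x' by (rule balancedI) (simp_all add: bilin)
    show "\<delta>O (ev (\<Psi> t) (tens x f)) = tsum (\<delta>T (tens x f)) (\<lambda>b r. tsum (\<delta>T t) (\<lambda>a q. ma b (star a) \<otimes> ev (\<Psi> q) r))"
      by (simp add: ev_\<Psi> \<delta>O_mult \<delta>O_\<Psi> pairing_def tsum_tsum[OF b2] tsum_pure[OF b2] \<delta>T_sum[OF b] ma_assoc)
  qed (simp_all add: additive_def clinearD[OF ev_\<Psi>(1)] bilin clinearD[OF \<delta>T(1)] tsum_add[OF b])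
qed

text \<open>The antipode cancels \<open>f\<^bsub>(-1)\<^esub>\<close> from the pairing, and the dual basis then recovers the tensor.\<close>

lemma pairing_injective:
  assumes eq: "\<And>f. pairing f Y = pairing f Z" shows "Y = Z"
proof -
  have bm: "balanced (\<lambda>c m. ma b c \<otimes> (m :: 'o))" for b by (rule balancedI) (simp_all add: bilin)
  have cancel: "tsum Y (\<lambda>a t. star a \<otimes> \<Psi> t f) = tsum (\<delta>F f) (\<lambda>c g. tsum (pairing g Y) (\<lambda>d y. ma (anti c) d \<otimes> y))" for f Y
  proof -
    have "tsum (\<delta>F f) (\<lambda>c g. tsum (pairing g Y) (\<lambda>d y. ma (anti c) d \<otimes> y)) =
      tsum (\<delta>F f) (\<lambda>c f0. tsum (\<delta>F f0) (\<lambda>b g. tsum Y (\<lambda>a t. ma (anti c) (ma b (star a)) \<otimes> \<Psi> t g)))"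
      by (simp add: pairing_def tsum_tsum[OF bm] tsum_pure[OF bm])
    also have "\<dots> = tsum (\<delta>F f) (\<lambda>x g. tsum (comult A x) (\<lambda>c b. tsum Y (\<lambda>a t. ma (anti c) (ma b (star a)) \<otimes> \<Psi> t g)))"
      by (rule comodule_coassoc[OF \<delta>F comult_linear, symmetric])
        (rule balancedI; simp add: bilin \<Psi>_lin)+
    also have "\<dots> = tsum (\<delta>F f) (\<lambda>x g. counit A x *\<^sub>C tsum Y (\<lambda>a t. star a \<otimes> \<Psi> t g))"
    proof -
      have "tsum (comult A x) (\<lambda>c b. ma (ma (anti c) b) d \<otimes> y) = counit A x *\<^sub>C (d \<otimes> y)" for x d and y :: 'o
        by (subst additive_tsum[of "\<lambda>z. ma z d \<otimes> y", symmetric])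
          (simp_all add: additive_def bilin anti_left ma_one)
      then have "tsum (comult A x) (\<lambda>c b. tsum Y (\<lambda>a t. ma (anti c) (ma b (star a)) \<otimes> \<Psi> t g)) =
          counit A x *\<^sub>C tsum Y (\<lambda>a t. star a \<otimes> \<Psi> t g)" for x g
        by (subst tsum_swap) (simp add: tsum_scale flip: ma_assoc)
      then show ?thesis by simp
    qed
    also have "\<dots> = tsum Y (\<lambda>a t. star a \<otimes> \<Psi> t (tsum (\<delta>F f) (\<lambda>x g. counit A x *\<^sub>C g)))"
      by (subst additive_tsum[of "\<lambda>g. tsum Y (\<lambda>a t. star a \<otimes> \<Psi> t g)"]) (simp_all add: additive_def bilin \<Psi>_lin)
    finally show ?thesis by (simp add: comodule_counit[OF \<delta>F counit_linear])
  qed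
  \<comment> \<open>This is \<open>\<Phi> (\<Psi> t) = t\<close> applied in the second leg; the two
    occurrences of \<open>star\<close> cancel in the first.\<close>
  have recover: "X = (\<Sum>i<rank. tsum (tsum X (\<lambda>a t. star a \<otimes> \<Psi> t (e i))) (\<lambda>a y. star a \<otimes> tens (R y) (dual i)))"
    for X :: "('a, 't) tensor"
  proof -
    have b: "balanced (\<lambda>(a :: 'a) y. star a \<otimes> tens (R y) (dual i))" for i
      by (rule balanced_conj_linear) (simp_all add: additive_def bilin R)
    have "(\<Sum>i<rank. tsum (tsum X (\<lambda>a t. star a \<otimes> \<Psi> t (e i))) (\<lambda>a y. star a \<otimes> tens (R y) (dual i))) =
        tsum X (\<lambda>a t. \<Sum>i<rank. a \<otimes> tens (R (\<Psi> t (e i))) (dual i))"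
      by (simp add: tsum_tsum[OF b] tsum_pure[OF b] star_star tsum_sum)
    also have "\<dots> = tsum X (\<lambda>a t. a \<otimes> \<Phi> (\<Psi> t))"
      unfolding \<Phi>_def additive.sum[OF balanced_additive(1)[OF balanced_pure]] ..
    finally show ?thesis by (simp add: \<Phi>_\<Psi> tsum_self)
  qed
  show ?thesis using recover[of Y] recover[of Z] by (simp add: cancel eq)
qed

text \<open>\<open>adj t\<close> is accessible through the forms \<open>\<Psi> (adj t) f\<close>,
  which are built from \<open>delbar\<close>, \<open>ev\<close>, \<open>dF\<close> and
  \<open>sg\<close>, all known to be equivariant; \<open>pairing_injective\<close> transfers this
  back to tensors.\<close>

lemma \<delta>T_adj: "\<delta>T (adj t) = tensor_map id adj (\<delta>T t)"
proof (rule pairing_injective)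
  fix f
  have bev: "balanced (\<lambda>b r. tsum (\<delta>T t) (\<lambda>a q. ma b (star a) \<otimes> ev (\<Psi> q) r))"
    by (rule balancedI) (simp_all add: bilin clinearD[OF ev_\<Psi>(1)])
  have tm: "a \<otimes> (- y) = - (a \<otimes> y)" "a \<otimes> (y - z) = a \<otimes> y - a \<otimes> z" for a :: 'a and y z :: 'o
    using additive.minus[OF balanced_additive(1)[OF balanced_pure]]
      additive.diff[OF balanced_additive(1)[OF balanced_pure]] by auto
  have 1: "\<delta>O (delbar (\<Psi> t f)) = tsum (\<delta>F f) (\<lambda>b g. tsum (\<delta>T t) (\<lambda>a q. ma b (star a) \<otimes> delbar (\<Psi> q g)))"
    unfolding \<delta>O_delbar tensor_map_id_tsum[OF delbar_linear] \<delta>O_\<Psi> pairing_def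
    by (simp only: tsum_tsum[OF balanced_right[OF delbar_linear]] tsum_pure[OF balanced_right[OF delbar_linear]])
  have 2: "\<delta>O (ev (\<Psi> t) (dF f)) = tsum (\<delta>F f) (\<lambda>b g. tsum (\<delta>T t) (\<lambda>a q. ma b (star a) \<otimes> ev (\<Psi> q) (dF g)))"
    unfolding \<delta>O_ev dF_coact by (rule tsum_tensor_map_id[OF dF_linear bev])
  have "\<delta>O (N (\<Psi> t) f) = tsum (\<delta>F f) (\<lambda>b g. tsum (\<delta>T t) (\<lambda>a q. ma b (star a) \<otimes> N (\<Psi> q) g))"
    unfolding N_def clinear_diff[OF \<delta>O_linear] 1 2 tm tsum_minus ..
  then have "\<delta>O (sg (N (\<Psi> t) f)) = tsum (\<delta>F f) (\<lambda>b g. tsum (\<delta>T t) (\<lambda>a q. ma b (star a) \<otimes> sg (N (\<Psi> q) g)))"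
    unfolding \<delta>O_sg tensor_map_id_tsum[OF sg_linear]
    by (simp only: tsum_tsum[OF balanced_right[OF sg_linear]] tsum_pure[OF balanced_right[OF sg_linear]])
  then have "\<delta>O (\<Psi> (adj t) f) = tsum (\<delta>F f) (\<lambda>b g. tsum (\<delta>T t) (\<lambda>a q. ma b (star a) \<otimes> \<Psi> (adj q) g))"
    unfolding \<Psi>_adj clinear_minus[OF \<delta>O_linear] tm
    by (simp add: additive_tsum[of uminus] additive_def)
  also have "\<dots> = pairing f (tensor_map id adj (\<delta>T t))"
    by (simp add: pairing_def tsum_tensor_map_id[OF adj_linear pair_balanced(1)])
  finally show "pairing f (\<delta>T (adj t)) = pairing f (tensor_map id adj (\<delta>T t))" by (simp add: \<delta>O_\<Psi>)
qed

sublocale hodge_theory ip db adj P J \<delta>T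
proof (rule hodge_theory.intro)
  fix x y z :: 't and c :: complex and i j :: "nat \<times> nat" and k l :: nat
  show "ip (x + y) z = ip x z + ip y z" by (rule ip_bilin(1))
  show "ip (c *\<^sub>C x) y = c * ip x y" by (rule ip_bilin(3))
  show "ip x y = cnj (ip y x)" by (rule ip_sym)
  show "y = 0" if "\<And>x. ip x y = 0" for y by (rule ip_nondegenerate) (rule that)
  show "clinear db" by (rule db(1))
  show "db (db x) = 0" by (rule dbar_dbar)
  show "ip (db x) y = ip x (adj y)" by (rule ip_db)
  show "clinear (P i)" by (rule P(1))
  show "P i (P j x) = (if i = j then P i x else 0)" by (rule P_P)
  show "finite J" by (rule J)
  show "(\<Sum>i\<in>J. P i x) = x" by (rule P_sum)
  show "db (P (k, l) x) = P (k, l + 1) (db x)" by (rule db_P)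
  show "P (k, 0) (db x) = 0" by (rule P_db_0)
  show "ip (P i x) y = ip x (P i y)" by (rule ip_P)
  show "\<delta>T (db x) = tensor_map id db (\<delta>T x)" by (rule \<delta>T_db)
  show "\<delta>T (adj x) = tensor_map id adj (\<delta>T x)" by (rule \<delta>T_adj)
  show "\<delta>T (P i x) = tensor_map id (P i) (\<delta>T x)" by (rule \<delta>T_P)
qed

end

context form_bundle
begin

lemma span_bidegree: "cspan {tens x f | x f. p i x = x} = {t. P i t = t}"
proof
  have sub: "csubspace {t. P i t = t}"
    by (rule complex_vector.subspaceI) (simp_all add: clinearD[OF P(1)] clinear_zero[OF P(1)])
  show "cspan {tens x f | x f. p i x = x} \<subseteq> {t. P i t = t}"
    by (rule complex_vector.span_minimal[OF _ sub]) (auto simp: P(2))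
  have *: "P i t \<in> cspan {tens x f | x f. p i x = x}" for t
  proof (induction t rule: T_induct)
    case zero
    then show ?case by (simp add: clinear_zero[OF P(1)] complex_vector.span_zero)
  next
    case (add s t)
    then show ?case by (simp add: clinearD[OF P(1)] complex_vector.span_add)
  next
    case (tens x f)
    have "p i (p i x) = p i x" by (simp add: p_p)
    then show ?case unfolding P(2) by (intro complex_vector.span_base) blast
  qed
  show "{t. P i t = t} \<subseteq> cspan {tens x f | x f. p i x = x}"
  proof
    fix t assume "t \<in> {t. P i t = t}"
    then have "t = P i t" by simp
    also note *
    finally show "t \<in> cspan {tens x f | x f. p i x = x}" .
  qed
qed

end

context hermitian_bundle
begin

definition Dual where
  "Dual = {\<phi>. (\<forall>f g. \<phi> (f + g) = \<phi> f + \<phi> g) \<and> (\<forall>m f. \<phi> (lact m f) = mm m (\<phi> f))}"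

lemma h_Dual: "h f \<in> Dual"
  using h_bij unfolding bij_betw_def Dual_def by blast

text \<open>The structure map \<open>dt\<close> is known to be bilinear only on functionals in
  \<open>Dual\<close>, so each functional that arises is first recognised as a value of
  \<open>h\<close>.\<close>

lemma hodge_lift:
  fixes dt :: "('f \<Rightarrow> 'm) \<Rightarrow> 'o \<Rightarrow> 's::complex_vector"
  assumes bd: "balanced_tensor Dual (\<lambda>\<phi> m f. mm (\<phi> f) m) UNIV (\<lambda>m x. mo (incl m) x) dt"
  shows "additive (lift_over UNIV UNIV tens (\<lambda>x f. dt (h f) (hs x)))"
    "lift_over UNIV UNIV tens (\<lambda>x f. dt (h f) (hs x)) (tens x f) = dt (h f) (hs x)"
proof -
  have lact_h: "(\<lambda>f. mm (h g f) (star m)) = h (lact m g)" for m g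
    using h_lact[of "star m" g] by (simp add: fun_eq_iff star_star)
  have hD: "h f \<in> Dual" "h f + h g \<in> Dual" "c *\<^sub>C h f \<in> Dual" "(\<lambda>g. mm (h f g) (star m)) \<in> Dual" for f g c m
    using h_Dual[of f] h_Dual[of "f + g"] h_Dual[of "cnj c *\<^sub>C f"] h_Dual[of "lact m f"] lact_h
    by (simp_all add: h_add h_scale)
  note dt = balanced_tensor_tens_on[OF bd hD(1) hD(1) hD(2) hD(3) hD(4)]
  have b: "balanced (\<lambda>x f. dt (h f) (hs x))"
    by (rule balancedI) (simp_all add: hs_add hs_scale h_add h_scale dt)
  have m: "dt (h f) (hs (mo x (incl m))) = dt (h (lact m f)) (hs x)" for x m f
    by (simp add: hs_incl flip: lact_h dt(5))
  show "additive (lift_over UNIV UNIV tens (\<lambda>x f. dt (h f) (hs x)))" by (rule lift(1)[OF b m])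
  show "lift_over UNIV UNIV tens (\<lambda>x f. dt (h f) (hs x)) (tens x f) = dt (h f) (hs x)" by (rule lift(2)[OF b m])
qed

lemma Dual_subspace:
  assumes "\<And>a b c. mm a (b + c) = mm a b + mm a c" "\<And>a c b. mm a (c *\<^sub>C b) = c *\<^sub>C mm a b"
  shows "csubspace Dual"
proof (rule complex_vector.subspaceI)
  have "mm a 0 = 0" for a using assms(1)[of a 0 0] by simp
  then show "0 \<in> Dual" by (simp add: Dual_def zero_fun_def)
qed (auto simp: Dual_def plus_fun_def assms scaleC_add_right scaleC_fun_def)

end

section \<open>Left and right bundles\<close>

lemma free_module_unit: "j < N \<Longrightarrow> (\<lambda>i. if i = j then m else 0) \<in> free_module N"
  by (simp add: free_module_def)

text \<open>Induction on the truncations of \<open>x\<close>, which stay in the free module, the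
  only place where \<open>p\<close> is known to be additive.\<close>

lemma free_module_expand:
  assumes x: "x \<in> free_module N"
    and p: "\<forall>x\<in>free_module N. \<forall>y\<in>free_module N. p (x + y) = p x + (p y :: 'f::ab_group_add)"
  shows "p x = (\<Sum>j<N. p (\<lambda>i. if i = j then x j else (0 :: 'm::comm_monoid_add)))"
proof -
  have z: "(0 :: nat \<Rightarrow> 'm) \<in> free_module N" by (simp add: free_module_def)
  have p0: "p 0 = 0" using p[rule_format, OF z z] by simp
  have "p (\<lambda>i. if i < k then x i else 0) = (\<Sum>j<k. p (\<lambda>i. if i = j then x j else 0))" if "k \<le> N" for k
    using that
  proof (induction k)
    case 0
    then show ?case using p0 by (simp add: zero_fun_def)
  next
    case (Suc k)
    have "(\<lambda>i. if i < Suc k then x i else 0) = (\<lambda>i. if i < k then x i else 0) + (\<lambda>i. if i = k then x k else 0)"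
      by (auto simp: fun_eq_iff less_Suc_eq)
    moreover have "(\<lambda>i. if i < k then x i else 0) \<in> free_module N" using x Suc(2) by (simp add: free_module_def)
    moreover have "(\<lambda>i. if i = k then x k else 0) \<in> free_module N"
      using Suc(2) by (intro free_module_unit) simp
    ultimately have "p (\<lambda>i. if i < Suc k then x i else 0) =
        p (\<lambda>i. if i < k then x i else 0) + p (\<lambda>i. if i = k then x k else 0)"
      using p by metis
    then show ?case using Suc by simp
  qed
  from this[of N] have "p (\<lambda>i. if i < N then x i else 0) = (\<Sum>j<N. p (\<lambda>i. if i = j then x j else 0))"
    by simp
  moreover have "(\<lambda>i. if i < N then x i else 0) = x"
    using x by (auto simp: fun_eq_iff free_module_def not_less)
  ultimately show ?thesis by simp
qed

text \<open>The dual basis lemma: the coordinates are those of the section \<open>s\<close>, and the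
  basis elements are the images of the unit vectors under the retraction \<open>p\<close>.\<close>

lemma fg_projective_left_basis:
  assumes "fg_projective_left l"
  obtains N :: nat and e coor where "\<And>i f g. coor i (f + g) = coor i f + coor i g" "\<And>i m f. coor i (l m f) = m * coor i f"
    "\<And>f. (\<Sum>i<N. l (coor i f) (e i)) = f"
proof -
  obtain N s p where s: "\<forall>f. s f \<in> free_module N" "\<forall>f g. s (f + g) = s f + s g" "\<forall>m f. s (l m f) = (\<lambda>j. m * s f j)"
    and p: "\<forall>x\<in>free_module N. \<forall>y\<in>free_module N. p (x + y) = p x + p y"
      "\<forall>m. \<forall>x\<in>free_module N. p (\<lambda>j. m * x j) = l m (p x)" "\<forall>f. p (s f) = f"
    using assms unfolding fg_projective_left_def by blast
  show thesis
  proof (rule that[where coor = "\<lambda>i f. s f i" and N = N and e = "\<lambda>j. p (\<lambda>i. if i = j then 1 else 0)"])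
    show "s (f + g) i = s f i + s g i" "s (l m f) i = m * s f i" for i f g m using s by simp_all
    fix f
    have "p (\<lambda>i. if i = j then s f j else 0) = l (s f j) (p (\<lambda>i. if i = j then 1 else 0))" if "j < N" for j
    proof -
      have "(\<lambda>i. if i = j then s f j else 0) = (\<lambda>i. s f j * (if i = j then 1 else 0))" by auto
      then show ?thesis using p(2)[rule_format, OF free_module_unit[OF that, of 1], of "s f j"] by simp
    qed
    then show "(\<Sum>j<N. l (s f j) (p (\<lambda>i. if i = j then 1 else 0))) = f"
      using free_module_expand[OF s(1)[rule_format] p(1), of f] p(3) by simp
  qed
qed

lemma fg_projective_right_basis:
  assumes "fg_projective_right r"
  obtains N :: nat and e coor where "\<And>i f g. coor i (f + g) = coor i f + coor i g" "\<And>i m f. coor i (r f m) = coor i f * m"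
    "\<And>f. (\<Sum>i<N. r (e i) (coor i f)) = f"
proof -
  obtain N s p where s: "\<forall>f. s f \<in> free_module N" "\<forall>f g. s (f + g) = s f + s g" "\<forall>m f. s (r f m) = (\<lambda>j. s f j * m)"
    and p: "\<forall>x\<in>free_module N. \<forall>y\<in>free_module N. p (x + y) = p x + p y"
      "\<forall>m. \<forall>x\<in>free_module N. p (\<lambda>j. x j * m) = r (p x) m" "\<forall>f. p (s f) = f"
    using assms unfolding fg_projective_right_def by blast
  show thesis
  proof (rule that[where coor = "\<lambda>i f. s f i" and N = N and e = "\<lambda>j. p (\<lambda>i. if i = j then 1 else 0)"])
    show "s (f + g) i = s f i + s g i" "s (r f m) i = s f i * m" for i f g m using s by simp_all
    fix f
    have "p (\<lambda>i. if i = j then s f j else 0) = r (p (\<lambda>i. if i = j then 1 else 0)) (s f j)" if "j < N" for j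
    proof -
      have "(\<lambda>i. if i = j then s f j else 0) = (\<lambda>i. (if i = j then 1 else 0) * s f j)" by auto
      then show ?thesis using p(2)[rule_format, OF free_module_unit[OF that, of 1], of "s f j"] by simp
    qed
    then show "(\<Sum>j<N. r (p (\<lambda>i. if i = j then 1 else 0)) (s f j)) = f"
      using free_module_expand[OF s(1)[rule_format] p(1), of f] p(3) by simp
  qed
qed

context kaehler_state
begin

lemma bideg_iff: "\<omega> \<in> bideg K i \<longleftrightarrow> p i \<omega> = \<omega>"
  using p_base[of \<omega> i i] p_in[of i \<omega>] by metis

lemma coactM_linear: "clinear (coactM K)"
  using coactM_comodule by (simp add: comodule_star_algebra_def comodule_algebra_def comodule_def)

lemma coact_hs: "coact K (hs x) = tensor_map star hs (coact K x)"
  using coact_hodge_fstar[of x] by (simp add: hs_def[abs_def])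

lemma form_algebra_left:
  "form_algebra A (*) (antipode A) (*) (*) (incl K) (delbar K) sg hs p J v (coactM K) (coact K)"
proof (rule form_algebra.intro)
  fix x y :: 'o
  show "coact K (x * y) = tsum (coact K x) (\<lambda>a x'. tsum (coact K y) (\<lambda>b y'. (a * b) \<otimes> (x' * y')))"
    using coact_mult[OF balanced_pure, of x y] by (simp add: tsum_self)
  show "v (x * hs y) = cnj (v (y * hs x))" using B_hermitian[of x y] by (simp add: B_def)
  show "x = 0" if "v (x * hs x) = 0" using B_definite[of x] that by (simp add: B_def)
  show "v (p i x * hs y) = v (x * hs (p i y))" for i using B_p[of i x y] by (simp add: B_def)
qed (simp_all add: linear mult_simps mult.assoc star_mult antipode_left antipode_right incl_linear incl_one
    incl_mult delbar_linear sg_linear delbar_mult sg_mult sg_incl hs_add hs_scale bij_hs hs_incl p_linear p_p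
    finite_J p_sum p_incl_mult p_delbar[simplified] sg_p p_mult[simplified] v_linear v_delbar v_sg coactM_linear coact_linear
    coact_incl coact_delbar coact_sg coact_p coact_hs)

text \<open>The opposite Hopf algebra has the inverse antipode as its antipode, and symmetry and
  definiteness for \<open>tw\<close> are transported from \<open>B\<close> by conjugation.\<close>

lemma form_algebra_right:
  "form_algebra A (\<lambda>a b. b * a) (inv (antipode A)) (\<lambda>m m'. m' * m) tw (incl K) (delbar K) sg hs p J v (coactM K) (coact K)"
proof (rule form_algebra.intro)
  fix x y :: 'o
  show "coact K (tw x y) = tsum (coact K x) (\<lambda>a x'. tsum (coact K y) (\<lambda>b y'. (b * a) \<otimes> tw x' y'))"
    by (rule coact_tw)
  show "v (tw x (hs y)) = cnj (v (tw y (hs x)))" unfolding v_tw using B_hermitian by metis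
  show "x = 0" if "v (tw x (hs x)) = 0"
    using B_definite[of "fstar K x"] that unfolding v_tw by (metis complex_cnj_zero_iff fstar_fstar fstar_zero)
  show "v (tw (p i x) (hs y)) = v (tw x (hs (p i y)))" for i
    unfolding v_tw by (cases i) (simp add: fstar_p B_p)
qed (simp_all add: linear inv_antipode skew_linear mult_simps mult.assoc star_mult skew_left skew_right incl_linear
    incl_one incl_mult delbar_linear sg_linear delbar_tw sg_tw sg_incl hs_add hs_scale bij_hs hs_incl p_linear p_p
    finite_J p_sum p_incl_mult p_delbar[simplified] sg_p p_tw[simplified] v_linear v_delbar v_sg_tw coactM_linear coact_linear
    coact_incl coact_delbar coact_sg coact_p coact_hs tw_bilinear tw_assoc tw_incl
    tw_incl(1)[of 1, simplified incl_one mult_1_right])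

text \<open>Moving a form of degree one past degree \<open>k\<close> costs \<open>(-1) ^ k\<close>,
  which \<open>sg\<close> compensates. This accounts for the absence of a sign in the extension of
  \<open>rdbar\<close>.\<close>

lemma tw_sg: "\<nu> \<in> bideg K (0, 1) \<Longrightarrow> tw (sg \<omega>) \<nu> = \<nu> * \<omega>"
proof (rule additive_ext[of "\<lambda>\<omega>. tw (sg \<omega>) \<nu>" "\<lambda>\<omega>. \<nu> * \<omega>"])
  fix a b \<omega> assume \<nu>: "\<nu> \<in> bideg K (0, 1)" and w: "\<omega> \<in> bideg K (a, b)"
  show "tw (sg \<omega>) \<nu> = \<nu> * \<omega>"
    using tw_deg[OF bideg_deg[OF w] bideg_deg[OF \<nu>]] by (simp add: sg_bideg[OF w] tw_bilinear sign_sign)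
qed (simp_all add: additive_def clinearD[OF sg_linear] tw_bilinear mult_simps)

text \<open>Only \<open>\<eta>\<close> of degree \<open>2 * n - k\<close> contributes, and there the
  sign \<open>(-1) ^ (k * (2 * n - k))\<close> equals \<open>(-1) ^ k\<close>. This is the sign in
  \<open>right_inner\<close>.\<close>

lemma v_tw_deg: "\<omega> \<in> deg K k \<Longrightarrow> v (tw \<omega> \<eta>) = (-1) ^ k * v (\<eta> * \<omega>)"
proof (rule additive_ext[of "\<lambda>\<eta>. v (tw \<omega> \<eta>)" "\<lambda>\<eta>. (-1) ^ k * v (\<eta> * \<omega>)"])
  fix c d \<eta> assume \<omega>: "\<omega> \<in> deg K k" and "\<eta> \<in> bideg K (c, d)"
  then have \<eta>: "\<eta> \<in> deg K (c + d)" using bideg_deg by blast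
  have tw: "v (tw \<omega> \<eta>) = (-1) ^ (k * (c + d)) * v (\<eta> * \<omega>)"
    using tw_deg[OF \<omega> \<eta>] by (simp add: clinearD[OF v_linear] scaleC_complex_def)
  show "v (tw \<omega> \<eta>) = (-1) ^ k * v (\<eta> * \<omega>)"
  proof (cases "c + d + k = 2 * n")
    case True
    then have "even (k * (c + d)) = even k" by (metis even_add even_mult_iff dvd_triv_left)
    then show ?thesis unfolding tw by (simp add: minus_one_power_iff)
  next
    case False
    then have "p (n, n) (\<eta> * \<omega>) = 0" using p_deg[OF deg_mult[OF \<eta> \<omega>], of "(n, n)"] by (simp add: mult_2)
    then have "vol K (\<eta> * \<omega>) = vol K 0"
      using vol_p[of "(n, n)" "\<eta> * \<omega>"] by simp
    then have "v (\<eta> * \<omega>) = v 0" by (simp add: v_def)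
    then show ?thesis unfolding tw using clinear_zero[OF v_linear] by simp
  qed
qed (simp_all add: additive_def tw_bilinear mult_simps clinearD[OF v_linear] distrib_left)

lemma left_hodge_theorem:
  fixes E :: "('a, 'm, 'o, 'f::complex_vector, 't::complex_vector, 's::complex_vector) left_bundle"
  assumes vb: "left_vector_bundle A K E" and hol: "left_holomorphic K E" and herm: "left_hermitian A K E"
    and diag: "diagonalisable (dirac (left_inner K \<tau> E) (left_dbar K E))"
  shows "let ip = left_inner K \<tau> E; db = left_dbar K E; \<delta> = left_coact K E in
          orthogonal_decomposition ip [harmonic ip db, range db, range (adjoint ip db)] \<and>
          subcomodule \<delta> (harmonic ip db) \<and> subcomodule \<delta> (range db) \<and>
          subcomodule \<delta> (range (adjoint ip db)) \<and>
          (\<forall>a b. let U = left_bideg K E (a, b) in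
            represents_quotient (harmonic ip db \<inter> U) (cocycles db U) (coboundaries db U) \<and>
            subcomodule \<delta> (harmonic ip db \<inter> U) \<and> subcomodule \<delta> (cocycles db U) \<and>
            subcomodule \<delta> (coboundaries db U))"
proof -
  let ?l = "laction E"
  have md: "left_module ?l" and fg: "fg_projective_left ?l" and cm: "comodule A (lcoact E)"
    and lc: "\<And>f m. lcoact E (?l m f) = tensor_mult ?l (coactM K m) (lcoact E f)"
    and bt: "balanced_tensor UNIV (\<lambda>\<omega> m. \<omega> * incl K m) UNIV ?l (ltens E)"
    and bd: "balanced_tensor (left_dual ?l) (\<lambda>\<phi> m. (\<lambda>f. \<phi> f * m)) UNIV (\<lambda>m \<omega>. incl K m * \<omega>) (ldtens E)"
    using vb unfolding left_vector_bundle_def by blast+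
  have mod: "?l (m + m') f = ?l m f + ?l m' f" "?l m (f + g) = ?l m f + ?l m g" "?l (m * m') f = ?l m (?l m' f)"
    "?l 1 f = f" "?l (c *\<^sub>C m) f = c *\<^sub>C ?l m f" for m m' f g c
    using md unfolding left_module_def by blast+
  have mod': "?l m (c *\<^sub>C f) = c *\<^sub>C ?l m f" for m c f
    using mod(3)[of m "c *\<^sub>C 1" f] by (simp add: mod(4,5) mult_scaleC_right)
  obtain N :: nat and e coor where basis: "\<And>i f g. coor i (f + g) = coor i f + coor i g"
    "\<And>i m f. coor i (?l m f) = m * coor i f" "\<And>f. (\<Sum>i<N. ?l (coor i f) (e i)) = f"
    by (rule fg_projective_left_basis[OF fg]) (rule that)
  interpret FA: form_algebra A "(*)" "antipode A" "(*)" "(*)" "incl K" "delbar K" sg hs p J v "coactM K" "coact K"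
    by (rule form_algebra_left)
  interpret FB: form_bundle A "(*)" "antipode A" "(*)" "(*)" "incl K" "delbar K" sg hs p J v "coactM K" "coact K"
    ?l "lcoact E" "ltens E" N e coor
  proof (rule form_bundle.intro[OF form_algebra_left], rule form_bundle_axioms.intro)
    show "lcoact E (?l m f) = tsum (coactM K m) (\<lambda>a m'. tsum (lcoact E f) (\<lambda>b g. (a * b) \<otimes> ?l m' g))" for m f
      unfolding lc by (rule tensor_mult_tsum) (simp_all add: mod mod')
  qed (simp_all add: mod basis cm bt)
  have W: "left_wedge E = FB.W" by (simp add: fun_eq_iff left_wedge_def FB.W_def)
  have coact: "left_coact K E = FB.\<delta>T"
    unfolding left_coact_def FB.\<delta>T_def
    by (intro arg_cong[of _ _ "lift_over UNIV UNIV (ltens E)"] ext tensor_mult_tsum) (simp_all add: FB.tens_bilin)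
  have bideg: "left_bideg K E i = {t. FB.P i t = t}" for i
    unfolding left_bideg_def bideg_iff FB.span_bidegree[symmetric] by (rule arg_cong[of _ _ cspan]) auto
  have dbl: "clinear (ldbar E)" and dbm: "ldbar E (?l m f) = ltens E (delbar K (incl K m)) f + FB.W (incl K m) (ldbar E f)"
    and dbr: "range (ldbar E) \<subseteq> left_bideg K E (0, 1)"
    and dbc: "FB.\<delta>T (ldbar E f) = tensor_map id (ldbar E) (lcoact E f)"
    and dbdb: "left_dbar K E (left_dbar K E t) = 0" for m f t
    using hol by (simp_all add: left_holomorphic_def W coact)
  note db = FB.dbar[OF dbl dbm]
  \<comment> \<open>The definition prescribes values on homogeneous forms only, with an explicit
    sign; additivity in the form determines the others.\<close>
  have dbar: "left_dbar K E = FB.dbar (ldbar E)"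
    unfolding left_dbar_def
  proof (rule the_equality)
    show "additive (FB.dbar (ldbar E)) \<and> (\<forall>k. \<forall>\<omega>\<in>deg K k. \<forall>f. FB.dbar (ldbar E) (ltens E \<omega> f) =
        ltens E (delbar K \<omega>) f + (-1) ^ k *\<^sub>C left_wedge E \<omega> (ldbar E f))"
      by (simp add: clinear_additive[OF db(1)] db(2) sg_deg W FB.W_left)
    fix F assume F: "additive F \<and> (\<forall>k. \<forall>\<omega>\<in>deg K k. \<forall>f. F (ltens E \<omega> f) =
        ltens E (delbar K \<omega>) f + (-1) ^ k *\<^sub>C left_wedge E \<omega> (ldbar E f))"
    have "F (ltens E \<omega> f) = FB.dbar (ldbar E) (ltens E \<omega> f)" for \<omega> f
    proof (rule additive_ext[of "\<lambda>\<omega>. F (ltens E \<omega> f)" "\<lambda>\<omega>. FB.dbar (ldbar E) (ltens E \<omega> f)"])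
      show "F (ltens E \<omega> f) = FB.dbar (ldbar E) (ltens E \<omega> f)" if "\<omega> \<in> bideg K (a, b)" for a b \<omega>
        using F bideg_deg[OF that] by (simp add: db(2) sg_deg[OF bideg_deg[OF that]] W FB.W_left)
    qed (use F in \<open>simp_all add: additive_def FB.tens_bilin clinearD[OF db(1)]\<close>)
    then show "F = FB.dbar (ldbar E)"
      using F FB.T_ext[of F "FB.dbar (ldbar E)"] clinear_additive[OF db(1)] by blast
  qed
  have dual: "left_dual ?l = {\<phi>. (\<forall>f g. \<phi> (f + g) = \<phi> f + \<phi> g) \<and> (\<forall>m f. \<phi> (?l m f) = m * \<phi> f)}"
    by (simp add: left_dual_def)
  have hm: "bij_betw (lherm E) UNIV (left_dual ?l)" "lherm E (f + g) = lherm E f + lherm E g"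
    "lherm E (c *\<^sub>C f) = cnj c *\<^sub>C lherm E f" "lherm E (?l (star m) f) g = lherm E f g * m"
    "tensor_map id (\<lambda>\<psi>. \<psi> g) (tensor_map star (lherm E) (lcoact E f)) = left_dual_coact_at A K E (lherm E f) g"
    "lherm E f g = star (lherm E g f)" for f g c m
  proof -
    note c = herm[unfolded left_hermitian_def]
    show "bij_betw (lherm E) UNIV (left_dual ?l)" by (rule conjunct1[OF c])
    note c = conjunct2[OF c]
    show "lherm E (f + g) = lherm E f + lherm E g" by (rule conjunct1[OF c, rule_format])
    note c = conjunct2[OF c]
    show "lherm E (c *\<^sub>C f) = cnj c *\<^sub>C lherm E f" by (rule conjunct1[OF c, rule_format])
    note c = conjunct2[OF c]
    show "lherm E (?l (star m) f) g = lherm E f g * m" by (rule conjunct1[OF c, rule_format])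
    note c = conjunct2[OF c]
    show "tensor_map id (\<lambda>\<psi>. \<psi> g) (tensor_map star (lherm E) (lcoact E f)) = left_dual_coact_at A K E (lherm E f) g"
      by (rule conjunct1[OF c, rule_format])
    show "lherm E f g = star (lherm E g f)" by (rule conjunct2[OF c, rule_format])
  qed
  have \<phi>: "\<phi> (c *\<^sub>C f) = c *\<^sub>C \<phi> f" if "\<phi> \<in> left_dual ?l" for \<phi> c f
    using that FB.scale_lact[of c f] by (simp add: left_dual_def mult_scaleC_left)
  interpret HB: hermitian_bundle A "(*)" "antipode A" "(*)" "(*)" "incl K" "delbar K" sg hs p J v "coactM K" "coact K"
    ?l "lcoact E" "ltens E" N e coor "ldbar E" "lherm E"
  proof (rule hermitian_bundle.intro[OF FB.form_bundle_axioms], rule hermitian_bundle_axioms.intro)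
    show "ldbar E f \<in> cspan {ltens E y g | y g. p (0, 1) y = y}" for f
      using dbr unfolding bideg FB.span_bidegree by blast
    show "FB.dbar (ldbar E) (FB.dbar (ldbar E) t) = 0" for t using dbdb[of t] by (simp add: dbar)
    fix f g
    have hf: "lherm E f \<in> left_dual ?l" using hm(1) unfolding bij_betw_def by blast
    have i: "balanced (\<lambda>c m. (antipode A b * c) \<otimes> (m :: 'm))" for b
      by (rule balancedI) (simp_all add: pure_tensor_bilinear mult_simps)
    have o: "balanced (\<lambda>b g'. tsum (coactM K (lherm E f g')) (\<lambda>c m. (antipode A b * c) \<otimes> m))"
    proof (rule balancedI)
      fix c b g'
      show "tsum (coactM K (lherm E f g')) (\<lambda>d m. (antipode A (c *\<^sub>C b) * d) \<otimes> m) =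
          tsum (coactM K (lherm E f (c *\<^sub>C g'))) (\<lambda>d m. (antipode A b * d) \<otimes> m)"
        by (simp add: \<phi>[OF hf] clinearD[OF coactM_linear] tsum_scaleC[OF i] lin_simps mult_simps)
    next
      show "tsum (coactM K (lherm E f (g' + g''))) (\<lambda>c m. (antipode A b * c) \<otimes> m) =
          tsum (coactM K (lherm E f g')) (\<lambda>c m. (antipode A b * c) \<otimes> m) +
          tsum (coactM K (lherm E f g'')) (\<lambda>c m. (antipode A b * c) \<otimes> m)" for b g' g''
        using hf by (simp add: left_dual_def clinearD[OF coactM_linear] tsum_add[OF i])
    qed (simp add: lin_simps mult_simps pure_tensor_bilinear tsum_distrib)
    show "tensor_map id (\<lambda>\<psi>. \<psi> g) (tensor_map star (lherm E) (lcoact E f)) =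
        tsum (lcoact E g) (\<lambda>b g'. tsum (coactM K (lherm E f g')) (\<lambda>c m. (antipode A b * c) \<otimes> m))"
      unfolding hm(5) left_dual_coact_at_def by (simp add: tensor_lift_tsum[OF i] tensor_lift_tsum[OF o])
    show "bij_betw (lherm E) UNIV {\<phi>. (\<forall>f g. \<phi> (f + g) = \<phi> f + \<phi> g) \<and> (\<forall>m f. \<phi> (?l m f) = m * \<phi> f)}"
      using hm(1) unfolding dual .
    show "lherm E f g = star (lherm E g f)" by (rule hm(6))
  qed (simp_all add: dbl dbm dbc hm(2-4))
  have Dual: "left_dual ?l = HB.Dual" by (simp add: dual HB.Dual_def)
  note hl = HB.hodge_lift[OF bd[unfolded Dual]]
  have ip: "left_inner K \<tau> E = HB.ip"
  proof (intro ext)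
    fix \<alpha> \<beta>
    \<comment> \<open>Checked on pure \<open>\<beta>\<close>, where the Hodge dual pairs the
      functional \<open>lherm E g\<close> with the form \<open>hs x\<close>; their product at
      \<open>f\<close> is the value of \<open>\<Psi>\<close>.\<close>
    have "lift_over (left_dual ?l) UNIV (ldtens E) (\<lambda>\<phi> \<nu>. \<omega> * incl K (\<phi> f) * \<nu>) (left_hodge K E \<beta>) = \<omega> * HB.\<Psi> \<beta> f" for \<omega> f
    proof -
      let ?g = "\<lambda>\<phi> \<nu>. \<omega> * incl K (\<phi> f) * \<nu>"
      have sub: "csubspace (left_dual ?l)" unfolding Dual by (rule HB.Dual_subspace) (simp_all add: mult_simps)
      have ex: "\<exists>!F. additive F \<and> (\<forall>\<phi>\<in>left_dual ?l. \<forall>\<nu>\<in>UNIV. F (ldtens E \<phi> \<nu>) = ?g \<phi> \<nu>)"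
        by (rule balanced_tensor_lift_on[OF bd sub])
          (simp_all add: plus_fun_def scaleC_fun_def left_dual_def mult_simps incl_mult clinearD[OF incl_linear] mult.assoc
            fun_eq_iff)
      note F = lift_over_tens(1,2)[OF ex]
      show ?thesis
      proof (rule FB.T_ext[of "\<lambda>\<beta>. lift_over (left_dual ?l) UNIV (ldtens E) ?g (left_hodge K E \<beta>)" "\<lambda>\<beta>. \<omega> * HB.\<Psi> \<beta> f"])
        show "additive (\<lambda>\<beta>. lift_over (left_dual ?l) UNIV (ldtens E) ?g (left_hodge K E \<beta>))"
          using F(1) hl(1) unfolding left_hodge_def hs_def[symmetric] by (simp add: additive_def)
        show "lift_over (left_dual ?l) UNIV (ldtens E) ?g (left_hodge K E (ltens E x g)) = \<omega> * HB.\<Psi> (ltens E x g) f" for x g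
          unfolding left_hodge_def hs_def[symmetric] hl(2)
          using F(2)[OF HB.h_Dual[folded Dual]] by (simp add: HB.\<Psi>_tens mult.assoc)
      qed (simp add: additive_def HB.\<Psi>_add mult_simps)
    qed
    then have "left_eval K E \<alpha> (left_hodge K E \<beta>) = FB.ev (HB.\<Psi> \<beta>) \<alpha>"
      by (simp add: left_eval_def FB.ev_def)
    then show "left_inner K \<tau> E \<alpha> \<beta> = HB.ip \<alpha> \<beta>" by (simp add: left_inner_def HB.ip_def v_def)
  qed
  show ?thesis
    using HB.hodge_theorem[OF diag[unfolded ip dbar] FB.\<delta>T(1)]
    unfolding Let_def ip dbar coact bideg HB.U_def .
qed

end

context kaehler_state
begin

lemma right_hodge_theorem:
  fixes E :: "('a, 'm, 'o, 'f::complex_vector, 't::complex_vector, 's::complex_vector) right_bundle"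
  assumes vb: "right_vector_bundle A K E" and hol: "right_holomorphic K E" and herm: "right_hermitian A K E"
    and diag: "diagonalisable (dirac (right_inner K \<tau> E) (right_dbar K E))"
  shows "let ip = right_inner K \<tau> E; db = right_dbar K E; \<delta> = right_coact K E in
          orthogonal_decomposition ip [harmonic ip db, range db, range (adjoint ip db)] \<and>
          subcomodule \<delta> (harmonic ip db) \<and> subcomodule \<delta> (range db) \<and>
          subcomodule \<delta> (range (adjoint ip db)) \<and>
          (\<forall>a b. let U = right_bideg K E (a, b) in
            represents_quotient (harmonic ip db \<inter> U) (cocycles db U) (coboundaries db U) \<and>
            subcomodule \<delta> (harmonic ip db \<inter> U) \<and> subcomodule \<delta> (cocycles db U) \<and>
            subcomodule \<delta> (coboundaries db U))"
proof -
  let ?r = "raction E"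
  let ?l = "\<lambda>m f. ?r f m" and ?t = "\<lambda>\<omega> f. rtens E f \<omega>" and ?dt = "\<lambda>\<phi> \<omega>. rdtens E \<omega> \<phi>"
  have md: "right_module ?r" and fg: "fg_projective_right ?r" and cm: "comodule A (rcoact E)"
    and lc: "\<And>f m. rcoact E (?r f m) = tensor_mult ?r (rcoact E f) (coactM K m)"
    and bt: "balanced_tensor UNIV ?r UNIV (\<lambda>m \<omega>. incl K m * \<omega>) (rtens E)"
    and bd: "balanced_tensor UNIV (\<lambda>\<omega> m. \<omega> * incl K m) (right_dual ?r) (\<lambda>m \<phi>. (\<lambda>f. m * \<phi> f)) (rdtens E)"
    using vb unfolding right_vector_bundle_def by blast+
  have mod: "?r f (m + m') = ?r f m + ?r f m'" "?r (f + g) m = ?r f m + ?r g m" "?r f (m * m') = ?r (?r f m) m'"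
    "?r f 1 = f" "?r f (c *\<^sub>C m) = c *\<^sub>C ?r f m" for m m' f g c
    using md unfolding right_module_def by blast+
  have mod': "?r (c *\<^sub>C f) m = c *\<^sub>C ?r f m" for m c f
    using mod(3)[of f "c *\<^sub>C 1" m] by (simp add: mod(4,5) mult_scaleC_left)
  obtain N :: nat and e coor where basis: "\<And>i f g. coor i (f + g) = coor i f + coor i g"
    "\<And>i m f. coor i (?r f m) = coor i f * m" "\<And>f. (\<Sum>i<N. ?r (e i) (coor i f)) = f"
    by (rule fg_projective_right_basis[OF fg]) (rule that)
  interpret FA: form_algebra A "\<lambda>a b. b * a" "inv (antipode A)" "\<lambda>m m'. m' * m" tw "incl K" "delbar K" sg hs p J v
    "coactM K" "coact K"
    by (rule form_algebra_right)
  interpret FB: form_bundle A "\<lambda>a b. b * a" "inv (antipode A)" "\<lambda>m m'. m' * m" tw "incl K" "delbar K" sg hs p J v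
    "coactM K" "coact K" ?l "rcoact E" ?t N e coor
  proof (rule form_bundle.intro[OF form_algebra_right], rule form_bundle_axioms.intro)
    show "rcoact E (?r f m) = tsum (coactM K m) (\<lambda>a m'. tsum (rcoact E f) (\<lambda>b g. (b * a) \<otimes> ?r g m'))" for m f
    proof -
      have "rcoact E (?r f m) = tsum (rcoact E f) (\<lambda>b g. tsum (coactM K m) (\<lambda>a m'. (b * a) \<otimes> ?r g m'))"
        unfolding lc by (rule tensor_mult_tsum) (simp_all add: mod mod')
      then show ?thesis by (simp only: tsum_swap[of "rcoact E f"])
    qed
    show "balanced_tensor UNIV (\<lambda>x m. tw x (incl K m)) UNIV ?l ?t"
      using balanced_tensor_swap[OF bt] by (simp add: tw_incl)
  qed (simp_all add: mod basis cm)
  have tb: "?t (incl K m * x) f = ?t x (?r f m)" for m x f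
    using FB.tens_balanced[where x = x and m = m and y = f] by (simp add: tw_incl)
  have wedge: "clinear (\<lambda>t. right_wedge E t \<eta>)" "right_wedge E (?t x f) \<eta> = ?t (x * \<eta>) f" for \<eta> x f
  proof -
    have eq: "(\<lambda>t. right_wedge E t \<eta>) = lift_over UNIV UNIV ?t (\<lambda>x f. ?t (x * \<eta>) f)"
      unfolding right_wedge_def by (subst lift_over_swap) rule
    have b: "balanced (\<lambda>x f. ?t (x * \<eta>) f)" by (rule balancedI) (simp_all add: mult_simps FB.tens_bilin)
    have m: "?t (tw x (incl K m) * \<eta>) f = ?t (x * \<eta>) (?r f m)" for x m f
      by (simp add: tw_incl tb mult.assoc)
    show "clinear (\<lambda>t. right_wedge E t \<eta>)" unfolding eq by (rule FB.lift(3)[OF b m]) (simp add: mult_simps FB.tens_bilin)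
    show "right_wedge E (?t x f) \<eta> = ?t (x * \<eta>) f"
      unfolding fun_cong[OF eq] by (rule FB.lift(2)[OF b m])
  qed
  have wedge_incl: "right_wedge E t (incl K m) = FB.W (incl K m) t" for t m
    by (rule FB.T_ext[of "\<lambda>t. right_wedge E t (incl K m)" "FB.W (incl K m)"])
      (simp_all add: clinear_additive wedge FB.W tw_incl)
  have coact: "right_coact K E = FB.\<delta>T"
  proof -
    have "tensor_mult (rtens E) (rcoact E f) (coact K x) =
        tsum (coact K x) (\<lambda>a x'. tsum (rcoact E f) (\<lambda>b g. (b * a) \<otimes> ?t x' g))" for f x
    proof -
      have "tensor_mult (rtens E) (rcoact E f) (coact K x) =
          tsum (rcoact E f) (\<lambda>b g. tsum (coact K x) (\<lambda>a x'. (b * a) \<otimes> ?t x' g))"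
        by (rule tensor_mult_tsum) (simp_all add: FB.tens_bilin)
      then show ?thesis by (simp only: tsum_swap[of "rcoact E f"])
    qed
    then show ?thesis unfolding right_coact_def FB.\<delta>T_def by (subst lift_over_swap) simp
  qed
  have bideg: "right_bideg K E i = {t. FB.P i t = t}" for i
    unfolding right_bideg_def bideg_iff FB.span_bidegree[symmetric] by (rule arg_cong[of _ _ cspan]) auto
  have dbl: "clinear (rdbar E)"
    and dbm: "rdbar E (?r f m) = ?t (delbar K (incl K m)) f + FB.W (incl K m) (rdbar E f)"
    and dbr: "range (rdbar E) \<subseteq> right_bideg K E (0, 1)"
    and dbc: "FB.\<delta>T (rdbar E f) = tensor_map id (rdbar E) (rcoact E f)"
    and dbdb: "right_dbar K E (right_dbar K E t) = 0" for m f t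
    using hol by (simp_all add: right_holomorphic_def wedge_incl coact add.commute)
  \<comment> \<open>\<open>rdbar E f\<close> has degree one, so multiplying it by
    \<open>\<omega>\<close> from the right is the twisted product with \<open>sg \<omega>\<close>
    from the left.\<close>
  have wedge_sg: "right_wedge E (rdbar E f) \<omega> = FB.W (sg \<omega>) (rdbar E f)" for f \<omega>
  proof -
    have "rdbar E f \<in> cspan {rtens E f \<omega> | f \<omega>. \<omega> \<in> bideg K (0, 1)}"
      using dbr unfolding right_bideg_def by blast
    then show ?thesis
    proof (induction rule: complex_vector.span_induct_alt)
      case base
      show ?case
        by (simp add: clinear_zero[OF wedge(1)] clinear_zero[OF FB.W(1)])
    next
      case (step c x y)
      then obtain g \<nu> where x: "x = ?t \<nu> g" "\<nu> \<in> bideg K (0, 1)" by blast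
      then have "right_wedge E x \<omega> = FB.W (sg \<omega>) x" by (simp add: wedge FB.W tw_sg)
      then show ?case using step by (simp add: clinearD[OF wedge(1)] clinearD[OF FB.W(1)])
    qed
  qed
  have dbar: "right_dbar K E = FB.dbar (rdbar E)"
    unfolding right_dbar_def FB.dbar_def wedge_sg by (subst lift_over_swap) (simp add: add.commute)
  have dual: "right_dual ?r = {\<phi>. (\<forall>f g. \<phi> (f + g) = \<phi> f + \<phi> g) \<and> (\<forall>m f. \<phi> (?r f m) = \<phi> f * m)}"
    by (auto simp: right_dual_def)
  have hm: "bij_betw (rherm E) UNIV (right_dual ?r)" "rherm E (f + g) = rherm E f + rherm E g"
    "rherm E (c *\<^sub>C f) = cnj c *\<^sub>C rherm E f" "rherm E (?r f (star m)) g = m * rherm E f g"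
    "tensor_map id (\<lambda>\<psi>. \<psi> g) (tensor_map star (rherm E) (rcoact E f)) = right_dual_coact_at A K E (rherm E f) g"
    "rherm E f g = star (rherm E g f)" for f g c m
  proof -
    note c = herm[unfolded right_hermitian_def]
    show "bij_betw (rherm E) UNIV (right_dual ?r)" by (rule conjunct1[OF c])
    note c = conjunct2[OF c]
    show "rherm E (f + g) = rherm E f + rherm E g" by (rule conjunct1[OF c, rule_format])
    note c = conjunct2[OF c]
    show "rherm E (c *\<^sub>C f) = cnj c *\<^sub>C rherm E f" by (rule conjunct1[OF c, rule_format])
    note c = conjunct2[OF c]
    show "rherm E (?r f (star m)) g = m * rherm E f g" by (rule conjunct1[OF c, rule_format])
    note c = conjunct2[OF c]
    show "tensor_map id (\<lambda>\<psi>. \<psi> g) (tensor_map star (rherm E) (rcoact E f)) = right_dual_coact_at A K E (rherm E f) g"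
      by (rule conjunct1[OF c, rule_format])
    show "rherm E f g = star (rherm E g f)" by (rule conjunct2[OF c, rule_format])
  qed
  have \<phi>: "\<phi> (c *\<^sub>C f) = c *\<^sub>C \<phi> f" if "\<phi> \<in> right_dual ?r" for \<phi> c f
    using that FB.scale_lact[of c f] by (simp add: right_dual_def mult_scaleC_right)
  interpret HB: hermitian_bundle A "\<lambda>a b. b * a" "inv (antipode A)" "\<lambda>m m'. m' * m" tw "incl K" "delbar K" sg hs p J v
    "coactM K" "coact K" ?l "rcoact E" ?t N e coor "rdbar E" "rherm E"
  proof (rule hermitian_bundle.intro[OF FB.form_bundle_axioms], rule hermitian_bundle_axioms.intro)
    show "rdbar E f \<in> cspan {?t y g | y g. p (0, 1) y = y}" for f
      using dbr unfolding bideg FB.span_bidegree by blast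
    show "FB.dbar (rdbar E) (FB.dbar (rdbar E) t) = 0" for t using dbdb[of t] by (simp add: dbar)
    fix f g
    have hf: "rherm E f \<in> right_dual ?r" using hm(1) unfolding bij_betw_def by blast
    have i: "balanced (\<lambda>c m. (c * inv (antipode A) b) \<otimes> (m :: 'm))" for b
      by (rule balancedI) (simp_all add: pure_tensor_bilinear mult_simps)
    have o: "balanced (\<lambda>b g'. tsum (coactM K (rherm E f g')) (\<lambda>c m. (c * inv (antipode A) b) \<otimes> m))"
    proof (rule balancedI)
      fix c b g'
      show "tsum (coactM K (rherm E f g')) (\<lambda>d m. (d * inv (antipode A) (c *\<^sub>C b)) \<otimes> m) =
          tsum (coactM K (rherm E f (c *\<^sub>C g'))) (\<lambda>d m. (d * inv (antipode A) b) \<otimes> m)"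
        by (simp add: \<phi>[OF hf] clinearD[OF coactM_linear] tsum_scaleC[OF i] clinearD[OF FA.anti_linear] mult_simps)
    next
      show "tsum (coactM K (rherm E f (g' + g''))) (\<lambda>c m. (c * inv (antipode A) b) \<otimes> m) =
          tsum (coactM K (rherm E f g')) (\<lambda>c m. (c * inv (antipode A) b) \<otimes> m) +
          tsum (coactM K (rherm E f g'')) (\<lambda>c m. (c * inv (antipode A) b) \<otimes> m)" for b g' g''
        using hf by (simp add: right_dual_def clinearD[OF coactM_linear] tsum_add[OF i])
    qed (simp add: clinearD[OF FA.anti_linear] mult_simps pure_tensor_bilinear tsum_distrib)
    show "tensor_map id (\<lambda>\<psi>. \<psi> g) (tensor_map star (rherm E) (rcoact E f)) =
        tsum (rcoact E g) (\<lambda>b g'. tsum (coactM K (rherm E f g')) (\<lambda>c m. (c * inv (antipode A) b) \<otimes> m))"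
      unfolding hm(5) right_dual_coact_at_def by (simp add: tensor_lift_tsum[OF i] tensor_lift_tsum[OF o])
    show "bij_betw (rherm E) UNIV {\<phi>. (\<forall>f g. \<phi> (f + g) = \<phi> f + \<phi> g) \<and> (\<forall>m f. \<phi> (?r f m) = \<phi> f * m)}"
      using hm(1) unfolding dual .
    show "rherm E f g = star (rherm E g f)" by (rule hm(6))
  qed (simp_all add: dbl dbm dbc hm(2-4))
  have Dual: "right_dual ?r = HB.Dual" by (simp add: dual HB.Dual_def)
  have bd': "balanced_tensor HB.Dual (\<lambda>\<phi> m f. m * \<phi> f) UNIV (\<lambda>m x. tw (incl K m) x) ?dt"
    using balanced_tensor_swap[OF bd] by (simp add: Dual tw_incl)
  note hl = HB.hodge_lift[OF bd']
  have hodge_eq: "right_hodge K E = lift_over UNIV UNIV ?t (\<lambda>x f. ?dt (rherm E f) (hs x))"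
    unfolding right_hodge_def hs_def by (subst lift_over_swap) rule
  \<comment> \<open>The inner lift of \<open>right_eval\<close>, for a fixed functional and a fixed
    form.\<close>
  define G where "G \<phi> \<nu> = lift_over UNIV UNIV ?t (\<lambda>x f. \<nu> * incl K (\<phi> f) * x)" for \<phi> \<nu>
  have G: "clinear (G \<phi> \<nu>)" "G \<phi> \<nu> (?t x f) = \<nu> * incl K (\<phi> f) * x" if D: "\<phi> \<in> HB.Dual" for \<phi> \<nu> x f
  proof -
    have d: "\<phi> (f + g) = \<phi> f + \<phi> g" "\<phi> (?r f m) = \<phi> f * m" "\<phi> (c *\<^sub>C f) = c *\<^sub>C \<phi> f" for f g m c
      using D \<phi>[of \<phi>] by (auto simp: Dual HB.Dual_def)
    have b: "balanced (\<lambda>x f. \<nu> * incl K (\<phi> f) * x)"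
      by (rule balancedI) (simp_all add: d mult_simps clinearD[OF incl_linear])
    have m: "\<nu> * incl K (\<phi> f) * tw x (incl K m) = \<nu> * incl K (\<phi> (?r f m)) * x" for x m f
      by (simp add: d tw_incl incl_mult mult.assoc)
    show "G \<phi> \<nu> (?t x f) = \<nu> * incl K (\<phi> f) * x" unfolding G_def by (rule FB.lift(2)[OF b m])
    show "clinear (G \<phi> \<nu>)" unfolding G_def by (rule FB.lift(3)[OF b m]) (simp add: mult_simps)
  qed
  \<comment> \<open>The expected value of \<open>right_eval\<close> on the Hodge dual of
    \<open>\<beta>\<close>, still with the original product of forms.\<close>
  define V where "V \<beta> = lift_over UNIV UNIV ?t (\<lambda>x f. HB.\<Psi> \<beta> f * x)" for \<beta>
  have U: "additive (V \<beta>)"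
    "V \<beta> (?t x f) = HB.\<Psi> \<beta> f * x" for \<beta> x f
  proof -
    have b: "balanced (\<lambda>x f. HB.\<Psi> \<beta> f * x)"
      by (rule balancedI) (simp_all add: HB.\<Psi>_lin mult_simps)
    have m: "HB.\<Psi> \<beta> f * tw x (incl K m) = HB.\<Psi> \<beta> (?r f m) * x" for x m f
      by (simp add: HB.\<Psi>_lin tw_incl mult.assoc)
    show "additive (V \<beta>)" unfolding V_def by (rule FB.lift(1)[OF b m])
    show "V \<beta> (?t x f) = HB.\<Psi> \<beta> f * x" unfolding V_def by (rule FB.lift(2)[OF b m])
  qed
  have eval: "right_eval K E (right_hodge K E \<beta>) \<alpha> = V \<beta> \<alpha>" for \<alpha> \<beta>
  proof -
    have sub: "csubspace HB.Dual" by (rule HB.Dual_subspace) (simp_all add: mult_simps)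
    have Dsub: "\<phi> + \<phi>' \<in> HB.Dual" "c *\<^sub>C \<phi> \<in> HB.Dual" "(\<lambda>f. m * \<phi> f) \<in> HB.Dual"
      if "\<phi> \<in> HB.Dual" "\<phi>' \<in> HB.Dual" for \<phi> \<phi>' c m
      using that complex_vector.subspace_add[OF sub] complex_vector.subspace_scale[OF sub]
      by (auto simp: HB.Dual_def mult_simps mult.assoc)
    have ext: "G \<phi> \<nu> \<alpha> = F \<alpha>" if "\<phi> \<in> HB.Dual" "additive F" "\<And>x f. \<nu> * incl K (\<phi> f) * x = F (?t x f)" for \<phi> \<nu> F
      by (rule FB.T_ext) (use that G in \<open>simp_all add: clinear_additive\<close>)
    have ex: "\<exists>!F. additive F \<and> (\<forall>\<phi>\<in>HB.Dual. \<forall>\<nu>\<in>UNIV. F (?dt \<phi> \<nu>) = G \<phi> \<nu> \<alpha>)"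
    proof (rule balanced_tensor_lift_on[OF bd' sub])
      fix \<phi> \<phi>' \<nu> \<nu>' c m assume D: "\<phi> \<in> HB.Dual"
      show "(\<lambda>f. m * (c *\<^sub>C \<phi>) f) = c *\<^sub>C (\<lambda>f. m * \<phi> f)" by (simp add: scaleC_fun_def mult_simps)
      show "(\<lambda>f. m * \<phi> f) \<in> HB.Dual" by (rule Dsub(3)[OF D D])
      show "G \<phi> (\<nu> + \<nu>') \<alpha> = G \<phi> \<nu> \<alpha> + G \<phi> \<nu>' \<alpha>"
        by (rule ext[OF D, of "\<lambda>\<alpha>. G \<phi> \<nu> \<alpha> + G \<phi> \<nu>' \<alpha>"])
          (simp_all add: additive_def G[OF D] clinearD[OF G(1)[OF D]] mult_simps)
      show "G (c *\<^sub>C \<phi>) \<nu> \<alpha> = G \<phi> (c *\<^sub>C \<nu>) \<alpha>"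
        by (rule ext[OF Dsub(2)[OF D D], of "G \<phi> (c *\<^sub>C \<nu>)"])
          (simp_all add: clinear_additive G[OF D] scaleC_fun_def clinearD[OF incl_linear] mult_simps)
      show "G (\<lambda>f. m * \<phi> f) \<nu> \<alpha> = G \<phi> (tw (incl K m) \<nu>) \<alpha>"
        by (rule ext[OF Dsub(3)[OF D D], of "G \<phi> (tw (incl K m) \<nu>)"])
          (simp_all add: clinear_additive G[OF D] tw_incl incl_mult mult.assoc)
      assume D': "\<phi>' \<in> HB.Dual"
      show "G (\<phi> + \<phi>') \<nu> \<alpha> = G \<phi> \<nu> \<alpha> + G \<phi>' \<nu> \<alpha>"
        by (rule ext[OF Dsub(1)[OF D D'], of "\<lambda>\<alpha>. G \<phi> \<nu> \<alpha> + G \<phi>' \<nu> \<alpha>"])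
          (simp_all add: additive_def G[OF D] G[OF D'] clinearD[OF G(1)[OF D]] clinearD[OF G(1)[OF D']]
            mult_simps clinearD[OF incl_linear] plus_fun_def)
    qed
    note F = lift_over_tens(1,2)[OF ex]
    have outer: "right_eval K E \<gamma> \<alpha> = lift_over HB.Dual UNIV ?dt (\<lambda>\<phi> \<nu>. G \<phi> \<nu> \<alpha>) \<gamma>" for \<gamma>
      unfolding right_eval_def G_def Dual
      by (subst lift_over_swap, subst (2) lift_over_swap) rule
    show ?thesis
    proof (rule FB.T_ext[of "\<lambda>\<beta>. right_eval K E (right_hodge K E \<beta>) \<alpha>" "\<lambda>\<beta>. V \<beta> \<alpha>"])
      show "additive (\<lambda>\<beta>. right_eval K E (right_hodge K E \<beta>) \<alpha>)"
        using F(1) hl(1) unfolding outer hodge_eq by (simp add: additive_def)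
      show "additive (\<lambda>\<beta>. V \<beta> \<alpha>)"
      proof (rule additive.intro)
        fix \<beta> \<beta>'
        show "V (\<beta> + \<beta>') \<alpha> =
            V \<beta> \<alpha> + V \<beta>' \<alpha>"
          by (rule FB.T_ext[of "V (\<beta> + \<beta>')"
                "\<lambda>\<alpha>. V \<beta> \<alpha> + V \<beta>' \<alpha>"])
            (simp_all add: U additive_def additive.add[OF U(1)] HB.\<Psi>_add mult_simps)
      qed
      fix y g
      have "right_eval K E (right_hodge K E (?t y g)) \<alpha> = G (rherm E g) (hs y) \<alpha>"
        unfolding outer hodge_eq hl(2) by (rule F(2)[OF HB.h_Dual]) simp
      also have "\<dots> = V (?t y g) \<alpha>"
        by (rule ext[OF HB.h_Dual U(1)]) (simp add: U(2) HB.\<Psi>_tens tw_incl)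
      finally show "right_eval K E (right_hodge K E (?t y g)) \<alpha> = V (?t y g) \<alpha>" .
    qed
  qed
  \<comment> \<open>\<open>Q k\<close> is the projection of bundle-valued forms to total degree
    \<open>k\<close>. It identifies \<open>component (right_deg K E) k\<close>, which carries the
    sign in \<open>right_inner\<close>.\<close>
  define Jk where "Jk k = {i \<in> J. fst i + snd i = k}" for k
  define Q where "Q k t = (\<Sum>i\<in>Jk k. FB.P i t)" for k t
  have fJ: "finite (Jk k)" for k using finite_J by (simp add: Jk_def)
  have Ql: "clinear (Q k)" for k
    by (rule clinearI) (simp_all add: Q_def clinearD[OF FB.P(1)] sum.distrib complex_vector.scale_sum_right)
  have Q_tens: "Q k (?t x f) = ?t (\<Sum>i\<in>Jk k. p i x) f" for k x f
  proof -
    have "?t (\<Sum>i\<in>Jk k. p i x) f = (\<Sum>i\<in>Jk k. ?t (p i x) f)"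
      by (rule additive.sum[of "\<lambda>x. ?t x f"]) (simp add: additive_def FB.tens_bilin)
    then show ?thesis by (simp add: Q_def FB.P(2))
  qed
  have QQ: "Q k (Q l t) = (if k = l then Q k t else 0)" for k l t
  proof -
    have "Q k (Q l t) = (\<Sum>i\<in>Jk k. \<Sum>j\<in>Jk l. FB.P i (FB.P j t))"
      unfolding Q_def by (simp add: clinear_sum[OF FB.P(1)])
    also have "\<dots> = (\<Sum>i\<in>Jk k. if i \<in> Jk l then FB.P i t else 0)"
      using fJ by (simp add: FB.P_P)
    also have "\<dots> = (if k = l then Q k t else 0)"
      unfolding Q_def by (auto simp: Jk_def intro!: sum.cong sum.neutral)
    finally show ?thesis .
  qed
  have Jk_sum: "(\<Sum>k\<le>2 * n. \<Sum>i\<in>Jk k. g i) = (\<Sum>i\<in>J. g i)" for g :: "nat \<times> nat \<Rightarrow> 'z::comm_monoid_add"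
    unfolding Jk_def by (rule sum.group[OF finite_J]) (auto simp: J_def)
  have deg_p: "(\<Sum>i\<in>Jk k. p i x) \<in> deg K k" for k x
    using p_in bideg_deg by (intro complex_vector.subspace_sum[OF deg_subspace]) (fastforce simp: Jk_def)
  have p_deg_sum: "(\<Sum>i\<in>Jk k. p i x) = x" if "x \<in> deg K k" for x k
  proof -
    have "(\<Sum>i\<in>Jk k. p i x) = (\<Sum>i\<in>J. p i x)"
      using p_deg[OF that] by (intro sum.mono_neutral_left finite_J) (auto simp: Jk_def)
    then show ?thesis by (simp add: p_sum)
  qed
  have rdeg: "right_deg K E = (\<lambda>k. {t. Q k t = t})"
  proof
    fix k
    show "right_deg K E k = {t. Q k t = t}"
    proof
      have sub: "csubspace {t. Q k t = t}"
        by (rule complex_vector.subspaceI) (simp_all add: clinearD[OF Ql] clinear_zero[OF Ql])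
      show "right_deg K E k \<subseteq> {t. Q k t = t}"
        unfolding right_deg_def by (rule complex_vector.span_minimal[OF _ sub]) (auto simp: Q_tens p_deg_sum)
      have *: "Q k t \<in> right_deg K E k" for t
      proof (induction t rule: FB.T_induct)
        case zero
        show ?case by (simp add: clinear_zero[OF Ql] right_deg_def complex_vector.span_zero)
      next
        case (add s t)
        then show ?case by (simp add: clinearD[OF Ql] right_deg_def complex_vector.span_add)
      next
        case (tens x f)
        show ?case unfolding Q_tens right_deg_def using deg_p by (intro complex_vector.span_base) blast
      qed
      show "{t. Q k t = t} \<subseteq> right_deg K E k"
      proof
        fix t assume "t \<in> {t. Q k t = t}"
        then have "t = Q k t" by simp
        also note *
        finally show "t \<in> right_deg K E k" .
      qed
    qed
  qed
  have comp: "component (right_deg K E) k t = Q k t" for k t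
    unfolding rdeg
  proof (rule component_projection[OF Ql QQ])
    show "(\<Sum>k\<in>{..2 * n}. Q k x) = x" for x unfolding Q_def Jk_sum by (rule FB.P_sum)
  qed simp
  have ip: "right_inner K \<tau> E = HB.ip"
  proof (intro ext)
    fix \<alpha> \<beta>
    have r: "right_inner K \<tau> E \<alpha> \<beta> = (\<Sum>k\<le>2 * n. (-1) ^ k * v (V \<beta> (Q k \<alpha>)))" for \<alpha>
      by (simp add: right_inner_def eval comp v_def)
    show "right_inner K \<tau> E \<alpha> \<beta> = HB.ip \<alpha> \<beta>"
    proof (rule FB.T_ext[of "\<lambda>\<alpha>. right_inner K \<tau> E \<alpha> \<beta>" "\<lambda>\<alpha>. HB.ip \<alpha> \<beta>"])
      show "additive (\<lambda>\<alpha>. right_inner K \<tau> E \<alpha> \<beta>)"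
        by (simp add: additive_def r clinearD[OF Ql] additive.add[OF U(1)] clinearD[OF v_linear] distrib_left sum.distrib)
      show "additive (\<lambda>\<alpha>. HB.ip \<alpha> \<beta>)" by (simp add: additive_def HB.ip_bilin)
      fix x f
      have "right_inner K \<tau> E (?t x f) \<beta> = (\<Sum>k\<le>2 * n. (-1) ^ k * v (HB.\<Psi> \<beta> f * (\<Sum>i\<in>Jk k. p i x)))"
        by (simp only: r Q_tens U(2))
      \<comment> \<open>In each degree the sign is absorbed by passing from the product to
        \<open>tw\<close>, after which the degrees can be summed again.\<close>
      also have "\<dots> = (\<Sum>k\<le>2 * n. v (tw (\<Sum>i\<in>Jk k. p i x) (HB.\<Psi> \<beta> f)))"
        by (simp only: v_tw_deg[OF deg_p])
      also have "\<dots> = v (tw (\<Sum>k\<le>2 * n. \<Sum>i\<in>Jk k. p i x) (HB.\<Psi> \<beta> f))"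
        by (rule additive.sum[of "\<lambda>x. v (tw x (HB.\<Psi> \<beta> f))", symmetric])
          (simp add: additive_def tw_bilinear clinearD[OF v_linear])
      also have "\<dots> = HB.ip (?t x f) \<beta>" by (simp add: Jk_sum p_sum HB.ip_def HB.ev_\<Psi>)
      finally show "right_inner K \<tau> E (?t x f) \<beta> = HB.ip (?t x f) \<beta>" .
    qed
  qed
  show ?thesis
    using HB.hodge_theorem[OF diag[unfolded ip dbar] FB.\<delta>T(1)]
    unfolding Let_def ip dbar coact bideg HB.U_def .
qed

end

theorem theorem6p4:
  fixes A :: "('a::complex_star_algebra) hopf"
    and K :: "('a, 'm::complex_star_algebra, 'o::complex_algebra_1) kaehler"
    and \<tau> :: "'m \<Rightarrow> complex"
    and E :: "('a, 'm, 'o, 'f::complex_vector, 't::complex_vector, 's::complex_vector) left_bundle"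
    and E' :: "('a, 'm, 'o, 'g::complex_vector, 'u::complex_vector, 'v::complex_vector) right_bundle"
  assumes "hopf_star_algebra A"
    and "kaehler_structure A K" and "positive_definite_kaehler K"
    and "state \<tau>" and "closed_integral K \<tau>"
  shows "(left_vector_bundle A K E \<and> left_holomorphic K E \<and> left_hermitian A K E \<and>
      left_positive_definite E \<and>
      diagonalisable (dirac (left_inner K \<tau> E) (left_dbar K E)) \<longrightarrow>
        (let ip = left_inner K \<tau> E; db = left_dbar K E; \<delta> = left_coact K E in
          orthogonal_decomposition ip [harmonic ip db, range db, range (adjoint ip db)] \<and>
          subcomodule \<delta> (harmonic ip db) \<and> subcomodule \<delta> (range db) \<and>
          subcomodule \<delta> (range (adjoint ip db)) \<and>
          (\<forall>a b. let U = left_bideg K E (a, b) in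
            represents_quotient (harmonic ip db \<inter> U) (cocycles db U) (coboundaries db U) \<and>
            subcomodule \<delta> (harmonic ip db \<inter> U) \<and> subcomodule \<delta> (cocycles db U) \<and>
            subcomodule \<delta> (coboundaries db U))))
    \<and> (right_vector_bundle A K E' \<and> right_holomorphic K E' \<and> right_hermitian A K E' \<and>
      right_positive_definite E' \<and>
      diagonalisable (dirac (right_inner K \<tau> E') (right_dbar K E')) \<longrightarrow>
        (let ip = right_inner K \<tau> E'; db = right_dbar K E'; \<delta> = right_coact K E' in
          orthogonal_decomposition ip [harmonic ip db, range db, range (adjoint ip db)] \<and>
          subcomodule \<delta> (harmonic ip db) \<and> subcomodule \<delta> (range db) \<and>
          subcomodule \<delta> (range (adjoint ip db)) \<and>
          (\<forall>a b. let U = right_bideg K E' (a, b) in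
            represents_quotient (harmonic ip db \<inter> U) (cocycles db U) (coboundaries db U) \<and>
            subcomodule \<delta> (harmonic ip db \<inter> U) \<and> subcomodule \<delta> (cocycles db U) \<and>
            subcomodule \<delta> (coboundaries db U))))"
proof -
  interpret kaehler_state A K \<tau>
    by unfold_locales (use assms in auto)
  show ?thesis using left_hodge_theorem[of E] right_hodge_theorem[of E'] by blast
qed

end
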